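(* For persistent spaces $X_\bullet,Y_\bullet$ (with $\mathrm{q}$-tame persistent (co)homology), $$\max_{\ell\geq1,\,p\geq1}d_{\mathrm{B}}\left(\mathrm{barc}\left(\deg_p(\Phi^\ell(X_\bullet))\right),\mathrm{barc}\left(\deg_p(\Phi^\ell(Y_\bullet))\right)\right)\leq d_{\mathrm{HI}}(X_\bullet,Y_\bullet),$$ where the maximum is understood as a supremum. For the Vietoris-Rips filtrations $X_\bullet=\mathrm{VR}_\bullet(X)$ and $Y_\bullet=\mathrm{VR}_\bullet(Y)$ of two metric spaces $X$ and $Y$ (with $\mathrm{q}$-tame persistent (co)homology), the two quantities $\max_{\ell\geq1,\,p\geq1}d_{\mathrm{B}}\left(\mathrm{barc}\left(\deg_p(\Phi^\ell(\mathrm{VR}_\bullet(X)))\right),\mathrm{barc}\left(\deg_p(\Phi^\ell(\mathrm{VR}_\bullet(Y)))\right)\right)$ and $d_{\mathrm{HI}}(\mathrm{VR}_\bullet(X),\mathrm{VR}_\bullet(Y))$ are both bounded above by $2\cdot d_{\mathrm{GH}}(X,Y)$.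
   Context: $\mathrm{Top}$ is the category of compactly generated weak Hausdorff spaces; a persistent space is a functor $X_\bullet:(\mathbb{R},\leq)\to\mathrm{Top}$. Cohomology is over a fixed field $K$. A persistence module is $\mathrm{q}$-tame if all its structure maps between indices $t<t'$ have finite rank; $X_\bullet$ has $\mathrm{q}$-tame persistent (co)homology if $\mathbf{H}^p(X_\bullet)$ is $\mathrm{q}$-tame for each $p$. Let $\mathbf{H}^+(X)=\bigoplus_{p\geq1}\mathbf{H}^p(X)$, and for $\ell\geq1$ let $(\mathbf{H}^+(X))^\ell$ be the graded subalgebra generated by (equivalently, the linear span of) all $\ell$-fold cup products of elements of $\mathbf{H}^+(X)$. The persistent $\ell$-cup module of $X_\bullet$ is the contravariant persistent graded vector space $\Phi^\ell(X_\bullet):t\mapsto(\mathbf{H}^+(X_t))^\ell$, with maps $(\mathbf{H}^+(X_{t'}))^\ell\to(\mathbf{H}^+(X_t))^\ell$, $t\leq t'$, induced on cohomology. $\deg_p$ denotes the degree-$p$ component, so $\deg_p(\Phi^\ell(X_\bullet))$ is a ($\mathrm{q}$-tame) persistence module, and $\mathrm{barc}$ denotes its barcode (multiset of intervals in the interval decomposition; the standard barcode of a $\mathrm{q}$-tame module). $d_{\mathrm{B}}$ is the bottleneck distance between barcodes. Persistent spaces with transition maps $f_a^b,g_a^b$ are $\epsilon$-interleaved if there are maps $\varphi_t:X_t\to Y_{t+\epsilon}$, $\psi_t:Y_t\to X_{t+\epsilon}$, commuting with transition maps, with $\psi_{t+\epsilon}\circ\varphi_t=f_t^{t+2\epsilon}$,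 $\varphi_{t+\epsilon}\circ\psi_t=g_t^{t+2\epsilon}$; $d_{\mathrm{I}}^{\mathrm{Top}}$ is the infimum of such $\epsilon\geq0$. $X_\bullet\simeq X'_\bullet$ means there are a persistent space $Z_\bullet$ and natural transformations $Z_\bullet\Rightarrow X_\bullet$, $Z_\bullet\Rightarrow X'_\bullet$ that are objectwise weak homotopy equivalences. $d_{\mathrm{HI}}(X_\bullet,Y_\bullet)=\inf\{d_{\mathrm{I}}^{\mathrm{Top}}(X'_\bullet,Y'_\bullet): X'_\bullet\simeq X_\bullet,\ Y'_\bullet\simeq Y_\bullet\}$. $\mathrm{VR}_t(X)$ is the geometric realization of the simplicial complex of finite nonempty subsets of diameter at most $t$ (empty for $t<0$). $d_{\mathrm{GH}}$ is the Gromov-Hausdorff distance. *)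

theory Defs
  imports "HOL-Homology.Homology" "HOL-Analysis.Analysis" "HOL-Algebra.Module" "HOL-Algebra.AbelCoset"
begin

section \<open>Persistent spaces\<close>

text \<open>
  The test spaces range over all compact Hausdorff spaces with underlying set in the type
  \<^typ>\<open>'a set set\<close>. This is no restriction. For weak Hausdorffness, given \<open>u : T \<rightarrow> X\<close>, choose a
  subset \<open>D\<close> of \<open>T\<close> meeting each nonempty fibre of \<open>u\<close> in one point; the closure of \<open>D\<close> has the same
  image as \<open>T\<close>, and being Hausdorff with a dense subset that embeds into \<open>'a\<close>, it embeds into
  \<open>'a set set\<close>. In a weak Hausdorff space the images of compact Hausdorff spaces are compact
  Hausdorff subspaces, so subspaces of \<open>X\<close> suffice to test whether a set is closed.
\<close>

definition weak_Hausdorff_space :: "'a topology \<Rightarrow> bool" where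
  "weak_Hausdorff_space X \<longleftrightarrow>
     (\<forall>(T :: 'a set set topology) u.
        compact_space T \<and> Hausdorff_space T \<and> continuous_map T X u \<longrightarrow> closedin X (u ` topspace T))"

definition compactly_generated_space :: "'a topology \<Rightarrow> bool" where
  "compactly_generated_space X \<longleftrightarrow>
     (\<forall>A \<subseteq> topspace X.
        (\<forall>(T :: 'a set set topology) u.
           compact_space T \<and> Hausdorff_space T \<and> continuous_map T X u \<longrightarrow>
             closedin T {x \<in> topspace T. u x \<in> A})
        \<longrightarrow> closedin X A)"

definition cgwh_space :: "'a topology \<Rightarrow> bool" where
  "cgwh_space X \<longleftrightarrow> compactly_generated_space X \<and> weak_Hausdorff_space X"

record 'a pers_space =
  space_at :: "real \<Rightarrow> 'a topology"
  transition :: "real \<Rightarrow> real \<Rightarrow> 'a \<Rightarrow> 'a"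

definition persistent_space :: "'a pers_space \<Rightarrow> bool" where
  "persistent_space X \<longleftrightarrow>
     (\<forall>t. cgwh_space (space_at X t)) \<and>
     (\<forall>s t. s \<le> t \<longrightarrow> continuous_map (space_at X s) (space_at X t) (transition X s t)) \<and>
     (\<forall>t. \<forall>x \<in> topspace (space_at X t). transition X t t x = x) \<and>
     (\<forall>r s t. r \<le> s \<and> s \<le> t \<longrightarrow>
        (\<forall>x \<in> topspace (space_at X r).
           transition X s t (transition X r s x) = transition X r t x))"

definition nat_trans :: "'a pers_space \<Rightarrow> 'b pers_space \<Rightarrow> (real \<Rightarrow> 'a \<Rightarrow> 'b) \<Rightarrow> bool" where
  "nat_trans X Y \<phi> \<longleftrightarrow>
     (\<forall>t. continuous_map (space_at X t) (space_at Y t) (\<phi> t)) \<and>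
     (\<forall>s t. s \<le> t \<longrightarrow>
        (\<forall>x \<in> topspace (space_at X s). \<phi> t (transition X s t x) = transition Y s t (\<phi> s x)))"

definition interleaved :: "real \<Rightarrow> 'a pers_space \<Rightarrow> 'b pers_space \<Rightarrow> bool" where
  "interleaved \<epsilon> X Y \<longleftrightarrow>
     (\<exists>\<phi> \<psi>.
        (\<forall>t. continuous_map (space_at X t) (space_at Y (t + \<epsilon>)) (\<phi> t)) \<and>
        (\<forall>t. continuous_map (space_at Y t) (space_at X (t + \<epsilon>)) (\<psi> t)) \<and>
        (\<forall>s t. s \<le> t \<longrightarrow> (\<forall>x \<in> topspace (space_at X s).
           \<phi> t (transition X s t x) = transition Y (s + \<epsilon>) (t + \<epsilon>) (\<phi> s x))) \<and>
        (\<forall>s t. s \<le> t \<longrightarrow> (\<forall>y \<in> topspace (space_at Y s).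
           \<psi> t (transition Y s t y) = transition X (s + \<epsilon>) (t + \<epsilon>) (\<psi> s y))) \<and>
        (\<forall>t. \<forall>x \<in> topspace (space_at X t).
           \<psi> (t + \<epsilon>) (\<phi> t x) = transition X t (t + 2 * \<epsilon>) x) \<and>
        (\<forall>t. \<forall>y \<in> topspace (space_at Y t).
           \<phi> (t + \<epsilon>) (\<psi> t y) = transition Y t (t + 2 * \<epsilon>) y))"

definition d_I_Top :: "'a pers_space \<Rightarrow> 'b pers_space \<Rightarrow> ereal" where
  "d_I_Top X Y = Inf {ereal \<epsilon> | \<epsilon>. 0 \<le> \<epsilon> \<and> interleaved \<epsilon> X Y}"

section \<open>Weak homotopy equivalences and the homotopy interleaving distance\<close>

definition sphere_base :: "nat \<Rightarrow> real" where
  "sphere_base = (\<lambda>i. if i = 0 then 1 else 0)"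

definition homotopy_class ::
    "nat \<Rightarrow> 'a topology \<Rightarrow> 'a \<Rightarrow> ((nat \<Rightarrow> real) \<Rightarrow> 'a) \<Rightarrow> ((nat \<Rightarrow> real) \<Rightarrow> 'a) set" where
  "homotopy_class n X x f = {g. homotopic_with (\<lambda>h. h sphere_base = x) (nsphere n) X f g}"

definition homotopy_group :: "nat \<Rightarrow> 'a topology \<Rightarrow> 'a \<Rightarrow> ((nat \<Rightarrow> real) \<Rightarrow> 'a) set set" where
  "homotopy_group n X x =
     homotopy_class n X x ` {f. continuous_map (nsphere n) X f \<and> f sphere_base = x}"

text \<open>
  The map induced by \<open>\<phi>\<close> on \<open>\<pi>\<^sub>n\<close>, \<open>n \<ge> 1\<close>, is always a group homomorphism, so it is an isomorphism
  iff it is bijective.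
\<close>

definition weak_homotopy_equivalence :: "'a topology \<Rightarrow> 'b topology \<Rightarrow> ('a \<Rightarrow> 'b) \<Rightarrow> bool" where
  "weak_homotopy_equivalence X Y \<phi> \<longleftrightarrow>
     continuous_map X Y \<phi> \<and>
     bij_betw (\<lambda>C. \<Union>x\<in>C. path_component_of_set Y (\<phi> x)) (path_components_of X) (path_components_of Y) \<and>
     (\<forall>n \<ge> 1. \<forall>x \<in> topspace X.
        bij_betw (\<lambda>C. \<Union>f\<in>C. homotopy_class n Y (\<phi> x) (\<phi> \<circ> f))
          (homotopy_group n X x) (homotopy_group n Y (\<phi> x)))"

text \<open>
  A formula of HOL cannot quantify over all topological spaces, only over those carried by subsets
  of one type. The infimum over replacements therefore depends on a type \<open>'u\<close>, which plays the part
  of a universe: the persistent spaces replacing \<open>X\<close> and \<open>Y\<close>, and those mediating the weak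
  equivalences, have their points in \<open>'u\<close>. The value decreases as \<open>'u\<close> grows, and for all
  sufficiently large \<open>'u\<close> it is the infimum over all persistent spaces.
\<close>

definition weakly_equivalent :: "'u itself \<Rightarrow> 'a pers_space \<Rightarrow> 'b pers_space \<Rightarrow> bool" where
  "weakly_equivalent U X X' \<longleftrightarrow>
     (\<exists>(Z :: 'u pers_space) \<phi> \<psi>.
        persistent_space Z \<and> nat_trans Z X \<phi> \<and> nat_trans Z X' \<psi> \<and>
        (\<forall>t. weak_homotopy_equivalence (space_at Z t) (space_at X t) (\<phi> t)) \<and>
        (\<forall>t. weak_homotopy_equivalence (space_at Z t) (space_at X' t) (\<psi> t)))"

definition d_HI :: "'u itself \<Rightarrow> 'a pers_space \<Rightarrow> 'b pers_space \<Rightarrow> ereal" where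
  "d_HI U X Y =
     Inf {d_I_Top X' Y' | (X' :: 'u pers_space) (Y' :: 'u pers_space).
            persistent_space X' \<and> persistent_space Y' \<and>
            weakly_equivalent U X' X \<and> weakly_equivalent U Y' Y}"

section \<open>Linear algebra over a field\<close>

text \<open>
  Vector spaces are \<open>module\<close> records of HOL-Algebra. The fields \<^const>\<open>monoid.mult\<close> and \<^const>\<open>one\<close> of such a
  record are irrelevant (and left \<^const>\<open>undefined\<close>) unless the vector space is an algebra.
\<close>

definition lin_span :: "('k, 'r) ring_scheme \<Rightarrow> ('k, 'v) module \<Rightarrow> 'v set \<Rightarrow> 'v set" where
  "lin_span K V S = \<Inter>{W. submodule W K V \<and> S \<subseteq> W}"

definition quot_space :: "('k, 'v) module \<Rightarrow> 'v set \<Rightarrow> ('k, 'v set) module" where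
  "quot_space V B =
     \<lparr>carrier = a_rcosets\<^bsub>V\<^esub> B, monoid.mult = undefined, one = undefined,
      zero = B, add = set_add V, module.smult = (\<lambda>a A. \<Union>v\<in>A. B +>\<^bsub>V\<^esub> (a \<odot>\<^bsub>V\<^esub> v))\<rparr>"

definition lin_map :: "('k, 'r) ring_scheme \<Rightarrow> ('k, 'v) module \<Rightarrow> ('k, 'w) module \<Rightarrow> ('v \<Rightarrow> 'w) \<Rightarrow> bool" where
  "lin_map K V W f \<longleftrightarrow>
     f \<in> carrier V \<rightarrow> carrier W \<and>
     (\<forall>x \<in> carrier V. \<forall>y \<in> carrier V. f (x \<oplus>\<^bsub>V\<^esub> y) = f x \<oplus>\<^bsub>W\<^esub> f y) \<and>
     (\<forall>a \<in> carrier K. \<forall>x \<in> carrier V. f (a \<odot>\<^bsub>V\<^esub> x) = a \<odot>\<^bsub>W\<^esub> f x)"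

section \<open>Singular cohomology and the cup product\<close>

type_synonym ('a, 'k) cochain = "((nat \<Rightarrow> real) \<Rightarrow> 'a) \<Rightarrow> 'k"
type_synonym ('a, 'k) coh_class = "('a, 'k) cochain set"

definition cochains :: "'k ring \<Rightarrow> 'a topology \<Rightarrow> nat \<Rightarrow> ('k, ('a, 'k) cochain) module" where
  "cochains K X p =
     \<lparr>carrier = {c. (\<forall>\<sigma>. singular_simplex p X \<sigma> \<longrightarrow> c \<sigma> \<in> carrier K) \<and>
                    (\<forall>\<sigma>. \<not> singular_simplex p X \<sigma> \<longrightarrow> c \<sigma> = \<zero>\<^bsub>K\<^esub>)},
      monoid.mult = undefined, one = undefined,
      zero = (\<lambda>\<sigma>. \<zero>\<^bsub>K\<^esub>), add = (\<lambda>c d \<sigma>. c \<sigma> \<oplus>\<^bsub>K\<^esub> d \<sigma>), module.smult = (\<lambda>a c \<sigma>. a \<otimes>\<^bsub>K\<^esub> c \<sigma>)\<rparr>"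

definition coboundary_map :: "'k ring \<Rightarrow> 'a topology \<Rightarrow> nat \<Rightarrow> ('a, 'k) cochain \<Rightarrow> ('a, 'k) cochain" where
  "coboundary_map K X p c =
     (\<lambda>\<sigma>. if singular_simplex (Suc p) X \<sigma>
          then \<Oplus>\<^bsub>K\<^esub>k\<in>{..Suc p}. ((\<ominus>\<^bsub>K\<^esub> \<one>\<^bsub>K\<^esub>) [^]\<^bsub>K\<^esub> k) \<otimes>\<^bsub>K\<^esub> c (singular_face (Suc p) k \<sigma>)
          else \<zero>\<^bsub>K\<^esub>)"

definition cocycles :: "'k ring \<Rightarrow> 'a topology \<Rightarrow> nat \<Rightarrow> ('a, 'k) cochain set" where
  "cocycles K X p = {c \<in> carrier (cochains K X p). coboundary_map K X p c = \<zero>\<^bsub>cochains K X (Suc p)\<^esub>}"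

fun coboundaries :: "'k ring \<Rightarrow> 'a topology \<Rightarrow> nat \<Rightarrow> ('a, 'k) cochain set" where
  "coboundaries K X 0 = {\<zero>\<^bsub>cochains K X 0\<^esub>}"
| "coboundaries K X (Suc p) = coboundary_map K X p ` carrier (cochains K X p)"

definition cohomology :: "'k ring \<Rightarrow> 'a topology \<Rightarrow> nat \<Rightarrow> ('k, ('a, 'k) coh_class) module" where
  "cohomology K X p = quot_space ((cochains K X p)\<lparr>carrier := cocycles K X p\<rparr>) (coboundaries K X p)"

definition coh_class_of :: "'k ring \<Rightarrow> 'a topology \<Rightarrow> nat \<Rightarrow> ('a, 'k) cochain \<Rightarrow> ('a, 'k) coh_class" where
  "coh_class_of K X p c = coboundaries K X p +>\<^bsub>cochains K X p\<^esub> c"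

definition cochain_pullback ::
    "'k ring \<Rightarrow> 'a topology \<Rightarrow> nat \<Rightarrow> ('a \<Rightarrow> 'b) \<Rightarrow> ('b, 'k) cochain \<Rightarrow> ('a, 'k) cochain" where
  "cochain_pullback K X p f c = (\<lambda>\<sigma>. if singular_simplex p X \<sigma> then c (simplex_map p f \<sigma>) else \<zero>\<^bsub>K\<^esub>)"

text \<open>
  For \<open>f : X \<rightarrow> Y\<close>, the map \<open>coh_map K X p f\<close> is the induced map \<open>H\<^sup>p(Y; K) \<rightarrow> H\<^sup>p(X; K)\<close>. As the pullback
  does not depend on the representative, the union is that of a single coset; the same idiom is used
  for the cup product below.
\<close>

definition coh_map ::
    "'k ring \<Rightarrow> 'a topology \<Rightarrow> nat \<Rightarrow> ('a \<Rightarrow> 'b) \<Rightarrow> ('b, 'k) coh_class \<Rightarrow> ('a, 'k) coh_class" where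
  "coh_map K X p f A = (\<Union>c\<in>A. coh_class_of K X p (cochain_pullback K X p f c))"

definition front_face :: "nat \<Rightarrow> ((nat \<Rightarrow> real) \<Rightarrow> 'a) \<Rightarrow> (nat \<Rightarrow> real) \<Rightarrow> 'a" where
  "front_face p \<sigma> = restrict \<sigma> (standard_simplex p)"

definition back_face :: "nat \<Rightarrow> nat \<Rightarrow> ((nat \<Rightarrow> real) \<Rightarrow> 'a) \<Rightarrow> (nat \<Rightarrow> real) \<Rightarrow> 'a" where
  "back_face p q \<sigma> = restrict (\<sigma> \<circ> (\<lambda>x i. if i < p then 0 else x (i - p))) (standard_simplex q)"

definition cochain_cup ::
    "'k ring \<Rightarrow> 'a topology \<Rightarrow> nat \<Rightarrow> nat \<Rightarrow> ('a, 'k) cochain \<Rightarrow> ('a, 'k) cochain \<Rightarrow> ('a, 'k) cochain" where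
  "cochain_cup K X p q c d =
     (\<lambda>\<sigma>. if singular_simplex (p + q) X \<sigma>
          then c (front_face p \<sigma>) \<otimes>\<^bsub>K\<^esub> d (back_face p q \<sigma>)
          else \<zero>\<^bsub>K\<^esub>)"

definition coh_cup ::
    "'k ring \<Rightarrow> 'a topology \<Rightarrow> nat \<Rightarrow> nat \<Rightarrow> ('a, 'k) coh_class \<Rightarrow> ('a, 'k) coh_class \<Rightarrow> ('a, 'k) coh_class" where
  "coh_cup K X p q A D = (\<Union>c\<in>A. \<Union>d\<in>D. coh_class_of K X (p + q) (cochain_cup K X p q c d))"

definition cohomology_algebra :: "'k ring \<Rightarrow> 'a topology \<Rightarrow> ('k, nat \<Rightarrow> ('a, 'k) coh_class) module" where
  "cohomology_algebra K X =
     \<lparr>carrier = {a. (\<forall>p. a p \<in> carrier (cohomology K X p)) \<and>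
                    finite {p. a p \<noteq> \<zero>\<^bsub>cohomology K X p\<^esub>}},
      monoid.mult = (\<lambda>a b n. \<Oplus>\<^bsub>cohomology K X n\<^esub>p\<in>{..n}. coh_cup K X p (n - p) (a p) (b (n - p))),
      one = (\<lambda>p. if p = 0
                 then coh_class_of K X 0 (\<lambda>\<sigma>. if singular_simplex 0 X \<sigma> then \<one>\<^bsub>K\<^esub> else \<zero>\<^bsub>K\<^esub>)
                 else \<zero>\<^bsub>cohomology K X p\<^esub>),
      zero = (\<lambda>p. \<zero>\<^bsub>cohomology K X p\<^esub>),
      add = (\<lambda>a b p. a p \<oplus>\<^bsub>cohomology K X p\<^esub> b p),
      module.smult = (\<lambda>r a p. r \<odot>\<^bsub>cohomology K X p\<^esub> a p)\<rparr>"

definition positive_cohomology :: "'k ring \<Rightarrow> 'a topology \<Rightarrow> (nat \<Rightarrow> ('a, 'k) coh_class) set" where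
  "positive_cohomology K X =
     {a \<in> carrier (cohomology_algebra K X). a 0 = \<zero>\<^bsub>cohomology K X 0\<^esub>}"

definition cup_power :: "'k ring \<Rightarrow> 'a topology \<Rightarrow> nat \<Rightarrow> (nat \<Rightarrow> ('a, 'k) coh_class) set" where
  "cup_power K X l =
     lin_span K (cohomology_algebra K X)
       {foldr (monoid.mult (cohomology_algebra K X)) as \<one>\<^bsub>cohomology_algebra K X\<^esub> | as.
          length as = l \<and> set as \<subseteq> positive_cohomology K X}"

section \<open>Contravariant persistence modules\<close>

text \<open>For \<open>s \<le> t\<close>, the structure map \<open>res V s t\<close> goes from \<open>vec_at V t\<close> to \<open>vec_at V s\<close>.\<close>

record ('k, 'v) pers_module =
  vec_at :: "real \<Rightarrow> ('k, 'v) module"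
  res :: "real \<Rightarrow> real \<Rightarrow> 'v \<Rightarrow> 'v"

definition q_tame :: "'k ring \<Rightarrow> ('k, 'v) pers_module \<Rightarrow> bool" where
  "q_tame K V \<longleftrightarrow>
     (\<forall>s t. s < t \<longrightarrow>
        (\<exists>S \<subseteq> carrier (vec_at V s). finite S \<and>
           res V s t ` carrier (vec_at V t) \<subseteq> lin_span K (vec_at V s) S))"

definition pers_iso :: "'k ring \<Rightarrow> ('k, 'v) pers_module \<Rightarrow> ('k, 'w) pers_module \<Rightarrow> bool" where
  "pers_iso K V W \<longleftrightarrow>
     (\<exists>h. (\<forall>t. lin_map K (vec_at V t) (vec_at W t) (h t) \<and>
               bij_betw (h t) (carrier (vec_at V t)) (carrier (vec_at W t))) \<and>
          (\<forall>s t. s \<le> t \<longrightarrow>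
             (\<forall>v \<in> carrier (vec_at V t). h s (res V s t v) = res W s t (h t v))))"

definition interval_module :: "'k ring \<Rightarrow> real set \<Rightarrow> ('k, 'k) pers_module" where
  "interval_module K J =
     \<lparr>vec_at = (\<lambda>t. \<lparr>carrier = (if t \<in> J then carrier K else {\<zero>\<^bsub>K\<^esub>}), monoid.mult = undefined, one = undefined,
                     zero = \<zero>\<^bsub>K\<^esub>, add = add K, module.smult = monoid.mult K\<rparr>),
      res = (\<lambda>s t v. if s \<in> J then v else \<zero>\<^bsub>K\<^esub>)\<rparr>"

definition pers_direct_sum :: "'i set \<Rightarrow> ('i \<Rightarrow> ('k, 'v) pers_module) \<Rightarrow> ('k, 'i \<Rightarrow> 'v) pers_module" where
  "pers_direct_sum I V =
     \<lparr>vec_at = (\<lambda>t.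
        \<lparr>carrier = {v \<in> (\<Pi>\<^sub>E i\<in>I. carrier (vec_at (V i) t)). finite {i \<in> I. v i \<noteq> \<zero>\<^bsub>vec_at (V i) t\<^esub>}},
         monoid.mult = undefined, one = undefined,
         zero = (\<lambda>i\<in>I. \<zero>\<^bsub>vec_at (V i) t\<^esub>),
         add = (\<lambda>v w. \<lambda>i\<in>I. v i \<oplus>\<^bsub>vec_at (V i) t\<^esub> w i),
         module.smult = (\<lambda>a v. \<lambda>i\<in>I. a \<odot>\<^bsub>vec_at (V i) t\<^esub> v i)\<rparr>),
      res = (\<lambda>s t v. \<lambda>i\<in>I. res (V i) s t (v i))\<rparr>"

text \<open>Barcodes can be infinite, so these multisets of intervals are given as indexed families.\<close>

type_synonym 'i barcode = "'i set \<times> ('i \<Rightarrow> real set)"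

fun interval_decomposition :: "'k ring \<Rightarrow> ('k, 'v) pers_module \<Rightarrow> 'i barcode \<Rightarrow> bool" where
  "interval_decomposition K V (I, J) \<longleftrightarrow>
     (\<forall>i\<in>I. J i \<noteq> {} \<and> is_interval (J i)) \<and>
     pers_iso K V (pers_direct_sum I (\<lambda>i. interval_module K (J i)))"

definition radical :: "'k ring \<Rightarrow> ('k, 'v) pers_module \<Rightarrow> ('k, 'v) pers_module" where
  "radical K V =
     \<lparr>vec_at = (\<lambda>s. (vec_at V s)\<lparr>carrier :=
                  lin_span K (vec_at V s) (\<Union>t\<in>{s<..}. res V s t ` carrier (vec_at V t))\<rparr>),
      res = res V\<rparr>"

text \<open>
  A q-tame module need not be a direct sum of interval modules, but its radical is one (Chazal,
  Crawley-Boevey and de Silva, The observable structure of persistence modules), and that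
  decomposition is then its standard barcode. If the module itself is decomposable, the two barcodes
  differ only by which endpoints belong to the intervals and by one-point intervals; this does not
  affect the bottleneck distance. By the Krull-Remak-Schmidt-Azumaya theorem a decomposition is
  unique up to reindexing. The index type \<open>real \<times> 'v\<close> is large enough: a summand can be
  indexed by a nonzero vector of its image in the module, together with its parameter.
\<close>

definition barc :: "'k ring \<Rightarrow> ('k, 'v) pers_module \<Rightarrow> (real \<times> 'v) barcode" where
  "barc K V =
     (if \<exists>B :: (real \<times> 'v) barcode. interval_decomposition K V B
      then SOME B. interval_decomposition K V B
      else SOME B. interval_decomposition K (radical K V) B)"

definition left_end :: "real set \<Rightarrow> ereal" where
  "left_end J = Inf (ereal ` J)"

definition right_end :: "real set \<Rightarrow> ereal" where
  "right_end J = Sup (ereal ` J)"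

text \<open>The inequalities between endpoints are stated without differences, so that infinite endpoints
  match exactly those that are equal to them.\<close>

fun barcode_matching :: "real \<Rightarrow> 'i barcode \<Rightarrow> 'j barcode \<Rightarrow> ('i \<times> 'j) set \<Rightarrow> bool" where
  "barcode_matching \<epsilon> (I, A) (J, B) M \<longleftrightarrow>
     M \<subseteq> I \<times> J \<and>
     (\<forall>i j i' j'. (i, j) \<in> M \<and> (i', j') \<in> M \<longrightarrow> (i = i' \<longleftrightarrow> j = j')) \<and>
     (\<forall>(i, j)\<in>M.
        left_end (A i) \<le> left_end (B j) + ereal \<epsilon> \<and> left_end (B j) \<le> left_end (A i) + ereal \<epsilon> \<and>
        right_end (A i) \<le> right_end (B j) + ereal \<epsilon> \<and> right_end (B j) \<le> right_end (A i) + ereal \<epsilon>) \<and>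
     (\<forall>i \<in> I - fst ` M. right_end (A i) \<le> left_end (A i) + ereal (2 * \<epsilon>)) \<and>
     (\<forall>j \<in> J - snd ` M. right_end (B j) \<le> left_end (B j) + ereal (2 * \<epsilon>))"

definition d_B :: "'i barcode \<Rightarrow> 'j barcode \<Rightarrow> ereal" where
  "d_B B B' = Inf {ereal \<epsilon> | \<epsilon>. 0 \<le> \<epsilon> \<and> (\<exists>M. barcode_matching \<epsilon> B B' M)}"

section \<open>Persistent cohomology and persistent cup modules\<close>

definition pers_cohomology :: "'k ring \<Rightarrow> 'a pers_space \<Rightarrow> nat \<Rightarrow> ('k, ('a, 'k) coh_class) pers_module" where
  "pers_cohomology K X p =
     \<lparr>vec_at = (\<lambda>t. cohomology K (space_at X t) p),
      res = (\<lambda>s t. coh_map K (space_at X s) p (transition X s t))\<rparr>"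

definition q_tame_cohomology :: "'k ring \<Rightarrow> 'a pers_space \<Rightarrow> bool" where
  "q_tame_cohomology K X \<longleftrightarrow> (\<forall>p. q_tame K (pers_cohomology K X p))"

definition cup_module ::
    "'k ring \<Rightarrow> nat \<Rightarrow> 'a pers_space \<Rightarrow> ('k, nat \<Rightarrow> ('a, 'k) coh_class) pers_module" where
  "cup_module K l X =
     \<lparr>vec_at = (\<lambda>t. (cohomology_algebra K (space_at X t))\<lparr>carrier := cup_power K (space_at X t) l\<rparr>),
      res = (\<lambda>s t a p. coh_map K (space_at X s) p (transition X s t) (a p))\<rparr>"

text \<open>The elements of a graded vector space being families indexed by the degree, its degree-\<open>p\<close>
  component consists of those concentrated in degree \<open>p\<close>.\<close>

definition degree_part :: "nat \<Rightarrow> ('k, nat \<Rightarrow> 'v) pers_module \<Rightarrow> ('k, nat \<Rightarrow> 'v) pers_module" where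
  "degree_part p V =
     \<lparr>vec_at = (\<lambda>t. (vec_at V t)\<lparr>carrier :=
                  {a \<in> carrier (vec_at V t). \<forall>q. q \<noteq> p \<longrightarrow> a q = \<zero>\<^bsub>vec_at V t\<^esub> q}\<rparr>),
      res = res V\<rparr>"

section \<open>Vietoris-Rips filtrations and the Gromov-Hausdorff distance\<close>

definition realization_points :: "'a set set \<Rightarrow> ('a \<Rightarrow> real) set" where
  "realization_points S = {x. (\<forall>v. 0 \<le> x v) \<and> {v. x v \<noteq> 0} \<in> S \<and> (\<Sum>v | x v \<noteq> 0. x v) = 1}"

definition closed_simplex :: "'a set \<Rightarrow> ('a \<Rightarrow> real) set" where
  "closed_simplex \<sigma> = {x. (\<forall>v. 0 \<le> x v) \<and> (\<forall>v. v \<notin> \<sigma> \<longrightarrow> x v = 0) \<and> (\<Sum>v\<in>\<sigma>. x v) = 1}"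

text \<open>The geometric realization carries the weak topology with respect to the closed simplices.\<close>

definition geometric_realization :: "'a set set \<Rightarrow> ('a \<Rightarrow> real) topology" where
  "geometric_realization S =
     topology (\<lambda>U. U \<subseteq> realization_points S \<and>
       (\<forall>\<sigma>\<in>S. openin (subtopology (powertop_real UNIV) (closed_simplex \<sigma>)) (U \<inter> closed_simplex \<sigma>)))"

lemma openin_geometric_realization:
  "openin (geometric_realization S) U \<longleftrightarrow>
     U \<subseteq> realization_points S \<and>
     (\<forall>\<sigma>\<in>S. openin (subtopology (powertop_real UNIV) (closed_simplex \<sigma>)) (U \<inter> closed_simplex \<sigma>))"
proof -
  have "istopology (\<lambda>U. U \<subseteq> realization_points S \<and>
       (\<forall>\<sigma>\<in>S. openin (subtopology (powertop_real UNIV) (closed_simplex \<sigma>)) (U \<inter> closed_simplex \<sigma>)))"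
    unfolding istopology_def
  proof (intro conjI allI impI ballI)
    fix U V \<sigma>
    assume U: "U \<subseteq> realization_points S \<and> (\<forall>\<sigma>\<in>S. openin (subtopology (powertop_real UNIV)
          (closed_simplex \<sigma>)) (U \<inter> closed_simplex \<sigma>))"
      and V: "V \<subseteq> realization_points S \<and> (\<forall>\<sigma>\<in>S. openin (subtopology (powertop_real UNIV)
          (closed_simplex \<sigma>)) (V \<inter> closed_simplex \<sigma>))"
    show "U \<inter> V \<subseteq> realization_points S" using U by blast
    assume "\<sigma> \<in> S"
    then have "openin (subtopology (powertop_real UNIV) (closed_simplex \<sigma>))
        ((U \<inter> closed_simplex \<sigma>) \<inter> (V \<inter> closed_simplex \<sigma>))"
      using openin_Int U V by (metis (no_types, lifting))
    then show "openin (subtopology (powertop_real UNIV) (closed_simplex \<sigma>)) (U \<inter> V \<inter> closed_simplex \<sigma>)"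
      by (simp add: Int_ac)
  next
    fix \<U> \<sigma>
    assume \<U>: "\<forall>U\<in>\<U>. U \<subseteq> realization_points S \<and> (\<forall>\<sigma>\<in>S. openin (subtopology (powertop_real UNIV)
          (closed_simplex \<sigma>)) (U \<inter> closed_simplex \<sigma>))"
    show "\<Union>\<U> \<subseteq> realization_points S" using \<U> by blast
    assume "\<sigma> \<in> S"
    then have "openin (subtopology (powertop_real UNIV) (closed_simplex \<sigma>)) (U \<inter> closed_simplex \<sigma>)"
      if "U \<in> \<U>" for U
      using \<U> that by metis
    then have "openin (subtopology (powertop_real UNIV) (closed_simplex \<sigma>))
        (\<Union>((\<lambda>U. U \<inter> closed_simplex \<sigma>) ` \<U>))"
      by (metis (no_types, lifting) openin_Union imageE)
    then show "openin (subtopology (powertop_real UNIV) (closed_simplex \<sigma>)) (\<Union>\<U> \<inter> closed_simplex \<sigma>)"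
      by (metis Int_Union2)
  qed
  then show ?thesis
    unfolding geometric_realization_def by (simp add: topology_inverse')
qed

definition vr_complex :: "'a metric \<Rightarrow> real \<Rightarrow> 'a set set" where
  "vr_complex M t =
     {\<sigma>. \<sigma> \<subseteq> mspace M \<and> finite \<sigma> \<and> \<sigma> \<noteq> {} \<and> (\<forall>x\<in>\<sigma>. \<forall>y\<in>\<sigma>. mdist M x y \<le> t)}"

definition VR :: "'a metric \<Rightarrow> ('a \<Rightarrow> real) pers_space" where
  "VR M = \<lparr>space_at = (\<lambda>t. geometric_realization (vr_complex M t)), transition = (\<lambda>s t x. x)\<rparr>"

definition isometric_embedding :: "'a metric \<Rightarrow> 'b metric \<Rightarrow> ('a \<Rightarrow> 'b) \<Rightarrow> bool" where
  "isometric_embedding M Z f \<longleftrightarrow>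
     f \<in> mspace M \<rightarrow> mspace Z \<and>
     (\<forall>x \<in> mspace M. \<forall>y \<in> mspace M. mdist Z (f x) (f y) = mdist M x y)"

definition d_H :: "'a metric \<Rightarrow> 'a set \<Rightarrow> 'a set \<Rightarrow> ereal" where
  "d_H Z A B =
     Inf {ereal \<epsilon> | \<epsilon>. 0 \<le> \<epsilon> \<and> (\<forall>a\<in>A. \<exists>b\<in>B. mdist Z a b \<le> \<epsilon>) \<and> (\<forall>b\<in>B. \<exists>a\<in>A. mdist Z a b \<le> \<epsilon>)}"

text \<open>Only the union of the two images matters, so every metric space into which both \<open>M\<close> and \<open>N\<close>
  embed can be replaced by one with points in \<open>'a + 'b\<close>.\<close>

definition d_GH :: "'a metric \<Rightarrow> 'b metric \<Rightarrow> ereal" where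
  "d_GH M N =
     Inf {d_H Z (f ` mspace M) (g ` mspace N) | (Z :: ('a + 'b) metric) f g.
            isometric_embedding M Z f \<and> isometric_embedding N Z g}"

end

theory Submission imports Defs
begin

text \<open>The module \<open>deg\<^sub>p \<Phi>\<^sup>l\<close> is functorial and q-tame, since its elements of degree \<open>p\<close> form a submodule of
  the q-tame module \<open>H\<^sup>p\<close>. Interleaved spaces have interleaved modules, and a weak equivalence is an isomorphism on
  singular cohomology: by obstruction theory over the skeleta, simplices of the target deform compatibly into
  the source. So the first claim follows from the algebraic stability theorem. There the radical of a q-tame
  module is decomposed with Crawley-Boevey's functorial filtrations, and the matching comes from Hall's theorem,
  whose condition is Bjerkevik's linear algebra argument. For the second claim, a correspondence \<open>R\<close> of
  distortion \<open>2\<epsilon>\<close> carries the simplicial complexes pulled back from both metric spaces, which are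
  \<open>2\<epsilon>\<close>-interleaved by inclusions. Pushing forward along a projection of \<open>R\<close> is a weak equivalence, since
  spreading barycentric coordinates over the fibres is an inverse up to straight-line homotopy, and the weights
  can be chosen so that a prescribed point is fixed.\<close>

text \<open>The standard barcode is chosen by \<open>barc\<close> from the decompositions of the
  module itself or of its radical. Matchings are constructed for direct sums of interval modules
  only: whichever module was decomposed is interleaved with the original one for every positive
  shift, and this error disappears in the infimum defining \<open>d_B\<close>. Barcodes may be
  infinite, but q-tameness leaves only finitely many bars through two given parameters, so a long
  bar has finitely many candidates and Hall's theorem applies.

  A weak equivalence is given by bijections on path components and pointed homotopy classes, without
  any map backwards. The inverse on cohomology comes from a map on singular simplices, compatible
  with faces but not induced by a continuous map; hence pullbacks and chain homotopies are set up
  for all face-compatible maps.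

  Homotopy groups are taken at every base point and homotopies are pointed. This is why a section of
  a projection of realizations is made anew for each base point, with weights reproducing that
  point.\<close>

abbreviation (input) "cmap == continuous_map"
abbreviation (input) "tp == top_of_set"
abbreviation (input) "std == standard_simplex"
abbreviation (input) "sing == singular_simplex"
abbreviation (input) "geo == geometric_realization"
abbreviation (input) "calg == cohomology_algebra"
abbreviation (input) "csx == closed_simplex"
abbreviation (input) "sface == simplical_face"
abbreviation (input) "fce == singular_face"
abbreviation (input) "sp == space_at"
abbreviation (input) "degp == degree_part"
abbreviation (input) "cls == coh_class_of"
abbreviation (input) "cob == coboundary_map"
abbreviation (input) "cpb == cochain_pullback"
abbreviation (input) "con == continuous_on"
abbreviation (input) "pcs == path_component_of_set"
abbreviation (input) "pco == path_component_of"
abbreviation (input) "hcl == homotopy_class"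
abbreviation (input) "whe == weak_homotopy_equivalence"
abbreviation (input) "lend == left_end"
abbreviation (input) "rend == right_end"
abbreviation (input) "vt == vec_at"
abbreviation (input) "car == carrier"
abbreviation (input) "ts == topspace"
abbreviation (input) "coh == cohomology"
abbreviation (input) "psp == persistent_space"
abbreviation (input) "posc == positive_cohomology"
abbreviation (input) "bnd == chain_boundary"
abbreviation (input) "tr == transition"
abbreviation (input) "ptop == prod_topology"
abbreviation (input) "hgr == homotopy_group"
abbreviation (input) "pcso == path_components_of"
abbreviation (input) "ccy == cocycles"
abbreviation (input) "cch == cochains"
abbreviation (input) "cbd == coboundaries"
abbreviation (input) "ccup == cochain_cup"
abbreviation (input) "pcoh == pers_cohomology"
abbreviation (input) "rpts == realization_points"
abbreviation (input) "lsp == lin_span"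
abbreviation (input) "vc V t == car (vt V t)"
abbreviation (input) radd ("_ +[_] _" [65, 0, 66] 65) where "x +[R] y == add R x y"
abbreviation (input) rmul ("_ *[_] _" [70, 0, 71] 70) where "x *[R] y == monoid.mult R x y"
abbreviation (input) rsmul ("_ .[_] _" [70, 0, 71] 70) where "x .[R] y == module.smult R x y"
abbreviation (input) rdiff ("_ -[_] _" [65, 0, 66] 65) where "x -[R] y == a_minus R x y"
type_synonym ptx = "nat => real"
abbreviation (input) "dcup p K l X == degree_part p (cup_module K l X)"
type_notation (input) prod (infixr "><" 20)
abbreviation (input) Times2 (infixr "><" 80) where "A >< B == A \<times> B"
abbreviation (input) "cts A B == cmap (tp A) (tp B)"
syntax "_index" :: "logic => index" ("\<^sub>_" [1000] 1000)
notation (input) iff (infixr "<->" 25) and funcset (infixr "->" 60)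
lemmas cm_comp = continuous_map_compose and con_coordwise = continuous_on_coordinatewise_then_product and con_id = continuous_on_id and con_Pair = continuous_on_Pair and cm_in_sub = continuous_map_in_subtopology and con_snd = continuous_on_snd and con_fst = continuous_on_fst and euc_prod = euclidean_product_topology and fin_sub = finite_subset and con_coords = continuous_on_product_coordinates and sing_map = singular_simplex_simplex_map and open_pre = openin_continuous_map_preimage and open_geo = openin_geometric_realization and con_sub = continuous_on_subset and hom_with_comp_l = homotopic_with_compose_continuous_map_left and cm_eq = continuous_map_eq and con_comp2 = continuous_on_compose2

section \<open>Linear algebra over a record field\<close>

locale vspace = K: field K + module K V for K :: "('k, 'r) ring_scheme" (structure) and V :: "('k, 'v) module" (structure)

lemma vspaceI: "field K ==> module K V ==> vspace K V" by (simp add: vspace_def)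

section \<open>Homogeneous linear systems over a field\<close>

context field begin

text \<open>The ring identities behind one elimination step of \<open>linear_sys_nt\<close>, where
  \<open>u\<close> is the inverse of the pivot.\<close>

lemma elim_ids:
 assumes "a : car R" "b : car R" "c : car R" "d : car R" "u : car R"
 shows "a \<otimes> b = a \<otimes> (b \<ominus> (c \<otimes> u) \<otimes> d) \<oplus> (a \<otimes> (c \<otimes> u)) \<otimes> d" and "\<ominus> a \<otimes> b \<oplus> (c \<oplus> a \<otimes> b) = c" and "a \<ominus> (a \<otimes> u) \<otimes> d = a \<ominus> a \<otimes> (u \<otimes> d)"
 using assms by algebra+

text \<open>Gaussian elimination, by induction on the equations \<open>J\<close> in the unknowns
  \<open>I\<close>. If equation \<open>j\<close> is not trivial, an unknown \<open>i0\<close> with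
  nonzero coefficient is eliminated, and the remaining system still has more unknowns than
  equations. The dimension counts below, and the cardinality condition of Hall's theorem, rest on
  this.\<close>

lemma linear_sys_nt:
 assumes "finite J" "finite I" "card J < card I" "!!i j. i : I ==> j : J ==> f i j : car R"
 shows "EX c. c : I -> car R & (EX i:I. c i ~= \<zero>) & (ALL j:J. (\<Oplus>i\<in>I. c i \<otimes> f i j) = \<zero>)"
using assms
proof (induction J arbitrary: I f rule: finite_induct)
 case empty
 then obtain i where "i : I" by fastforce
 thus ?case by force
next
 case (insert j J)
 note f = insert.prems(3)
 show ?case
 proof (cases "ALL i:I. f i j = \<zero>")
  case True
  have "card J < card I" using insert by simp
  then obtain c where c: "c : I -> car R" "EX i:I. c i ~= \<zero>" "ALL j:J. (\<Oplus>i\<in>I. c i \<otimes> f i j) = \<zero>"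
   using insert.IH[of I f] insert.prems by auto
  have "(\<Oplus>i\<in>I. c i \<otimes> f i j) = (\<Oplus>i\<in>I. \<zero>)" using True c(1) by (intro finsum_cong') (auto intro!: r_null)
  thus ?thesis using c by auto
 next
  case False
  then obtain i0 where i0: "i0 : I" "f i0 j ~= \<zero>" by blast
  define u where "u = inv (f i0 j)"
  have u: "u : car R" "u \<otimes> f i0 j = \<one>" using i0 f field_Units by (auto simp: u_def)
  define g where "g i k = f i k \<ominus> (f i j \<otimes> u) \<otimes> f i0 k" for i k
  let ?I = "I - {i0}"
  have g: "g i k : car R" if "i : I" "k : insert j J" for i k using that f u(1) i0(1) by (auto simp: g_def)
  have "card J < card ?I" using insert.prems insert.hyps i0 by simp
  then obtain c where c: "c : ?I -> car R" "EX i:?I. c i ~= \<zero>" "ALL k:J. (\<Oplus>i\<in>?I. c i \<otimes> g i k) = \<zero>"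
   using insert.IH[of ?I g] insert.prems g by auto
  \<comment> \<open>Back substitution: the eliminated unknown receives minus \<open>s\<close>, and
    equation \<open>j\<close> then holds because \<open>u\<close> inverts its coefficient.\<close>
  define s where "s = (\<Oplus>i\<in>?I. c i \<otimes> (f i j \<otimes> u))"
  define d where "d = c(i0 := \<ominus> s)"
  have s: "s : car R" unfolding s_def using c(1) f u(1) by (intro finsum_closed) auto
  have d: "d : I -> car R" using c(1) s by (auto simp: d_def)
  have split: "(\<Oplus>i\<in>I. d i \<otimes> f i k) = \<ominus> s \<otimes> f i0 k \<oplus> (\<Oplus>i\<in>?I. c i \<otimes> f i k)" if k: "k : insert j J" for k
  proof -
  have "I = insert i0 ?I" using i0 by auto
  hence "(\<Oplus>i\<in>I. d i \<otimes> f i k) = (\<Oplus>i\<in>insert i0 ?I. d i \<otimes> f i k)" by simp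
  also have "... = d i0 \<otimes> f i0 k \<oplus> (\<Oplus>i\<in>?I. d i \<otimes> f i k)" using insert.prems d k i0 by (subst finsum_insert) auto
  also have "(\<Oplus>i\<in>?I. d i \<otimes> f i k) = (\<Oplus>i\<in>?I. c i \<otimes> f i k)" using c(1) f k by (intro finsum_cong') (auto simp: d_def)
  finally show ?thesis by (simp add: d_def)
  qed
  have sum_eq: "(\<Oplus>i\<in>?I. c i \<otimes> f i k) = (\<Oplus>i\<in>?I. c i \<otimes> g i k) \<oplus> s \<otimes> f i0 k" if k: "k : insert j J" for k
  proof -
  have "(\<Oplus>i\<in>?I. c i \<otimes> f i k) = (\<Oplus>i\<in>?I. c i \<otimes> g i k \<oplus> (c i \<otimes> (f i j \<otimes> u)) \<otimes> f i0 k)"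
  proof (intro finsum_cong')
  fix i
  assume i: "i : ?I"
  have cl: "c i : car R" "f i k : car R" "f i j : car R" "f i0 k : car R" using i c(1) f k i0 by auto
  show "c i \<otimes> f i k = c i \<otimes> g i k \<oplus> (c i \<otimes> (f i j \<otimes> u)) \<otimes> f i0 k" unfolding g_def
   by (rule elim_ids) (use cl u(1) in auto)
  next
  show "(%i. c i \<otimes> g i k \<oplus> c i \<otimes> (f i j \<otimes> u) \<otimes> f i0 k) : ?I -> car R"
   using c(1) g[of _ k] f[of _ j] f[of i0 k] u(1) i0 k by blast
  qed auto
  also have "... = (\<Oplus>i\<in>?I. c i \<otimes> g i k) \<oplus> (\<Oplus>i\<in>?I. (c i \<otimes> (f i j \<otimes> u)) \<otimes> f i0 k)"
   using c(1) that g f u(1) i0 by (intro finsum_addf) (auto intro!: m_closed)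
  also have "(\<Oplus>i\<in>?I. (c i \<otimes> (f i j \<otimes> u)) \<otimes> f i0 k) = s \<otimes> f i0 k"
   unfolding s_def using insert.prems c(1) that u(1) i0 by (subst finsum_ldistr) (auto intro!: m_closed)
  finally show ?thesis .
  qed
  have z: "(\<Oplus>i\<in>I. d i \<otimes> f i k) = (\<Oplus>i\<in>?I. c i \<otimes> g i k)" if k: "k : insert j J" for k
  proof -
  have "(\<Oplus>i\<in>?I. c i \<otimes> g i k) : car R" using c(1) g k by (intro finsum_closed) auto
  moreover have "f i0 k : car R" using f i0 k by auto
  ultimately show ?thesis unfolding split[OF k] sum_eq[OF k] by (intro elim_ids(2)[of _ _ _ \<zero> \<zero>]) (use s in auto)
  qed
  have "(\<Oplus>i\<in>?I. c i \<otimes> g i j) = (\<Oplus>i\<in>?I. \<zero>)"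
  proof (intro finsum_cong')
  fix i
  assume i: "i : ?I"
  have cl: "c i : car R" "f i j : car R" "f i0 j : car R" using i c(1) f i0 by auto
  have "g i j = f i j \<ominus> f i j \<otimes> (u \<otimes> f i0 j)" unfolding g_def by (rule elim_ids(3)[of _ \<zero> \<zero>]) (use cl u(1) in auto)
  also have "... = \<zero>" using u cl by simp
  finally show "c i \<otimes> g i j = \<zero>" using cl by simp
  qed auto
  hence "(\<Oplus>i\<in>I. d i \<otimes> f i k) = \<zero>" if k: "k : insert j J" for k using z[OF k] c(3) k by auto
  moreover have "EX i:I. d i ~= \<zero>" using c(2) by (auto simp: d_def)
  ultimately show ?thesis using d by blast
 qed
qed

end

section \<open>Spans, independent sets and finite dimension\<close>

context vspace begin

lemma span_sub_car: "S <= car V ==> lsp K V S <= car V" using carrier_is_submodule unfolding lin_span_def by blast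

lemma span_sub: assumes "S <= car V" shows "submodule (lsp K V S) K V"
proof (rule submoduleI)
 show "lsp K V S <= car V" using span_sub_car[OF assms] .
 show "(zero V) : lsp K V S" unfolding lin_span_def by (auto intro!: subgroup.one_closed[of _ "add_monoid V", simplified] dest: submodule.axioms)
qed (auto simp: lin_span_def dest: submoduleE)

lemma span_sup: "S <= lsp K V S" unfolding lin_span_def by blast

lemma span_min: "submodule W K V ==> S <= W ==> lsp K V S <= W" unfolding lin_span_def by blast

lemma span_mono: "S <= T ==> lsp K V S <= lsp K V T" unfolding lin_span_def by blast

lemma sub_zero: "submodule W K V ==> (zero V) : W" by (metis submodule.axioms(1) subgroup.one_closed monoid.select_convs(2))

lemma sub_lc:
 assumes "submodule W K V" "f : A -> W" "c : A -> car K"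
 shows "(\<Oplus>\<^sub>V i\<in>A. c i .[V] f i) : W"
using assms
proof (induction A rule: infinite_finite_induct)
 case (infinite A)
 thus ?case using sub_zero by simp
next
 case empty
 thus ?case using sub_zero by simp
next
 case (insert x F)
 note sub = submoduleE[OF \<open>submodule W K V\<close>]
 have "c i .[V] f i : car V" if "i : insert x F" for i using that insert.prems sub(1) by auto
 moreover have "c x .[V] f x : W" using insert.prems sub(4) by simp
 ultimately show ?case using insert sub(5) by simp
qed

lemma span_eq_lc:
 assumes "finite S" "S <= car V"
 shows "lsp K V S = {\<Oplus>\<^sub>V s\<in>S. c s .[V] s | c. c : S -> car K}" (is "_ = ?L")
proof
 show "?L <= lsp K V S" using sub_lc[OF span_sub[OF assms(2)], of "%s. s" S] span_sup[of S] by auto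
 have "submodule ?L K V"
 proof (rule submoduleI)
  show "?L <= car V" using assms(2) by (auto intro!: M.finsum_closed)
  have "(\<Oplus>\<^sub>V s\<in>S. \<zero> \<odot>\<^sub>V s) = (\<Oplus>\<^sub>V s\<in>S. (zero V))" using assms(2) by (intro M.finsum_cong') auto
  thus "(zero V) : ?L" by force
 next
  have sm: "a .[V] x : ?L" if ax: "a : car K" "x : ?L" for a x
  proof -
  obtain c where c: "c : S -> car K" "x = (\<Oplus>\<^sub>V s\<in>S. c s .[V] s)" using ax by blast
  have "a .[V] x = (\<Oplus>\<^sub>V s\<in>S. a .[V] (c s .[V] s))" unfolding c(2) using ax c assms by (intro finsum_smult_ldistr) auto
  also have "... = (\<Oplus>\<^sub>V s\<in>S. (a \<otimes> c s) .[V] s)" using ax c assms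
   by (intro M.finsum_cong') (auto simp: smult_assoc1 Pi_def subset_iff)
  finally show ?thesis using ax c by (intro CollectI exI[of _ "%s. a \<otimes> c s"]) auto
  qed
  show "a .[V] x : ?L" if "a : car K" "x : ?L" for a x using sm that .
  show "x +[V] y : ?L" if xy: "x : ?L" "y : ?L" for x y
  proof -
  obtain c where c: "c : S -> car K" "x = (\<Oplus>\<^sub>V s\<in>S. c s .[V] s)" using xy by blast
  obtain d where d: "d : S -> car K" "y = (\<Oplus>\<^sub>V s\<in>S. d s .[V] s)" using xy by blast
  have "x +[V] y = (\<Oplus>\<^sub>V s\<in>S. c s .[V] s +[V] d s .[V] s)" using c d assms by (subst M.finsum_addf) auto
  also have "... = (\<Oplus>\<^sub>V s\<in>S. (c s \<oplus> d s) .[V] s)" using c d assms by (intro M.finsum_cong') (auto simp: smult_l_distr Pi_def)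
  finally show ?thesis using c d by (intro CollectI exI[of _ "%s. c s \<oplus> d s"]) auto
  qed
  show "\<ominus>\<^sub>V x : ?L" if x: "x : ?L" for x
  proof -
  have "x : car V" using x assms(2) by (auto intro!: M.finsum_closed)
  hence "\<ominus>\<^sub>V x = (\<ominus> \<one>) .[V] x" by (simp add: smult_l_minus)
  thus ?thesis using sm[OF _ x, of "\<ominus> \<one>"] by simp
  qed
 qed
 moreover have "S <= ?L"
 proof
  fix s
  assume s: "s : S"
  have "(\<Oplus>\<^sub>V x\<in>S. (if x = s then \<one> else \<zero>) .[V] x) = (\<Oplus>\<^sub>V x\<in>S. if s = x then x else (zero V))" using assms
   by (intro M.finsum_cong') auto
  also have "... = s" using M.finsum_singleton[OF s assms(1), of "%x. x"] assms by auto
  finally show "s : ?L" by (intro CollectI exI[of _ "%x. if x = s then \<one> else \<zero>"]) auto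
 qed
 ultimately show "lsp K V S <= ?L" by (rule span_min)
qed

text \<open>Finiteness is part of the notion because a \<open>finsum\<close> over an infinite set
  carries no information.\<close>

definition indep :: "'v set => bool" where "indep T <-> finite T & T <= car V & (ALL c : T -> car K. (\<Oplus>\<^sub>V t\<in>T. c t .[V] t) = zero V --> (ALL t:T. c t = \<zero>))"

text \<open>Writing the vectors in terms of \<open>S\<close> turns a relation between them into a
  linear system with \<open>card I\<close> unknowns and \<open>card S\<close> equations. A family is
  used instead of a set because its members may coincide.\<close>

lemma fam_dep:
 assumes "finite S" "S <= car V" "finite I" "card S < card I" "!!i. i : I ==> x i : lsp K V S"
 shows "EX c : I -> car K. (\<Oplus>\<^sub>V i\<in>I. c i .[V] x i) = zero V & (EX i:I. c i ~= \<zero>)"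
proof -
 have "ALL i:I. EX c. c : S -> car K & x i = (\<Oplus>\<^sub>V s\<in>S. c s .[V] s)" using assms(5) unfolding span_eq_lc[OF assms(1,2)] by blast
 then obtain f where f: "!!i. i : I ==> f i : S -> car K" "!!i. i : I ==> x i = (\<Oplus>\<^sub>V s\<in>S. f i s .[V] s)" by metis
 obtain c where c: "c : I -> car K" "EX i:I. c i ~= \<zero>" "ALL s:S. (\<Oplus>i\<in>I. c i \<otimes> f i s) = \<zero>"
  using K.linear_sys_nt[OF assms(1,3,4), of f] f(1) by auto
 have cl: "c i : car K" "f i s : car K" "s : car V" if "i : I" "s : S" for i s using that c f(1) assms(2) by auto
 have *: "(\<Oplus>\<^sub>V i\<in>I'. c i .[V] x i) = (\<Oplus>\<^sub>V s\<in>S. (\<Oplus>i\<in>I'. c i \<otimes> f i s) .[V] s)" if "finite I'" "I' <= I" for I' using that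
 proof (induction I' rule: finite_induct)
  case empty
  have "(\<Oplus>\<^sub>V s\<in>S. \<zero> \<odot>\<^sub>V s) = (\<Oplus>\<^sub>V s\<in>S. (zero V))" using assms(2) by (intro M.finsum_cong') auto
  thus ?case by simp
 next
  case (insert i I')
  have i: "i : I" and sub: "I' <= I" using insert by auto
  have xcl: "x j : car V" if "j : I" for j using span_sub_car[OF assms(2)] assms(5)[OF that] by blast
  have scl: "(\<Oplus>i\<in>I'. c i \<otimes> f i s) : car K" if "s : S" for s using cl sub that by (intro K.finsum_closed) auto
  have "c i .[V] x i = (\<Oplus>\<^sub>V s\<in>S. c i .[V] (f i s .[V] s))" unfolding f(2)[OF i] using assms(1) i cl c
   by (intro finsum_smult_ldistr) auto
  also have "... = (\<Oplus>\<^sub>V s\<in>S. (c i \<otimes> f i s) .[V] s)" using cl i by (intro M.finsum_cong') (auto simp: smult_assoc1)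
  finally have ci: "c i .[V] x i = (\<Oplus>\<^sub>V s\<in>S. (c i \<otimes> f i s) .[V] s)" .
  have "(\<Oplus>\<^sub>V i\<in>insert i I'. c i .[V] x i) = c i .[V] x i +[V] (\<Oplus>\<^sub>V i\<in>I'. c i .[V] x i)"
   using insert.hyps c(1) i sub xcl by (intro M.finsum_insert) auto
  also have "... = (\<Oplus>\<^sub>V s\<in>S. (c i \<otimes> f i s) .[V] s +[V] (\<Oplus>i\<in>I'. c i \<otimes> f i s) .[V] s)"
   unfolding ci insert.IH[OF sub] using cl i scl by simp
  also have "... = (\<Oplus>\<^sub>V s\<in>S. (\<Oplus>i\<in>insert i I'. c i \<otimes> f i s) .[V] s)"
  proof (intro M.finsum_cong')
  fix s
  assume s: "s : S"
  have "(\<Oplus>i\<in>insert i I'. c i \<otimes> f i s) = c i \<otimes> f i s \<oplus> (\<Oplus>i\<in>I'. c i \<otimes> f i s)"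
   using insert.hyps cl i sub s by (intro K.finsum_insert) auto
  thus "(c i \<otimes> f i s) .[V] s +[V] (\<Oplus>i\<in>I'. c i \<otimes> f i s) .[V] s = (\<Oplus>i\<in>insert i I'. c i \<otimes> f i s) .[V] s"
   using cl i s scl by (simp add: smult_l_distr)
  next
  show "(%s. (\<Oplus>i\<in>insert i I'. c i \<otimes> f i s) .[V] s) : S -> car V" using cl insert.prems by (auto intro!: smult_closed K.finsum_closed)
  qed auto
  finally show ?case .
 qed
 have "(\<Oplus>\<^sub>V i\<in>I. c i .[V] x i) = (\<Oplus>\<^sub>V s\<in>S. (zero V))" unfolding *[OF assms(3) subset_refl] using c(3) assms(2)
  by (intro M.finsum_cong') auto
 thus ?thesis using c by auto
qed

lemma indep_card_le:
 assumes "finite S" "S <= car V" "indep T" "T <= lsp K V S"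
 shows "card T <= card S" using assms(3) fam_dep[OF assms(1,2), where x = "%t. t" and I = T] assms(4) by (fastforce simp: indep_def)

lemma indep_insert:
 assumes W: "submodule W K V" and T: "indep T" "T <= W" and w: "w : car V" "w ~: W"
 shows "indep (insert w T)"
unfolding indep_def
proof (intro conjI ballI impI)
 show "finite (insert w T)" "insert w T <= car V" using T w by (auto simp: indep_def)
 fix c t
 assume c: "c : insert w T -> car K" and t: "t : insert w T" and z: "(\<Oplus>\<^sub>V t\<in>insert w T. c t .[V] t) = zero V"
 have Tc: "T <= car V" "finite T" "w ~: T" using T w by (auto simp: indep_def)
 let ?s = "\<Oplus>\<^sub>V t\<in>T. c t .[V] t"
 have sW: "?s : W" using sub_lc[OF W, of "%x. x" T c] T(2) c by auto
 note sub = submoduleE[OF W]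
 have eq: "c w .[V] w +[V] ?s = zero V" using z Tc c w by (subst (asm) M.finsum_insert) auto
 have cw: "c w = \<zero>"
 proof (rule ccontr)
  assume nz: "c w ~= \<zero>"
  have "c w .[V] w = \<ominus>\<^sub>V ?s" using eq c w sW sub(1) by (intro M.minus_equality[symmetric]) auto
  hence "inv (c w) .[V] (c w .[V] w) : W" using sub(3) sW using sub(4) c nz K.field_Units by simp
  moreover have "inv (c w) .[V] (c w .[V] w) = w" using c nz K.field_Units w(1) by (simp add: smult_assoc1[symmetric])
  ultimately show False using w by simp
 qed
 thus "c t = \<zero>" using eq w sW sub(1) using T(1) c t by (auto simp: indep_def)
qed

text \<open>The spanning vectors may lie outside \<open>W\<close>. This matches the form of
  \<open>q_tame\<close> and makes the notion inherited by subsets; \<open>fin_dim_spd\<close> moves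
  the vectors into \<open>W\<close> when \<open>W\<close> is a subspace.\<close>

definition fin_dim :: "'v set => bool" where "fin_dim W <-> (EX S. finite S & S <= car V & W <= lsp K V S)"

definition ldim :: "'v set => nat" where "ldim W = Max {card T | T. indep T & T <= W}"

lemma indep_empty [simp]: "indep {}" by (simp add: indep_def)

lemma fin_dim_mono: "fin_dim W ==> U <= W ==> fin_dim U" unfolding fin_dim_def by blast

lemma ldim_props:
 assumes "fin_dim W"
 shows "finite {card T | T. indep T & T <= W}" "EX T. indep T & T <= W & card T = ldim W"
proof -
 obtain S where S: "finite S" "S <= car V" "W <= lsp K V S" using assms unfolding fin_dim_def by blast
 have "{card T | T. indep T & T <= W} <= {..card S}" using indep_card_le[OF S(1,2)] S(3) by auto
 thus fin: "finite {card T | T. indep T & T <= W}" by (rule fin_sub) simp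
 have "ldim W : {card T | T. indep T & T <= W}" unfolding ldim_def by (rule Max_in[OF fin]) (use indep_empty in blast)
 thus "EX T. indep T & T <= W & card T = ldim W" by auto
qed

lemma ldim_strict_mono:
 assumes "fin_dim W" "submodule U K V" "U \<subset> W" "W <= car V"
 shows "ldim U < ldim W"
proof -
 obtain T where T: "indep T" "T <= U" "card T = ldim U" using ldim_props(2)[OF fin_dim_mono[OF assms(1)], of U] assms(3) by blast
 obtain w where w: "w : W" "w ~: U" using assms(3) by blast
 have ins: "indep (insert w T)" using indep_insert[OF assms(2) T(1,2), of w] w assms(4) by blast
 have "card (insert w T) <= ldim W" unfolding ldim_def
 proof (rule Max_ge[OF ldim_props(1)[OF assms(1)]])
  show "card (insert w T) : {card T |T. indep T & T <= W}" using w T(2) assms(3) using ins by blast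
 qed
 moreover have "card (insert w T) = Suc (card T)" using ins w T(2) by (subst card_insert_disjoint) (auto simp: indep_def)
 ultimately show ?thesis using T by simp
qed

text \<open>An independent subset of \<open>W\<close> with the largest possible cardinality spans,
  since otherwise its span would be a proper subspace with the same \<open>ldim\<close>.\<close>

lemma fin_dim_spd:
 assumes "fin_dim W" "submodule W K V"
 shows "EX S. finite S & S <= W & W = lsp K V S"
proof -
 obtain T where T: "indep T" "T <= W" "card T = ldim W" using ldim_props(2)[OF assms(1)] by blast
 have WV: "W <= car V" using submoduleE(1)[OF assms(2)] .
 hence TV: "T <= car V" using T by blast
 have sub: "lsp K V T <= W" using span_min[OF assms(2) T(2)] .
 have "lsp K V T = W"
 proof (rule ccontr)
  assume "lsp K V T ~= W"
  hence "ldim (lsp K V T) < ldim W" using ldim_strict_mono[OF assms(1) span_sub[OF TV] _ WV] sub by blast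
  moreover have "card T <= ldim (lsp K V T)" unfolding ldim_def using T(1) span_sup[of T]
   by (intro Max_ge[OF ldim_props(1)[OF fin_dim_mono[OF assms(1) sub]]]) blast
  ultimately show False using T by simp
 qed
 thus ?thesis using T by (auto simp: indep_def)
qed

text \<open>A member of least dimension is minimal for inclusion. This is the descending chain
  condition through which q-tameness enters the decomposition.\<close>

lemma fin_dim_min_subsp:
 assumes "\<F> ~= {}" "!!W. W : \<F> ==> fin_dim W & submodule W K V"
 shows "EX W:\<F>. ALL U:\<F>. ~ U \<subset> W"
proof -
 obtain W0 where "W0 : \<F>" using assms(1) by blast
 then obtain W where W: "W : \<F>" "!!U. U : \<F> ==> ldim W <= ldim U" using ex_has_least_nat[of "%W. W : \<F>" W0 ldim] by auto
 have "~ U \<subset> W" if U: "U : \<F>" for U using ldim_strict_mono[of W U] assms(2)[OF W(1)] assms(2)[OF U] submoduleE(1) W(2)[OF U] by auto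
 thus ?thesis using W(1) by blast
qed

text \<open>Among the finite subsets of \<open>B\<close> that span \<open>B\<close> together with
  \<open>A\<close>, one of least cardinality is independent modulo \<open>A\<close>: a vector
  occurring in a relation with nonzero coefficient could be dropped.\<close>

lemma compl_basis:
 assumes A: "submodule A K V" and B: "submodule B K V" "fin_dim B" and AB: "A <= B"
 shows "EX bt. finite bt & bt <= B & B <= lsp K V (A Un bt) & (ALL c : bt -> car K. (\<Oplus>\<^sub>V b\<in>bt. c b .[V] b) : A --> (ALL b:bt. c b = \<zero>))"
proof -
 let ?P = "%bt. finite bt & bt <= B & B <= lsp K V (A Un bt)"
 obtain bt0 where bt0: "finite bt0" "bt0 <= B" "B = lsp K V bt0" using fin_dim_spd[OF B(2,1)] by blast
 then obtain bt where bt: "?P bt" and min: "!!ga. ?P ga ==> card bt <= card ga"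
  using span_mono[of bt0 "A Un bt0"] using ex_has_least_nat[of ?P bt0 card] by auto
 note subA = submoduleE[OF A] and subB = submoduleE[OF B(1)]
 have "c b = \<zero>" if c: "c : bt -> car K" "(\<Oplus>\<^sub>V b\<in>bt. c b .[V] b) : A" and b: "b : bt" for c b
 proof (rule ccontr)
  assume nz: "c b ~= \<zero>"
  let ?ga = "bt - {b}"
  let ?S = "lsp K V (A Un ?ga)"
  have gV: "A Un ?ga <= car V" using bt subA(1) subB(1) by blast
  have S: "submodule ?S K V" using span_sub[OF gV] .
  note subS = submoduleE[OF S]
  let ?r = "\<Oplus>\<^sub>V x\<in>?ga. c x .[V] x"
  have r: "?r : ?S" using sub_lc[OF S, of "%x. x" ?ga c] c(1) span_sup[of "A Un ?ga"] by auto
  have bV: "b : car V" "c b : car K" using b bt subB(1) c(1) by auto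
  have "(\<Oplus>\<^sub>V x\<in>bt. c x .[V] x) = (\<Oplus>\<^sub>V x\<in>insert b ?ga. c x .[V] x)" using b by (simp add: insert_absorb)
  also have "... = c b .[V] b +[V] ?r" using bt c(1) bV gV by (intro M.finsum_insert) auto
  finally have e: "c b .[V] b +[V] ?r : ?S" using c(2) span_sup[of "A Un ?ga"] by auto
  have "c b .[V] b = (c b .[V] b +[V] ?r) +[V] \<ominus>\<^sub>V ?r" using bV r subS(1) by (simp add: M.a_assoc M.r_neg subset_iff)
  hence "inv (c b) .[V] (c b .[V] b) : ?S" using subS(5)[OF e subS(3)[OF r]] using subS(4) bV nz K.field_Units by simp
  hence bS: "b : ?S" using bV nz K.field_Units by (simp add: smult_assoc1[symmetric])
  have "B <= ?S" using bS span_sup[of "A Un ?ga"] using span_min[OF S, of "A Un bt"] bt by blast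
  hence "card bt <= card ?ga" using min[of ?ga] bt by auto
  thus False using b bt by (metis card_Diff1_less linorder_not_less)
 qed
 thus ?thesis using bt by blast
qed

end

section \<open>Persistence modules\<close>

context fixes K :: "'k ring" and V :: "('k, 'v) module" and W :: "('k, 'w) module" and f assumes V: "vspace K V" and W: "vspace K W" and f: "lin_map K V W f" begin

interpretation V: vspace K V by (rule V)

interpretation W: vspace K W by (rule W)

lemma lin_map_cl: "x : car V ==> f x : car W" and lin_map_add: "x : car V ==> y : car V ==> f (x +[V] y) = f x +[W] f y" and lin_map_smult: "a : car K ==> x : car V ==> f (a .[V] x) = a .[W] f x"
 using f unfolding lin_map_def by auto

lemma lin_map_zero: "f (zero V) = zero W"
proof -
 have "f ((zero K) .[V] (zero V)) = (zero K) .[W] f (zero V)" by (intro lin_map_smult) auto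
 thus ?thesis using lin_map_cl by simp
qed

lemma lin_map_minus: "x : car V ==> f (\<ominus>\<^sub>V x) = \<ominus>\<^sub>W f x" using lin_map_smult lin_map_cl
 by (force simp: V.smult_l_minus W.smult_l_minus)

lemma lin_map_finsum:
 assumes "x : A -> car V"
 shows "f (\<Oplus>\<^sub>V i\<in>A. x i) = (\<Oplus>\<^sub>W i\<in>A. f (x i))"
using assms
proof (induction A rule: infinite_finite_induct)
 case (insert a A)
 thus ?case using lin_map_cl by (auto simp: Pi_def lin_map_add)
qed (auto simp: lin_map_zero V.M.finsum_infinite W.M.finsum_infinite)

lemma lin_map_img_sub: assumes "submodule A K V" shows "submodule (f ` A) K W"
proof (rule W.submoduleI)
 note A = V.submoduleE[OF assms]
 show "f ` A <= car W" using A(1) lin_map_cl by auto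
 show "(zero W) : f ` A" using lin_map_zero V.sub_zero[OF assms] by force
 show "\<ominus>\<^sub>W a : f ` A" if "a : f ` A" for a using that A(1,3) lin_map_minus by (auto simp: image_iff) (metis subsetD)
 show "a +[W] b : f ` A" if "a : f ` A" "b : f ` A" for a b using that A(1,5) lin_map_add by (auto simp: image_iff) (metis subsetD)
 show "a .[W] x : f ` A" if "a : car K" "x : f ` A" for a x using that A(1,4) lin_map_smult by (auto simp: image_iff) (metis subsetD)
qed

lemma lin_map_vim_sub: assumes "submodule B K W" shows "submodule {x : car V. f x : B} K V"
proof (rule V.submoduleI)
 show "(zero V) : {x : car V. f x : B}" using lin_map_zero W.sub_zero[OF assms] by simp
qed (use W.submoduleE[OF assms] in \<open>auto simp: lin_map_minus lin_map_add lin_map_smult\<close>)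

lemma lin_map_span: assumes "S <= car V" shows "f ` lsp K V S <= lsp K W (f ` S)"
proof -
 have fS: "f ` S <= car W" using assms lin_map_cl by auto
 have "lsp K V S <= {x : car V. f x : lsp K W (f ` S)}" using assms W.span_sup[of "f ` S"] by (intro V.span_min lin_map_vim_sub W.span_sub[OF fS]) auto
 thus ?thesis by blast
qed

end

locale per_mod =
 fixes K :: "'k ring" and V :: "('k, 'v) pers_module"
 assumes vs: "!!t. vspace K (vt V t)" and res_lin: "!!s t. s <= t ==> lin_map K (vt V t) (vt V s) (res V s t)" and res_id: "!!t v. v : vc V t ==> res V t t v = v" and res_comp: "!!r s t v. r <= s ==> s <= t ==> v : vc V t ==> res V r s (res V s t v) = res V r t v" begin

lemmas res_cl = lin_map_cl[OF vs vs res_lin] and res_zero = lin_map_zero[OF vs vs res_lin] and res_add = lin_map_add[OF vs vs res_lin] and res_smult = lin_map_smult[OF vs vs res_lin] and res_finsum = lin_map_finsum[OF vs vs res_lin]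
lemma field: "field K" using vs[of undefined] by (simp add: vspace_def)

lemma mod: "module K (vt V t)" using vs by (simp add: vspace_def)

end

lemma per_iso_sym:
 assumes V: "!!t. vspace K (vt V t)" and W: "!!t. vspace K (vt W t)" and cl: "!!s t v. s <= t ==> v : vc V t ==> res V s t v : vc V s" and iso: "pers_iso K V W"
 shows "pers_iso K W V"
proof -
 obtain h where h: "!!t. lin_map K (vt V t) (vt W t) (h t)" "!!t. bij_betw (h t) (vc V t) (vc W t)" "!!s t v. s <= t ==> v : vc V t ==> h s (res V s t v) = res W s t (h t v)"
  using iso unfolding pers_iso_def by blast
 define k where "k t = inv_into (vc V t) (h t)" for t
 have k: "bij_betw (k t) (vc W t) (vc V t)" for t unfolding k_def using h(2) by (rule bij_betw_inv_into)
 have hk: "h t (k t w) = w" "k t w : vc V t" if "w : vc W t" for t w using h(2)[of t] that k[of t]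
  by (auto simp: k_def bij_betw_inv_into_right bij_betw_apply)
 have kh: "k t (h t v) = v" if "v : vc V t" for t v using h(2)[of t] that by (auto simp: k_def bij_betw_inv_into_left)
 have mod: "module K (vt V t)" for t using V[of t] by (simp add: vspace_def)
 note h_add = lin_map_add[OF V W h(1)] and h_smult = lin_map_smult[OF V W h(1)]
 have "lin_map K (vt W t) (vt V t) (k t)" for t
 proof -
  interpret module K "vt V t" by (rule mod)
  show ?thesis unfolding lin_map_def
  proof (intro conjI ballI)
  show "k t : vc W t -> vc V t" using hk by blast
  fix x y
  assume "x : vc W t" "y : vc W t"
  thus "k t (x +[vt W t] y) = k t x +[vt V t] k t y" using kh[of "k t x +[vt V t] k t y" t] hk h_add by simp
  next
  fix a x
  assume "a : car K" "x : vc W t"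
  thus "k t (a .[vt W t] x) = a .[vt V t] k t x" using kh[of "a .[vt V t] k t x" t] hk h_smult by simp
  qed
 qed
 moreover have "k s (res W s t w) = res V s t (k t w)" if "s <= t" "w : vc W t" for s t w
  using h(3)[OF that(1), of "k t w"] hk that kh[of "res V s t (k t w)" s] cl by metis
 ultimately show ?thesis using k unfolding pers_iso_def by blast
qed

subsection \<open>Direct sums of interval modules\<close>

abbreviation int_sum :: "'k ring => 'i set => ('i => real set) => ('k, 'i => 'k) pers_module" where "int_sum K I J \<equiv> pers_direct_sum I (%i. interval_module K (J i))"
lemma car_int_sum: "vc (int_sum K I J) t = {v : I \<rightarrow>\<^sub>E car K. (ALL i:I. t ~: J i --> v i = zero K) & finite {i : I. v i ~= zero K}}" if "field K"
proof -
 interpret field K by fact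
 show ?thesis by (force simp: pers_direct_sum_def interval_module_def split: if_splits)
qed

lemma int_sum_s: "zero (vt (int_sum K I J) t) = (\<lambda>i\<in>I. (zero K))" "add (vt (int_sum K I J) t) = (%v w. \<lambda>i\<in>I. v i +[K] w i)" "module.smult (vt (int_sum K I J) t) = (%a v. \<lambda>i\<in>I. a *[K] v i)" "res (int_sum K I J) s t v = (\<lambda>i\<in>I. if s : J i then v i else (zero K))"
 by (simp_all add: pers_direct_sum_def interval_module_def)

lemma vs_int_sum: assumes "field K" shows "vspace K (vt (int_sum K I J) t)"
proof (rule vspaceI[OF assms])
 interpret field K by fact
 let ?D = "vt (int_sum K I J) t"
 note [simp] = int_sum_s car_int_sum[OF assms]
 have fin: "finite {i : I. v i +[K] w i ~= zero K}" if "finite {i : I. v i ~= zero K}" "finite {i : I. w i ~= zero K}" for v w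
  by (rule fin_sub[of _ "{i : I. v i ~= zero K} Un {i : I. w i ~= zero K}"]) (use that in auto)
 show "module K ?D"
 proof (rule moduleI)
  show "cring K" by (rule is_cring)
  show "abelian_group ?D"
  proof (rule abelian_groupI)
  fix x y z
  assume x: "x : car ?D" and y: "y : car ?D" and z: "z : car ?D"
  have xy: "x i : car K" "y i : car K" "z i : car K" if "i : I" for i using x y z that by auto
  show "x +[?D] y : car ?D" using x y fin[of x y] by (auto cong: conj_cong)
  show "x +[?D] y = y +[?D] x" using xy by (auto intro!: restrict_ext a_comm)
  show "x +[?D] y +[?D] z = x +[?D] (y +[?D] z)" using xy by (auto intro!: restrict_ext a_assoc)
  next
  show "(zero ?D) : car ?D" by simp
  next
  fix x
  assume x: "x : car ?D"
  hence xc: "x i : car K" if "i : I" for i using that by auto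
  show "(zero ?D) +[?D] x = x" using x xc by force
  let ?y = "\<lambda>i\<in>I. \<ominus>\<^sub>K x i"
  have "{i : I. ?y i ~= zero K} <= {i : I. x i ~= zero K}" by auto
  moreover have "finite {i : I. x i ~= zero K}" using x by simp
  ultimately have "finite {i : I. ?y i ~= zero K}" by (rule fin_sub)
  moreover have "?y : I \<rightarrow>\<^sub>E car K" "ALL i:I. t ~: J i --> ?y i = zero K" using x by auto
  ultimately have "?y : car ?D" unfolding car_int_sum[OF assms] by blast
  moreover have "?y +[?D] x = zero ?D" using xc by (auto intro!: restrict_ext l_neg)
  ultimately show "EX y:car ?D. y +[?D] x = zero ?D" by blast
  qed
 next
  fix a b x y
  assume a: "a : car K" and x: "x : car ?D"
  have xc: "x i : car K" if "i : I" for i using that x by auto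
  have "{i : I. a *[K] x i ~= zero K} <= {i : I. x i ~= zero K}" using a by auto
  hence "finite {i : I. a *[K] x i ~= zero K}" using x by (auto intro: fin_sub)
  thus "a .[?D] x : car ?D" using x a by (auto cong: conj_cong)
  show "(a +[K] b) .[?D] x = a .[?D] x +[?D] b .[?D] x" if "b : car K" using a that xc by (auto intro!: restrict_ext l_distr)
  show "a *[K] b .[?D] x = a .[?D] (b .[?D] x)" if "b : car K" using a that xc by (auto intro!: restrict_ext m_assoc)
  show "a .[?D] (x +[?D] y) = a .[?D] x +[?D] a .[?D] y" if "y : car ?D" using \<open>y : car ?D\<close> using a xc
   by (auto intro!: restrict_ext r_distr)
 next
  fix x
  assume x: "x : car ?D"
  show "(one K) .[?D] x = x" using x by (auto simp: PiE_iff extensional_def)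
 qed
qed

lemma int_sum_res_cl:
 assumes "field K" "v : vc (int_sum K I J) t"
 shows "res (int_sum K I J) s t v : vc (int_sum K I J) s"
proof -
 interpret field K by fact
 let ?w = "\<lambda>i\<in>I. if s : J i then v i else (zero K)"
 have "{i : I. ?w i ~= zero K} <= {i : I. v i ~= zero K}" by auto
 moreover have "finite {i : I. v i ~= zero K}" using assms(2) by (simp add: car_int_sum[OF assms(1)])
 ultimately have "finite {i : I. ?w i ~= zero K}" by (rule fin_sub)
 moreover have "?w : I \<rightarrow>\<^sub>E car K" "ALL i:I. s ~: J i --> ?w i = zero K" using assms(2) by (auto simp: car_int_sum[OF assms(1)])
 ultimately show ?thesis unfolding car_int_sum[OF assms(1)] int_sum_s by blast
qed

lemma per_mod_int_sum:
 assumes "field K" "!!i. i : I ==> is_interval (J i)"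
 shows "per_mod K (int_sum K I J)"
proof (rule per_mod.intro)
 interpret field K by fact
 show "vspace K (vt (int_sum K I J) t)" for t using vs_int_sum[OF assms(1)] .
 show "lin_map K (vt (int_sum K I J) t) (vt (int_sum K I J) s) (res (int_sum K I J) s t)" if "s <= t" for s t
  unfolding lin_map_def using int_sum_res_cl[OF assms(1)] by (auto simp: int_sum_s)
 fix v r s t
 assume v: "v : vc (int_sum K I J) t"
 show "res (int_sum K I J) t t v = v" using v unfolding car_int_sum[OF assms(1)] by (auto simp: int_sum_s fun_eq_iff)
 assume rs: "r <= s" "s <= t"
 have "v i = zero K" if "i : I" "r : J i" "s ~: J i" for i
 proof -
  have "t ~: J i" using assms(2)[OF that(1)] that rs unfolding is_interval_1 by blast
  thus ?thesis using v that unfolding car_int_sum[OF assms(1)] by auto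
 qed
 thus "res (int_sum K I J) r s (res (int_sum K I J) s t v) = res (int_sum K I J) r t v" by (auto simp: int_sum_s)
qed

text \<open>It suffices to give vectors that follow the bars under restriction and form a basis at
  every parameter. Linear combination then defines an isomorphism from the sum of interval modules
  onto \<open>V\<close>, and \<open>per_iso_sym\<close> turns it round.\<close>

lemma (in per_mod) int_decompositionI:
 fixes J :: "'i => real set"
 assumes J: "!!i. i : I ==> J i ~= {} & is_interval (J i)" and bt: "!!i t. i : I ==> t : J i ==> bt i t : vc V t" and bt_res: "!!i s t. i : I ==> s <= t ==> t : J i ==> res V s t (bt i t) = (if s : J i then bt i s else (zero (vt V s)))" and ind: "!!t F c. finite F ==> F <= {i : I. t : J i} ==> c : F -> car K ==> (\<Oplus>\<^sub>(vt V t) i\<in>F. c i .[vt V t] bt i t) = zero (vt V t) ==> ALL i:F. c i = zero K" and span: "!!t. vc V t <= lsp K (vt V t) {bt i t | i. i : I & t : J i}"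
 shows "interval_decomposition K V (I, J)"
proof -
 define D where "D = int_sum K I J"
 note Dc = car_int_sum[OF field, of I J, folded D_def]
 note Ds = int_sum_s[where K = K and I = I and J = J, folded D_def]
 have Dv: "vspace K (vt D t)" for t unfolding D_def by (rule vs_int_sum[OF field])
 define supp where "supp v = {i : I. v i ~= zero K}" for v :: "'i => 'k"
 \<comment> \<open>Extension by zero outside the bars makes the sum defining \<open>g\<close>
   meaningful for all coefficient families at all parameters.\<close>
 define b where "b i t = (if t : J i then bt i t else (zero (vt V t)))" for i t
 define g where "g t v = (\<Oplus>\<^sub>(vt V t) i\<in>supp v. v i .[vt V t] b i t)" for t and v :: "'i => 'k"
 have bV: "b i t : vc V t" if "i : I" for i t
 proof -
  interpret module K "vt V t" by (rule mod)
  show ?thesis using bt[OF that] by (simp add: b_def)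
 qed
 have supp: "finite (supp v)" "supp v <= {i : I. t : J i}" "v i : car K" if "v : vc D t" "i : I" for v t i using that by (auto simp: Dc supp_def)
 have suppf: "finite (supp v)" if "v : vc D t" for v t using that by (auto simp: Dc supp_def)
 have g_eq: "g t v = (\<Oplus>\<^sub>(vt V t) i\<in>F. v i .[vt V t] b i t)" if v: "v : vc D t" and F: "finite F" "supp v <= F" "F <= I" for t v F
 proof -
  interpret module K "vt V t" by (rule mod)
  show ?thesis unfolding g_def
  proof (rule M.add.finprod_mono_neutral_cong_left[OF F(1,2)])
  show "v i .[vt V t] b i t = zero (vt V t)" if "i : F - supp v" for i using that F(3) bV[of i t] by (auto simp: supp_def)
  show "(%i. v i .[vt V t] b i t) : F -> vc V t" using supp(3)[OF v] bV F(3) by auto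
  qed auto
 qed
 have gV: "g t v : vc V t" if v: "v : vc D t" for t v
 proof -
  interpret module K "vt V t" by (rule mod)
  show ?thesis unfolding g_def using supp(3)[OF v] bV by (intro M.finsum_closed) (auto simp: supp_def)
 qed
 have g_lin: "lin_map K (vt D t) (vt V t) (g t)" for t unfolding lin_map_def
 proof (intro conjI ballI funcsetI)
  interpret D: vspace K "vt D t" by (rule Dv)
  interpret module K "vt V t" by (rule mod)
  show "g t v : vc V t" if "v : vc D t" for v using gV[OF that] .
  fix v
  assume v: "v : vc D t"
  have vc: "v i : car K" if "i : I" for i using supp(3)[OF v that] .
  show "g t (v +[vt D t] w) = g t v +[vt V t] g t w" if w: "w : vc D t" for w
  proof -
  let ?F = "supp v Un supp w"
  have wc: "w i : car K" if "i : I" for i using supp(3)[OF w that] .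
  have F: "finite ?F" "?F <= I" using suppf[OF v] suppf[OF w] by (auto simp: supp_def)
  have "supp (v +[vt D t] w) <= ?F" by (auto simp: supp_def Ds)
  hence "g t (v +[vt D t] w) = (\<Oplus>\<^sub>(vt V t) i\<in>?F. (v +[vt D t] w) i .[vt V t] b i t)" using v w F by (intro g_eq) auto
  also have "... = (\<Oplus>\<^sub>(vt V t) i\<in>?F. v i .[vt V t] b i t +[vt V t] w i .[vt V t] b i t)" using F(2) vc wc bV
   by (intro M.finsum_cong') (auto simp: Ds smult_l_distr)
  also have "... = g t v +[vt V t] g t w" using F vc wc bV g_eq[OF v F(1) _ F(2)] g_eq[OF w F(1) _ F(2)] by (subst M.finsum_addf) auto
  finally show ?thesis .
  qed
  show "g t (a .[vt D t] v) = a .[vt V t] g t v" if a: "a : car K" for a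
  proof -
  have F: "finite (supp v)" "supp v <= I" using suppf[OF v] by (auto simp: supp_def)
  have "supp (a .[vt D t] v) <= supp v" using a by (auto simp: supp_def Ds)
  hence "g t (a .[vt D t] v) = (\<Oplus>\<^sub>(vt V t) i\<in>supp v. (a .[vt D t] v) i .[vt V t] b i t)" using v a F by (intro g_eq) auto
  also have "... = (\<Oplus>\<^sub>(vt V t) i\<in>supp v. a .[vt V t] (v i .[vt V t] b i t))" using F(2) vc a bV
   by (intro M.finsum_cong') (auto simp: Ds smult_assoc1)
  also have "... = a .[vt V t] g t v" unfolding g_def using F a vc bV by (intro finsum_smult_ldistr[symmetric]) auto
  finally show ?thesis .
  qed
 qed
 have g_inj: "inj_on (g t) (vc D t)" for t
 proof -
  interpret D: vspace K "vt D t" by (rule Dv)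
  interpret module K "vt V t" by (rule mod)
  have ker: "v = zero (vt D t)" if v: "v : vc D t" and z: "g t v = zero (vt V t)" for v
  proof -
  have s: "supp v <= {i : I. t : J i}" using v by (auto simp: Dc supp_def)
  have "g t v = (\<Oplus>\<^sub>(vt V t) i\<in>supp v. v i .[vt V t] bt i t)" unfolding g_def using s supp(3)[OF v] bt
   by (intro M.finsum_cong') (auto simp: b_def)
  hence "ALL i:supp v. v i = zero K" using ind[OF suppf[OF v] s, of v] z supp(3)[OF v] s by auto
  hence "v i = zero K" if "i : I" for i using that by (auto simp: supp_def)
  thus ?thesis using v by (auto simp: Ds Dc PiE_iff extensional_def)
  qed
  show ?thesis
  proof (rule inj_onI)
  fix v w
  assume v: "v : vc D t" and w: "w : vc D t" and e: "g t v = g t w"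
  have "g t (v +[vt D t] (\<ominus>\<^sub>(vt D t) w)) = zero (vt V t)" using v w e gV[OF w]
   by (simp add: lin_map_add[OF Dv vs g_lin] lin_map_minus[OF Dv vs g_lin] M.r_neg)
  hence "v +[vt D t] (\<ominus>\<^sub>(vt D t) w) = zero (vt D t)" using ker v w by simp
  thus "v = w" using v w by (simp add: D.M.add.inv_solve_right')
  qed
 qed
 have g_surj: "g t ` vc D t = vc V t" for t
 proof
  interpret D: vspace K "vt D t" by (rule Dv)
  interpret V: vspace K "vt V t" by (rule vs)
  show "g t ` vc D t <= vc V t" using gV by blast
  have "bt i t : g t ` vc D t" if i: "i : I" "t : J i" for i
  proof -
  let ?e = "\<lambda>j\<in>I. if j = i then (one K) else (zero K)"
  have s: "supp ?e = {i}" using i by (auto simp: supp_def)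
  hence e: "?e : vc D t" using i unfolding Dc supp_def[symmetric] by simp
  have "g t ?e = bt i t" unfolding g_def s using i bt[OF i] by (simp add: b_def)
  thus ?thesis using e by force
  qed
  thus "vc V t <= g t ` vc D t"
   using span[of t] V.span_min[OF lin_map_img_sub[OF Dv vs g_lin D.carrier_is_submodule], of "{bt i t | i. i : I & t : J i}"] by blast
 qed
 have b_res: "res V s t (b i t) = (if s : J i & t : J i then b i s else (zero (vt V s)))" if "i : I" "s <= t" for i s t using bt_res[OF that] that
  by (auto simp: b_def res_zero)
 have g_res: "g s (res D s t v) = res V s t (g t v)" if st: "s <= t" and v: "v : vc D t" for s t v
 proof -
  interpret Vs: module K "vt V s" by (rule mod)
  interpret Vt: module K "vt V t" by (rule mod)
  have F: "finite (supp v)" "supp v <= I" using suppf[OF v] by (auto simp: supp_def)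
  have vc: "v i : car K" if "i : I" for i using supp(3)[OF v that] .
  have rD: "res D s t v : vc D s" using int_sum_res_cl[OF field] v unfolding D_def by blast
  have "res V s t (g t v) = (\<Oplus>\<^sub>(vt V s) i\<in>supp v. res V s t (v i .[vt V t] b i t))" unfolding g_def using F vc bV
   by (intro res_finsum[OF st]) auto
  also have "... = (\<Oplus>\<^sub>(vt V s) i\<in>supp v. res D s t v i .[vt V s] b i s)"
  proof (intro Vs.M.finsum_cong')
  fix i
  assume i: "i : supp v"
  hence iI: "i : I" and tJ: "t : J i" using v by (auto simp: Dc supp_def)
  show "res V s t (v i .[vt V t] b i t) = res D s t v i .[vt V s] b i s" using iI tJ vc[OF iI] bV[OF iI]
   by (simp add: res_smult[OF st] b_res[OF iI st] Ds)
  next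
  show "(%i. res D s t v i .[vt V s] b i s) : supp v -> vc V s" using F vc bV by (auto simp: Ds)
  qed auto
  also have "... = g s (res D s t v)"
  proof -
  have "supp (res D s t v) <= supp v" by (auto simp: supp_def Ds)
  thus ?thesis using g_eq[OF rD F(1) _ F(2)] by simp
  qed
  finally show ?thesis by simp
 qed
 have "pers_iso K D V" unfolding pers_iso_def using g_lin g_inj g_surj g_res by (intro exI[of _ g]) (auto simp: bij_betw_def)
 hence "pers_iso K V D" by (intro per_iso_sym[OF Dv vs]) (auto simp: D_def intro: int_sum_res_cl[OF field])
 thus ?thesis using J by (simp add: D_def)
qed

subsection \<open>The radical of a q-tame module\<close>

context per_mod begin

text \<open>The images are nested and grow as \<open>t\<close> decreases to \<open>s\<close>; two
  vectors of the union therefore come from a common parameter, and the union is a subspace.\<close>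

lemma rad_car: "vc (radical K V) s = (\<Union>t\<in>{s<..}. res V s t ` vc V t)"
proof -
 interpret Vs: vspace K "vt V s" by (rule vs)
 let ?U = "\<Union>t\<in>{s<..}. res V s t ` vc V t"
 have im: "submodule (res V s t ` vc V t) K (vt V s)" if "s < t" for t
  using lin_map_img_sub[OF vs vs res_lin[of s t] module.carrier_is_submodule[OF mod]] that by simp
 have mono: "res V s t ` vc V t <= res V s u ` vc V u" if "s < u" "u <= t" for u t
 proof
  fix x
  assume "x : res V s t ` vc V t"
  then obtain y where y: "y : vc V t" "x = res V s t y" by blast
  hence "x = res V s u (res V u t y)" using res_comp[of s u t y] that by simp
  thus "x : res V s u ` vc V u" using res_cl[OF that(2) y(1)] by blast
 qed
 have "submodule ?U K (vt V s)"
 proof (rule Vs.submoduleI)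
  show "?U <= vc V s" using Vs.submoduleE(1)[OF im] by blast
  show "(zero (vt V s)) : ?U" using Vs.sub_zero[OF im[of "s + 1"]] by auto
 next
  fix x y
  assume "x : ?U" "y : ?U"
  then obtain t u where tu: "s < t" "s < u" "x : res V s t ` vc V t" "y : res V s u ` vc V u" by auto
  thus "x +[vt V s] y : ?U" using subsetD[OF mono[of "min t u" t]] subsetD[OF mono[of "min t u" u]] using Vs.submoduleE(5)[OF im[of "min t u"]]
   by (intro UN_I[of "min t u"]) auto
 next
  fix x
  assume "x : ?U"
  then obtain t where t: "s < t" "x : res V s t ` vc V t" by auto
  show "\<ominus>\<^sub>(vt V s) x : ?U" using t Vs.submoduleE(3)[OF im[OF t(1)] t(2)] by auto
  show "a .[vt V s] x : ?U" if "a : car K" for a using t Vs.submoduleE(4)[OF im[OF t(1)] that t(2)] by auto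
 qed
 hence "lsp K (vt V s) ?U = ?U" using Vs.span_min Vs.span_sup by (metis subset_antisym subset_refl)
 thus ?thesis by (simp add: radical_def)
qed

lemma rad_sub: "submodule (vc (radical K V) s) K (vt V s)"
proof -
 interpret Vs: vspace K "vt V s" by (rule vs)
 have "(\<Union>t\<in>{s<..}. res V s t ` vc V t) <= vc V s" using res_cl by auto
 thus ?thesis using Vs.span_sub by (simp add: radical_def)
qed

end

lemma (in vspace) sub_res:
 assumes "submodule U K V" "W <= U"
 shows "submodule W K (V\<lparr>carrier := U\<rparr>) <-> submodule W K V"
proof -
 interpret U: module K "V\<lparr>carrier := U\<rparr>" by (rule submodule.submodule_is_module[OF assms(1)]) (rule module_axioms)
 \<comment> \<open>The negative in a record with smaller carrier is a description over that carrier,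
   so its agreement with the negative of \<open>V\<close> has to be derived.\<close>
 have inv: "\<ominus>\<^bsub>V\<lparr>carrier := U\<rparr>\<^esub> x = \<ominus>\<^sub>V x" if "x : U" for x
  using M.add.m_inv_consistent[of U x] that assms(1) by (auto simp: submodule_def a_inv_def)
 show ?thesis
 proof
  assume W: "submodule W K (V\<lparr>carrier := U\<rparr>)"
  show "submodule W K V" using U.submoduleE[OF W] submoduleE(1)[OF assms(1)] inv subgroup.one_closed[OF submodule.axioms(1)[OF W]]
   by (intro submoduleI) (auto simp: subset_iff)
 next
  assume W: "submodule W K V"
  show "submodule W K (V\<lparr>carrier := U\<rparr>)" using submoduleE[OF W] sub_zero[OF W] inv assms(2) by (intro U.submoduleI) auto
 qed
qed

lemma (in vspace) span_res:
 assumes "submodule U K V" "S <= U"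
 shows "lsp K (V\<lparr>carrier := U\<rparr>) S = lsp K V S"
proof
 interpret U: vspace K "V\<lparr>carrier := U\<rparr>" using submodule.submodule_is_module[OF assms(1) module_axioms] K.field_axioms
  by (simp add: vspace_def)
 have SV: "S <= car V" using assms submoduleE(1) by blast
 have sub: "lsp K V S <= U" by (rule span_min[OF assms])
 show "lsp K (V\<lparr>carrier := U\<rparr>) S <= lsp K V S" using sub span_sub[OF SV] span_sup sub_res[OF assms(1)] by (intro U.span_min) auto
 show "lsp K V S <= lsp K (V\<lparr>carrier := U\<rparr>) S" using U.span_sub_car[of S] assms(2) U.span_sub[of S] U.span_sup[of S] sub_res[OF assms(1)]
  by (intro span_min) auto
qed

text \<open>Applied to the radical, to the elements concentrated in one degree and to the cup
  powers. \<open>W\<close> is given by equations because each of these modules is defined by a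
  record of its own.\<close>

lemma per_mod_sub:
 assumes "per_mod K V" "!!t. submodule (U t) K (vt V t)" "!!s t. s <= t ==> res V s t ` U t <= U s" and W: "!!t. vt W t = (vt V t)\<lparr>carrier := U t\<rparr>" "res W = res V"
 shows "per_mod K W"
proof (rule per_mod.intro)
 interpret per_mod K V by fact
 have U: "U t <= vc V t" for t using module.submoduleE(1)[OF mod assms(2)] .
 show "vspace K (vt W t)" for t unfolding W using submodule.submodule_is_module[OF assms(2) mod] field by (rule vspaceI[rotated])
 show "lin_map K (vt W t) (vt W s) (res W s t)" if "s <= t" for s t using res_lin[OF that] assms(3)[OF that] U[of t] unfolding W lin_map_def
  by (auto simp: subset_iff)
 show "res W t t v = v" if "v : vc W t" for t v using res_id that U unfolding W by auto
 show "res W r s (res W s t v) = res W r t v" if "r <= s" "s <= t" "v : vc W t" for r s t v using res_comp[OF that(1,2)] that(3) U[of t] unfolding W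
  by auto
qed

lemma (in per_mod) per_mod_rad: "per_mod K (radical K V)"
proof (rule per_mod_sub[OF per_mod_axioms rad_sub])
 show "vt (radical K V) t = (vt V t)\<lparr>carrier := vc (radical K V) t\<rparr>" for t by (simp add: radical_def)
 show "res (radical K V) = res V" by (simp add: radical_def)
 show "res V s t ` vc (radical K V) t <= vc (radical K V) s" if "s <= t" for s t
 proof -
  have "res V s t (res V t u x) : (\<Union>u\<in>{s<..}. res V s u ` vc V u)" if "t < u" "x : vc V u" for u x
   using res_comp[of s t u x] that \<open>s <= t\<close> by auto
  thus ?thesis unfolding rad_car by auto
 qed
qed

subsection \<open>Decomposition of the radical\<close>

text \<open>In the following locale every bar is open on the right, since every vector comes from a strictly
  larger parameter. For such an interval \<open>I\<close> the subspaces \<open>upper I t\<close> and \<open>lower I t\<close> are the numerator and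
  the denominator of the functorial subquotient of Crawley-Boevey that counts the bars equal to \<open>I\<close>.\<close>

locale rad_mod = per_mod +
 assumes q_tame: "q_tame K V" and rad: "!!s v. v : vc V s ==> EX t>s. v : res V s t ` vc V t" begin

section \<open>The subquotient of a module that belongs to an interval\<close>

definition im :: "real => real => 'b set" where "im s t = res V s t ` vc V t"

definition ker :: "real => real => 'b set" where "ker r t = {v : vc V t. res V r t v = zero (vt V r)}"

definition upper :: "real set => real => 'b set" where "upper I t = {v : vc V t. (ALL s:I. t <= s --> v : im t s) & (ALL r. r ~: I --> r < t --> v : ker r t)}"

text \<open>The vectors that come from beyond the upper end of \<open>I\<close>. The zero vector is
  added separately because for \<open>I\<close> unbounded above there is no such parameter.\<close>

definition im_below :: "real set => real => 'b set" where "im_below I t = {v : vc V t. v = zero (vt V t) | (EX s. s ~: I & t < s & v : im t s)}"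

text \<open>Restriction lowers the parameter, so these are the vectors that die while still inside
  \<open>I\<close>, before its lower end.\<close>

definition ker_below :: "real set => real => 'b set" where "ker_below I t = (\<Union>r\<in>{r:I. r <= t}. ker r t)"

definition lower :: "real set => real => 'b set" where "lower I t = {x +[vt V t] y | x y. x : im_below I t & (ALL r. r ~: I --> r < t --> x : ker r t) & y : upper I t & y : ker_below I t}"

lemma im_submodule: "s <= t ==> submodule (im s t) K (vt V s)" unfolding im_def
 by (rule lin_map_img_sub[OF vs vs res_lin module.carrier_is_submodule[OF mod]])

lemma ker_sub: "r <= t ==> submodule (ker r t) K (vt V t)"
proof -
 assume "r <= t"
 interpret module K "vt V r" by (rule mod)
 have "submodule {(zero (vt V r))} K (vt V r)" by (intro submoduleI) auto
 from lin_map_vim_sub[OF vs vs res_lin[OF \<open>r <= t\<close>] this] show ?thesis by (simp add: ker_def)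
qed

lemma im_subset: "s <= t ==> im s t <= vc V s" unfolding im_def using res_cl by auto

lemma im_anti: "s <= t ==> t <= u ==> im s u <= im s t" unfolding im_def by (auto simp: res_comp[symmetric, of s t u] intro!: res_cl)

lemma ker_anti: "q <= r ==> r <= t ==> ker r t <= ker q t" unfolding ker_def by (auto simp: res_comp[symmetric, of q r t] res_zero)

lemma ker_self: "ker t t = {(zero (vt V t))}"
proof -
 interpret module K "vt V t" by (rule mod)
 show ?thesis unfolding ker_def by (auto simp: res_id)
qed

lemma res_im: "r <= s ==> s <= t ==> res V r s ` im s t = im r t" unfolding im_def image_image by (intro image_cong) (auto simp: res_comp)

lemma im_fin_dim: "s < t ==> vspace.fin_dim K (vt V s) (im s t)"
proof -
 assume "s < t"
 then obtain S where "S <= vc V s" "finite S" "im s t <= lsp K (vt V s) S"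
  using q_tame[unfolded q_tame_def, rule_format, OF \<open>s < t\<close>] unfolding im_def by auto
 thus ?thesis unfolding vspace.fin_dim_def[OF vs] by auto
qed

lemma fin_dim_mono': "vspace.fin_dim K (vt V t) W ==> U <= W ==> vspace.fin_dim K (vt V t) U" using vspace.fin_dim_mono[OF vs] .

text \<open>The images decrease as \<open>s\<close> grows and are finite-dimensional by q-tameness,
  so one of them is the smallest. The strict inequality \<open>t < s\<close> matters: q-tameness
  says nothing about \<open>im t t\<close>.\<close>

lemma im_stable: assumes "I ~= {}" "!!s. s : I ==> t < s" shows "EX s:I. ALL u:I. im t s <= im t u"
proof -
 interpret vspace K "vt V t" by (rule vs)
 have "EX W:im t ` I. ALL U:im t ` I. ~ U \<subset> W" using assms im_fin_dim im_submodule by (intro fin_dim_min_subsp) (auto simp: less_imp_le)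
 then obtain s where s: "s : I" "!!u. u : I ==> ~ im t u \<subset> im t s" by auto
 have "im t s <= im t u" if "u : I" for u using im_anti[of t u s] assms(2)[OF that] s(2)[OF that] im_anti[of t s u] assms(2)[OF s(1)] by force
 thus ?thesis using s(1) by blast
qed

text \<open>An interval without greatest element. The empty set qualifies, which is why nonemptiness
  appears separately in \<open>bars\<close>.\<close>

definition op_r :: "real set => bool" where "op_r I <-> is_interval I & (ALL t:I. EX s:I. t < s)"

lemma op_r_btw: "op_r I ==> r : I ==> t : I ==> r <= s ==> s <= t ==> s : I" unfolding op_r_def is_interval_1 by blast

lemma op_r_above: "op_r I ==> t : I ==> EX s:I. t < s" unfolding op_r_def by blast

text \<open>A Mittag-Leffler property: coming from all points of \<open>I\<close> above
  \<open>t\<close> amounts to coming from a single well chosen one.\<close>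

lemma upper_wit:
 assumes I: "op_r I" "t : I"
 shows "EX s:I. t < s & (ALL u:I. t <= u --> im t s <= im t u)"
proof -
 have "{s:I. t < s} ~= {}" using op_r_above[OF I] by blast
 from im_stable[OF this, of t] obtain s where s: "s : I" "t < s" "!!u. u : I ==> t < u ==> im t s <= im t u" by auto
 have "im t s <= im t u" if "u : I" "t <= u" for u using im_anti[of t t s] s using s(3)[OF that(1)] that(2) by force
 thus ?thesis using s(1,2) by blast
qed

lemma upper_sub: "upper I t <= vc V t" by (auto simp: upper_def)

lemma upper_submodule: "submodule (upper I t) K (vt V t)"
proof -
 interpret vspace K "vt V t" by (rule vs)
 note im = submoduleE[OF im_submodule] and ker = submoduleE[OF ker_sub]
 show ?thesis
 proof (rule submoduleI)
  show "(zero (vt V t)) : upper I t" by (auto simp: upper_def intro!: sub_zero[OF im_submodule] sub_zero[OF ker_sub])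
  show "\<ominus>\<^sub>(vt V t) a : upper I t" if "a : upper I t" for a using that by (auto simp: upper_def intro!: im(3) ker(3))
  show "a +[vt V t] b : upper I t" if "a : upper I t" "b : upper I t" for a b using that by (auto simp: upper_def intro!: im(5) ker(5))
  show "a .[vt V t] b : upper I t" if "a : car K" "b : upper I t" for a b using that by (auto simp: upper_def intro!: im(4) ker(4))
 qed (auto simp: upper_def)
qed

lemma upper_fin_dim: assumes "op_r I" "t : I" shows "vspace.fin_dim K (vt V t) (upper I t)"
proof -
 obtain s where "s : I" "t < s" using op_r_above[OF assms] by blast
 thus ?thesis by (intro fin_dim_mono'[OF im_fin_dim[of t s]]) (auto simp: upper_def)
qed

lemma im_below_sub: "submodule (im_below I t) K (vt V t)"
proof -
 interpret vspace K "vt V t" by (rule vs)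
 note im = submoduleE[OF im_submodule]
 show ?thesis
 proof (rule submoduleI)
  fix x y
  assume "x : im_below I t" "y : im_below I t"
  moreover have "x +[vt V t] y : im_below I t" if su: "s ~: I" "t < s" "x : im t s" "u ~: I" "t < u" "y : im t u" for s u
  proof -
  have "x +[vt V t] y : im t (min s u)" using subsetD[OF im_anti[of t "min s u" s]] subsetD[OF im_anti[of t "min s u" u]] using su by (intro im(5)) auto
  moreover have "min s u ~: I" "t < min s u" using su by (auto simp: min_def)
  ultimately show ?thesis using im_subset[of t "min s u"] unfolding im_below_def by auto
  qed
  ultimately show "x +[vt V t] y : im_below I t" unfolding im_below_def by auto
 next
  fix x
  assume x: "x : im_below I t"
  thus "\<ominus>\<^sub>(vt V t) x : im_below I t" unfolding im_below_def by (auto intro!: im(3))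
  show "a .[vt V t] x : im_below I t" if "a : car K" for a using x that unfolding im_below_def by (auto intro!: im(4))
 qed (auto simp: im_below_def)
qed

lemma ker_below_sub: assumes "t : I" shows "submodule (ker_below I t) K (vt V t)"
proof -
 interpret vspace K "vt V t" by (rule vs)
 note ker = submoduleE[OF ker_sub]
 show ?thesis
 proof (rule submoduleI)
  fix x y
  assume "x : ker_below I t" "y : ker_below I t"
  then obtain r s where rs: "r : I" "r <= t" "x : ker r t" "s : I" "s <= t" "y : ker s t" unfolding ker_below_def by blast
  have "x +[vt V t] y : ker (min r s) t" using subsetD[OF ker_anti[of "min r s" r t]] subsetD[OF ker_anti[of "min r s" s t]] using rs
   by (intro ker(5)) auto
  moreover have "min r s : I" "min r s <= t" using rs by (auto simp: min_def)
  ultimately show "x +[vt V t] y : ker_below I t" unfolding ker_below_def by blast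
 next
  show "ker_below I t <= vc V t" by (auto simp: ker_below_def ker_def)
  show "(zero (vt V t)) : ker_below I t" unfolding ker_below_def using assms ker_self[of t] by auto
  show "\<ominus>\<^sub>(vt V t) x : ker_below I t" if "x : ker_below I t" for x using that unfolding ker_below_def by (auto intro: ker(3))
  show "a .[vt V t] x : ker_below I t" if "a : car K" "x : ker_below I t" for a x using that unfolding ker_below_def by (auto intro: ker(4))
 qed
qed

lemma kerP_sub: "submodule {x : vc V t. ALL r. r ~: I --> r < t --> x : ker r t} K (vt V t)"
proof -
 interpret vspace K "vt V t" by (rule vs)
 note ker = submoduleE[OF ker_sub]
 show ?thesis by (rule submoduleI) (auto intro!: ker(3,4,5) sub_zero[OF ker_sub])
qed

lemma lower_eq: "lower I t = {x +[vt V t] y | x y. x : im_below I t Int {x : vc V t. ALL r. r ~: I --> r < t --> x : ker r t} & y : upper I t Int ker_below I t}"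
 unfolding lower_def im_below_def by blast

end

lemma (in vspace) sub_Int: "submodule A K V ==> submodule B K V ==> submodule (A Int B) K V" using submoduleE[of A] submoduleE[of B] sub_zero
 by (intro submoduleI) auto

lemma (in vspace) sub_sum:
 assumes "submodule A K V" "submodule B K V"
 shows "submodule {x +[V] y | x y. x : A & y : B} K V" (is "submodule ?S K V")
proof (rule submoduleI)
 note A = submoduleE[OF assms(1)] and B = submoduleE[OF assms(2)]
 show "?S <= car V" using A(1) B(1) by auto
 show "(zero V) : ?S" using sub_zero[OF assms(1)] sub_zero[OF assms(2)] by force
 show "\<ominus>\<^sub>V a : ?S" if "a : ?S" for a using that A(1,3) B(1,3) by (smt (verit) M.minus_add mem_Collect_eq subsetD)
 show "a .[V] x : ?S" if "a : car K" "x : ?S" for a x using that A(1,4) B(1,4) by (smt (verit) smult_r_distr mem_Collect_eq subsetD)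
 fix a b
 assume "a : ?S" "b : ?S"
 then obtain x y u v where *: "x : A" "y : B" "u : A" "v : B" "a = x +[V] y" "b = u +[V] v" by blast
 have c: "x : car V" "y : car V" "u : car V" "v : car V" using * A(1) B(1) by auto
 have "a +[V] b = (x +[V] u) +[V] (y +[V] v)" using * c by (simp add: M.a_ac)
 thus "a +[V] b : ?S" using * A(5) B(5) by blast
qed

context rad_mod begin

lemma lower_sub: "t : I ==> submodule (lower I t) K (vt V t)" unfolding lower_eq
 by (intro vspace.sub_sum[OF vs] vspace.sub_Int[OF vs] im_below_sub kerP_sub upper_submodule ker_below_sub)

lemma im_below_sub_im:
 assumes "op_r I" "t : I" "x : im_below I t" "s : I" "t <= s"
 shows "x : im t s"
proof -
 interpret vspace K "vt V t" by (rule vs)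
 consider "x = zero (vt V t)" | u where "u ~: I" "t < u" "x : im t u" using assms(3) unfolding im_below_def by blast
 thus ?thesis
 proof cases
  case 1
  thus ?thesis using sub_zero[OF im_submodule] assms by simp
 next
  case 2
  hence "~ u <= s" using op_r_btw[OF assms(1,2,4), of u] by auto
  thus ?thesis using 2 im_anti[of t s u] assms by auto
 qed
qed

lemma lower_sub_upper: "op_r I ==> t : I ==> lower I t <= upper I t"
proof
 fix v
 assume I: "op_r I" "t : I" and "v : lower I t"
 then obtain x y where xy: "v = x +[vt V t] y" "x : im_below I t" "ALL r. r ~: I --> r < t --> x : ker r t" "y : upper I t" unfolding lower_def by blast
 have "x : vc V t" using xy(2) by (simp add: im_below_def)
 moreover have "x : im t s" if "s : I" "t <= s" for s using im_below_sub_im[OF I xy(2) that] .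
 ultimately have "x : upper I t" using xy(3) by (simp add: upper_def)
 thus "v : upper I t" using xy module.submoduleE(5)[OF mod upper_submodule] by blast
qed

text \<open>No parameter outside \<open>I\<close> lies between the points \<open>r\<close> and
  \<open>t\<close> of \<open>I\<close>, so the conditions at \<open>t\<close> and at
  \<open>r\<close> concern the same parameters.\<close>

lemma kerP_pb:
 assumes I: "op_r I" "r : I" "t : I" "r <= t" and v: "v : vc V t"
 shows "(ALL q. q ~: I --> q < t --> v : ker q t) <-> (ALL q. q ~: I --> q < r --> res V r t v : ker q r)"
proof -
 have "v : ker q t <-> res V r t v : ker q r" if "q <= r" for q using res_comp[OF that I(4) v] v res_cl[OF I(4) v] by (simp add: ker_def)
 moreover have "q < r" if "q ~: I" "q < t" for q using op_r_btw[OF I(1-3), of q] that by force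
 ultimately show ?thesis using I(4) by force
qed

lemma res_upper:
 assumes I: "op_r I" "r : I" "t : I" "r <= t" and v: "v : upper I t"
 shows "res V r t v : upper I r"
proof -
 have vc: "v : vc V t" using v by (simp add: upper_def)
 have "res V r t v : im r s" if s: "s : I" "r <= s" for s
 proof (cases "t <= s")
  case True
  thus ?thesis using v s res_im[OF I(4) True] by (auto simp: upper_def)
 next
  case False
  have "res V r t v : im r t" using vc by (auto simp: im_def)
  thus ?thesis using im_anti[of r s t] False s by auto
 qed
 moreover have "ALL q. q ~: I --> q < r --> res V r t v : ker q r" using kerP_pb[OF I vc] v by (simp add: upper_def)
 ultimately show ?thesis using res_cl[OF I(4) vc] by (simp add: upper_def)
qed

text \<open>Any preimage at \<open>t\<close> taken through the parameter \<open>s\<close> of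
  \<open>upper_wit\<close> works: it lies in the smallest image \<open>im t s\<close>, hence in all
  images that \<open>upper\<close> asks for.\<close>

lemma upper_lift:
 assumes I: "op_r I" "r : I" "t : I" "r <= t" and v: "v : upper I r"
 shows "EX w:upper I t. res V r t w = v"
proof -
 obtain s where s: "s : I" "t < s" "!!u. u : I ==> t <= u ==> im t s <= im t u" using upper_wit[OF I(1,3)] by blast
 have "v : im r s" using v s(1,2) I(4) by (auto simp: upper_def)
 then obtain x where x: "x : vc V s" "v = res V r s x" by (auto simp: im_def)
 let ?w = "res V t s x"
 have w: "?w : vc V t" "?w : im t s" and rw: "res V r t ?w = v" using x s res_cl[of t s x] res_comp[of r t s x] I(4) by (simp_all add: im_def)
 have "ALL q. q ~: I --> q < t --> ?w : ker q t" using kerP_pb[OF I w(1)] v unfolding rw by (simp add: upper_def)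
 hence "?w : upper I t" using s(3) w by (auto simp: upper_def)
 thus ?thesis using rw by blast
qed

lemma ker_below_pb:
 assumes I: "op_r I" "r : I" "t : I" "r <= t" and v: "v : vc V t"
 shows "v : ker_below I t <-> res V r t v : ker_below I r"
proof
 assume "v : ker_below I t"
 then obtain q where q: "q : I" "q <= t" "v : ker q t" by (auto simp: ker_below_def)
 have "v : ker (min q r) t" using q(2,3) ker_anti[of "min q r" q t] by auto
 hence "res V r t v : ker (min q r) r" using res_comp[of "min q r" r t v] I(4) res_cl[OF I(4) v] by (simp add: ker_def)
 moreover have "min q r : I" using q I by (simp add: min_def)
 ultimately show "res V r t v : ker_below I r" unfolding ker_below_def by auto
next
 assume "res V r t v : ker_below I r"
 then obtain q where q: "q : I" "q <= r" "res V r t v : ker q r" by (auto simp: ker_below_def)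
 hence "v : ker q t" using res_comp[OF q(2) I(4) v] v by (simp add: ker_def)
 thus "v : ker_below I t" using q I(4) unfolding ker_below_def by auto
qed

text \<open>Restriction is injective on \<open>upper\<close> modulo \<open>lower\<close>. The two
  summands of the restriction of \<open>w\<close> are lifted to \<open>t\<close> separately; what
  remains of \<open>w\<close> vanishes at \<open>r\<close>, a point of \<open>I\<close>, and is
  absorbed into the summand from \<open>ker_below\<close>.\<close>

lemma lower_pb:
 assumes I: "op_r I" "r : I" "t : I" "r <= t" and w: "w : upper I t" "res V r t w : lower I r"
 shows "w : lower I t"
proof -
 interpret vspace K "vt V t" by (rule vs)
 let ?V = "vt V t"
 note subU = submoduleE[OF upper_submodule]
 obtain x y where xy: "res V r t w = x +[vt V r] y" "x : im_below I r" "ALL q. q ~: I --> q < r --> x : ker q r" "y : upper I r" "y : ker_below I r"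
  using w(2) unfolding lower_def by blast
 obtain z where z: "z : upper I t" "res V r t z = y" using upper_lift[OF I xy(4)] by blast
 have zc: "z : car ?V" and wc: "w : car ?V" using z(1) w(1) upper_sub by auto
 have "EX x':im_below I t. res V r t x' = x"
 proof (cases "x = zero (vt V r)")
  case True
  thus ?thesis using res_zero[OF I(4)] sub_zero[OF im_below_sub] by blast
 next
  case False
  then obtain u where u: "u ~: I" "r < u" "x : im r u" using xy(2) by (auto simp: im_below_def)
  have "t < u" using op_r_btw[OF I(1-3), of u] u by force
  hence "x : res V r t ` im t u" using u res_im[of r t u] I(4) by simp
  then obtain x' where "x' : im t u" "x = res V r t x'" by blast
  moreover have "x' : im_below I t" using \<open>x' : im t u\<close> u(1) \<open>t < u\<close> im_subset[of t u] by (auto simp: im_below_def)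
  ultimately show ?thesis by blast
 qed
 then obtain x' where x': "x' : im_below I t" "res V r t x' = x" by blast
 have x'c: "x' : car ?V" using x' by (simp add: im_below_def)
 have x'U: "x' : upper I t" using im_below_sub_im[OF I(1,3) x'(1)] kerP_pb[OF I x'c] x' xy(3) x'c by (simp add: upper_def)
 \<comment> \<open>The defect of the lifted decomposition; its restriction to \<open>r\<close> is
   zero by construction.\<close>
 let ?d = "w +[?V] \<ominus>\<^sub>?V (x' +[?V] z)"
 interpret R: vspace K "vt V r" by (rule vs)
 have "x : vc V r" "y : vc V r" using xy by (auto simp: im_below_def upper_def)
 hence "res V r t ?d = zero (vt V r)" using wc x'c zc x'(2) z(2) xy(1)
  by (simp add: lin_map_add[OF vs vs res_lin[OF I(4)]] lin_map_minus[OF vs vs res_lin[OF I(4)]] R.M.r_neg)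
 hence "?d : ker r t" using wc x'c zc by (simp add: ker_def)
 hence "?d : ker_below I t" using I unfolding ker_below_def by auto
 hence y': "z +[?V] ?d : upper I t" "z +[?V] ?d : ker_below I t"
  using ker_below_pb[OF I zc] z xy w(1) x'U subU(3,5) submoduleE(5)[OF ker_below_sub[OF I(3)]] by auto
 have "w = x' +[?V] (z +[?V] ?d)"
 proof -
  have "x' +[?V] (z +[?V] ?d) = (x' +[?V] z) +[?V] (\<ominus>\<^sub>?V (x' +[?V] z) +[?V] w)" using wc x'c zc by (simp add: M.a_ac)
  also have "... = w" by (rule M.r_neg2) (use wc x'c zc in auto)
  finally show ?thesis by simp
 qed
 thus ?thesis using kerP_pb[OF I x'c] x' xy(3) y' unfolding lower_def by blast
qed

end

lemma (in vspace) span_Un_lc: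
 assumes A: "submodule A K V" and bt: "finite bt" "bt <= car V" and v: "v : lsp K V (A Un bt)"
 shows "EX a:A. EX c:bt -> car K. v = a +[V] (\<Oplus>\<^sub>V b\<in>bt. c b .[V] b)"
proof -
 let ?S = "{x +[V] y | x y. x : A & y : lsp K V bt}"
 have "A Un bt <= ?S"
 proof
  fix x
  assume "x : A Un bt"
  then consider "x : A" | "x : bt" by blast
  thus "x : ?S"
  proof cases
  case 1
  hence "x = x +[V] (zero V)" using submoduleE(1)[OF A] by auto
  thus ?thesis using 1 sub_zero[OF span_sub[OF bt(2)]] by blast
  next
  case 2
  hence "x = (zero V) +[V] x" "x : lsp K V bt" using bt span_sup[of bt] by auto
  thus ?thesis using sub_zero[OF A] by blast
  qed
 qed
 hence "lsp K V (A Un bt) <= ?S" by (intro span_min sub_sum[OF A span_sub[OF bt(2)]])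
 thus ?thesis using v unfolding span_eq_lc[OF bt] by blast
qed

section \<open>Coherent families of vectors along a bar\<close>

context rad_mod begin

text \<open>A coherent lift over a whole interval is obtained by countably many successive choices;
  this provides the parameters at which they are made.\<close>

lemma op_r_cofinal:
 assumes I: "op_r I" "t0 : I"
 shows "EX T :: nat => real. T 0 = t0 & (ALL n. T n : I & T n <= T (Suc n)) & (ALL t:I. EX n. t <= T n)"
proof (cases "bdd_above I")
 case True
 define b where "b = Sup I"
 have lt: "t < b" if t: "t : I" for t
 proof -
  obtain s where "s : I" "t < s" using op_r_above[OF I(1) t] by blast
  thus ?thesis using cSup_upper[OF _ True, of s] unfolding b_def by simp
 qed
 have mem: "x : I" if x: "t0 <= x" "x < b" for x
 proof -
  obtain y where y: "y : I" "x < y" using x(2) less_cSup_iff[of I x] True I(2) unfolding b_def by blast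
  thus ?thesis using op_r_btw[OF I y(1), of x] x by simp
 qed
 \<comment> \<open>The sequence starts at \<open>t0\<close> for \<open>n = 0\<close> and converges
   to the supremum \<open>b\<close>, which is not a point of \<open>I\<close>.\<close>
 let ?T = "%n::nat. b - (b - t0) / (real n + 1)"
 show ?thesis
 proof (intro exI[of _ ?T] conjI allI ballI)
  fix n :: nat
  have "(b - t0) / (real n + 1) <= (b - t0) / 1" using lt[OF I(2)] by (intro divide_left_mono) auto
  moreover have "0 < (b - t0) / (real n + 1)" using lt[OF I(2)] by simp
  ultimately show "?T n : I" by (intro mem) auto
  show "?T n <= ?T (Suc n)" using lt[OF I(2)] by (simp add: frac_le)
 next
  fix t
  assume t: "t : I"
  obtain n where "(b - t0) / (b - t) < real n" using reals_Archimedean2 by blast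
  hence "(b - t0) / (real n + 1) <= b - t" using lt[OF t] by (simp add: field_simps)
  thus "EX n. t <= ?T n" by (intro exI[of _ n]) simp
 qed simp
next
 case False
 have mem: "x : I" if "t0 <= x" for x
 proof -
  obtain y where y: "y : I" "x < y" using False unfolding bdd_above_def by (meson not_le)
  thus ?thesis using op_r_btw[OF I y(1), of x] that by simp
 qed
 have "EX n::nat. t <= t0 + real n" for t using real_arch_simple[of "t - t0"] by (auto simp: algebra_simps)
 thus ?thesis using mem by (intro exI[of _ "%n. t0 + real n"]) auto
qed

text \<open>The vector is lifted step by step along a cofinal sequence with
  \<open>upper_lift\<close>, and the values at all other points are restrictions of these lifts.
  They do not depend on the member of the sequence used, as \<open>bt_eq\<close> shows.\<close>

lemma coh_lift:
 assumes I: "op_r I" "t0 : I" and v: "v : upper I t0"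
 shows "EX bt. bt t0 = v & (ALL t:I. bt t : upper I t) & (ALL r:I. ALL t:I. r <= t --> res V r t (bt t) = bt r)"
proof -
 obtain T :: "nat => real" where T: "T 0 = t0" "!!n. T n : I" "!!n. T n <= T (Suc n)" "!!t. t : I ==> EX n. t <= T n" using op_r_cofinal[OF I] by blast
 have Tmono: "T m <= T n" if "m <= n" for m n using lift_Suc_mono_le[of T, OF T(3) that] .
 have "EX x. ALL n. (x n : upper I (T n) & (n = 0 --> x n = v)) & res V (T n) (T (Suc n)) (x (Suc n)) = x n"
 proof (rule dependent_nat_choice)
  show "EX x. x : upper I (T 0) & (0 = (0::nat) --> x = v)" using v T(1) by simp
  fix x n
  assume "x : upper I (T n) & (n = 0 --> x = v)"
  thus "EX y. (y : upper I (T (Suc n)) & (Suc n = 0 --> y = v)) & res V (T n) (T (Suc n)) y = x" using upper_lift[OF I(1) T(2,2) T(3), of x n] by auto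
 qed
 then obtain x where x: "!!n. x n : upper I (T n)" "x 0 = v" "!!n. res V (T n) (T (Suc n)) (x (Suc n)) = x n" by blast
 have xc: "x n : vc V (T n)" for n using x(1) upper_sub by blast
 have x_res: "res V (T m) (T n) (x n) = x m" if "m <= n" for m n using that
 proof (induction n rule: dec_induct)
  case base
  thus ?case using res_id[OF xc] .
 next
  case (step n)
  show ?case using res_comp[OF Tmono[OF step.hyps(1)] T(3) xc] using x(3) step.IH by simp
 qed
 define N where "N t = (LEAST n. t <= T n)" for t
 define bt where "bt t = res V t (T (N t)) (x (N t))" for t
 have N: "t <= T (N t)" if "t : I" for t using LeastI_ex[OF T(4)[OF that]] by (simp add: N_def)
 have bt_eq: "res V t (T n) (x n) = bt t" if t: "t : I" "t <= T n" for t n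
 proof -
  have "N t <= n" unfolding N_def using t(2) by (rule Least_le)
  thus ?thesis using res_comp[OF N[OF t(1)] Tmono xc, of n] x_res unfolding bt_def by simp
 qed
 have "bt t0 = v" using bt_eq[OF I(2), of 0] x(2) res_id[OF xc, of 0] by (simp add: T(1))
 moreover have "bt t : upper I t" if "t : I" for t unfolding bt_def using res_upper[OF I(1) that T(2) N[OF that] x(1)] .
 moreover have "res V r t (bt t) = bt r" if "r : I" "t : I" "r <= t" for r t
  using res_comp[OF that(3) N[OF that(2)] xc] bt_eq[OF that(1), of "N t"] N[OF that(2)] that(3) unfolding bt_def[of t] by simp
 ultimately show ?thesis by blast
qed

lemma res_lower:
 assumes I: "op_r I" "r : I" "t : I" "r <= t" and w: "w : lower I t"
 shows "res V r t w : lower I r"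
proof -
 obtain x y where xy: "w = x +[vt V t] y" "x : im_below I t" "ALL q. q ~: I --> q < t --> x : ker q t" "y : upper I t" "y : ker_below I t"
  using w unfolding lower_def by blast
 have xc: "x : vc V t" and yc: "y : vc V t" using xy(2,4) by (auto simp: im_below_def upper_def)
 have "res V r t x : im_below I r"
 proof (cases "x = zero (vt V t)")
  case True
  thus ?thesis using res_zero[OF I(4)] vspace.sub_zero[OF vs im_below_sub] by simp
 next
  case False
  then obtain s where s: "s ~: I" "t < s" "x : im t s" using xy(2) by (auto simp: im_below_def)
  hence "res V r t x : im r s" using res_im[of r t s] I(4) by auto
  thus ?thesis using s I(4) res_cl[OF I(4) xc] unfolding im_below_def by auto
 qed
 moreover have "ALL q. q ~: I --> q < r --> res V r t x : ker q r" using kerP_pb[OF I xc] xy(3) by simp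
 moreover have "res V r t y : upper I r" using res_upper[OF I xy(4)] .
 moreover have "res V r t y : ker_below I r" using ker_below_pb[OF I yc] xy(5) by simp
 moreover have "res V r t w = res V r t x +[vt V r] res V r t y" using res_add[OF I(4) xc yc] xy(1) by simp
 ultimately show ?thesis unfolding lower_def by blast
qed

definition base_pt :: "real set => real" where "base_pt I = (SOME t. t : I)"

text \<open>A basis of \<open>upper\<close> modulo \<open>lower\<close> at one arbitrarily chosen
  point of \<open>I\<close>. Its cardinality is the multiplicity of \<open>I\<close> in the
  barcode.\<close>

definition bar_basis :: "real set => 'b set" where "bar_basis I = (SOME bt. finite bt & bt <= upper I (base_pt I) & upper I (base_pt I) <= lsp K (vt V (base_pt I)) (lower I (base_pt I) Un bt) & (ALL c : bt -> car K. (\<Oplus>\<^sub>(vt V (base_pt I)) b\<in>bt. c b .[vt V (base_pt I)] b) : lower I (base_pt I) --> (ALL b:bt. c b = zero K)))"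

text \<open>A coherent family through the basis vector \<open>v\<close>; it spans a copy of the
  interval module of \<open>I\<close> inside \<open>V\<close>.\<close>

definition bar_vec :: "real set => 'b => real => 'b" where "bar_vec I v = (SOME bt. bt (base_pt I) = v & (ALL t:I. bt t : upper I t) & (ALL r:I. ALL t:I. r <= t --> res V r t (bt t) = bt r))"

lemma base_pt: "t : I ==> base_pt I : I" unfolding base_pt_def by (rule someI)

lemma bar_basis:
 assumes I: "op_r I" "t : I"
 shows "finite (bar_basis I)" "bar_basis I <= upper I (base_pt I)" "upper I (base_pt I) <= lsp K (vt V (base_pt I)) (lower I (base_pt I) Un bar_basis I)" "!!c. c : bar_basis I -> car K ==> (\<Oplus>\<^sub>(vt V (base_pt I)) b\<in>bar_basis I. c b .[vt V (base_pt I)] b) : lower I (base_pt I) ==> ALL b:bar_basis I. c b = zero K"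
proof -
 note b = base_pt[OF I(2)]
 note ex = vspace.compl_basis[OF vs lower_sub[OF b] upper_submodule upper_fin_dim[OF I(1) b] lower_sub_upper[OF I(1) b]]
 note * = someI_ex[OF ex, folded bar_basis_def]
 show "finite (bar_basis I)" "bar_basis I <= upper I (base_pt I)" "upper I (base_pt I) <= lsp K (vt V (base_pt I)) (lower I (base_pt I) Un bar_basis I)"
  using * by auto
 show "!!c. c : bar_basis I -> car K ==> (\<Oplus>\<^sub>(vt V (base_pt I)) b\<in>bar_basis I. c b .[vt V (base_pt I)] b) : lower I (base_pt I) ==> ALL b:bar_basis I. c b = zero K"
  using * by simp
qed

lemma bar_vec:
 assumes I: "op_r I" and v: "v : bar_basis I" and t: "t : I"
 shows "bar_vec I v (base_pt I) = v" "bar_vec I v t : upper I t" "!!r. r : I ==> r <= t ==> res V r t (bar_vec I v t) = bar_vec I v r"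
proof -
 have vU: "v : upper I (base_pt I)" using bar_basis(2)[OF I t] v by blast
 note * = someI_ex[OF coh_lift[OF I base_pt[OF t] vU], folded bar_vec_def]
 show "bar_vec I v (base_pt I) = v" "bar_vec I v t : upper I t" using * t by auto
 show "!!r. r : I ==> r <= t ==> res V r t (bar_vec I v t) = bar_vec I v r" using * t by simp
qed

lemma bar_vec_cl: "op_r I ==> v : bar_basis I ==> t : I ==> bar_vec I v t : vc V t" using bar_vec(2) upper_sub by blast

lemma res_bar_sum:
 assumes I: "op_r I" "r : I" "t : I" "r <= t" and c: "c : bar_basis I -> car K"
 shows "res V r t (\<Oplus>\<^sub>(vt V t) b\<in>bar_basis I. c b .[vt V t] bar_vec I b t) = (\<Oplus>\<^sub>(vt V r) b\<in>bar_basis I. c b .[vt V r] bar_vec I b r)"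
proof -
 interpret T: vspace K "vt V t" by (rule vs)
 interpret R: vspace K "vt V r" by (rule vs)
 have cl: "c b : car K" "bar_vec I b t : vc V t" "bar_vec I b r : vc V r" if "b : bar_basis I" for b using c bar_vec_cl[OF I(1) that] I that by auto
 have "res V r t (\<Oplus>\<^sub>(vt V t) b\<in>bar_basis I. c b .[vt V t] bar_vec I b t) = (\<Oplus>\<^sub>(vt V r) b\<in>bar_basis I. res V r t (c b .[vt V t] bar_vec I b t))"
  using cl by (intro res_finsum[OF I(4)]) auto
 also have "... = (\<Oplus>\<^sub>(vt V r) b\<in>bar_basis I. c b .[vt V r] bar_vec I b r)" using cl bar_vec(3)[OF I(1) _ I(3,2,4)]
  by (intro R.M.finsum_cong') (auto simp: res_smult[OF I(4)])
 finally show ?thesis .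
qed

lemma bar_sum_base:
 assumes I: "op_r I" "t : I" and c: "c : bar_basis I -> car K"
 shows "(\<Oplus>\<^sub>(vt V (base_pt I)) b\<in>bar_basis I. c b .[vt V (base_pt I)] bar_vec I b (base_pt I)) = (\<Oplus>\<^sub>(vt V (base_pt I)) b\<in>bar_basis I. c b .[vt V (base_pt I)] b)"
proof -
 interpret vspace K "vt V (base_pt I)" by (rule vs)
 have cl: "c b : car K" "b : vc V (base_pt I)" "bar_vec I b (base_pt I) = b" if "b : bar_basis I" for b
  using c bar_vec(1)[OF I(1) that I(2)] subsetD[OF upper_sub subsetD[OF bar_basis(2)[OF I] that]] that by auto
 show ?thesis using cl by (intro M.finsum_cong') auto
qed

lemma bar_sum_cl:
 assumes I: "op_r I" "t : I" and c: "c : bar_basis I -> car K"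
 shows "(\<Oplus>\<^sub>(vt V t) b\<in>bar_basis I. c b .[vt V t] bar_vec I b t) : upper I t"
proof (rule vspace.sub_lc[OF vs upper_submodule _ c])
 show "(%b. bar_vec I b t) : bar_basis I -> upper I t" using bar_vec(2)[OF I(1) _ I(2)] by blast
qed

text \<open>A relation modulo \<open>lower\<close> at \<open>t\<close> is moved to the base point,
  where the basis was chosen: by \<open>res_lower\<close> if the base point is below
  \<open>t\<close>, by \<open>lower_pb\<close> otherwise.\<close>

lemma bar_indep:
 assumes I: "op_r I" "t : I" and c: "c : bar_basis I -> car K" and l: "(\<Oplus>\<^sub>(vt V t) b\<in>bar_basis I. c b .[vt V t] bar_vec I b t) : lower I t"
 shows "ALL b:bar_basis I. c b = zero K"
proof (rule bar_basis(4)[OF I c])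
 note b = base_pt[OF I(2)]
 have "(\<Oplus>\<^sub>(vt V (base_pt I)) b\<in>bar_basis I. c b .[vt V (base_pt I)] bar_vec I b (base_pt I)) : lower I (base_pt I)"
 proof (cases "base_pt I <= t")
  case True
  thus ?thesis using res_lower[OF I(1) b I(2) True l] res_bar_sum[OF I(1) b I(2) True c] by simp
 next
  case False
  thus ?thesis using lower_pb[OF I(1,2) b _ bar_sum_cl[OF I(1) b c]] res_bar_sum[OF I(1,2) b _ c] l by simp
 qed
 thus "(\<Oplus>\<^sub>(vt V (base_pt I)) b\<in>bar_basis I. c b .[vt V (base_pt I)] b) : lower I (base_pt I)" using bar_sum_base[OF I c] by simp
qed

text \<open>For \<open>t\<close> below the base point a vector is lifted to the base point, expanded
  there and restricted again. For \<open>t\<close> above it, the restriction is expanded; the same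
  combination at \<open>t\<close> then differs from the vector by an element of
  \<open>lower\<close>, again by \<open>lower_pb\<close>.\<close>

lemma bar_spans:
 assumes I: "op_r I" "t : I"
 shows "upper I t <= lsp K (vt V t) (lower I t Un (%b. bar_vec I b t) ` bar_basis I)"
proof
 let ?b = "base_pt I"
 note b = base_pt[OF I(2)]
 interpret T: vspace K "vt V t" by (rule vs)
 interpret B: vspace K "vt V ?b" by (rule vs)
 let ?L = "lower I t Un (%b. bar_vec I b t) ` bar_basis I"
 have LV: "?L <= vc V t" using lower_sub_upper[OF I] upper_sub bar_vec_cl[OF I(1) _ I(2)] by blast
 note subS = T.submoduleE[OF T.span_sub[OF LV]]
 have BV: "bar_basis I <= vc V ?b" using bar_basis(2)[OF I] upper_sub by blast
 have in_span: "l +[vt V t] (\<Oplus>\<^sub>(vt V t) b\<in>bar_basis I. c b .[vt V t] bar_vec I b t) : lsp K (vt V t) ?L" if "l : lower I t" "c : bar_basis I -> car K" for l c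
  using that T.span_sup[of ?L] by (intro subS(5) T.sub_lc[OF T.span_sub[OF LV]]) auto
 have decomp: "EX l:lower I ?b. EX c:bar_basis I -> car K. w = l +[vt V ?b] (\<Oplus>\<^sub>(vt V ?b) b\<in>bar_basis I. c b .[vt V ?b] bar_vec I b ?b)" if "w : upper I ?b" for w
  using B.span_Un_lc lower_sub[OF b] bar_basis(1)[OF I] BV subsetD[OF bar_basis(3)[OF I] that] bar_sum_base[OF I] by simp
 fix v
 assume v: "v : upper I t"
 show "v : lsp K (vt V t) ?L"
 proof (cases "t <= ?b")
  case True
  obtain w where w: "w : upper I ?b" "res V t ?b w = v" using upper_lift[OF I(1,2) b True v] by blast
  obtain l c where lc: "l : lower I ?b" "c : bar_basis I -> car K" "w = l +[vt V ?b] (\<Oplus>\<^sub>(vt V ?b) b\<in>bar_basis I. c b .[vt V ?b] bar_vec I b ?b)"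
   using decomp[OF w(1)] by blast
  have "l : vc V ?b" "(\<Oplus>\<^sub>(vt V ?b) b\<in>bar_basis I. c b .[vt V ?b] bar_vec I b ?b) : vc V ?b"
   using lc(1) lower_sub_upper[OF I(1) b] upper_sub bar_sum_cl[OF I(1) b lc(2)] by blast+
  thus ?thesis using res_add[OF True] res_bar_sum[OF I b True lc(2)] w(2) lc(3) using in_span[OF res_lower[OF I b True lc(1)] lc(2)] by simp
 next
  case False
  hence bt: "?b <= t" by simp
  obtain l c where lc: "l : lower I ?b" "c : bar_basis I -> car K" "res V ?b t v = l +[vt V ?b] (\<Oplus>\<^sub>(vt V ?b) b\<in>bar_basis I. c b .[vt V ?b] bar_vec I b ?b)"
   using decomp[OF res_upper[OF I(1) b I(2) bt v]] by blast
  let ?x = "\<Oplus>\<^sub>(vt V t) b\<in>bar_basis I. c b .[vt V t] bar_vec I b t"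
  let ?w = "v +[vt V t] \<ominus>\<^sub>(vt V t) ?x"
  note subU = T.submoduleE[OF upper_submodule]
  have wU: "?w : upper I t" using subU(3,5) v bar_sum_cl[OF I lc(2)] by blast
  have vc: "v : vc V t" and xc: "?x : vc V t" and lcl: "l : vc V ?b" using v bar_sum_cl[OF I lc(2)] upper_sub lc(1) lower_sub_upper[OF I(1) b] by auto
  have "res V ?b t ?w = res V ?b t v +[vt V ?b] \<ominus>\<^sub>(vt V ?b) res V ?b t ?x" using vc xc
   by (simp add: res_add[OF bt] lin_map_minus[OF vs vs res_lin[OF bt]])
  also have "... = l" unfolding lc(3) res_bar_sum[OF I(1) b I(2) bt lc(2)] using lcl bar_sum_cl[OF I(1) b lc(2)] upper_sub[of I ?b]
   by (simp add: B.M.a_assoc B.M.r_neg subset_iff)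
  finally have "?w : lower I t" using lower_pb[OF I(1) b I(2) bt wU] lc(1) by simp
  hence "?w +[vt V t] ?x : lsp K (vt V t) ?L" by (rule in_span[OF _ lc(2)])
  moreover have "?w +[vt V t] ?x = v" using vc xc by (simp add: T.M.a_assoc T.M.l_neg)
  ultimately show ?thesis by simp
 qed
qed

end

section \<open>The vectors of all bars form a basis\<close>

context rad_mod begin

text \<open>The parts of the intervals below \<open>t\<close> form a chain. \<open>I\<close> is
  chosen with minimal part above \<open>t\<close> and, among those with that part, with maximal part
  below \<open>t\<close>. Any other interval then either reaches a point beyond \<open>I\<close>, or
  agrees with \<open>I\<close> above \<open>t\<close> and starts later.\<close>

lemma extreme_int:
 assumes fin: "finite \<I>" and ne: "\<I> ~= {}" and I: "!!I. I : \<I> ==> op_r I & t : I"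
 shows "EX I:\<I>. ALL J:\<I>. J = I | (EX s:J. s ~: I & t < s) | ({s:J. t <= s} = {s:I. t <= s} & {s:J. s <= t} <= {s:I. s <= t} & (EX r:I. r ~: J & r < t))"
proof -
 define up lo where "up I = {s:I. t <= s}" and "lo I = {s:I. s <= t}" for I
 have lo_chain: "lo I <= lo J | lo J <= lo I" if "I : \<I>" "J : \<I>" for I J
 proof (rule ccontr)
  assume "~ (lo I <= lo J | lo J <= lo I)"
  then obtain x y where x: "x : I" "x ~: J" "x <= t" and y: "y : J" "y ~: I" "y <= t" by (auto simp: lo_def)
  have "y : I" if "x <= y" using op_r_btw[of I x t y] I[OF \<open>I : \<I>\<close>] x y that by simp
  moreover have "x : J" if "y <= x" using op_r_btw[of J y t x] I[OF \<open>J : \<I>\<close>] x y that by simp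
  ultimately show False using x y by linarith
 qed
 have eq: "I = up I Un lo I" for I by (auto simp: up_def lo_def)
 obtain A where A: "A : up ` \<I>" "!!B. B : up ` \<I> ==> B <= A ==> A = B" using finite_has_minimal[of "up ` \<I>"] fin ne by auto
 define \<I>' where "\<I>' = {I : \<I>. up I = A}"
 have "finite (lo ` \<I>')" "lo ` \<I>' ~= {}" using fin A(1) by (auto simp: \<I>'_def)
 then obtain L where L: "L : lo ` \<I>'" "!!B. B : lo ` \<I>' ==> L <= B ==> L = B" using finite_has_maximal[of "lo ` \<I>'"] by metis
 then obtain I where I0: "I : \<I>" "up I = A" "lo I = L" by (auto simp: \<I>'_def)
 have "J = I | (EX s:J. s ~: I & t < s) | (up J = up I & lo J <= lo I & (EX r:I. r ~: J & r < t))" if J: "J : \<I>" for J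
 proof (cases "up J = A")
  case False
  then obtain s where "s : J" "t <= s" "s ~: I" using A(2)[of "up J"] J I0 by (auto simp: up_def)
  moreover have "s ~= t" using I[OF I0(1)] \<open>s ~: I\<close> by auto
  ultimately show ?thesis by force
 next
  case True
  hence JI: "J : \<I>'" using J by (simp add: \<I>'_def)
  show ?thesis
  proof (cases "lo J = lo I")
  case True
  thus ?thesis using \<open>up J = A\<close> I0 eq[of I] eq[of J] by simp
  next
  case False
  hence "~ lo I <= lo J" using L(2)[of "lo J"] JI I0 by auto
  moreover from this have "lo J <= lo I" using lo_chain[OF J I0(1)] by blast
  ultimately obtain r where "r : I" "r <= t" "r ~: J" "lo J <= lo I" by (auto simp: lo_def)
  moreover have "r ~= t" using I[OF J] \<open>r ~: J\<close> by auto
  ultimately show ?thesis using True I0(2) by force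
  qed
 qed
 thus ?thesis unfolding up_def lo_def using I0(1) by (intro bexI[of _ I]) auto
qed

definition bars :: "(real set >< 'b) set" where "bars = {(I, v). I ~= {} & op_r I & v : bar_basis I}"

text \<open>Among the bars with nonzero coefficient let \<open>I\<close> be the one of
  \<open>extreme_int\<close>. Bars reaching beyond \<open>I\<close> contribute to
  \<open>im_below I t\<close>, bars starting later contribute to \<open>ker_below I t\<close>; so
  the terms belonging to \<open>I\<close> add up to an element of \<open>lower I t\<close>, against
  \<open>bar_indep\<close>.\<close>

lemma bars_indep:
 assumes F: "finite F" "F <= {i : bars. t : fst i}" and c: "c : F -> car K" and z: "(\<Oplus>\<^sub>(vt V t) i\<in>F. c i .[vt V t] bar_vec (fst i) (snd i) t) = zero (vt V t)"
 shows "ALL i:F. c i = zero K"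
proof (rule ccontr)
 interpret vspace K "vt V t" by (rule vs)
 let ?V = "vt V t"
 define x where "x i = c i .[?V] bar_vec (fst i) (snd i) t" for i
 assume nz: "~ (ALL i:F. c i = zero K)"
 define F' where "F' = {i : F. c i ~= zero K}"
 have F': "finite F'" "F' ~= {}" "F' <= F" using F nz by (auto simp: F'_def)
 have bar: "op_r (fst i)" "snd i : bar_basis (fst i)" "t : fst i" if "i : F" for i using F(2) that by (auto simp: bars_def)
 have cc: "c i : car K" if "i : F" for i using c that by auto
 have xU: "x i : upper (fst i) t" if "i : F" for i unfolding x_def using submoduleE(4)[OF upper_submodule cc[OF that] bar_vec(2)[OF bar[OF that]]] .
 have xc: "x i : car ?V" if "i : F" for i using xU[OF that] upper_sub by blast
 have "finite (fst ` F')" "fst ` F' ~= {}" "!!I. I : fst ` F' ==> op_r I & t : I" using F' bar by auto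
 note ex = extreme_int[OF this]
 define P where "P I J <-> J = I | (EX s:J. s ~: I & t < s) | ({s:J. t <= s} = {s:I. t <= s} & {s:J. s <= t} <= {s:I. s <= t} & (EX r:I. r ~: J & r < t))" for I J
 obtain I where I: "I : fst ` F'" and ext': "ALL J:fst ` F'. P I J" using ex unfolding P_def[symmetric] by blast
 note ext = bspec[OF ext', unfolded P_def]
 have It: "op_r I" "t : I" using I bar F'(3) by auto
 \<comment> \<open>\<open>G0\<close> holds the terms of the bar \<open>I\<close>, \<open>G1\<close>
   those of bars reaching beyond \<open>I\<close>, and \<open>G2\<close> those of bars that agree
   with \<open>I\<close> above \<open>t\<close> and start later.\<close>
 define G0 where "G0 = {i : F'. fst i = I}"
 define G1 where "G1 = {i : F'. fst i ~= I & (EX s:fst i. s ~: I & t < s)}"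
 define G2 where "G2 = F' - G0 - G1"
 have G: "finite G0" "finite G1" "finite G2" "G0 <= F" "G1 <= F" "G2 <= F" using F' by (auto simp: G0_def G1_def G2_def)
 let ?x0 = "\<Oplus>\<^sub>?V i\<in>G0. x i" and ?x1 = "\<Oplus>\<^sub>?V i\<in>G1. x i" and ?x2 = "\<Oplus>\<^sub>?V i\<in>G2. x i"
 have cl: "?x0 : car ?V" "?x1 : car ?V" "?x2 : car ?V" using G xc by (auto intro!: M.finsum_closed)
 have sum_sub: "(\<Oplus>\<^sub>?V i\<in>A. x i) : W" if W: "submodule W K ?V" and xW: "!!i. i : A ==> x i : W" for W A
 proof -
  have WV: "W <= car ?V" using submoduleE(1)[OF W] .
  have "(\<Oplus>\<^sub>?V i\<in>A. (one K) .[?V] x i) : W" using W xW by (intro sub_lc) auto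
  moreover have "(one K) .[?V] x i = x i" if "i : A" for i using subsetD[OF WV xW[OF that]] by simp
  hence "(\<Oplus>\<^sub>?V i\<in>A. (one K) .[?V] x i) = (\<Oplus>\<^sub>?V i\<in>A. x i)" using WV xW by (intro M.finsum_cong') auto
  ultimately show ?thesis by simp
 qed
 have x0: "?x0 : upper I t" using xU G(4) by (intro sum_sub upper_submodule) (auto simp: G0_def)
 have x1: "?x1 : im_below I t"
 proof (intro sum_sub im_below_sub)
  fix i
  assume i: "i : G1"
  then obtain s where s: "s : fst i" "s ~: I" "t < s" by (auto simp: G1_def)
  have "x i : upper (fst i) t" using xU G(5) i by blast
  hence "x i : im t s" "x i : car ?V" using s by (auto simp: upper_def)
  thus "x i : im_below I t" using s by (auto simp: im_below_def)
 qed
 have x2: "?x2 : upper I t Int ker_below I t"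
 proof (intro sum_sub sub_Int upper_submodule ker_below_sub It(2))
  fix i
  assume i: "i : G2"
  hence iF: "i : F" "i : F'" and e: "{s:fst i. t <= s} = {s:I. t <= s}" "{s:fst i. s <= t} <= {s:I. s <= t}" "EX r:I. r ~: fst i & r < t"
   using G(6) ext[of "fst i"] by (auto simp: G2_def G0_def G1_def)
  have xi: "x i : upper (fst i) t" using xU iF by blast
  have "x i : im t s" if "s : I" "t <= s" for s
  proof -
  have "s : fst i" using e(1) that by blast
  thus ?thesis using xi that by (simp add: upper_def)
  qed
  moreover have "x i : ker r t" if "r ~: I" "r < t" for r
  proof -
  have "r ~: fst i" using e(2) that by force
  thus ?thesis using xi that by (simp add: upper_def)
  qed
  ultimately have "x i : upper I t" using xi by (simp add: upper_def)
  moreover have "x i : ker_below I t" using e(3) using xi unfolding upper_def ker_below_def by auto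
  ultimately show "x i : upper I t Int ker_below I t" by blast
 qed
 have "(\<Oplus>\<^sub>?V i\<in>F. x i) = (\<Oplus>\<^sub>?V i\<in>F'. x i)"
 proof (rule M.add.finprod_mono_neutral_cong_right)
  show "x i = zero ?V" if "i : F - F'" for i
  proof -
  have "c i = zero K" "i : F" using that by (auto simp: F'_def)
  thus ?thesis using bar_vec_cl[OF bar] by (simp add: x_def)
  qed
 qed (use F F' xc in auto)
 also have "... = (\<Oplus>\<^sub>?V i\<in>G0 Un (G1 Un G2). x i)" by (rule arg_cong[of _ _ "finsum ?V x"]) (auto simp: G0_def G1_def G2_def)
 also have "... = ?x0 +[?V] (?x1 +[?V] ?x2)"
 proof -
  have d: "G1 Int G2 = {}" "G0 Int (G1 Un G2) = {}" by (auto simp: G0_def G1_def G2_def)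
  have s: "x : G0 -> car ?V" "x : G1 -> car ?V" "x : G2 -> car ?V" using G xc by auto
  thus ?thesis using G M.finsum_Un_disjoint[OF G(1) _ d(2) s(1)] M.finsum_Un_disjoint[OF G(2,3) d(1) s(2,3)] by simp
 qed
 finally have "?x0 +[?V] (?x1 +[?V] ?x2) = zero ?V" using z by (simp add: x_def)
 hence neg: "?x1 +[?V] ?x2 = \<ominus>\<^sub>?V ?x0" using cl by (metis M.add.m_closed M.minus_equality M.minus_minus)
 note subU = submoduleE[OF upper_submodule]
 \<comment> \<open>A single term of \<open>G1\<close> need not vanish below \<open>I\<close>, but
   their sum does: the relation expresses it by elements of \<open>upper I t\<close>.\<close>
 have "?x1 = \<ominus>\<^sub>?V ?x0 +[?V] \<ominus>\<^sub>?V ?x2" using cl by (simp add: neg[symmetric] M.a_assoc M.r_neg)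
 hence "?x1 : upper I t" using x0 x2 subU(3,5) by auto
 hence "ALL r. r ~: I --> r < t --> ?x1 : ker r t" by (simp add: upper_def)
 hence "?x1 +[?V] ?x2 : lower I t" unfolding lower_def using x1 x2 by blast
 hence "\<ominus>\<^sub>?V (\<ominus>\<^sub>?V ?x0) : lower I t" using neg submoduleE(3)[OF lower_sub[OF It(2)]] by metis
 hence x0l: "?x0 : lower I t" using cl by simp
 define d where "d b = (if (I, b) : G0 then c (I, b) else (zero K))" for b
 have dK: "d : bar_basis I -> car K" and sub: "Pair I -` G0 <= bar_basis I" using cc G(4) bar(2) by (auto simp: d_def)
 have "(\<Oplus>\<^sub>?V b\<in>bar_basis I. d b .[?V] bar_vec I b t) = (\<Oplus>\<^sub>?V b\<in>Pair I -` G0. x (I, b))"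
 proof (rule M.add.finprod_mono_neutral_cong_right[OF bar_basis(1)[OF It] sub])
  show "d b .[?V] bar_vec I b t = zero ?V" if "b : bar_basis I - Pair I -` G0" for b using that bar_vec_cl[OF It(1) _ It(2)] by (auto simp: d_def)
  show "d b .[?V] bar_vec I b t = x (I, b)" if "b : Pair I -` G0" for b using that by (auto simp: d_def x_def)
  show "(%b. d b .[?V] bar_vec I b t) : bar_basis I -> car ?V" using dK bar_vec_cl[OF It(1) _ It(2)] by auto
 qed
 also have "... = (\<Oplus>\<^sub>?V i\<in>Pair I ` (Pair I -` G0). x i)" using xc G(4) by (intro M.finsum_reindex[symmetric]) (auto simp: inj_on_def)
 also have "Pair I ` (Pair I -` G0) = G0" by (auto simp: G0_def)
 finally have "ALL b:bar_basis I. d b = zero K" using bar_indep[OF It dK] x0l by simp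
 moreover obtain i where i: "i : F'" "fst i = I" using I by blast
 moreover have "snd i : bar_basis I" using bar(2)[of i] i F'(3) by auto
 ultimately have "c i = zero K" by (auto simp: d_def G0_def)
 thus False using i(1) by (simp add: F'_def)
qed

text \<open>If the span \<open>?S\<close> misses a vector, choose \<open>F\<close> minimal among the
  images not contained in \<open>?S\<close>, and then \<open>G\<close> minimal among
  \<open>F\<close> and its intersections with kernels that are not contained in \<open>?S\<close>.
  These determine an interval \<open>I\<close> with \<open>G\<close> inside \<open>upper I t\<close>
  and, by minimality, \<open>lower I t\<close> inside \<open>?S\<close>; \<open>bar_spans\<close>
  then puts \<open>G\<close> into \<open>?S\<close>.\<close>

lemma bars_span: "vc V t <= lsp K (vt V t) {bar_vec (fst i) (snd i) t | i. i : bars & t : fst i}" (is "_ <= ?S")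
proof (rule ccontr)
 interpret vspace K "vt V t" by (rule vs)
 let ?V = "vt V t"
 have "{bar_vec (fst i) (snd i) t | i. i : bars & t : fst i} <= car ?V" using bar_vec_cl by (auto simp: bars_def)
 note S = span_sub[OF this]
 note subS = submoduleE[OF S]
 assume "~ car ?V <= ?S"
 then obtain v where v: "v : car ?V" "v ~: ?S" by blast
 obtain s1 where s1: "t < s1" "v : im t s1" using rad[OF v(1)] by (auto simp: im_def)
 let ?F1 = "{im t s | s. t < s & ~ im t s <= ?S}"
 have "?F1 ~= {}" using s1 v(2) by blast
 moreover have "!!W. W : ?F1 ==> fin_dim W & submodule W K ?V" using im_fin_dim im_submodule by auto
 ultimately have "EX W:?F1. ALL U:?F1. ~ U \<subset> W" by (rule fin_dim_min_subsp)
 then obtain W where W: "W : ?F1" "!!U. U : ?F1 ==> ~ U \<subset> W" by auto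
 then obtain s0 where s0W: "t < s0" "~ im t s0 <= ?S" "W = im t s0" by auto
 have s0: "t < s0" "~ im t s0 <= ?S" "!!s. t < s ==> ~ im t s <= ?S ==> ~ im t s \<subset> im t s0" using s0W W(2) by auto
 define F where "F = im t s0"
 have F: "fin_dim F" "submodule F K ?V" "F <= car ?V" using im_fin_dim im_submodule im_subset s0(1) by (auto simp: F_def)
 define \<G> where "\<G> = {G. ~ G <= ?S & (G = F | (EX r<=t. G = F Int ker r t))}"
 have "F : \<G>" using s0(2) by (simp add: \<G>_def F_def)
 moreover have "fin_dim G & submodule G K ?V" if "G : \<G>" for G using that F sub_Int[OF F(2) ker_sub] fin_dim_mono[OF F(1), of G]
  by (auto simp: \<G>_def)
 ultimately have "EX W:\<G>. ALL U:\<G>. ~ U \<subset> W" by (intro fin_dim_min_subsp) auto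
 then obtain G where G: "G : \<G>" "!!U. U : \<G> ==> ~ U \<subset> G" by auto
 have GF: "G <= F" "~ G <= ?S" using G(1) by (auto simp: \<G>_def)
 \<comment> \<open>The part \<open>A\<close> of the interval records how far up \<open>F\<close> can
   be lifted, the part \<open>L\<close> how far down \<open>G\<close> survives.\<close>
 define A where "A = {s. t <= s & F <= im t s}"
 define L where "L = {r. r <= t & ~ G <= ker r t}"
 define I where "I = A Un L"
 have tA: "t : A" and s0A: "s0 : A" and tL: "t : L" using F(3) res_id s0(1) GF(2) sub_zero[OF S] by (auto simp: A_def im_def F_def L_def ker_self)
 have A_down: "s : A" if "s' : A" "t <= s" "s <= s'" for s s' using that im_anti[of t s s'] by (auto simp: A_def)
 have L_up: "r : L" if "r' : L" "r' <= r" "r <= t" for r r' using that ker_anti[of r' r t] by (auto simp: L_def)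
 have LA: "x <= t" if "x : L" for x using that by (simp add: L_def)
 have AL: "t <= x" if "x : A" for x using that by (simp add: A_def)
 have above: "EX s':I. s < s'" if "s : I" for s
 proof (cases "s < s0")
  case True
  thus ?thesis using s0A by (auto simp: I_def)
 next
  case False
  hence sA: "s : A" "s0 <= s" using that LA[of s] s0(1) by (auto simp: I_def)
  hence Fe: "F = im t s" using im_anti[of t s0 s] s0(1) by (auto simp: A_def F_def)
  \<comment> \<open>No last element: each of finitely many spanning vectors comes from a parameter
    strictly above \<open>s\<close> by the assumption \<open>rad\<close>, and the least of these
    parameters, capped by \<open>s + 1\<close> in case \<open>B\<close> is empty, serves for
    all.\<close>
  obtain B where B: "finite B" "B <= F" "F = lsp K ?V B" using fin_dim_spd[OF F(1,2)] by blast
  have "EX u>s. b : im t u" if b: "b : B" for b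
  proof -
  obtain y where y: "y : vc V s" "b = res V t s y" using B(2) b Fe by (auto simp: im_def)
  obtain u where u: "u > s" "y : im s u" using rad[OF y(1)] by (auto simp: im_def)
  thus ?thesis using y(2) res_im[of t s u] AL[OF sA(1)] by auto
  qed
  then obtain u where u: "!!b. b : B ==> s < u b & b : im t (u b)" by metis
  define m where "m = Min (insert (s + 1) (u ` B))"
  have m: "s < m" "!!b. b : B ==> m <= u b" using u B(1) by (auto simp: m_def)
  have tm: "t <= m" using AL[OF sA(1)] m by simp
  have "B <= im t m" using u im_anti[OF tm m(2)] by blast
  thus ?thesis using span_min[OF im_submodule[OF tm]] B(3) using m(1) tm by (auto simp: I_def A_def)
 qed
 have interval: "x : I" if "a : I" "b : I" "a <= x" "x <= b" for a b x
 proof (cases "t <= x")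
  case True
  have "x : A"
  proof (cases "b : A")
  case True
  thus ?thesis using A_down[of b x] that \<open>t <= x\<close> by simp
  next
  case False
  hence "x = t" using LA[of b] that True by (auto simp: I_def)
  thus ?thesis using tA by simp
  qed
  thus ?thesis by (simp add: I_def)
 next
  case False
  hence "a : L" using AL[of a] that by (auto simp: I_def)
  thus ?thesis using L_up[of a x] that False by (simp add: I_def)
 qed
 have oI: "op_r I" unfolding op_r_def is_interval_1 using above interval by blast
 have tI: "t : I" and upper_F: "upper I t <= F" using tA s0A s0(1) by (auto simp: I_def upper_def F_def)
 have G_upper: "G <= upper I t"
 proof
  fix x
  assume x: "x : G"
  have "x : im t s" if "s : I" "t <= s" for s
  proof -
  have "s : A" using that LA[of s] tA by (cases "s = t") (auto simp: I_def)
  thus ?thesis using x GF(1) by (auto simp: A_def)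
  qed
  moreover have "x : ker r t" if "r ~: I" "r < t" for r using that x by (auto simp: I_def L_def)
  ultimately show "x : upper I t" using x GF(1) F(3) by (auto simp: upper_def)
 qed
 have lower_S: "lower I t <= ?S"
 proof
  fix w
  assume "w : lower I t"
  then obtain x y where xy: "w = x +[?V] y" "x : im_below I t" "y : upper I t" "y : ker_below I t" unfolding lower_def by blast
  have "x : ?S"
  proof (cases "x = zero ?V")
  case True
  thus ?thesis using sub_zero[OF S] by simp
  next
  case False
  then obtain s where s: "s ~: I" "t < s" "x : im t s" using xy(2) by (auto simp: im_below_def)
  hence nF: "~ F <= im t s" by (auto simp: I_def A_def)
  hence "s0 < s" using im_anti[of t s s0] s by (force simp: F_def)
  hence "im t s \<subset> im t s0" using im_anti[of t s0 s] s0(1) nF by (auto simp: F_def)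
  thus ?thesis using s0(3)[OF s(2)] using s(3) by blast
  qed
  moreover have "y : ?S"
  proof -
  obtain r where r: "r : I" "r <= t" "y : ker r t" using xy(4) by (auto simp: ker_below_def)
  have "r : L" using r AL[of r] tL by (cases "r = t") (auto simp: I_def)
  hence nG: "~ G <= ker r t" by (simp add: L_def)
  have "F Int ker r t \<subset> G"
  proof (cases "G = F")
  case True
  thus ?thesis using nG by blast
  next
  case False
  then obtain r0 where r0: "r0 <= t" "G = F Int ker r0 t" using G(1) by (auto simp: \<G>_def)
  have "~ r < r0" using ker_anti[of r r0 t] r0 nG by auto
  hence "ker r t <= ker r0 t" using ker_anti[of r0 r t] r(2) by simp
  thus ?thesis using r0(2) nG by blast
  qed
  hence "F Int ker r t ~: \<G>" using G(2) by blast
  hence "F Int ker r t <= ?S" using r(2) by (auto simp: \<G>_def)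
  thus ?thesis using r(3) xy(3) upper_F by blast
  qed
  ultimately show "w : ?S" using xy(1) subS(5) by simp
 qed
 have "(%b. bar_vec I b t) ` bar_basis I <= ?S"
 proof
  fix y
  assume "y : (%b. bar_vec I b t) ` bar_basis I"
  then obtain b where "b : bar_basis I" "y = bar_vec I b t" by blast
  hence "y : {bar_vec (fst i) (snd i) t | i. i : bars & t : fst i}" using oI tI by (auto simp: bars_def)
  thus "y : ?S" by (rule subsetD[OF span_sup])
 qed
 hence "lsp K ?V (lower I t Un (%b. bar_vec I b t) ` bar_basis I) <= ?S" using lower_S by (intro span_min[OF S]) simp
 thus False using bar_spans[OF oI tI] using G_upper GF(2) by blast
qed

text \<open>The bars are indexed by pairs of an interval and a vector, whereas a barcode has indices
  in a smaller type; the base point of the interval replaces the interval.\<close>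

theorem int_dec: "EX B :: (real >< 'b) barcode. interval_decomposition K V B"
proof -
 define ph where "ph i = (base_pt (fst i), snd i)" for i :: "real set >< 'b"
 have inj: "inj_on ph bars"
 proof (rule inj_onI, rule ccontr)
  fix i j
  assume ij: "i : bars" "j : bars" "ph i = ph j" "i ~= j"
  let ?t = "base_pt (fst i)"
  interpret vspace K "vt V ?t" by (rule vs)
  have bar: "op_r (fst k)" "snd k : bar_basis (fst k)" "?t : fst k" "bar_vec (fst k) (snd k) ?t = snd i" "snd i : vc V ?t" if "k : {i, j}" for k
  proof -
  have k: "fst k ~= {}" "op_r (fst k)" "snd k : bar_basis (fst k)" "base_pt (fst k) = ?t" "snd k = snd i" using that ij by (auto simp: bars_def ph_def)
  then obtain s where s: "s : fst k" by blast
  have t: "?t : fst k" using base_pt[OF s] k by simp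
  show "op_r (fst k)" "snd k : bar_basis (fst k)" "?t : fst k" using k t by auto
  show e: "bar_vec (fst k) (snd k) ?t = snd i" using bar_vec(1)[OF k(2,3) t] k by simp
  show "snd i : vc V ?t" using bar_vec_cl[OF k(2,3) t] e by simp
  qed
  \<comment> \<open>Two different bars with the same index would have the same vector at a common
    parameter, and their difference would be a nontrivial relation.\<close>
  let ?c = "%k. if k = i then (one K) else \<ominus>\<^sub>K (one K)"
  have "ALL k:{i, j}. ?c k = zero K"
  proof (rule bars_indep)
  show "{i, j} <= {i : bars. ?t : fst i}" using bar(3) ij by auto
  show "(\<Oplus>\<^sub>(vt V ?t) k\<in>{i, j}. ?c k .[vt V ?t] bar_vec (fst k) (snd k) ?t) = zero (vt V ?t)" using bar(4,5)[of i] bar(4)[of j] ij(4)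
   by (simp add: smult_l_minus M.r_neg)
  qed auto
  thus False by simp
 qed
 define io where "io = inv_into bars ph"
 have io: "io k : bars" "ph (io k) = k" if "k : ph ` bars" for k using that by (auto simp: io_def inv_into_into f_inv_into_f)
 have io_bar: "op_r (fst (io k))" "snd (io k) : bar_basis (fst (io k))" "fst (io k) ~= {}" if "k : ph ` bars" for k using io(1)[OF that]
  by (auto simp: bars_def)
 have io_inj: "inj_on io F" if "F <= ph ` bars" for F using inj_on_subset[OF inj_on_inv_into[OF subset_refl] that] by (simp add: io_def)
 have "interval_decomposition K V (ph ` bars, %k. fst (io k))"
 proof (rule int_decompositionI[where bt = "%k t. bar_vec (fst (io k)) (snd (io k)) t"])
  fix k
  assume k: "k : ph ` bars"
  show "fst (io k) ~= {} & is_interval (fst (io k))" using io_bar[OF k] by (simp add: op_r_def)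
  fix t
  assume t: "t : fst (io k)"
  show "bar_vec (fst (io k)) (snd (io k)) t : vc V t" using bar_vec_cl[OF io_bar(1,2)[OF k] t] .
  fix s
  assume st: "s <= t"
  show "res V s t (bar_vec (fst (io k)) (snd (io k)) t) = (if s : fst (io k) then bar_vec (fst (io k)) (snd (io k)) s else (zero (vt V s)))"
  proof (cases "s : fst (io k)")
  case True
  thus ?thesis using bar_vec(3)[OF io_bar(1,2)[OF k] t True st] by simp
  next
  case False
  hence "s < t" using st t by (cases "s = t") auto
  hence "bar_vec (fst (io k)) (snd (io k)) t : ker s t" using bar_vec(2)[OF io_bar(1,2)[OF k] t] False by (simp add: upper_def)
  thus ?thesis using False by (simp add: ker_def)
  qed
 next
  fix t F c
  assume F: "finite F" "F <= {k : ph ` bars. t : fst (io k)}" and c: "c : F -> car K" and z: "(\<Oplus>\<^sub>(vt V t) k\<in>F. c k .[vt V t] bar_vec (fst (io k)) (snd (io k)) t) = zero (vt V t)"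
  interpret vspace K "vt V t" by (rule vs)
  have k: "k : ph ` bars" "t : fst (io k)" "c k : car K" if "k : F" for k using that F c by auto
  have "(\<Oplus>\<^sub>(vt V t) i\<in>io ` F. c (ph i) .[vt V t] bar_vec (fst i) (snd i) t) = (\<Oplus>\<^sub>(vt V t) k\<in>F. c (ph (io k)) .[vt V t] bar_vec (fst (io k)) (snd (io k)) t)"
   using k io io_bar bar_vec_cl by (intro M.finsum_reindex io_inj[OF ]) auto
  also have "... = (\<Oplus>\<^sub>(vt V t) k\<in>F. c k .[vt V t] bar_vec (fst (io k)) (snd (io k)) t)" using k io io_bar bar_vec_cl
   by (intro M.finsum_cong') auto
  finally have z': "(\<Oplus>\<^sub>(vt V t) i\<in>io ` F. c (ph i) .[vt V t] bar_vec (fst i) (snd i) t) = zero (vt V t)" using z by simp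
  have "ALL i:io ` F. c (ph i) = zero K" by (rule bars_indep[OF _ _ _ z']) (use F k io in auto)
  thus "ALL k:F. c k = zero K" using io(2) k(1) by simp
 next
  fix t
  have "{bar_vec (fst i) (snd i) t | i. i : bars & t : fst i} <= {bar_vec (fst (io k)) (snd (io k)) t | k. k : ph ` bars & t : fst (io k)}"
  proof
  fix y
  assume "y : {bar_vec (fst i) (snd i) t | i. i : bars & t : fst i}"
  then obtain i where i: "y = bar_vec (fst i) (snd i) t" "i : bars" "t : fst i" by blast
  have "io (ph i) = i" using inv_into_f_f[OF inj i(2)] by (simp add: io_def)
  thus "y : {bar_vec (fst (io k)) (snd (io k)) t | k. k : ph ` bars & t : fst (io k)}" using i by (intro CollectI exI[of _ "ph i"]) auto
  qed
  from vspace.span_mono[OF vs this] show "vc V t <= lsp K (vt V t) {bar_vec (fst (io k)) (snd (io k)) t | k. k : ph ` bars & t : fst (io k)}"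
   by (rule order_trans[OF bars_span])
 qed
 thus ?thesis by blast
qed

end

section \<open>Interval decomposition of the radical of a q-tame module\<close>

context per_mod begin

lemma rad_vec_at: "vt (radical K V) s = (vt V s)\<lparr>carrier := vc (radical K V) s\<rparr>" and radical_res: "res (radical K V) = res V"
 by (simp_all add: radical_def)

lemma radical_subset: "vc (radical K V) s <= vc V s" using module.submoduleE(1)[OF mod rad_sub] .

text \<open>The finite spanning set of the image must consist of vectors of \<open>U s\<close>,
  which a spanning set in the ambient space does not give at once; \<open>fin_dim_spd\<close>
  supplies vectors of the image itself.\<close>

lemma q_tame_sub:
 assumes q: "q_tame K V" and U: "!!t. submodule (U t) K (vt V t)" and UU: "!!s t. s <= t ==> res V s t ` U t <= U s" and W: "!!t. vt W t = (vt V t)\<lparr>carrier := U t\<rparr>" "res W = res V"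
 shows "q_tame K W"
unfolding q_tame_def
proof (intro allI impI)
 fix s t :: real
 assume st: "s < t"
 interpret Vs: vspace K "vt V s" by (rule vs)
 let ?im = "res V s t ` U t"
 have imU: "?im <= U s" using UU[of s t] st by simp
 have sub: "U t <= vc V t" using module.submoduleE(1)[OF mod U] .
 have im_sub: "submodule ?im K (vt V s)" using lin_map_img_sub[OF vs vs res_lin U] st by simp
 obtain S where S: "S <= vc V s" "finite S" "res V s t ` vc V t <= lsp K (vt V s) S" using q[unfolded q_tame_def, rule_format, OF st] by auto
 hence "Vs.fin_dim ?im" unfolding Vs.fin_dim_def using sub by (intro exI[of _ S]) auto
 then obtain T where T: "finite T" "T <= ?im" "?im = lsp K (vt V s) T" using Vs.fin_dim_spd[OF _ im_sub] by blast
 have TU: "T <= U s" using T(2) imU by blast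
 have "lsp K (vt W s) T = lsp K (vt V s) T" unfolding W by (rule Vs.span_res[OF U TU])
 thus "EX S<=vc W s. finite S & res W s t ` vc W t <= lsp K (vt W s) S" using T TU by (intro exI[of _ T]) (auto simp: W)
qed

lemma rad_res_cl: assumes "s <= t" shows "res V s t ` vc (radical K V) t <= vc (radical K V) s"
proof -
 interpret R: per_mod K "radical K V" by (rule per_mod_rad)
 show ?thesis using R.res_cl[OF assms] by (auto simp: radical_res)
qed

lemma q_tame_rad: "q_tame K V ==> q_tame K (radical K V)" by (rule q_tame_sub[OF _ rad_sub rad_res_cl rad_vec_at radical_res])

lemma rad_dec:
 assumes q: "q_tame K V"
 shows "EX B :: (real >< 'v) barcode. interval_decomposition K (radical K V) B"
proof -
 let ?R = "radical K V"
 have "rad_mod K ?R"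
 proof (intro rad_mod.intro per_mod_rad rad_mod_axioms.intro q_tame_rad q)
  fix s v
  assume "v : vc ?R s"
  then obtain t y where t: "s < t" "y : vc V t" "v = res V s t y" unfolding rad_car by auto
  \<comment> \<open>Passing through the midpoint shows that a vector of the radical at
    \<open>s\<close> comes from the radical at a larger parameter, not merely from the module
    there.\<close>
  define u where "u = (s + t) / 2"
  have u: "s < u" "u < t" using t(1) by (auto simp: u_def)
  have "res V u t y : vc ?R u" unfolding rad_car using u t(2) by auto
  moreover have "v = res V s u (res V u t y)" using res_comp[of s u t y] u t by simp
  ultimately show "EX u>s. v : res ?R s u ` vc ?R u" using u(1) unfolding radical_res by blast
 qed
 thus ?thesis by (rule rad_mod.int_dec)
qed

end

section \<open>Matchings\<close>

text \<open>Induction on the size of \<open>A\<close>. If every nonempty proper subset has more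
  neighbours than elements, any choice for one element leaves Hall's condition intact. Otherwise a
  tight subset \<open>F\<close> is matched inside its own neighbourhood, and the rest outside of
  it.\<close>

lemma hall_finite:
 fixes N :: "'a => 'b set"
 assumes "finite A" "!!i. i : A ==> finite (N i)" "!!F. F <= A ==> card F <= card (\<Union>(N ` F))"
 shows "EX ph. inj_on ph A & (ALL i:A. ph i : N i)"
using assms
proof (induction "card A" arbitrary: A N rule: less_induct)
 case less
 note fin = less.prems(1) and finN = less.prems(2) and hall = less.prems(3)
 show ?case
 proof (cases "A = {}")
  case True
  thus ?thesis by simp
 next
  case False
  then obtain a where a: "a : A" by blast
  show ?thesis
  proof (cases "EX F. F \<subset> A & F ~= {} & card (\<Union>(N ` F)) <= card F")
  case False
  have "N a ~= {}" using hall[of "{a}"] a by auto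
  then obtain x where x: "x : N a" by blast
  let ?N = "%i. N i - {x}"
  have "EX ph. inj_on ph (A - {a}) & (ALL i:A - {a}. ph i : ?N i)"
  proof (rule less.hyps)
  show "card (A - {a}) < card A" using card_Diff1_less[OF fin a] .
  show "finite (A - {a})" using fin by simp
  show "finite (?N i)" if "i : A - {a}" for i using that finN by simp
  fix F
  assume F: "F <= A - {a}"
  show "card F <= card (\<Union>(?N ` F))"
  proof (cases "F = {}")
  case False
  have "F \<subset> A" using F a by blast
  hence "card F < card (\<Union>(N ` F))"
   using \<open>F ~= {}\<close> \<open>~ (EX F. F \<subset> A & F ~= {} & card (\<Union>(N ` F)) <= card F)\<close> by (meson not_le)
  moreover have "card (\<Union>(N ` F)) <= Suc (card (\<Union>(N ` F) - {x}))" using diff_card_le_card_Diff[of "{x}" "\<Union>(N ` F)"] by simp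
  ultimately have "card F <= card (\<Union>(N ` F) - {x})" by linarith
  also have "\<Union>(N ` F) - {x} = \<Union>(?N ` F)" by blast
  finally show ?thesis .
  qed simp
  qed
  then obtain ph where ph: "inj_on ph (A - {a})" "ALL i:A - {a}. ph i : ?N i" by blast
  have "inj_on (ph(a := x)) A"
  proof (rule inj_onI)
  fix i j
  assume ij: "i : A" "j : A" "(ph(a := x)) i = (ph(a := x)) j"
  show "i = j"
  proof (cases "i = a | j = a")
  case True
  thus ?thesis using ij ph(2) by (auto split: if_splits)
  next
  case False
  thus ?thesis using ij inj_onD[OF ph(1), of i j] by simp
  qed
  qed
  moreover have "ALL i:A. (ph(a := x)) i : N i" using ph(2) x by auto
  ultimately show ?thesis by blast
  next
  case True
  then obtain F where F: "F \<subset> A" "F ~= {}" "card (\<Union>(N ` F)) <= card F" by blast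
  have finF: "finite F" using F(1) fin by (auto intro: fin_sub)
  have "EX ph. inj_on ph F & (ALL i:F. ph i : N i)" using F(1) fin finN hall by (intro less.hyps psubset_card_mono finF) auto
  then obtain ph where ph: "inj_on ph F" "!!i. i : F ==> ph i : N i" by blast
  let ?U = "\<Union>(N ` F)"
  have finU: "finite ?U" using finF F(1) finN by auto
  have "EX ps. inj_on ps (A - F) & (ALL i:A - F. ps i : N i - ?U)"
  proof (rule less.hyps)
  show "card (A - F) < card A" using F(1,2) fin by (intro psubset_card_mono) auto
  show "finite (A - F)" using fin by simp
  show "finite (N i - ?U)" if "i : A - F" for i using that finN by simp
  fix E
  assume E: "E <= A - F"
  have finE: "finite E" using E fin by (auto intro: fin_sub)
  have finV: "finite (\<Union>i\<in>E. N i - ?U)" using E finE finN by auto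
  have "card E + card F = card (E Un F)" using E finE finF by (subst card_Un_disjoint) auto
  also have "... <= card (\<Union>(N ` (E Un F)))" using E F(1) by (intro hall) auto
  also have "\<Union>(N ` (E Un F)) = (\<Union>i\<in>E. N i - ?U) Un ?U" by auto
  also have "card ... = card (\<Union>i\<in>E. N i - ?U) + card ?U" by (rule card_Un_disjoint[OF finV finU]) auto
  finally show "card E <= card (\<Union>i\<in>E. N i - ?U)" using F(3) by simp
  qed
  then obtain ps where ps: "inj_on ps (A - F)" "!!i. i : A - F ==> ps i : N i - ?U" by blast
  let ?ch = "%i. if i : F then ph i else ps i"
  have "inj_on ?ch A"
  proof (rule inj_onI)
  fix i j
  assume ij: "i : A" "j : A" "?ch i = ?ch j"
  have "(i : F) = (j : F)" using ij ph(2)[of i] ph(2)[of j] ps(2)[of i] ps(2)[of j] by (auto split: if_splits)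
  thus "i = j" using ij inj_onD[OF ph(1), of i j] inj_onD[OF ps(1), of i j] by auto
  qed
  moreover have "?ch i : N i" if "i : A" for i using ph(2)[of i] ps(2)[of i] that by auto
  ultimately show ?thesis by blast
  qed
 qed
qed

text \<open>Choice functions form a product of finite discrete spaces, which is compact. The
  condition that two given indices receive different values is closed, and finitely many such
  conditions involve finitely many indices only.\<close>

lemma hall_infinite:
 fixes N :: "'a => 'b set"
 assumes finN: "!!i. i : A ==> finite (N i)" and hall: "!!F. finite F ==> F <= A ==> card F <= card (\<Union>(N ` F))"
 shows "EX ph. inj_on ph A & (ALL i:A. ph i : N i)"
proof -
 define X where "X = product_topology (%i. discrete_topology (N i)) A"
 have topX: "ts X = (\<Pi>\<^sub>E i\<in>A. N i)" by (simp add: X_def)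
 have cpt: "compact_space X" unfolding X_def using finN by (simp add: compact_space_product_topology compact_space_discrete_topology)
 define C where "C p = {f : ts X. f (fst p) ~= f (snd p)}" for p :: "'a >< 'a"
 \<comment> \<open>The whole space is included so that a point of the intersection is a choice
   function even when there are no pairs of distinct indices.\<close>
 define \<U> where "\<U> = insert (ts X) (C ` {(i, j). i : A & j : A & i ~= j})"
 have proj: "cmap X (discrete_topology (N i)) (%f. f i)" if "i : A" for i unfolding X_def using that by (rule continuous_map_product_projection)
 have closed: "closedin X D" if "D : \<U>" for D
 proof (cases "D = ts X")
  case False
  hence "D : C ` {(i, j). i : A & j : A & i ~= j}" using that by (simp add: \<U>_def)
  then obtain i j where ij: "i : A" "j : A" "D = C (i, j)" by blast
  have op: "openin X {f : ts X. f i = v}" if "i : A" for i v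
  proof -
  have "openin X {f : ts X. f i : {v} Int N i}" by (rule open_pre[OF proj[OF that]]) simp
  moreover have "{f : ts X. f i : {v} Int N i} = {f : ts X. f i = v}" using that by (auto simp: topX)
  ultimately show ?thesis by simp
  qed
  have "ts X - D = (\<Union>v. {f : ts X. f i = v} Int {f : ts X. f j = v})" unfolding ij C_def by auto
  moreover have "openin X (\<Union>v. {f : ts X. f i = v} Int {f : ts X. f j = v})" by (rule openin_Union) (auto intro!: op ij)
  ultimately have "openin X (ts X - D)" by simp
  moreover have "D <= ts X" unfolding ij C_def by auto
  ultimately show ?thesis by (simp add: closedin_def)
 qed simp
 have ne: "N i ~= {}" if "i : A" for i using hall[of "{i}"] that by auto
 have fip: "\<Inter>\<F> ~= {}" if \<F>: "finite \<F>" "\<F> <= \<U>" for \<F>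
 proof -
  have "\<F> - {ts X} <= C ` {(i, j). i : A & j : A & i ~= j}" using \<F>(2) unfolding \<U>_def by blast
  from finite_subset_image[OF _ this] obtain P where P: "P <= {(i, j). i : A & j : A & i ~= j}" "finite P" "\<F> - {ts X} = C ` P" using \<F>(1) by auto
  let ?F = "fst ` P Un snd ` P"
  have F: "finite ?F" "?F <= A" using P by auto
  have "EX ph. inj_on ph ?F & (ALL i:?F. ph i : N i)"
  proof (rule hall_finite[OF F(1)])
  show "finite (N i)" if "i : ?F" for i using finN F(2) that by blast
  show "card E <= card (\<Union>(N ` E))" if "E <= ?F" for E using that F fin_sub[OF that F(1)] by (intro hall) auto
  qed
  then obtain ph where ph: "inj_on ph ?F" "ALL i:?F. ph i : N i" by blast
  define f where "f = (\<lambda>i\<in>A. if i : ?F then ph i else (SOME x. x : N i))"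
  have fX: "f : ts X" unfolding topX f_def using ph(2) ne by (auto simp: some_in_eq)
  have "f : C p" if "p : P" for p
  proof -
  show ?thesis using that P(1) using inj_onD[OF ph(1), of "fst p" "snd p"] fX by (auto simp: C_def f_def)
  qed
  hence CP: "ALL D:C ` P. f : D" by blast
  have "ALL D:\<F>. f : D"
  proof
  fix D
  assume D: "D : \<F>"
  show "f : D"
  proof (cases "D = ts X")
  case False
  hence "D : C ` P" using D P(3) by blast
  thus ?thesis using CP by blast
  qed (use fX in simp)
  qed
  hence "f : \<Inter>\<F>" by simp
  thus ?thesis by auto
 qed
 obtain f where "f : \<Inter>\<U>" using cpt[unfolded compact_space_fip, rule_format, of \<U>] closed fip by auto
 hence f: "!!D. D : \<U> ==> f : D" by (rule InterD)
 have "f i ~= f j" if "i : A" "j : A" "i ~= j" for i j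
 proof -
  have "C (i, j) : \<U>" unfolding \<U>_def using that by blast
  thus ?thesis using f[of "C (i, j)"] by (simp add: C_def)
 qed
 hence "inj_on f A" unfolding inj_on_def by blast
 moreover have "f : ts X" using f by (auto simp: \<U>_def)
 hence "ALL i:A. f i : N i" by (auto simp: topX)
 ultimately show ?thesis by blast
qed

text \<open>The fixed point \<open>S\<close> is the one of the Cantor-Bernstein theorem: \<open>ph\<close> is used on \<open>S\<close>, and \<open>ps\<close> on the
  elements of \<open>B\<close> that this leaves unmatched.\<close>

lemma merge_matchings:
 assumes ph: "inj_on ph A" "!!i. i : A ==> E i (ph i)" and ps: "inj_on ps B" "!!j. j : B ==> E (ps j) j"
 shows "EX M. (ALL i j. (i, j) : M --> E i j) & (ALL i j i' j'. (i, j) : M & (i', j') : M --> (i = i' <-> j = j')) & A <= fst ` M & B <= snd ` M"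
proof -
 define S where "S = lfp (%S. A - ps ` (B - ph ` S))"
 have "mono (%S. A - ps ` (B - ph ` S))" by (rule monoI) blast
 hence S: "S = A - ps ` (B - ph ` S)" unfolding S_def by (rule lfp_unfold)
 hence SA: "S <= A" by blast
 define M where "M = {(i, ph i) | i. i : S} Un {(ps j, j) | j. j : B - ph ` S}"
 have "E i j" if "(i, j) : M" for i j using that ph(2) ps(2) SA by (auto simp: M_def)
 moreover have "i = i' <-> j = j'" if "(i, j) : M" "(i', j') : M" for i j i' j'
 proof -
  have c: "(i : S & j = ph i) | (j : B - ph ` S & i = ps j)" if "(i, j) : M" for i j using that by (auto simp: M_def)
  show ?thesis using c[OF that(1)] c[OF that(2)] S inj_onD[OF ps(1), of j j'] inj_onD[OF ph(1), of i i'] by auto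
 qed
 moreover have "A <= fst ` M"
 proof
  fix i
  assume "i : A"
  then consider "i : S" | j where "j : B - ph ` S" "i = ps j" using S by blast
  thus "i : fst ` M" by cases (force simp: M_def)+
 qed
 moreover have "B <= snd ` M"
 proof
  fix j
  assume "j : B"
  then consider i where "i : S" "j = ph i" | "j : B - ph ` S" by blast
  thus "j : snd ` M" by cases (force simp: M_def)+
 qed
 ultimately show ?thesis by (intro exI[of _ M] conjI allI impI) simp_all
qed

section \<open>Endpoints of intervals\<close>

lemma l_end_leI: assumes "!!b. b : B ==> EX a:A. a <= b + dl" shows "lend A <= lend B + ereal dl"
proof -
 have "lend A - ereal dl <= lend B" unfolding left_end_def[of B]
 proof (rule Inf_greatest)
  fix x
  assume "x : ereal ` B"
  then obtain b where b: "b : B" "x = ereal b" by blast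
  obtain a where a: "a : A" "a <= b + dl" using assms[OF b(1)] by blast
  have "lend A <= ereal a" unfolding left_end_def using a(1) by (intro Inf_lower) simp
  also have "... <= ereal b + ereal dl" using a(2) by simp
  finally show "lend A - ereal dl <= x" using b(2) by (simp add: ereal_minus_le_iff)
 qed
 thus ?thesis by (simp add: ereal_minus_le_iff)
qed

lemma r_end_leI: assumes "!!a. a : A ==> EX b:B. a <= b + dl" shows "rend A <= rend B + ereal dl"
unfolding right_end_def[of A]
proof (rule Sup_least)
 fix x
 assume "x : ereal ` A"
 then obtain a where a: "a : A" "x = ereal a" by blast
 obtain b where b: "b : B" "a <= b + dl" using assms[OF a(1)] by blast
 have "ereal a <= ereal b + ereal dl" using b(2) by simp
 also have "... <= rend B + ereal dl" unfolding right_end_def using b(1) by (intro add_right_mono Sup_upper) simp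
 finally show "x <= rend B + ereal dl" using a(2) by simp
qed

lemma btw_ends: assumes "is_interval J" "lend J < ereal s" "ereal s < rend J" shows "s : J" using assms(2) assms(3) assms(1)
 by (auto simp: left_end_def Inf_less_iff right_end_def less_Sup_iff is_interval_1)

lemma ends_bounds:
 assumes "J ~= {}"
 shows "lend J ~= \<infinity>" "rend J ~= -\<infinity>" "lend J <= rend J"
proof -
 obtain a where a: "a : J" using assms by blast
 have l: "lend J <= ereal a" unfolding left_end_def using a by (intro Inf_lower) simp
 have r: "ereal a <= rend J" unfolding right_end_def using a by (intro Sup_upper) simp
 show "lend J ~= \<infinity>" "rend J ~= -\<infinity>" using l r by auto
 show "lend J <= rend J" using l r by simp
qed

text \<open>\<open>A\<close> and the translate of \<open>B\<close> by \<open>c\<close> are disjoint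
  intervals, so one of them lies entirely to the left of the other.\<close>

lemma disj_ints_ends:
 assumes A: "is_interval A" "A ~= {}" and B: "is_interval B" "B ~= {}" and d: "!!t. t : A ==> t - c : B ==> False"
 shows "rend A <= lend B + ereal c | rend B + ereal c <= lend A"
proof -
 obtain a b where ab: "a : A" "b : B" using A B by blast
 show ?thesis
 proof (cases "a <= b + c")
  case True
  have lt: "x <= y + c" if "x : A" "y : B" for x y
  proof (rule ccontr)
  assume n: "~ x <= y + c"
  show False
  proof (cases "a <= y + c")
  case True
  hence "y + c : A" using A(1) ab that n unfolding is_interval_1 by (meson less_imp_le not_le)
  thus False using d[of "y + c"] that by simp
  next
  case False
  hence "a - c : B" using B(1) ab that \<open>a <= b + c\<close> unfolding is_interval_1 by (metis diff_le_eq less_imp_le not_le)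
  thus False using d[of a] ab by simp
  qed
  qed
  have "rend A <= lend B + ereal c" unfolding right_end_def
  proof (rule Sup_least)
  fix x
  assume "x : ereal ` A"
  then obtain a where a: "a : A" "x = ereal a" by blast
  have "x - ereal c <= lend B" unfolding left_end_def by (rule Inf_greatest) (use lt[OF a(1)] a(2) in \<open>auto simp: algebra_simps\<close>)
  thus "x <= lend B + ereal c" by (simp add: ereal_minus_le_iff)
  qed
  thus ?thesis ..
 next
  case False
  have lt: "y + c <= x" if "x : A" "y : B" for x y
  proof (rule ccontr)
  assume n: "~ y + c <= x"
  show False
  proof (cases "y + c <= a")
  case True
  hence "y + c : A" using A(1) ab that n unfolding is_interval_1 by (meson less_imp_le not_le)
  thus False using d[of "y + c"] that by simp
  next
  case False
  hence "a - c : B" using B(1) ab that \<open>~ a <= b + c\<close> unfolding is_interval_1 by (metis diff_le_eq less_imp_le not_le)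
  thus False using d[of a] ab by simp
  qed
  qed
  have "rend B + ereal c <= lend A" unfolding left_end_def
  proof (rule Inf_greatest)
  fix x
  assume "x : ereal ` A"
  then obtain a where a: "a : A" "x = ereal a" by blast
  have "rend B <= x - ereal c" unfolding right_end_def by (rule Sup_least) (use lt[OF a(1)] a(2) in \<open>auto simp: algebra_simps\<close>)
  thus "rend B + ereal c <= x" by (simp add: ereal_le_minus_iff)
  qed
  thus ?thesis ..
 qed
qed

section \<open>The preorder on bars that makes the interleaving matrices triangular\<close>

definition bars_close :: "real => real set => real set => bool" where "bars_close dl A B <-> lend A <= lend B + ereal dl & lend B <= lend A + ereal dl & rend A <= rend B + ereal dl & rend B <= rend A + ereal dl"

text \<open>The whole line and the bounded intervals share the value 1. This is harmless: when both
  ends of \<open>A\<close> exceed those of \<open>A'\<close> by at most a constant, each summand can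
  only grow from \<open>A\<close> to \<open>A'\<close>, so equal totals force equal
  summands.\<close>

definition bar_type :: "real set => nat" where "bar_type A = (if lend A = -\<infinity> then 0 else 1) + (if rend A = \<infinity> then 1 else 0)"

text \<open>Twice the midpoint of a bounded bar. An infinite end counts as 0, and centres are only
  compared between bars of equal type.\<close>

definition bar_centre :: "real set => real" where "bar_centre A = (if lend A = -\<infinity> then 0 else real_of_ereal (lend A)) + (if rend A = \<infinity> then 0 else real_of_ereal (rend A))"

definition bar_ge :: "real set => real set => bool" where "bar_ge A A' <-> bar_type A > bar_type A' | bar_type A = bar_type A' & bar_centre A >= bar_centre A'"

lemma bar_ge_same_type:
 assumes ne: "A ~= {}" "A' ~= {}" and ge: "bar_ge A A'" and l: "lend A <= lend A' + ereal c" and r: "rend A <= rend A' + ereal c"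
 shows "lend A = -\<infinity> <-> lend A' = -\<infinity>" "rend A = \<infinity> <-> rend A' = \<infinity>" "bar_centre A' <= bar_centre A"
proof -
 show "lend A = -\<infinity> <-> lend A' = -\<infinity>" "rend A = \<infinity> <-> rend A' = \<infinity>" "bar_centre A' <= bar_centre A"
  using ge l r unfolding bar_ge_def bar_type_def by (auto split: if_splits)
qed

text \<open>The key geometric fact of Bjerkevik's proof of the stability theorem.\<close>

lemma bar_close_alt:
 assumes ne: "A ~= {}" "B ~= {}" "A' ~= {}" and ge: "bar_ge A A'" and "lend A <= lend B + ereal dl" "rend A <= rend B + ereal dl" and "lend B <= lend A' + ereal dl" "rend B <= rend A' + ereal dl"
 shows "bars_close dl A B | bars_close dl A' B"
proof -
 note eA = ends_bounds[OF ne(1)] and eB = ends_bounds[OF ne(2)] and eA' = ends_bounds[OF ne(3)]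
 have le2: "lend A <= lend A' + ereal (2 * dl)" using assms(5,7) by (cases "lend A"; cases "lend B"; cases "lend A'") auto
 have re2: "rend A <= rend A' + ereal (2 * dl)" using assms(6,8) by (cases "rend A"; cases "rend B"; cases "rend A'") auto
 note T = bar_ge_same_type[OF ne(1,3) ge le2 re2]
 have L: "lend A = -\<infinity> & lend B = -\<infinity> & lend A' = -\<infinity> | (EX l m l'. lend A = ereal l & lend B = ereal m & lend A' = ereal l' & l <= m + dl & m <= l' + dl)"
  using T(1) assms(5,7) eA'(1) by (cases "lend A"; cases "lend A'"; cases "lend B") auto
 have R: "rend A = \<infinity> & rend B = \<infinity> & rend A' = \<infinity> | (EX l m l'. rend A = ereal l & rend B = ereal m & rend A' = ereal l' & l <= m + dl & m <= l' + dl)"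
  using T(2) assms(6,8) eA(2) by (cases "rend A"; cases "rend A'"; cases "rend B") auto
 \<comment> \<open>If both alternatives failed, some end of \<open>A\<close> would lie more than
   \<open>dl\<close> before that of \<open>B\<close>, and some end of \<open>A'\<close> more than
   \<open>dl\<close> after that of \<open>B\<close>. Adding up with the other inequalities gives
   \<open>bar_centre A < bar_centre A'\<close>.\<close>
 show ?thesis using L R T(3) unfolding bars_close_def bar_centre_def by (elim disjE exE conjE) auto
qed

text \<open>Provides a parameter at which the restriction over \<open>2 * dl\<close> can be compared
  between the two bars. If \<open>A\<close> and the translate of \<open>A'\<close> were disjoint,
  the order of the centres would contradict that both bars are longer than
  \<open>2 * dl\<close>.\<close>

lemma bar_ov:
 assumes dl: "0 <= dl" and A: "is_interval A" "A ~= {}" and A': "is_interval A'" "A' ~= {}" and ge: "bar_ge A A'" and long: "~ rend A <= lend A + ereal (2 * dl)" and long': "~ rend A' <= lend A' + ereal (2 * dl)" and l: "lend A <= lend A' + ereal (2 * dl)" and r: "rend A <= rend A' + ereal (2 * dl)"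
 shows "EX t:A. t - 2 * dl : A'"
proof (rule ccontr)
 assume "~ ?thesis"
 hence disj: "rend A <= lend A' + ereal (2 * dl) | rend A' + ereal (2 * dl) <= lend A" using disj_ints_ends[OF A A', of "2 * dl"] by blast
 note T = bar_ge_same_type[OF A(2) A'(2) ge l r]
 have L: "lend A = -\<infinity> & lend A' = -\<infinity> | (EX l l'. lend A = ereal l & lend A' = ereal l' & l <= l' + 2 * dl)"
  using T(1) l ends_bounds(1)[OF A'(2)] by (cases "lend A"; cases "lend A'") auto
 have R: "rend A = \<infinity> & rend A' = \<infinity> | (EX l l'. rend A = ereal l & rend A' = ereal l' & l <= l' + 2 * dl)"
  using T(2) r ends_bounds(2)[OF A(2)] by (cases "rend A"; cases "rend A'") auto
 consider (11) "lend A = -\<infinity>" "lend A' = -\<infinity>" "rend A = \<infinity>" "rend A' = \<infinity>" | (12) r r' where "lend A = -\<infinity>" "lend A' = -\<infinity>" "rend A = ereal r" "rend A' = ereal r'" | (21) l l' where "lend A = ereal l" "lend A' = ereal l'" "rend A = \<infinity>" "rend A' = \<infinity>" | (22) l l' r r' where "lend A = ereal l" "lend A' = ereal l'" "rend A = ereal r" "rend A' = ereal r'" "l <= l' + 2 * dl" "r <= r' + 2 * dl"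
  using L R by auto
 thus False
 proof cases
  case 22
  hence "l' + r' <= l + r" using T(3) by (simp add: bar_centre_def)
  moreover have "~ r <= l + 2 * dl" "~ r' <= l' + 2 * dl" using 22 long long' by auto
  moreover have "r <= l' + 2 * dl | r' + 2 * dl <= l" using disj 22 by simp
  ultimately show False using 22 by simp
 qed (use disj in simp_all)
qed

text \<open>Shrinking a long bar by \<open>dl\<close> at both ends leaves a nonempty open interval,
  and two of its points belong to every close bar. By q-tameness only finitely many bars contain
  both.\<close>

lemma bars_close_contains:
 assumes long: "~ rend A <= lend A + ereal (2 * dl)"
 shows "EX s t. s < t & (ALL B. is_interval B --> bars_close dl A B --> s : B & t : B)"
proof -
 have "lend A + ereal dl < rend A - ereal dl" using long by (cases "lend A"; cases "rend A") auto
 from ereal_dense2[OF this] obtain s where s: "lend A + ereal dl < ereal s" "ereal s < rend A - ereal dl" by auto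
 from ereal_dense2[OF s(2)] obtain t where t: "ereal s < ereal t" "ereal t < rend A - ereal dl" by auto
 have "s : B & t : B" if "is_interval B" "bars_close dl A B" for B
 proof -
  have b: "lend B <= lend A + ereal dl" "rend A <= rend B + ereal dl" using that(2) by (auto simp: bars_close_def)
  have "rend A - ereal dl <= rend B" using b(2) by (simp add: ereal_minus_le_iff)
  moreover have "lend A + ereal dl < ereal t" using s(1) t(1) by (rule less_trans)
  ultimately show ?thesis
   using le_less_trans[OF b(1) s(1)] less_le_trans[OF s(2)] less_le_trans[OF t(2)] le_less_trans[OF b(1)] using btw_ends[OF that(1)] by simp
 qed
 thus ?thesis using t(1) by auto
qed

section \<open>Algebraic stability\<close>

text \<open>A morphism of degree \<open>dl\<close>. The parameter is lowered because the modules are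
  contravariant.\<close>

definition shift_map :: "'k ring => real => ('k, 'v) pers_module => ('k, 'w) pers_module => (real => 'v => 'w) => bool" where "shift_map K dl V W f <-> (ALL t. lin_map K (vt V t) (vt W (t - dl)) (f t)) & (ALL s t. s <= t --> (ALL v:vc V t. f s (res V s t v) = res W (s - dl) (t - dl) (f t v)))"

definition per_intl :: "'k ring => real => ('k, 'v) pers_module => ('k, 'w) pers_module => bool" where "per_intl K dl V W <-> (EX f g. shift_map K dl V W f & shift_map K dl W V g & (ALL t. ALL v:vc V t. g (t - dl) (f t v) = res V (t - 2 * dl) t v) & (ALL t. ALL w:vc W t. f (t - dl) (g t w) = res W (t - 2 * dl) t w))"

lemma per_intl_sym: "per_intl K dl V W ==> per_intl K dl W V" unfolding per_intl_def by auto

section \<open>Morphisms between sums of interval modules as matrices\<close>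

context fixes K :: "'k ring" assumes field: "field K" begin

interpretation K: field K by (rule field)

text \<open>The generator of summand \<open>i\<close>. As a function it does not depend on the
  parameter, so restriction leaves it literally unchanged as long as bar \<open>i\<close> is
  alive.\<close>

definition ivec :: "'i set => 'i => 'i => 'k" where "ivec I i = (\<lambda>j\<in>I. if j = i then (one K) else (zero K))"

lemma ivec_car: assumes "i : I" "t : J i" shows "ivec I i : vc (int_sum K I J) t" using assms by (simp add: ivec_def car_int_sum[OF field])

lemma int_sum_co_cl: "v : vc (int_sum K I J) t ==> i : I ==> v i : car K" unfolding car_int_sum[OF field] by auto

lemma int_sum_co_zero: "v : vc (int_sum K I J) t ==> i : I ==> t ~: J i ==> v i = zero K" unfolding car_int_sum[OF field] by auto

lemma finsum_co:
 assumes "finite S" "!!j. j : S ==> x j : vc (int_sum K I J) t" "i : I"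
 shows "(\<Oplus>\<^sub>(vt (int_sum K I J) t) j\<in>S. x j) i = (\<Oplus>\<^sub>K j\<in>S. x j i)"
using assms
proof (induction S rule: finite_induct)
 interpret D: vspace K "vt (int_sum K I J) t" by (rule vs_int_sum[OF field])
 {
 case empty
 thus ?case by (simp add: int_sum_s)
 }
 case (insert a S)
 have "(\<Oplus>\<^sub>(vt (int_sum K I J) t) j\<in>insert a S. x j) = x a +[vt (int_sum K I J) t] (\<Oplus>\<^sub>(vt (int_sum K I J) t) j\<in>S. x j)"
  using insert by simp
 moreover have "x j i : car K" if "j : insert a S" for j using int_sum_co_cl[OF insert.prems(1)[OF that] insert.prems(2)] .
 ultimately show ?case using insert by (simp add: int_sum_s)
qed

lemma int_sum_expand:
 assumes w: "w : vc (int_sum K I J) t" and S: "finite S" "{j : I. w j ~= zero K} <= S" "S <= {j : I. t : J j}"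
 shows "w = (\<Oplus>\<^sub>(vt (int_sum K I J) t) j\<in>S. w j .[vt (int_sum K I J) t] ivec I j)"
proof -
 let ?D = "vt (int_sum K I J) t"
 interpret D: vspace K ?D by (rule vs_int_sum[OF field])
 have cl: "w j .[?D] ivec I j : car ?D" if "j : S" for j using that S(3) int_sum_co_cl[OF w, of j] ivec_car[of j I t J] by auto
 let ?s = "\<Oplus>\<^sub>?D j\<in>S. w j .[?D] ivec I j"
 have s: "?s : car ?D" using cl by simp
 have "w i = ?s i" if i: "i : I" for i
 proof -
  have wK: "w j : car K" if "j : S" for j using that S(3) int_sum_co_cl[OF w, of j] by auto
  have "?s i = (\<Oplus>\<^sub>K j\<in>S. (w j .[?D] ivec I j) i)" by (rule finsum_co[OF S(1) cl i])
  also have "... = (\<Oplus>\<^sub>K j\<in>S. if i = j then w j else (zero K))" using i wK by (intro K.finsum_cong') (auto simp: int_sum_s ivec_def)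
  also have "... = w i"
  proof (cases "i : S")
  case True
  thus ?thesis using K.finsum_singleton[OF True S(1), of w] wK by auto
  next
  case False
  hence "(\<Oplus>\<^sub>K j\<in>S. if i = j then w j else (zero K)) = (\<Oplus>\<^sub>K j\<in>S. (zero K))" by (intro K.finsum_cong') auto
  moreover have "w i = zero K" using False S(2) i by auto
  ultimately show ?thesis by simp
  qed
  finally show ?thesis by simp
 qed
 moreover have "w : extensional I" "?s : extensional I" using w s unfolding car_int_sum[OF field] by (auto simp: PiE_iff)
 ultimately show ?thesis by (intro extensionalityI) auto
qed

lemma lin_map_co:
 assumes h: "lin_map K (vt (int_sum K I J) t) (vt (int_sum K I' J') t') h" and w: "w : vc (int_sum K I J) t" and S: "finite S" "{j : I. w j ~= zero K} <= S" "S <= {j : I. t : J j}" and i: "i : I'"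
 shows "h w i = (\<Oplus>\<^sub>K j\<in>S. w j *[K] h (ivec I j) i)"
proof -
 let ?D = "vt (int_sum K I J) t" and ?E = "vt (int_sum K I' J') t'"
 note Dv = vs_int_sum[OF field, of I J t] and Ev = vs_int_sum[OF field, of I' J' t']
 interpret D: vspace K ?D by (rule Dv)
 interpret E: vspace K ?E by (rule Ev)
 have c: "w j : car K" "ivec I j : car ?D" if "j : S" for j using that S(3) int_sum_co_cl[OF w, of j] ivec_car[of j I t J] by auto
 have hc: "h (ivec I j) : car ?E" if "j : S" for j using lin_map_cl[OF Dv Ev h] c[OF that] by simp
 have "h w = h (\<Oplus>\<^sub>?D j\<in>S. w j .[?D] ivec I j)" by (rule arg_cong[OF int_sum_expand[OF w S]])
 also have "... = (\<Oplus>\<^sub>?E j\<in>S. h (w j .[?D] ivec I j))" using c by (intro lin_map_finsum[OF Dv Ev h]) auto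
 also have "... = (\<Oplus>\<^sub>?E j\<in>S. w j .[?E] h (ivec I j))" using c hc by (intro E.M.finsum_cong') (auto simp: lin_map_smult[OF Dv Ev h])
 finally have "h w i = (\<Oplus>\<^sub>?E j\<in>S. w j .[?E] h (ivec I j)) i" by simp
 also have "... = (\<Oplus>\<^sub>K j\<in>S. (w j .[?E] h (ivec I j)) i)"
 proof (rule finsum_co[OF S(1) _ i])
  show "w j .[?E] h (ivec I j) : car ?E" if "j : S" for j using c[OF that] hc[OF that] by simp
 qed
 also have "... = (\<Oplus>\<^sub>K j\<in>S. w j *[K] h (ivec I j) i)" using i by (simp add: int_sum_s)
 finally show ?thesis .
qed

text \<open>By naturality each matrix entry is a single scalar. If it is nonzero at
  \<open>t\<close>, then going down from \<open>t\<close> the bar \<open>A i\<close> cannot end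
  while the translated \<open>B j\<close> is alive, and going up from \<open>t\<close> the
  translated \<open>B j\<close> cannot end while \<open>A i\<close> is alive. These facts are
  returned as the witness \<open>t\<close> and used through \<open>sc_wit_ends\<close>.\<close>

lemma shift_map_sc:
 assumes f: "shift_map K dl (int_sum K I A) (int_sum K J B) f" and A: "!!i. i : I ==> is_interval (A i)"
 shows "EX ph. ALL i:I. ALL j:J. ph i j : car K & (ALL t:A i. t - dl : B j --> f t (ivec I i) j = ph i j) & (ph i j ~= zero K --> (EX t:A i. t - dl : B j & (ALL s<=t. s - dl : B j --> s : A i) & (ALL s>=t. s : A i --> s - dl : B j)))"
proof -
 let ?D = "int_sum K I A" and ?E = "int_sum K J B"
 have lin: "lin_map K (vt ?D t) (vt ?E (t - dl)) (f t)" for t using f by (simp add: shift_map_def)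
 have nat: "f s (res ?D s t v) = res ?E (s - dl) (t - dl) (f t v)" if "s <= t" "v : vc ?D t" for s t v using f that by (simp add: shift_map_def)
 note Dv = vs_int_sum[OF field, of I A] and Ev = vs_int_sum[OF field, of J B]
 define F where "F i j t = f t (ivec I i) j" for i j t
 have F_closed: "f t (ivec I i) : vc ?E (t - dl)" if "i : I" "t : A i" for i t using lin_map_cl[OF Dv Ev lin] ivec_car[of i I t A] that by blast
 have F_K: "F i j t : car K" if "i : I" "j : J" "t : A i" for i j t unfolding F_def using int_sum_co_cl[OF F_closed] that by blast
 have F_z: "F i j t = zero K" if "i : I" "j : J" "t : A i" "t - dl ~: B j" for i j t unfolding F_def using int_sum_co_zero[OF F_closed] that by blast
 have F_const: "F i j s = F i j t" if "i : I" "j : J" "s <= t" "s : A i" "t : A i" "s - dl : B j" for i j s t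
 proof -
  have "res ?D s t (ivec I i) = ivec I i" using that by (auto simp: int_sum_s ivec_def)
  thus ?thesis using nat[OF that(3) ivec_car[of i I t A]] unfolding F_def using that by (simp add: int_sum_s)
 qed
 have F_dies: "F i j t = zero K" if "i : I" "j : J" "s <= t" "s ~: A i" "t : A i" "s - dl : B j" for i j s t
 proof -
  have "res ?D s t (ivec I i) = zero (vt ?D s)" using that by (auto simp: int_sum_s ivec_def)
  hence "(zero (vt ?E (s - dl))) j = res ?E (s - dl) (t - dl) (f t (ivec I i)) j"
   using nat[OF that(3) ivec_car[of i I t A]] lin_map_zero[OF Dv Ev lin, of s] that by simp
  thus ?thesis unfolding F_def using that by (simp add: int_sum_s)
 qed
 have wit: "t - dl : B j & (ALL s<=t. s - dl : B j --> s : A i & F i j s = F i j t) & (ALL s>=t. s : A i --> s - dl : B j & F i j s = F i j t)" if i: "i : I" and j: "j : J" and t: "t : A i" and nz: "F i j t ~= zero K" for i j t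
 proof (intro conjI allI impI)
  show tB: "t - dl : B j" using F_z[OF i j t] nz by blast
  fix s
  show "s : A i" if "s <= t" "s - dl : B j" using F_dies[OF i j that(1) _ t that(2)] nz by blast
  thus "F i j s = F i j t" if "s <= t" "s - dl : B j" using F_const[OF i j that(1) _ t that(2)] that by blast
  assume s: "t <= s" "s : A i"
  show "F i j s = F i j t" using F_const[OF i j s(1) t s(2) tB] by simp
  show "s - dl : B j" using F_z[OF i j s(2)] F_const[OF i j s(1) t s(2) tB] nz by metis
 qed
 define ph where "ph i j = (if EX t:A i. F i j t ~= zero K then F i j (SOME t. t : A i & F i j t ~= zero K) else (zero K))" for i j
 have "ph i j : car K & (ALL t:A i. t - dl : B j --> f t (ivec I i) j = ph i j) & (ph i j ~= zero K --> (EX t:A i. t - dl : B j & (ALL s<=t. s - dl : B j --> s : A i) & (ALL s>=t. s : A i --> s - dl : B j)))" if i: "i : I" and j: "j : J" for i j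
 proof (cases "EX t:A i. F i j t ~= zero K")
  case False
  hence "ph i j = zero K" "!!t. t : A i ==> F i j t = zero K" by (auto simp: ph_def)
  thus ?thesis by (simp add: F_def)
 next
  case True
  define t where "t = (SOME t. t : A i & F i j t ~= zero K)"
  have t: "t : A i" "F i j t ~= zero K" using someI_ex[of "%t. t : A i & F i j t ~= zero K"] True by (auto simp: t_def)
  have ph: "ph i j = F i j t" using True by (simp add: ph_def t_def)
  note w = wit[OF i j t]
  have c: "ALL s:A i. s - dl : B j --> F i j s = F i j t"
  proof (intro ballI impI)
  fix s
  assume s: "s : A i" "s - dl : B j"
  show "F i j s = F i j t" using w[THEN conjunct2, THEN conjunct1, rule_format, of s] s w[THEN conjunct2, THEN conjunct2, rule_format, of s] by force
  qed
  have "t - dl : B j & (ALL s<=t. s - dl : B j --> s : A i) & (ALL s>=t. s : A i --> s - dl : B j)" using w by simp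
  hence "EX t:A i. t - dl : B j & (ALL s<=t. s - dl : B j --> s : A i) & (ALL s>=t. s : A i --> s - dl : B j)" by auto
  with F_K[OF i j t(1)] c show ?thesis unfolding ph F_def[symmetric] by simp
 qed
 thus ?thesis by auto
qed

lemma sc_wit_ends:
 assumes A: "t : A" "t - dl : B" and low: "ALL s<=t. s - dl : B --> s : A" and up: "ALL s>=t. s : A --> s - dl : B"
 shows "lend A <= lend B + ereal dl" "rend A <= rend B + ereal dl"
proof -
 show "lend A <= lend B + ereal dl"
 proof (rule l_end_leI)
  fix b
  assume b: "b : B"
  show "EX a:A. a <= b + dl" by (smt (verit) low b A)
 qed
 show "rend A <= rend B + ereal dl"
 proof (rule r_end_leI)
  fix a
  assume a: "a : A"
  show "EX b:B. a <= b + dl" by (smt (verit) up a A)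
 qed
qed

end

lemma (in abelian_monoid) finsum_swap:
 assumes "finite A" "finite B" "!!i j. i : A ==> j : B ==> f i j : car G"
 shows "(\<Oplus>i\<in>A. \<Oplus>j\<in>B. f i j) = (\<Oplus>j\<in>B. \<Oplus>i\<in>A. f i j)"
using assms
proof (induction A rule: finite_induct)
 case (insert a A)
 have cl: "f a j : car G" "(\<Oplus>i\<in>A. f i j) : car G" if "j : B" for j using insert.prems that by auto
 have "(\<Oplus>i\<in>insert a A. \<Oplus>j\<in>B. f i j) = (\<Oplus>j\<in>B. f a j) \<oplus> (\<Oplus>i\<in>A. \<Oplus>j\<in>B. f i j)"
  using insert.hyps insert.prems by simp
 also have "... = (\<Oplus>j\<in>B. f a j) \<oplus> (\<Oplus>j\<in>B. \<Oplus>i\<in>A. f i j)" using insert.IH insert.prems by simp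
 also have "... = (\<Oplus>j\<in>B. f a j \<oplus> (\<Oplus>i\<in>A. f i j))" using cl by simp
 also have "... = (\<Oplus>j\<in>B. \<Oplus>i\<in>insert a A. f i j)"
 proof (intro finsum_cong')
  fix j
  assume j: "j : B"
  show "f a j \<oplus> (\<Oplus>i\<in>A. f i j) = (\<Oplus>i\<in>insert a A. f i j)" using insert.hyps insert.prems j by simp
 next
  show "(%j. \<Oplus>i\<in>insert a A. f i j) : B -> car G" using insert.prems by simp
 qed simp
 finally show ?case .
qed simp

section \<open>Matching of the long bars\<close>

lemma bar_ge_min: assumes "finite S" "S ~= {}" shows "EX i:S. ALL k:S. bar_ge (A k) (A i)"
proof -
 obtain i where i: "i : S" "!!k. k : S ==> bar_type (A i) <= bar_type (A k)" using ex_min_if_finite[of "(%i. bar_type (A i)) ` S"] assms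
  by (auto simp: not_less)
 let ?T = "{k : S. bar_type (A k) = bar_type (A i)}"
 obtain m where m: "m : ?T" "!!k. k : ?T ==> bar_centre (A m) <= bar_centre (A k)"
  using assms(1) i(1) using ex_min_if_finite[of "(%i. bar_centre (A i)) ` ?T"] by force
 have "bar_ge (A k) (A m)" if "k : S" for k using m(1) m(2)[of k] i(2)[OF that] that unfolding bar_ge_def by auto
 thus ?thesis using m(1) by blast
qed

text \<open>Hall's condition for the long bars of the first module and their close bars in the
  second. For a finite set \<open>F\<close> of long bars with neighbours \<open>NF\<close>, the
  product of the matrices \<open>ph\<close> and \<open>ga\<close> over \<open>NF\<close> is
  triangular with unit diagonal with respect to \<open>bar_ge\<close>. If \<open>NF\<close> were
  smaller than \<open>F\<close>, a nontrivial combination of the rows of \<open>ph\<close> would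
  vanish on \<open>NF\<close>, which triangularity forbids.\<close>

lemma stab_inj:
 fixes K :: "'k ring" and A :: "'i => real set" and B :: "'j => real set"
 assumes field: "field K" and dl: "0 <= dl" and f: "shift_map K dl (int_sum K I A) (int_sum K J B) f" and g: "shift_map K dl (int_sum K J B) (int_sum K I A) g" and gf: "!!t v. v : vc (int_sum K I A) t ==> g (t - dl) (f t v) = res (int_sum K I A) (t - 2 * dl) t v" and A: "!!i. i : I ==> is_interval (A i) & A i ~= {}" and B: "!!j. j : J ==> is_interval (B j) & B j ~= {}" and fin: "!!s t. s < t ==> finite {j : J. s : B j & t : B j}"
 shows "EX m. inj_on m {i : I. ~ rend (A i) <= lend (A i) + ereal (2 * dl)} & (ALL i:{i : I. ~ rend (A i) <= lend (A i) + ereal (2 * dl)}. m i : {j : J. bars_close dl (A i) (B j)})" (is "EX m. inj_on m ?L & _")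
proof (rule hall_infinite)
 interpret K: field K by (rule field)
 let ?N = "%i. {j : J. bars_close dl (A i) (B j)}"
 have "i : I" and long: "~ rend (A i) <= lend (A i) + ereal (2 * dl)" if "i : ?L" for i using that by auto
 show finN: "finite (?N i)" if i: "i : ?L" for i
 proof -
  obtain s t where st: "s < t" "!!B. is_interval B ==> bars_close dl (A i) B ==> s : B & t : B" using bars_close_contains[OF long[OF i]] by metis
  have "?N i <= {j : J. s : B j & t : B j}" using st(2) B by blast
  thus ?thesis using fin[OF st(1)] by (rule fin_sub)
 qed
 obtain ph where ph': "ALL i:I. ALL j:J. ph i j : car K & (ALL t:A i. t - dl : B j --> f t (ivec K I i) j = ph i j) & (ph i j ~= zero K --> (EX t:A i. t - dl : B j & (ALL s<=t. s - dl : B j --> s : A i) & (ALL s>=t. s : A i --> s - dl : B j)))"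
  using shift_map_sc[OF field f] A by metis
 obtain ga where ga': "ALL j:J. ALL i:I. ga j i : car K & (ALL t:B j. t - dl : A i --> g t (ivec K J j) i = ga j i) & (ga j i ~= zero K --> (EX t:B j. t - dl : A i & (ALL s<=t. s - dl : A i --> s : B j) & (ALL s>=t. s : B j --> s - dl : A i)))"
  using shift_map_sc[OF field g] B by metis
 have phK: "ph i j : car K" and gaK: "ga j i : car K" if "i : I" "j : J" for i j using ph' ga' that by auto
 have ph_eq: "f t (ivec K I i) j = ph i j" if "i : I" "j : J" "t : A i" "t - dl : B j" for i j t using ph' that by blast
 have ga_eq: "g t (ivec K J j) i = ga j i" if "i : I" "j : J" "t : B j" "t - dl : A i" for i j t using ga' that by blast
 have ph_wit: "EX t:A i. t - dl : B j & (ALL s<=t. s - dl : B j --> s : A i) & (ALL s>=t. s : A i --> s - dl : B j)" if "i : I" "j : J" "ph i j ~= zero K" for i j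
  using bspec[OF bspec[OF ph' that(1)] that(2)] that(3) by simp
 have ga_wit: "EX t:B j. t - dl : A i & (ALL s<=t. s - dl : A i --> s : B j) & (ALL s>=t. s : B j --> s - dl : A i)" if "i : I" "j : J" "ga j i ~= zero K" for i j
  using bspec[OF bspec[OF ga' that(2)] that(1)] that(3) by simp
 fix F
 assume F: "finite F" "F <= ?L"
 define NF where "NF = \<Union>(?N ` F)"
 have NF: "finite NF" "NF <= J" using F finN by (auto simp: NF_def)
 \<comment> \<open>The sum over all intermediate bars is an entry of the restriction over
   \<open>2 * dl\<close>, that is 1 on the diagonal and 0 elsewhere. Summing over \<open>NF\<close>
   alone gives the same value for pairs in the order \<open>bar_ge\<close>.\<close>
 have comp: "(\<Oplus>\<^sub>K j\<in>NF. ph i j *[K] ga j i') = (if i = i' then (one K) else (zero K))" if iF: "i : F" "i' : F" and ge: "bar_ge (A i) (A i')" for i i'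
 proof -
  have i: "i : I" "i' : I" and lo: "~ rend (A i) <= lend (A i) + ereal (2 * dl)" "~ rend (A i') <= lend (A i') + ereal (2 * dl)" using iF F(2) by auto
  define P where "P = {j : J. ph i j ~= zero K & ga j i' ~= zero K}"
  have Pends: "lend (A i) <= lend (B j) + ereal dl" "rend (A i) <= rend (B j) + ereal dl" "lend (B j) <= lend (A i') + ereal dl" "rend (B j) <= rend (A i') + ereal dl" if "j : P" for j
  proof -
  have j: "j : J" "ph i j ~= zero K" "ga j i' ~= zero K" using that by (auto simp: P_def)
  obtain t where "t : A i" "t - dl : B j" "ALL s<=t. s - dl : B j --> s : A i" "ALL s>=t. s : A i --> s - dl : B j" using ph_wit[OF i(1) j(1,2)] by blast
  from sc_wit_ends[OF field this] show "lend (A i) <= lend (B j) + ereal dl" "rend (A i) <= rend (B j) + ereal dl" by auto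
  obtain t where "t : B j" "t - dl : A i'" "ALL s<=t. s - dl : A i' --> s : B j" "ALL s>=t. s : B j --> s - dl : A i'" using ga_wit[OF i(2) j(1,3)]
   by blast
  from sc_wit_ends[OF field this] show "lend (B j) <= lend (A i') + ereal dl" "rend (B j) <= rend (A i') + ereal dl" by auto
  qed
  \<comment> \<open>Here the geometry enters: an intermediate bar with nonzero contribution is close
    to \<open>A i\<close> or to \<open>A i'\<close>, hence belongs to \<open>NF\<close>.\<close>
  have PN: "P <= NF"
  proof
  fix j
  assume j: "j : P"
  hence jJ: "j : J" by (simp add: P_def)
  show "j : NF" using bar_close_alt[OF _ _ _ ge Pends[OF j]] A[OF i(1)] A[OF i(2)] B[OF jJ] using jJ iF by (auto simp: NF_def)
  qed
  have nf: "(\<Oplus>\<^sub>K j\<in>NF. ph i j *[K] ga j i') = (\<Oplus>\<^sub>K j\<in>P. ph i j *[K] ga j i')"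
  proof (rule K.add.finprod_mono_neutral_cong_right[OF NF(1) PN])
  show "ph i j *[K] ga j i' = zero K" if "j : NF - P" for j using that NF(2) i phK[of i j] gaK[of i' j] by (auto simp: P_def)
  show "(%j. ph i j *[K] ga j i') : NF -> car K" using NF(2) i phK gaK by auto
  qed simp
  show ?thesis
  \<comment> \<open>For distinct bars without common intermediate bar both sides are zero. In all
    other cases \<open>bar_ov\<close> yields a parameter at which the composite can be
    evaluated.\<close>
  proof (cases "P = {} & i ~= i'")
  case True
  thus ?thesis using nf by simp
  next
  case False
  have "EX t:A i. t - 2 * dl : A i'"
  proof (cases "i = i'")
  case True
  have "lend (A i) <= lend (A i) + ereal (2 * dl)" "rend (A i) <= rend (A i) + ereal (2 * dl)" using dl
   by (cases "lend (A i)"; cases "rend (A i)"; simp)+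
  thus ?thesis using bar_ov[OF dl _ _ _ _ ge lo] A[OF i(1)] True by simp
  next
  case neq: False
  then obtain j where j: "j : P" using False by blast
  have "lend (A i) <= lend (A i') + ereal (2 * dl)" using Pends(1,3)[OF j] by (cases "lend (A i)"; cases "lend (B j)"; cases "lend (A i')") auto
  moreover have "rend (A i) <= rend (A i') + ereal (2 * dl)" using Pends(2,4)[OF j] by (cases "rend (A i)"; cases "rend (B j)"; cases "rend (A i')") auto
  ultimately show ?thesis using bar_ov[OF dl _ _ _ _ ge lo] A[OF i(1)] A[OF i(2)] by simp
  qed
  then obtain t where t: "t : A i" "t - 2 * dl : A i'" by blast
  let ?V = "int_sum K I A" and ?W = "int_sum K J B"
  define w where "w = f t (ivec K I i)"
  note ei = ivec_car[OF field i(1), of t A, OF t(1)]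
  have w: "w : vc ?W (t - dl)"
  proof -
  have "lin_map K (vt ?V t) (vt ?W (t - dl)) (f t)" using f by (simp add: shift_map_def)
  from lin_map_cl[OF vs_int_sum[OF field] vs_int_sum[OF field] this ei] show ?thesis by (simp add: w_def)
  qed
  define S where "S = {j : J. w j ~= zero K}"
  have S: "finite S" "S <= {j : J. t - dl : B j}" "S <= J" using w by (auto simp: car_int_sum[OF field] S_def)
  have lin_g: "lin_map K (vt ?W (t - dl)) (vt ?V (t - dl - dl)) (g (t - dl))" using g[unfolded shift_map_def, THEN conjunct1, THEN spec, of "t - dl"] .
  have "res ?V (t - 2 * dl) t (ivec K I i) i' = (\<Oplus>\<^sub>K j\<in>S. w j *[K] g (t - dl) (ivec K J j) i')"
   using lin_map_co[OF field lin_g w S(1) _ S(2) i(2)] gf[OF ei] by (simp add: S_def w_def)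
  also have "... = (\<Oplus>\<^sub>K j\<in>S. ph i j *[K] ga j i')"
  proof (intro K.finsum_cong')
  fix j
  assume j: "j : S"
  hence jB: "j : J" "t - dl : B j" using S(2) by auto
  show "w j *[K] g (t - dl) (ivec K J j) i' = ph i j *[K] ga j i'" using ph_eq[OF i(1) jB(1) t(1) jB(2)] ga_eq[OF i(2) jB] t(2) by (simp add: w_def )
  next
  show "(%j. ph i j *[K] ga j i') : S -> car K" using S(3) i phK gaK by auto
  qed simp
  also have "... = (\<Oplus>\<^sub>K j\<in>P. ph i j *[K] ga j i')"
  proof (rule K.add.finprod_mono_neutral_cong_right[OF S(1)])
  show "P <= S"
  proof
  fix j
  assume "j : P"
  hence j: "j : J" "ph i j ~= zero K" "ga j i' ~= zero K" by (auto simp: P_def)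
  obtain t1 where t1: "t1 : A i" "t1 - dl : B j" "ALL s>=t1. s : A i --> s - dl : B j" using ph_wit[OF i(1) j(1,2)] by blast
  obtain u where u: "u : B j" "ALL s<=u. s - dl : A i' --> s : B j" using ga_wit[OF i(2) j(1,3)] by blast
  \<comment> \<open>Every contributing intermediate bar is alive at \<open>t - dl\<close>: the two
    witnesses give points of \<open>B j\<close> on both sides of it. So the evaluation at
    \<open>t\<close> sees the whole sum.\<close>
  have "t - dl : B j" by (smt (verit) t1(3) t(1) u(2) t(2) B[OF j(1)] u(1) t1(2) is_interval_1)
  thus "j : S" using ph_eq[OF i(1) j(1) t(1)] j by (simp add: S_def w_def)
  qed
  show "ph i j *[K] ga j i' = zero K" if "j : S - P" for j using that S(3) i phK[of i j] gaK[of i' j] by (auto simp: P_def)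
  show "(%j. ph i j *[K] ga j i') : S -> car K" using S(3) i phK gaK by auto
  qed simp
  finally show ?thesis using nf t(2) i by (auto simp: int_sum_s ivec_def[OF field])
  qed
 qed
 have "card F <= card NF"
 proof (rule ccontr)
  assume "~ card F <= card NF"
  hence "card NF < card F" by simp
  moreover have FI: "F <= I" using F(2) by auto
  ultimately obtain c where c: "c : F -> car K" "EX i:F. c i ~= zero K" "ALL j:NF. (\<Oplus>\<^sub>K i\<in>F. c i *[K] ph i j) = zero K"
   using K.linear_sys_nt[OF NF(1) F(1), of ph] phK NF(2) by blast
  let ?S = "{i : F. c i ~= zero K}"
  have "finite ?S" "?S ~= {}" using F(1) c(2) by auto
  hence "EX i0:?S. ALL i:?S. bar_ge (A i) (A i0)" by (rule bar_ge_min)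
  \<comment> \<open>Minimality of \<open>i0\<close> in the support of \<open>c\<close> makes
    \<open>comp\<close> applicable to all terms with nonzero coefficient; multiplying the relation
    by column \<open>i0\<close> of \<open>ga\<close> leaves \<open>c i0 = 0\<close>.\<close>
  then obtain i0 where i0: "i0 : ?S" "ALL i:?S. bar_ge (A i) (A i0)" by (elim bexE)
  have i0F: "i0 : F" using i0(1) by simp
  have cl: "c i : car K" "ph i j : car K" "ga j i0 : car K" if "i : F" "j : NF" for i j
   using c(1) phK[OF subsetD[OF FI that(1)] subsetD[OF NF(2) that(2)]] gaK[OF subsetD[OF FI i0F] subsetD[OF NF(2) that(2)]] that by auto
  have cK: "c i : car K" if "i : F" for i using c(1) that by auto
  have "(zero K) = (\<Oplus>\<^sub>K j\<in>NF. (\<Oplus>\<^sub>K i\<in>F. c i *[K] ph i j) *[K] ga j i0)"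
  proof -
  have "(\<Oplus>\<^sub>K j\<in>NF. (\<Oplus>\<^sub>K i\<in>F. c i *[K] ph i j) *[K] ga j i0) = (\<Oplus>\<^sub>K j\<in>NF. (zero K))" using c(3) cl i0F
   by (intro K.finsum_cong') auto
  thus ?thesis by simp
  qed
  also have "... = (\<Oplus>\<^sub>K j\<in>NF. \<Oplus>\<^sub>K i\<in>F. c i *[K] (ph i j *[K] ga j i0))"
  proof (intro K.finsum_cong')
  fix j
  assume j: "j : NF"
  have "(\<Oplus>\<^sub>K i\<in>F. c i *[K] ph i j) *[K] ga j i0 = (\<Oplus>\<^sub>K i\<in>F. c i *[K] ph i j *[K] ga j i0)" using F(1) cl j i0F
   by (intro K.finsum_ldistr) auto
  also have "... = (\<Oplus>\<^sub>K i\<in>F. c i *[K] (ph i j *[K] ga j i0))" using cl j by (intro K.finsum_cong') (auto simp: K.m_assoc)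
  finally show "(\<Oplus>\<^sub>K i\<in>F. c i *[K] ph i j) *[K] ga j i0 = (\<Oplus>\<^sub>K i\<in>F. c i *[K] (ph i j *[K] ga j i0))" .
  next
  show "(%j. \<Oplus>\<^sub>K i\<in>F. c i *[K] (ph i j *[K] ga j i0)) : NF -> car K" using cl by simp
  qed simp
  also have "... = (\<Oplus>\<^sub>K i\<in>F. \<Oplus>\<^sub>K j\<in>NF. c i *[K] (ph i j *[K] ga j i0))" using cl by (intro K.finsum_swap NF F) auto
  also have "... = (\<Oplus>\<^sub>K i\<in>F. if i0 = i then c i else (zero K))"
  proof (intro K.finsum_cong')
  fix i
  assume i: "i : F"
  have "(\<Oplus>\<^sub>K j\<in>NF. c i *[K] (ph i j *[K] ga j i0)) = c i *[K] (\<Oplus>\<^sub>K j\<in>NF. ph i j *[K] ga j i0)"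
   using NF(1) cl[OF i] cK[OF i] by (intro K.finsum_rdistr[symmetric]) auto
  also have "... = (if i0 = i then c i else (zero K))"
  proof (cases "c i = zero K")
  case True
  show ?thesis using cl[OF i] using True by simp
  next
  case False
  thus ?thesis using i0(2) i using comp[OF i i0F] cK[OF i] by auto
  qed
  finally show "(\<Oplus>\<^sub>K j\<in>NF. c i *[K] (ph i j *[K] ga j i0)) = (if i0 = i then c i else (zero K))" .
  qed (use cK in auto)
  also have "... = c i0" using K.finsum_singleton[OF i0F F(1), of c] cK by auto
  finally show False using i0(1) by simp
 qed
 thus "card F <= card (\<Union>(?N ` F))" by (simp add: NF_def)
qed

text \<open>The generators of these bars survive from \<open>t\<close> to \<open>s\<close> and are
  independent there, so their number is bounded by the rank of the restriction.\<close>

lemma int_sum_q_tame_finite: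
 assumes field: "field K" and q: "q_tame K (int_sum K I J)" and st: "s < t"
 shows "finite {i : I. s : J i & t : J i}"
proof (rule ccontr)
 let ?D = "vt (int_sum K I J) s"
 interpret K: field K by (rule field)
 interpret D: vspace K ?D by (rule vs_int_sum[OF field])
 obtain S where S: "S <= car ?D" "finite S" "res (int_sum K I J) s t ` vc (int_sum K I J) t <= lsp K ?D S"
  using q[unfolded q_tame_def, rule_format, OF st] by auto
 assume "infinite {i : I. s : J i & t : J i}"
 then obtain F where F: "finite F" "card F = Suc (card S)" "F <= {i : I. s : J i & t : J i}" using infinite_arbitrarily_large by blast
 have FI: "i : I" "s : J i" "t : J i" if "i : F" for i using F(3) that by auto
 have "ivec K I i : lsp K ?D S" if i: "i : F" for i
 proof -
  have "res (int_sum K I J) s t (ivec K I i) = ivec K I i" using FI[OF i] by (auto simp: int_sum_s ivec_def[OF field])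
  moreover have "ivec K I i : vc (int_sum K I J) t" using ivec_car[OF field FI(1)[OF i], of t J] FI(3)[OF i] by simp
  ultimately show ?thesis using S(3) by auto
 qed
 then obtain c where c: "c : F -> car K" "(\<Oplus>\<^sub>?D i\<in>F. c i .[?D] ivec K I i) = zero ?D" "EX i:F. c i ~= zero K"
  using D.fam_dep[OF S(2,1) F(1), of "ivec K I"] F(2) by auto
 have ec: "ivec K I i : car ?D" if "i : F" for i using ivec_car[OF field FI(1)[OF that], of s J] FI(2)[OF that] by simp
 have cK: "c i : car K" if "i : F" for i using c(1) that by auto
 have "c k = zero K" if k: "k : F" for k
 proof -
  have "(\<Oplus>\<^sub>?D i\<in>F. c i .[?D] ivec K I i) k = (\<Oplus>\<^sub>K i\<in>F. (c i .[?D] ivec K I i) k)" using cK ec FI(1)[OF k]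
   by (intro finsum_co[OF field F(1)]) auto
  also have "... = (\<Oplus>\<^sub>K i\<in>F. if k = i then c i else (zero K))" using cK FI(1)[OF k]
   by (intro K.finsum_cong') (auto simp: int_sum_s ivec_def[OF field])
  also have "... = c k" using K.finsum_singleton[OF k F(1), of c] cK by auto
  finally show ?thesis using c(2) FI(1)[OF k] by (simp add: int_sum_s)
 qed
 thus False using c(3) by blast
qed

theorem int_sum_stab:
 fixes K :: "'k ring" and A :: "'i => real set" and B :: "'j => real set"
 assumes field: "field K" and dl: "0 <= dl" and int: "per_intl K dl (int_sum K I A) (int_sum K J B)" and A: "!!i. i : I ==> A i ~= {} & is_interval (A i)" and B: "!!j. j : J ==> B j ~= {} & is_interval (B j)" and q: "q_tame K (int_sum K I A)" "q_tame K (int_sum K J B)"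
 shows "EX M. barcode_matching dl (I, A) (J, B) M"
proof -
 obtain f g where fg: "shift_map K dl (int_sum K I A) (int_sum K J B) f" "shift_map K dl (int_sum K J B) (int_sum K I A) g" "!!t v. v : vc (int_sum K I A) t ==> g (t - dl) (f t v) = res (int_sum K I A) (t - 2 * dl) t v" "!!t v. v : vc (int_sum K J B) t ==> f (t - dl) (g t v) = res (int_sum K J B) (t - 2 * dl) t v"
  using int unfolding per_intl_def by blast
 let ?LI = "{i : I. ~ rend (A i) <= lend (A i) + ereal (2 * dl)}"
 let ?LJ = "{j : J. ~ rend (B j) <= lend (B j) + ereal (2 * dl)}"
 have "EX m. inj_on m ?LI & (ALL i:?LI. m i : {j : J. bars_close dl (A i) (B j)})" using A B int_sum_q_tame_finite[OF field q(2)]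
  by (intro stab_inj[OF field dl fg(1,2,3)]) auto
 then obtain ph where ph: "inj_on ph ?LI" "!!i. i : ?LI ==> ph i : {j : J. bars_close dl (A i) (B j)}" by blast
 have "EX m. inj_on m ?LJ & (ALL j:?LJ. m j : {i : I. bars_close dl (B j) (A i)})" using A B int_sum_q_tame_finite[OF field q(1)]
  by (intro stab_inj[OF field dl fg(2,1,4)]) auto
 then obtain ps where ps: "inj_on ps ?LJ" "!!j. j : ?LJ ==> ps j : {i : I. bars_close dl (B j) (A i)}" by blast
 define E where "E i j <-> i : I & j : J & bars_close dl (A i) (B j)" for i j
 have "EX M. (ALL i j. (i, j) : M --> E i j) & (ALL i j i' j'. (i, j) : M & (i', j') : M --> (i = i' <-> j = j')) & ?LI <= fst ` M & ?LJ <= snd ` M"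
 proof (rule merge_matchings[OF ph(1) _ ps(1)])
  show "E i (ph i)" if "i : ?LI" for i using ph(2)[OF that] that by (simp add: E_def)
  show "E (ps j) j" if "j : ?LJ" for j using ps(2)[OF that] that by (simp add: E_def bars_close_def)
 qed
 then obtain M where M: "ALL i j. (i, j) : M --> E i j" "ALL i j i' j'. (i, j) : M & (i', j') : M --> (i = i' <-> j = j')" "?LI <= fst ` M" "?LJ <= snd ` M"
  by auto
 have "M <= I >< J" using M(1) by (auto simp: E_def)
 moreover have "ALL (i, j):M. lend (A i) <= lend (B j) + ereal dl & lend (B j) <= lend (A i) + ereal dl & rend (A i) <= rend (B j) + ereal dl & rend (B j) <= rend (A i) + ereal dl"
  using M(1) by (auto simp: E_def bars_close_def)
 moreover have "ALL i : I - fst ` M. rend (A i) <= lend (A i) + ereal (2 * dl)" using M(3) by blast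
 moreover have "ALL j : J - snd ` M. rend (B j) <= lend (B j) + ereal (2 * dl)" using M(4) by blast
 ultimately have "barcode_matching dl (I, A) (J, B) M" using M(2) by simp
 thus ?thesis ..
qed

subsection \<open>Interleavings of modules\<close>

lemma shift_map_comp:
 assumes "!!t. vspace K (vt V t)" "!!t. vspace K (vt W t)" "!!t. vspace K (vt U t)" and f: "shift_map K al V W f" and g: "shift_map K bt W U g"
 shows "shift_map K (al + bt) V U (%t v. g (t - al) (f t v))"
proof -
 have e: "t - (al + bt) = t - al - bt" for t by simp
 have lf: "lin_map K (vt V t) (vt W (t - al)) (f t)" and lg: "lin_map K (vt W t) (vt U (t - bt)) (g t)" for t using f g by (auto simp: shift_map_def)
 have fc: "f t v : vc W (t - al)" if "v : vc V t" for t v using lf[of t] that unfolding lin_map_def by blast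
 have "lin_map K (vt V t) (vt U (t - (al + bt))) (%v. g (t - al) (f t v))" for t using lf[of t] lg[of "t - al"] fc[of _ t] unfolding lin_map_def e
  by auto
 moreover have "g (s - al) (f s (res V s t v)) = res U (s - (al + bt)) (t - (al + bt)) (g (t - al) (f t v))" if st: "s <= t" and v: "v : vc V t" for s t v
  using f st v g fc[OF v] by (simp add: shift_map_def e)
 ultimately show ?thesis unfolding shift_map_def by blast
qed

lemma shift_map_comp_inverse:
 assumes "per_mod K V" "per_mod K W" and dl: "0 <= al" "0 <= bt" and f: "shift_map K al V W f" and g: "shift_map K al W V g" and f': "shift_map K bt W U f'" and gf: "!!t v. v : vc V t ==> g (t - al) (f t v) = res V (t - 2 * al) t v" and g'f': "!!t w. w : vc W t ==> g' (t - bt) (f' t w) = res W (t - 2 * bt) t w" and v: "v : vc V t"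
 shows "g (t - (al + bt) - bt) (g' (t - (al + bt)) (f' (t - al) (f t v))) = res V (t - 2 * (al + bt)) t v"
proof -
 interpret V: per_mod K V by fact
 have fv: "f t v : vc W (t - al)" using f v unfolding shift_map_def lin_map_def by blast
 have e: "t - (al + bt) = t - al - bt" "t - al - bt - bt = t - al - 2 * bt" "t - al - 2 * bt - al = t - 2 * (al + bt)" "t - al - al = t - 2 * al"
  by simp_all
 have "g' (t - (al + bt)) (f' (t - al) (f t v)) = res W (t - al - 2 * bt) (t - al) (f t v)" using g'f'[OF fv] by (simp add: e)
 moreover have "g (t - al - 2 * bt) (res W (t - al - 2 * bt) (t - al) (f t v)) = res V (t - al - 2 * bt - al) (t - al - al) (g (t - al) (f t v))"
  using g fv dl unfolding shift_map_def by simp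
 moreover have "res V (t - 2 * (al + bt)) (t - 2 * al) (res V (t - 2 * al) t v) = res V (t - 2 * (al + bt)) t v" using dl v by (intro V.res_comp) auto
 ultimately show ?thesis by (simp only: e gf[OF v])
qed

lemma per_intl_trans:
 assumes V: "per_mod K V" and W: "per_mod K W" and U: "per_mod K U" and dl: "0 <= al" "0 <= bt" and VW: "per_intl K al V W" and WU: "per_intl K bt W U"
 shows "per_intl K (al + bt) V U"
proof -
 obtain f g where fg: "shift_map K al V W f" "shift_map K al W V g" "!!t v. v : vc V t ==> g (t - al) (f t v) = res V (t - 2 * al) t v" "!!t v. v : vc W t ==> f (t - al) (g t v) = res W (t - 2 * al) t v"
  using VW unfolding per_intl_def by blast
 obtain f' g' where fg': "shift_map K bt W U f'" "shift_map K bt U W g'" "!!t v. v : vc W t ==> g' (t - bt) (f' t v) = res W (t - 2 * bt) t v" "!!t v. v : vc U t ==> f' (t - bt) (g' t v) = res U (t - 2 * bt) t v"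
  using WU unfolding per_intl_def by blast
 note vs = per_mod.vs[OF V] per_mod.vs[OF W] per_mod.vs[OF U]
 have F: "shift_map K (al + bt) V U (%t v. f' (t - al) (f t v))" by (rule shift_map_comp[OF vs fg(1) fg'(1)])
 have G: "shift_map K (al + bt) U V (%t v. g (t - bt) (g' t v))" using shift_map_comp[OF vs(3,2,1) fg'(2) fg(2)] by (simp add: add.commute)
 have GF: "g (t - (al + bt) - bt) (g' (t - (al + bt)) (f' (t - al) (f t v))) = res V (t - 2 * (al + bt)) t v" if "v : vc V t" for t v
  by (rule shift_map_comp_inverse[OF V W dl fg(1,2) fg'(1) fg(3) fg'(3) that])
 have FG: "f' (t - (al + bt) - al) (f (t - (al + bt)) (g (t - bt) (g' t v))) = res U (t - 2 * (al + bt)) t v" if "v : vc U t" for t v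
  using shift_map_comp_inverse[OF U W dl(2,1) fg'(2,1) fg(2) fg'(4) fg(4) that] by (simp add: add.commute)
 show ?thesis unfolding per_intl_def
  by (rule exI[of _ "%t v. f' (t - al) (f t v)"], rule exI[of _ "%t v. g (t - bt) (g' t v)"]) (use F G GF FG in blast)
qed

text \<open>Restriction by a positive amount lands in the radical, so it gives both maps of the
  interleaving.\<close>

lemma per_intl_rad: assumes V: "per_mod K V" and dl: "0 < dl" shows "per_intl K dl (radical K V) V"
proof -
 interpret V: per_mod K V by fact
 let ?f = "%t. res V (t - dl) t"
 have nat: "res V (s - dl) s (res V s t v) = res V (s - dl) (t - dl) (res V (t - dl) t v)" if "s <= t" "v : vc V t" for s t v using that dl
  by (simp add: V.res_comp)
 have cl: "v : vc V t" if "v : vc (radical K V) t" for v t using V.radical_subset that by blast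
 have two: "res V (t - dl - dl) (t - dl) (res V (t - dl) t v) = res V (t - 2 * dl) t v" if "v : vc V t" for t v
  using V.res_comp[of "t - dl - dl" "t - dl" t v] that dl by simp
 have into: "res V (t - dl) t v : vc (radical K V) (t - dl)" if "v : vc V t" for t v unfolding V.rad_car using that dl by auto
 have ops: "add (vt (radical K V) t) = add (vt V t)" "module.smult (vt (radical K V) t) = module.smult (vt V t)" for t by (simp_all add: radical_def)
 have clo: "res V (t - dl) t v : vc V (t - dl)" if "v : vc V t" for t v using V.res_cl[OF _ that] dl by simp
 have "shift_map K dl (radical K V) V ?f" using dl by (auto simp: shift_map_def lin_map_def ops V.radical_res cl clo nat V.res_add V.res_smult)
 moreover have "shift_map K dl V (radical K V) ?f" using dl by (auto simp: shift_map_def lin_map_def ops V.radical_res into nat V.res_add V.res_smult)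
 ultimately show ?thesis unfolding per_intl_def V.radical_res using two cl by blast
qed

lemma per_intl_iso:
 assumes V: "per_mod K V" and W: "per_mod K W" and iso: "pers_iso K V W"
 shows "per_intl K 0 V W"
proof -
 interpret V: per_mod K V by fact
 interpret W: per_mod K W by fact
 obtain h where h: "!!t. lin_map K (vt V t) (vt W t) (h t)" "!!t. bij_betw (h t) (vc V t) (vc W t)" "!!s t v. s <= t ==> v : vc V t ==> h s (res V s t v) = res W s t (h t v)"
  using iso unfolding pers_iso_def by blast
 define k where "k t = inv_into (vc V t) (h t)" for t
 have hk: "h t (k t w) = w" "k t w : vc V t" if "w : vc W t" for t w using h(2)[of t] that bij_betw_inv_into[OF h(2)[of t]]
  by (auto simp: k_def bij_betw_inv_into_right bij_betw_apply)
 have kh: "k t (h t v) = v" if "v : vc V t" for t v using h(2)[of t] that by (auto simp: k_def bij_betw_inv_into_left)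
 note hc = lin_map_cl[OF V.vs W.vs h(1)] and h_add = lin_map_add[OF V.vs W.vs h(1)] and h_smult = lin_map_smult[OF V.vs W.vs h(1)]
 have "lin_map K (vt W t) (vt V t) (k t)" for t
 proof -
  interpret module K "vt V t" by (rule V.mod)
  show ?thesis unfolding lin_map_def
  proof (intro conjI ballI)
  show "k t : vc W t -> vc V t" using hk by blast
  fix x y
  assume "x : vc W t" "y : vc W t"
  thus "k t (x +[vt W t] y) = k t x +[vt V t] k t y" using kh[of "k t x +[vt V t] k t y" t] hk h_add by simp
  next
  fix a x
  assume "a : car K" "x : vc W t"
  thus "k t (a .[vt W t] x) = a .[vt V t] k t x" using kh[of "a .[vt V t] k t x" t] hk h_smult by simp
  qed
 qed
 moreover have "k s (res W s t w) = res V s t (k t w)" if "s <= t" "w : vc W t" for s t w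
  using h(3)[OF that(1), of "k t w"] hk(1)[OF that(2)] hk(2)[OF that(2)] kh[OF V.res_cl[OF that(1) hk(2)[OF that(2)]]] by simp
 ultimately show ?thesis unfolding per_intl_def shift_map_def using h kh hk by (intro exI[of _ h] exI[of _ k]) (simp add: V.res_id W.res_id)
qed

lemma q_tame_iso:
 assumes V: "per_mod K V" and W: "per_mod K W" and iso: "pers_iso K V W" and q: "q_tame K V"
 shows "q_tame K W"
unfolding q_tame_def
proof (intro allI impI)
 interpret V: per_mod K V by fact
 interpret W: per_mod K W by fact
 fix s t :: real
 assume st: "s < t"
 obtain h where h: "!!t. lin_map K (vt V t) (vt W t) (h t)" "!!t. bij_betw (h t) (vc V t) (vc W t)" "!!s t v. s <= t ==> v : vc V t ==> h s (res V s t v) = res W s t (h t v)"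
  using iso unfolding pers_iso_def by blast
 obtain S where S: "S <= vc V s" "finite S" "res V s t ` vc V t <= lsp K (vt V s) S" using q[unfolded q_tame_def, rule_format, OF st] by auto
 have "res W s t ` vc W t = (%v. h s (res V s t v)) ` vc V t" using h(2)[of t] h(3) st unfolding bij_betw_def by (auto simp: image_image[symmetric])
 also have "... <= h s ` lsp K (vt V s) S" using S(3) by auto
 also have "... <= lsp K (vt W s) (h s ` S)" by (rule lin_map_span[OF V.vs W.vs h(1) S(1)])
 finally show "EX S<=vc W s. finite S & res W s t ` vc W t <= lsp K (vt W s) S" using S lin_map_cl[OF V.vs W.vs h(1)]
  by (intro exI[of _ "h s ` S"]) auto
qed

text \<open>Covers both branches of \<open>barc\<close>. In each of them the decomposed module
  \<open>V'\<close> is q-tame and interleaved with \<open>V\<close> for all positive shifts.\<close>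

lemma barc_dec:
 fixes K :: "'k ring" and V :: "('k, 'v) pers_module"
 assumes V: "per_mod K V" and q: "q_tame K V"
 obtains V' :: "('k, 'v) pers_module" where "per_mod K V'" "q_tame K V'" "interval_decomposition K V' (barc K V)" "!!dl. 0 < dl ==> per_intl K dl V' V"
proof (cases "EX B :: (real >< 'v) barcode. interval_decomposition K V B")
 case True
 hence "interval_decomposition K V (barc K V)" unfolding barc_def by (simp add: someI_ex)
 moreover have "per_intl K dl V V" if "0 < dl" for dl
 proof -
  interpret per_mod K V by fact
  have two: "res V (t - dl - dl) (t - dl) (res V (t - dl) t v) = res V (t - 2 * dl) t v" if "v : vc V t" for t v
   using res_comp[of "t - dl - dl" "t - dl" t v] that \<open>0 < dl\<close> by simp
  have "shift_map K dl V V (%t. res V (t - dl) t)" unfolding shift_map_def using res_lin that by (auto simp: res_comp)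
  thus ?thesis unfolding per_intl_def using two by blast
 qed
 ultimately show thesis using that[of V] V q by blast
next
 case False
 interpret per_mod K V by fact
 have "interval_decomposition K (radical K V) (barc K V)" unfolding barc_def if_not_P[OF False] by (rule someI_ex[OF rad_dec[OF q]])
 thus thesis using that[of "radical K V"] per_mod_rad q_tame_rad[OF q] per_intl_rad[OF V] by blast
qed

theorem algebraic_stab:
 fixes V :: "('k, 'v) pers_module" and W :: "('k, 'w) pers_module"
 assumes V: "per_mod K V" "q_tame K V" and W: "per_mod K W" "q_tame K W" and ep: "0 <= ep" and int: "per_intl K ep V W"
 shows "d_B (barc K V) (barc K W) <= ereal ep"
proof (rule ereal_le_epsilon2)
 show "d_B (barc K V) (barc K W) <= ereal ep + ereal e" if e: "0 < e" for e
 proof -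
  have field: "field K" using per_mod.field[OF V(1)] .
  obtain V' :: "('k, 'v) pers_module" where V': "per_mod K V'" "q_tame K V'" "interval_decomposition K V' (barc K V)" "!!dl. 0 < dl ==> per_intl K dl V' V"
   by (rule barc_dec[OF V], rule that)
  obtain W' :: "('k, 'w) pers_module" where W': "per_mod K W'" "q_tame K W'" "interval_decomposition K W' (barc K W)" "!!dl. 0 < dl ==> per_intl K dl W' W"
   by (rule barc_dec[OF W], rule that)
  obtain I A where IA: "barc K V = (I, A)" by fastforce
  obtain J B where JB: "barc K W = (J, B)" by fastforce
  have A: "!!i. i : I ==> A i ~= {} & is_interval (A i)" "pers_iso K V' (int_sum K I A)" and B: "!!j. j : J ==> B j ~= {} & is_interval (B j)" "pers_iso K W' (int_sum K J B)"
   using V'(3) W'(3) by (simp_all add: IA JB)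
  have SA: "per_mod K (int_sum K I A)" using A(1) by (intro per_mod_int_sum[OF field]) auto
  have SB: "per_mod K (int_sum K J B)" using B(1) by (intro per_mod_int_sum[OF field]) auto
  \<comment> \<open>One half of the error is spent on passing from \<open>V\<close> to the
    decomposed module, the other half on doing so for \<open>W\<close>.\<close>
  have e2: "0 < e / 2" "0 <= e / 2" using e by auto
  have 1: "per_intl K 0 (int_sum K I A) V'" by (rule per_intl_sym[OF per_intl_iso[OF V'(1) SA A(2)]])
  have 2: "per_intl K (0 + e / 2) (int_sum K I A) V" by (rule per_intl_trans[OF SA V'(1) V(1) order_refl e2(2) 1 V'(4)[OF e2(1)]])
  have 3: "per_intl K (0 + e / 2 + ep) (int_sum K I A) W" using per_intl_trans[OF SA V(1) W(1) _ ep 2 int] e2 by simp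
  have 4: "per_intl K (0 + e / 2 + ep + e / 2) (int_sum K I A) W'"
   using per_intl_trans[OF SA W(1) W'(1) _ e2(2) 3 per_intl_sym[OF W'(4)[OF e2(1)]]] e2 ep by simp
  have "per_intl K (0 + e / 2 + ep + e / 2 + 0) (int_sum K I A) (int_sum K J B)"
   using per_intl_trans[OF SA W'(1) SB _ order_refl 4 per_intl_iso[OF W'(1) SB B(2)]] e2 ep by simp
  moreover have "0 + e / 2 + ep + e / 2 + 0 = ep + e" by simp
  ultimately have 5: "per_intl K (ep + e) (int_sum K I A) (int_sum K J B)" by (simp only:)
  have ee: "0 <= ep + e" using ep e by simp
  have "EX M. barcode_matching (ep + e) (I, A) (J, B) M"
   by (rule int_sum_stab[OF field ee 5 A(1) B(1) q_tame_iso[OF V'(1) SA A(2) V'(2)] q_tame_iso[OF W'(1) SB B(2) W'(2)]])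
  hence "d_B (I, A) (J, B) <= ereal (ep + e)" unfolding d_B_def using ee by (intro Inf_lower) blast
  thus "d_B (barc K V) (barc K W) <= ereal ep + ereal e" by (simp add: IA JB)
 qed
qed

section \<open>Discs and the homotopy extension property\<close>

text \<open>The homotopy extension property, encoded by a retraction of the cylinder onto its bottom
  and its wall. A definition by extensions would have to quantify over target spaces of all
  types.\<close>

definition hep :: "'p::topological_space set => 'p set => bool" where "hep S A <-> A <= S & closedin (tp S) A & (EX rh. con (S >< {0..1::real}) rh & rh ` (S >< {0..1}) <= S >< {0} Un A >< {0..1} & (ALL z : S >< {0} Un A >< {0..1}. rh z = z))"

lemma closedin_Times_l:
 fixes S :: "'a::topological_space set" and T :: "'b::topological_space set"
 assumes "closedin (tp S) A"
 shows "closedin (tp (S >< T)) (A >< T)"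
proof -
 obtain C where "closed C" "A = S Int C" using assms by (auto simp: closedin_closed)
 moreover have "closed (C >< (UNIV :: 'b::topological_space set))" using \<open>closed C\<close> by (intro closed_Times) auto
 moreover have "A >< T = (S >< T) Int (C >< UNIV)" using \<open>A = S Int C\<close> by auto
 ultimately show ?thesis unfolding closedin_closed by auto
qed

lemma closedin_Times_r:
 fixes S :: "'a::topological_space set" and T :: "'b::topological_space set"
 assumes "closedin (tp T) B"
 shows "closedin (tp (S >< T)) (S >< B)"
proof -
 obtain C where "closed C" "B = T Int C" using assms by (auto simp: closedin_closed)
 moreover have "closed ((UNIV :: 'a::topological_space set) >< C)" using \<open>closed C\<close> by (intro closed_Times) auto
 moreover have "S >< B = (S >< T) Int (UNIV >< C)" using \<open>B = T Int C\<close> by auto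
 ultimately show ?thesis unfolding closedin_closed by auto
qed

lemma cont_on_o_fst: "con A f ==> T <= A >< B ==> con T (%z. f (fst z))" by (rule con_comp2[of A f _ fst]) (auto intro: con_fst)

lemma cont_map_glue2:
 assumes "closedin (tp (A Un B)) A" "closedin (tp (A Un B)) B" and "cmap (tp A) X f" "cmap (tp B) X g" and "!!x. x : A ==> x : B ==> f x = g x"
 shows "cmap (tp (A Un B)) X (%x. if x : A then f x else g x)"
proof (rule pasting_lemma_closed[where I = "UNIV :: bool set" and T = "%b. if b then A else B" and f = "%b. if b then f else g"])
 show "cmap (subtopology (tp (A Un B)) (if b then A else B)) X (if b then f else g)" for b using assms(3,4) by (auto simp: subtopology_subtopology)
qed (use assms in \<open>auto split: if_splits\<close>)

lemma hep_ext:
 assumes "hep S A" and u: "cmap (tp S) X u" and T: "cmap (tp (A >< {0..1::real})) X T" and uT: "!!x. x : A ==> T (x, 0) = u x"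
 shows "EX E. cmap (tp (S >< {0..1})) X E & (ALL x:S. E (x, 0) = u x) & (ALL x:A. ALL t:{0..1}. E (x, t) = T (x, t))"
proof -
 let ?I = "{0..1::real}"
 let ?W = "S >< {0} Un A >< ?I"
 obtain rh where A: "A <= S" "closedin (tp S) A" and rh: "con (S >< ?I) rh" "rh ` (S >< ?I) <= ?W" "!!z. z : ?W ==> rh z = z"
  using assms(1) unfolding hep_def by blast
 define w where "w z = (if z : S >< {0} then (u o fst) z else T z)" for z
 have sub: "?W <= S >< ?I" using A by auto
 have "cmap (tp ?W) X w" unfolding w_def
 proof (rule cont_map_glue2)
  have "closedin (tp (S >< ?I)) (S >< {0})" by (rule closedin_Times_r) auto
  thus "closedin (tp ?W) (S >< {0})" by (rule closedin_subset_trans) (use sub in auto)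
  show "closedin (tp ?W) (A >< ?I)" by (rule closedin_subset_trans[OF closedin_Times_l[OF A(2)]]) (use sub in auto)
  have "cts (S >< {0::real}) S fst" by (auto intro!: continuous_intros)
  from cm_comp[OF this u] show "cmap (tp (S >< {0::real})) X (u o fst)" .
 qed (use T uT in auto)
 moreover have "cts (S >< ?I) ?W rh" using rh(1,2) by auto
 ultimately have "cmap (tp (S >< ?I)) X (w o rh)" by (rule cm_comp[rotated])
 moreover have "(w o rh) (x, 0) = u x" if "x : S" for x using rh(3)[of "(x, 0)"] that by (simp add: w_def)
 moreover have "(w o rh) (x, t) = T (x, t)" if "x : A" "t : ?I" for x t using rh(3)[of "(x, t)"] that uT[OF that(1)] A(1) by (auto simp: w_def)
 ultimately show ?thesis by blast
qed

lemma hep_homeo: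
 assumes "hep S A" and h: "homeomorphism S' S h k" and A': "A' = {x : S'. h x : A}"
 shows "hep S' A'"
proof -
 let ?I = "{0..1::real}"
 obtain rh where A: "A <= S" "closedin (tp S) A" and rh: "con (S >< ?I) rh" "rh ` (S >< ?I) <= S >< {0} Un A >< ?I" "!!z. z : S >< {0} Un A >< ?I ==> rh z = z"
  using assms(1) unfolding hep_def by blast
 have hk: "con S' h" "con S k" "!!x. x : S' ==> k (h x) = x" "!!y. y : S ==> h (k y) = y" "h ` S' = S" "k ` S = S'" using h unfolding homeomorphism_def
  by auto
 define rh' where "rh' z = (let w = rh (h (fst z), snd z) in (k (fst w), snd w))" for z
 have hh: "con (S' >< ?I) (%z. (h (fst z), snd z))" by (intro con_Pair cont_on_o_fst[OF hk(1) order_refl] con_snd con_id)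
 have r: "con (S' >< ?I) (%z. rh (h (fst z), snd z))"
 proof (rule con_comp2[OF rh(1) hh])
  show "(%z. (h (fst z), snd z)) ` (S' >< ?I) <= S >< ?I" using hk(5) by auto
 qed
 have rin: "rh (h (fst z), snd z) : S >< {0} Un A >< ?I" if "z : S' >< ?I" for z
 proof -
  have "(h (fst z), snd z) : S >< ?I" using that hk(5) by auto
  thus ?thesis using rh(2) by blast
 qed
 have "con (S' >< ?I) rh'" unfolding rh'_def Let_def
 proof (intro con_Pair con_snd r)
  show "con (S' >< ?I) (%z. k (fst (rh (h (fst z), snd z))))"
  proof (rule con_comp2[OF hk(2) con_fst[OF r]])
  have "fst (rh (h (fst z), snd z)) : S" if "z : S' >< ?I" for z using rin[OF that] A(1) by auto
  thus "(%z. fst (rh (h (fst z), snd z))) ` (S' >< ?I) <= S" by blast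
  qed
 qed
 moreover have "rh' ` (S' >< ?I) <= S' >< {0} Un A' >< ?I"
 proof
  fix y
  assume "y : rh' ` (S' >< ?I)"
  then obtain z where z: "z : S' >< ?I" "y = rh' z" by blast
  obtain w t where w: "rh (h (fst z), snd z) = (w, t)" by fastforce
  have "w : S" "w : S & t = 0 | w : A & t : ?I" using rin[OF z(1)] A(1) w by auto
  moreover have "k w : S'" "h (k w) = w" using \<open>w : S\<close> hk by auto
  ultimately show "y : S' >< {0} Un A' >< ?I" using z(2) w A' by (auto simp: rh'_def)
 qed
 moreover have "rh' z = z" if "z : S' >< {0} Un A' >< ?I" for z
 proof -
  have "(h (fst z), snd z) : S >< {0} Un A >< ?I" "fst z : S'" using that A' hk(5) by auto
  thus ?thesis using rh(3) hk(3) by (simp add: rh'_def)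
 qed
 moreover have "closedin (tp S') A'"
 proof -
  have "A' = S' Int h -` A" using A' by auto
  moreover have "h ` S' <= S" using hk(5) by simp
  ultimately show ?thesis using continuous_closedin_preimage_gen[OF hk(1) _ A(2)] by auto
 qed
 ultimately show ?thesis unfolding hep_def using A' by blast
qed

subsection \<open>Star-shaped bodies given by a gauge\<close>

text \<open>Euclidean n-space inside the real sequences, in the same coordinates as
  \<open>nsphere\<close> and \<open>standard_simplex\<close>.\<close>

definition co_sp :: "nat => ptx set" where "co_sp n = {x. ALL i>=n. x i = 0}"

definition fscale :: "real => ptx => nat => real" where "fscale c x = (%i. c * x i)"

lemma fscale_apply [simp]: "fscale c x i = c * x i" by (simp add: fscale_def)

lemma fscale_one [simp]: "fscale 1 x = x" and fscale_zero [simp]: "fscale 0 x = (%i. 0)" by auto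

lemma cont_on_co: "con S f ==> con S (%z. (f z :: nat => real) i)" by (rule continuous_on_product_then_coordinatewise)

lemma cont_on_fscale [continuous_intros]: "con S c ==> con S f ==> con S (%z. fscale (c z) (f z))" unfolding fscale_def
 by (rule con_coordwise) (rule continuous_on_mult, assumption, erule continuous_on_product_then_coordinatewise)

lemma fscale_co_sp: "x : co_sp n ==> fscale c x : co_sp n" by (simp add: co_sp_def)

text \<open>Discs, cylinders and simplices are all unit bodies of such functions, and radial
  rescaling identifies any two of them. The bound by \<open>C\<close> makes the gauge definite and
  the rescaling continuous at the origin.\<close>

locale gauge =
 fixes n :: nat and g :: "ptx => real" and C :: real
 assumes cont: "con (co_sp n) g" and nonneg: "x : co_sp n ==> 0 <= g x" and hom: "x : co_sp n ==> 0 <= c ==> g (fscale c x) = c * g x" and bound: "x : co_sp n ==> \<bar>x i\<bar> <= C * g x" and C_nonneg: "0 <= C" begin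

lemma zero: "g (%i. 0) = 0" using hom[of "%i. 0" 0] by (simp add: co_sp_def)

lemma eq_0: "x : co_sp n ==> g x = 0 ==> x = (%i. 0)"
proof
 fix i
 assume "x : co_sp n" "g x = 0"
 thus "x i = 0" using bound[of x i] by simp
qed

definition body :: "ptx set" where "body = {x : co_sp n. g x <= 1}"

definition bdry :: "ptx set" where "bdry = {x : co_sp n. g x = 1}"

lemma body_hep: "hep body bdry"
unfolding hep_def
proof (intro conjI)
 show "bdry <= body" by (auto simp: body_def bdry_def)
 have cb: "con body g" by (rule con_sub[OF cont]) (auto simp: body_def)
 have "bdry = body Int g -` {1}" by (auto simp: body_def bdry_def)
 thus "closedin (tp body) bdry" using continuous_closedin_preimage[OF cb, of "{1}"] by simp
 let ?I = "{0..1::real}"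
 \<comment> \<open>The projection from the point at height 2 above the centre. The ray through
   \<open>(x, t)\<close> meets the bottom inside the body exactly if
   \<open>2 * g x + t <= 2\<close>; otherwise it meets the wall first.\<close>
 define rh where "rh z = (if 2 * g (fst z) + snd z <= 2 then (fscale (2 / (2 - snd z)) (fst z), 0) else (fscale (1 / g (fst z)) (fst z), 2 - (2 - snd z) / g (fst z)))" for z :: "ptx >< real"
 have gz: "con (body >< ?I) (%z. g (fst z))" by (rule cont_on_o_fst[OF cb order_refl])
 have "con (body >< ?I) rh" unfolding rh_def
 proof (rule continuous_on_cases_le)
  show "con {z : body >< ?I. 2 * g (fst z) + snd z <= 2} (%z. (fscale (2 / (2 - snd z)) (fst z), 0))" by (intro continuous_intros) auto
  have "con {z : body >< ?I. 2 <= 2 * g (fst z) + snd z} (%z. g (fst z))" by (rule con_sub[OF gz]) auto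
  thus "con {z : body >< ?I. 2 <= 2 * g (fst z) + snd z} (%z. (fscale (1 / g (fst z)) (fst z), 2 - (2 - snd z) / g (fst z)))"
   by (intro continuous_intros) auto
  show "con (body >< ?I) (%z. 2 * g (fst z) + snd z)" using gz by (intro continuous_intros)
  fix z :: "ptx >< real"
  assume z: "z : body >< ?I" "2 * g (fst z) + snd z = 2"
  hence "2 - snd z = 2 * g (fst z)" "g (fst z) ~= 0" by auto
  thus "(fscale (2 / (2 - snd z)) (fst z), 0) = (fscale (1 / g (fst z)) (fst z), 2 - (2 - snd z) / g (fst z))" by simp
 qed
 moreover have "rh ` (body >< ?I) <= body >< {0} Un bdry >< ?I"
 proof
  fix y
  assume "y : rh ` (body >< ?I)"
  then obtain x t where xt: "x : co_sp n" "g x <= 1" "0 <= t" "t <= 1" "y = rh (x, t)" by (auto simp: body_def)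
  show "y : body >< {0} Un bdry >< ?I"
  proof (cases "2 * g x + t <= 2")
  case True
  have "fscale (2 / (2 - t)) x : body" using True using xt fscale_co_sp[OF xt(1)] hom[OF xt(1), of "2 / (2 - t)"] by (simp add: body_def)
  thus ?thesis using True xt by (simp add: rh_def)
  next
  case False
  hence "fscale (1 / g x) x : bdry" using xt using fscale_co_sp[OF xt(1), of "1 / g x"] hom[OF xt(1), of "1 / g x"] by (simp add: bdry_def)
  moreover have "0 <= 2 - (2 - t) / g x" "2 - (2 - t) / g x <= 1" using False xt by (auto simp: field_simps)
  ultimately show ?thesis using False xt by (simp add: rh_def)
  qed
 qed
 moreover have "rh z = z" if "z : body >< {0} Un bdry >< ?I" for z using that by (cases z) (auto simp: rh_def body_def bdry_def)
 ultimately show "EX rh. con (body >< ?I) rh & rh ` (body >< ?I) <= body >< {0} Un bdry >< ?I & (ALL z:body >< {0} Un bdry >< ?I. rh z = z)" by blast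
qed

end

text \<open>Only points with \<open>b x = 0\<close> need an argument. There the quotient is 0 by
  convention, and nearby each coordinate of the image is at most \<open>C * a y\<close>, which tends
  to 0.\<close>

lemma cont_on_radial:
 assumes a: "con S a" and b: "con S b" and z: "!!x. x : S ==> b x = 0 ==> a x = 0" and bd: "!!x i. x : S ==> \<bar>x i\<bar> <= C * b x" and C: "0 <= C" and nn: "!!x. x : S ==> 0 <= a x"
 shows "con S (%x :: nat => real. fscale (a x / b x) x)"
proof (rule con_coordwise)
 fix i
 have "con S (%x. x i)" by (rule con_sub[OF con_coords]) simp
 hence ci: "((%x. x i) \<longlongrightarrow> x i) (at x within S)" if "x : S" for x using that by (simp add: continuous_on_def)
 have "con S (%x. a x / b x * x i)" unfolding continuous_on_def
 proof
  fix x
  assume x: "x : S"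
  have la: "(a \<longlongrightarrow> a x) (at x within S)" and lb: "(b \<longlongrightarrow> b x) (at x within S)" using a b x
   by (auto simp: continuous_on_def)
  show "((%x. a x / b x * x i) \<longlongrightarrow> a x / b x * x i) (at x within S)"
  proof (cases "b x = 0")
  case False
  thus ?thesis by (intro tendsto_mult tendsto_divide la lb ci x)
  next
  case True
  have "((%x. a x / b x * x i) \<longlongrightarrow> 0) (at x within S)"
  proof (rule Lim_null_comparison)
  show "((%x. C * a x) \<longlongrightarrow> 0) (at x within S)" using tendsto_mult_right_zero[OF la[unfolded z[OF x True]], of C] .
  show "\<forall>\<^sub>F y in at x within S. norm (a y / b y * y i) <= C * a y" unfolding eventually_at_topological
  proof (intro exI[of _ UNIV] conjI ballI impI)
  fix y
  assume y: "y : S"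
  show "norm (a y / b y * y i) <= C * a y"
  proof (cases "b y = 0")
  case True
  thus ?thesis using z[OF y True] by simp
  next
  case False
  have "0 <= C * b y" using bd[OF y, of i] by simp
  have "0 <= b y | C = 0" using \<open>0 <= C * b y\<close> C by (auto simp: zero_le_mult_iff)
  thus ?thesis
  proof
  assume "C = 0"
  thus ?thesis using bd[OF y, of i] by simp
  next
  assume "0 <= b y"
  have "norm (a y / b y * y i) = a y / b y * \<bar>y i\<bar>" using nn[OF y] \<open>0 <= b y\<close> by (simp add: abs_mult)
  also have "... <= a y / b y * (C * b y)" using nn[OF y] \<open>0 <= b y\<close> bd[OF y] by (intro mult_left_mono) auto
  also have "... = C * a y" using False by simp
  finally show ?thesis .
  qed
  qed
  qed auto
  qed
  thus ?thesis using True by simp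
  qed
 qed
 thus "con S (%x. fscale (a x / b x) x i)" by simp
qed

lemma gg_homeo:
 assumes "gauge n g C" "gauge n g' C'"
 shows "homeomorphism (gauge.body n g) (gauge.body n g') (%x. fscale (g x / g' x) x) (%x. fscale (g' x / g x) x)" and "x : co_sp n ==> g' (fscale (g x / g' x) x) = g x"
proof -
 interpret G: gauge n g C by fact
 interpret G': gauge n g' C' by fact
 have zz: "g x = 0 <-> g' x = 0" if "x : co_sp n" for x using G.eq_0[OF that] G'.zero G'.eq_0[OF that] G.zero by auto
 have ratio: "g' (fscale (g x / g' x) x) = g x" "g (fscale (g' x / g x) x) = g' x" if "x : co_sp n" for x
  using zz[OF that] G.hom[OF that, of "g' x / g x"] G'.hom[OF that, of "g x / g' x"] G.nonneg[OF that] G'.nonneg[OF that] by auto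
 show "x : co_sp n ==> g' (fscale (g x / g' x) x) = g x" using ratio(1) .
 have inv: "fscale (g' (fscale (g x / g' x) x) / g (fscale (g x / g' x) x)) (fscale (g x / g' x) x) = x" "fscale (g (fscale (g' x / g x) x) / g' (fscale (g' x / g x) x)) (fscale (g' x / g x) x) = x" if x: "x : co_sp n" for x
 proof -
  have e: "g (fscale (g x / g' x) x) = g x / g' x * g x" "g' (fscale (g' x / g x) x) = g' x / g x * g' x"
   using G.hom[OF x] G'.hom[OF x] G.nonneg[OF x] G'.nonneg[OF x] by auto
  show "fscale (g' (fscale (g x / g' x) x) / g (fscale (g x / g' x) x)) (fscale (g x / g' x) x) = x" "fscale (g (fscale (g' x / g x) x) / g' (fscale (g' x / g x) x)) (fscale (g' x / g x) x) = x"
   unfolding ratio[OF x] e using zz[OF x] G.eq_0[OF x] by auto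
 qed
 have c1: "con (gauge.body n g) (%x. fscale (g x / g' x) x)" using G.cont G'.cont G'.bound G.nonneg zz G'.C_nonneg
  by (intro cont_on_radial[where C = C']) (auto simp: G.body_def intro: con_sub)
 have c2: "con (gauge.body n g') (%x. fscale (g' x / g x) x)" using G.cont G'.cont G.bound G'.nonneg zz G.C_nonneg
  by (intro cont_on_radial[where C = C]) (auto simp: G'.body_def intro: con_sub)
 have m1: "fscale (g x / g' x) x : gauge.body n g'" if "x : gauge.body n g" for x using that ratio(1)[of x] fscale_co_sp[of x n]
  by (simp add: G.body_def G'.body_def)
 have m2: "fscale (g' x / g x) x : gauge.body n g" if "x : gauge.body n g'" for x using that ratio(2)[of x] fscale_co_sp[of x n]
  by (simp add: G.body_def G'.body_def)
 show "homeomorphism (gauge.body n g) (gauge.body n g') (%x. fscale (g x / g' x) x) (%x. fscale (g' x / g x) x)"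
  by (rule homeomorphismI[OF c1 c2]) (use m1 m2 inv in \<open>auto simp: G.body_def G'.body_def\<close>)
qed

definition nrm :: "nat => ptx => real" where "nrm n x = L2_set x {..<n}"

lemma cont_on_nrm [continuous_intros]: "con S f ==> con S (%z. nrm n (f z))" unfolding nrm_def L2_set_def
 by (intro continuous_on_real_sqrt continuous_on_sum continuous_on_power) (erule cont_on_co)

lemma nrm_fscale: "0 <= c ==> nrm n (fscale c x) = c * nrm n x" by (simp add: nrm_def fscale_def L2_set_right_distrib)

lemma nrm_nonneg [simp]: "0 <= nrm n x" by (simp add: nrm_def)

lemma abs_le_nrm: "i < n ==> \<bar>x i\<bar> <= nrm n x" using member_le_L2_set[of "{..<n}" i "%i. \<bar>x i\<bar>"] by (simp add: nrm_def L2_set_def)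

interpretation nrm: gauge n "nrm n" 1 for n
proof
 show "con (co_sp n) (nrm n)" by (intro continuous_intros)
 show "\<bar>x i\<bar> <= 1 * nrm n x" if "x : co_sp n" for x i using that abs_le_nrm[of i n x] by (cases "i < n") (auto simp: co_sp_def)
qed (auto simp: nrm_fscale)

abbreviation disc :: "nat => ptx set" where "disc n \<equiv> nrm.body n"
text \<open>\<open>sph n\<close> bounds \<open>disc n\<close> and so has dimension
  \<open>n - 1\<close>; it is empty for \<open>n = 0\<close>. Hence \<open>nsphere n\<close> is
  \<open>sph (Suc n)\<close>.\<close>

abbreviation sph :: "nat => ptx set" where "sph n \<equiv> nrm.bdry n"
lemma nrm_square: "(nrm n x)\<^sup>2 = (\<Sum>i<n. (x i)\<^sup>2)" by (simp add: nrm_def L2_set_def sum_nonneg)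

lemma nsphere_eq: "nsphere n = tp (sph (Suc n))"
proof -
 have "{x. (\<Sum>i\<le>n. x i ^ 2) = 1 & (ALL i>n. x i = 0)} = sph (Suc n)"
 proof (rule Set.set_eqI)
  fix x :: "nat => real"
  have "nrm (Suc n) x = 1 <-> (nrm (Suc n) x)\<^sup>2 = 1" using nrm_nonneg[of "Suc n" x] by (simp only: power2_eq_1_iff) linarith
  thus "x : {x. (\<Sum>i\<le>n. x i ^ 2) = 1 & (ALL i>n. x i = 0)} <-> x : sph (Suc n)"
   by (auto simp: nrm.bdry_def co_sp_def nrm_square lessThan_Suc_atMost)
 qed
 thus ?thesis by (simp add: nsphere euc_prod)
qed

section \<open>Pairs homeomorphic to a disc and its boundary sphere\<close>

definition disc_pair :: "nat => 'p::topological_space set => 'p set => bool" where "disc_pair n S A <-> (EX h k. homeomorphism S (disc n) h k & A = {x : S. h x : sph n})"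

lemma disc_pair_hep: "disc_pair n S A ==> hep S A" unfolding disc_pair_def using hep_homeo[OF nrm.body_hep] by blast

lemma disc_pair_disc: "disc_pair n (disc n) (sph n)" unfolding disc_pair_def
 by (intro exI[of _ id] conjI) (auto simp: homeomorphism_def nrm.body_def nrm.bdry_def)

lemma disc_pair_homeo:
 assumes "disc_pair n S A" "homeomorphism S' S h k" "A' = {x : S'. h x : A}"
 shows "disc_pair n S' A'"
proof -
 obtain h' k' where hk: "homeomorphism S (disc n) h' k'" "A = {x : S. h' x : sph n}" using assms(1) unfolding disc_pair_def by blast
 have "homeomorphism S' (disc n) (h' o h) (k o k')" using homeomorphism_compose[OF assms(2) hk(1)] .
 moreover have "h ` S' = S" using assms(2) by (simp add: homeomorphism_def)
 hence "A' = {x : S'. (h' o h) x : sph n}" using hk(2) assms(3) by auto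
 ultimately show ?thesis unfolding disc_pair_def by blast
qed

lemma disc_pair_gg: assumes "gauge n g C" shows "disc_pair n (gauge.body n g) (gauge.bdry n g)"
proof (rule disc_pair_homeo[OF disc_pair_disc gg_homeo(1)[OF assms nrm.gauge_axioms]])
 interpret gauge n g C by fact
 show "bdry = {x : body. fscale (g x / nrm n x) x : sph n}"
 proof (rule Set.set_eqI)
  fix x
  show "x : bdry <-> x : {x : body. fscale (g x / nrm n x) x : sph n}"
  proof (cases "x : co_sp n")
  case True
  show ?thesis using gg_homeo(2)[OF assms nrm.gauge_axioms True] fscale_co_sp[OF True, of "g x / nrm n x"]
   by (simp only: bdry_def body_def nrm.bdry_def) auto
  qed (simp add: bdry_def body_def)
 qed
qed

subsection \<open>Cylinders and simplices\<close>

lemma cont_on_fun_upd: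
 assumes "con S f" "con S c"
 shows "con S (%z. (f z :: nat => real)(n := c z))"
proof (rule con_coordwise)
 show "con S (%z. ((f z)(n := c z)) i)" for i using assms cont_on_co[OF assms(1), of i] by (cases "i = n") auto
qed

lemma cont_on_comp: "con S (%x :: nat => real. x i)" by (rule con_sub[OF con_coords]) simp

lemma nrm_upd [simp]: "nrm n (x(n := c)) = nrm n x" by (simp add: nrm_def L2_set_def)

text \<open>The unit body is the product of \<open>disc n\<close> with the interval from -1 to 1,
  since \<open>nrm n\<close> ignores the coordinate with index \<open>n\<close>.\<close>

lemma gg_cyl: "gauge (Suc n) (%x. max (nrm n x) \<bar>x n\<bar>) 1"
proof
 show "con (co_sp (Suc n)) (%x. max (nrm n x) \<bar>x n\<bar>)" by (intro continuous_on_max cont_on_nrm continuous_on_rabs cont_on_co con_id)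
 show "\<bar>x i\<bar> <= 1 * max (nrm n x) \<bar>x n\<bar>" if "x : co_sp (Suc n)" for x i
 proof -
  consider "i < n" | "i = n" | "i >= Suc n" by linarith
  thus ?thesis using abs_le_nrm[of i n x] that by cases (auto simp: co_sp_def)
 qed
 show "max (nrm n (fscale c x)) \<bar>fscale c x n\<bar> = c * max (nrm n x) \<bar>x n\<bar>" if "0 <= c" for c x using that
  by (simp add: nrm_fscale abs_mult max_mult_distrib_left)
qed (auto simp: le_max_iff_disj)

lemma disc_pair_cyl_disc: "disc_pair (Suc n) (disc n >< {0..1::real}) (sph n >< {0..1} Un disc n >< {0, 1})"
proof (rule disc_pair_homeo[OF disc_pair_gg[OF gg_cyl]])
 interpret G: gauge "Suc n" "%x. max (nrm n x) \<bar>x n\<bar>" 1 by (rule gg_cyl)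
 let ?h = "%z. (fst z)(n := 2 * snd z - 1) :: nat => real" and ?k = "%y. (y(n := 0), (y n + 1) / 2) :: ptx >< real"
 have hin: "?h z : G.body" if "z : disc n >< {0..1}" for z using that by (auto simp: nrm.body_def G.body_def co_sp_def)
 have kin: "?k y : disc n >< {0..1}" if "y : G.body" for y using that by (auto simp: nrm.body_def G.body_def co_sp_def)
 show "homeomorphism (disc n >< {0..1}) G.body ?h ?k"
 proof (rule homeomorphismI)
  show "con (disc n >< {0..1}) ?h" by (intro cont_on_fun_upd continuous_intros)
  show "con G.body ?k" by (intro con_Pair cont_on_fun_upd continuous_intros cont_on_co) auto
  show "?h ` (disc n >< {0..1}) <= G.body" "?k ` G.body <= disc n >< {0..1}" using hin kin by blast+
  show "?k (?h z) = z" if "z : disc n >< {0..1}" for z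
  proof -
  have "(fst z) n = 0" using that by (auto simp: nrm.body_def co_sp_def)
  hence "(fst z)(n := 0) = fst z" by auto
  thus ?thesis by simp
  qed
 qed (simp add: field_simps)
 show "sph n >< {0..1::real} Un disc n >< {0, 1} = {z : disc n >< {0..1}. ?h z : G.bdry}"
 proof (rule Set.set_eqI)
  fix z :: "ptx >< real"
  show "z : sph n >< {0..1} Un disc n >< {0, 1} <-> z : {z : disc n >< {0..1}. ?h z : G.bdry}"
  proof (cases "z : disc n >< {0..1}")
  case True
  have "?h z : G.bdry <-> nrm n (fst z) = 1 | \<bar>2 * snd z - 1\<bar> = 1" using hin[OF True] by (auto simp: G.body_def G.bdry_def)
  also have "... <-> fst z : sph n | snd z : {0, 1}" using True by (auto simp: nrm.body_def nrm.bdry_def)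
  finally show ?thesis using True by force
  next
  case False
  thus ?thesis by (auto simp: nrm.body_def nrm.bdry_def)
  qed
 qed
qed

lemma disc_pair_cyl:
 assumes "disc_pair n S A"
 shows "disc_pair (Suc n) (S >< {0..1::real}) (A >< {0..1} Un S >< {0, 1})"
proof -
 obtain h k where hk: "homeomorphism S (disc n) h k" "A = {x : S. h x : sph n}" using assms unfolding disc_pair_def by blast
 have c: "con S h" "con (disc n) k" "!!x. x : S ==> k (h x) = x" "!!y. y : disc n ==> h (k y) = y" "h ` S = disc n" "k ` disc n = S"
  using hk(1) unfolding homeomorphism_def by auto
 show ?thesis
 proof (rule disc_pair_homeo[OF disc_pair_cyl_disc])
  show "homeomorphism (S >< {0..1}) (disc n >< {0..1}) (%z. (h (fst z), snd z)) (%z. (k (fst z), snd z))"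
  proof (rule homeomorphismI)
  show "con (S >< {0..1}) (%z. (h (fst z), snd z))" by (intro con_Pair cont_on_o_fst[OF c(1) order_refl] con_snd con_id)
  show "con (disc n >< {0..1}) (%z. (k (fst z), snd z))" by (intro con_Pair cont_on_o_fst[OF c(2) order_refl] con_snd con_id)
  qed (use c in auto)
  show "A >< {0..1::real} Un S >< {0, 1} = {z : S >< {0..1}. (h (fst z), snd z) : sph n >< {0..1} Un disc n >< {0, 1}}" using hk(2) c(5) by auto
 qed
qed

text \<open>The facet forms of the simplex once its barycentre is at the origin and the last
  coordinate is dropped: the simplex is where all \<open>n + 1\<close> forms are at most 1, and
  their sum is identically 0.\<close>

definition spx_dual :: "nat => ptx => nat => real" where "spx_dual n y k = (if k = n then \<Sum>i<n. y i else - y k)"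

definition spx_gg :: "nat => ptx => real" where "spx_gg n y = Max (spx_dual n y ` {..n})"

lemma cont_on_Max_atMost:
 fixes f :: "'p::topological_space => nat => real"
 assumes "!!k. con S (%x. f x k)"
 shows "con S (%x. Max (f x ` {..n}))"
proof (induction n)
 case 0
 thus ?case using assms by simp
next
 case (Suc n)
 have "Max (f x ` {..Suc n}) = max (f x (Suc n)) (Max (f x ` {..n}))" for x by (simp add: atMost_Suc)
 thus ?case using Suc assms by (simp add: continuous_on_max)
qed

text \<open>Since the forms add up to zero, their maximum is nonnegative, and \<open>y i\<close> is
  the sum of the other \<open>n\<close> forms. This bounds the coordinates by a multiple of the
  maximum.\<close>

lemma gg_spx: "gauge n (spx_gg n) (real n + 1)"
proof
 have sum0: "(\<Sum>k\<le>n. spx_dual n y k) = 0" for y by (simp add: spx_dual_def lessThan_Suc_atMost[symmetric] sum_negf)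
 have le: "spx_dual n y k <= spx_gg n y" if "k <= n" for y k unfolding spx_gg_def using that by simp
 show nn: "0 <= spx_gg n y" for y
 proof (rule ccontr)
  assume "~ 0 <= spx_gg n y"
  hence "(\<Sum>k\<le>n. spx_dual n y k) < (\<Sum>k\<le>n. 0)"
  proof (intro sum_strict_mono)
  show "spx_dual n y k < 0" if "k : {..n}" for k using le[of k y] that \<open>~ 0 <= spx_gg n y\<close> by simp
  qed auto
  thus False using sum0 by simp
 qed
 show "con (co_sp n) (spx_gg n)" unfolding spx_gg_def
 proof (rule cont_on_Max_atMost)
  show "con (co_sp n) (%x. spx_dual n x k)" for k unfolding spx_dual_def
   by (cases "k = n") (auto intro!: continuous_on_sum continuous_on_minus cont_on_comp)
 qed
 show "spx_gg n (fscale c y) = c * spx_gg n y" if "0 <= c" for c y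
 proof -
  have "mono ((*) c)" using that by (auto intro: monoI mult_left_mono)
  from mono_Max_commute[OF this, of "spx_dual n y ` {..n}"] have "c * spx_gg n y = Max ((*) c ` spx_dual n y ` {..n})" by (simp add: spx_gg_def)
  also have "(*) c ` spx_dual n y ` {..n} = spx_dual n (fscale c y) ` {..n}" by (simp add: image_image spx_dual_def sum_distrib_left cong:)
  finally show ?thesis by (simp add: spx_gg_def)
 qed
 show "\<bar>y i\<bar> <= (real n + 1) * spx_gg n y" if y: "y : co_sp n" for y i
 proof (cases "i < n")
  case False
  thus ?thesis using y nn[of y] by (simp add: co_sp_def)
 next
  case True
  have "- y i <= spx_gg n y" using le[of i y] True by (simp add: spx_dual_def)
  moreover have "spx_gg n y <= (real n + 1) * spx_gg n y" using nn[of y] by (simp add: algebra_simps)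
  moreover have "y i <= real n * spx_gg n y"
  proof -
  have "(\<Sum>k\<le>n. spx_dual n y k) = spx_dual n y i + (\<Sum>k\<in>{..n}-{i}. spx_dual n y k)" using True by (intro sum.remove) auto
  hence "y i = (\<Sum>k\<in>{..n}-{i}. spx_dual n y k)" using True sum0[of y] by (simp add: spx_dual_def[of n y i])
  also have "... <= (\<Sum>k\<in>{..n}-{i}. spx_gg n y)" by (intro sum_mono le) auto
  also have "... = real n * spx_gg n y" using True by simp
  finally show ?thesis .
  qed
  moreover have "real n * spx_gg n y <= (real n + 1) * spx_gg n y" using nn[of y] by (simp add: algebra_simps)
  ultimately show ?thesis by linarith
 qed
qed simp

lemma disc_pair_spx: "disc_pair n (std n) {x : std n. EX k<=n. x k = 0}"
proof (rule disc_pair_homeo[OF disc_pair_gg[OF gg_spx]])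
 interpret G: gauge n "spx_gg n" "real n + 1" by (rule gg_spx)
 \<comment> \<open>The factor \<open>n + 1\<close> and the subtracted 1 move the barycentre, with
   coordinates \<open>1 / (n + 1)\<close>, to the origin; the dropped coordinate is recovered from
   the sum.\<close>
 define h where "h x = (%i. if i < n then (real n + 1) * x i - 1 else 0)" for x :: "nat => real"
 define k where "k y = (%i. if i <= n then (1 - spx_dual n y i) / (real n + 1) else 0)" for y
 have dual_h: "spx_dual n (h x) i = 1 - (real n + 1) * x i" if x: "x : std n" and i: "i <= n" for x i
 proof (cases "i = n")
  case False
  thus ?thesis using i by (simp add: spx_dual_def h_def)
 next
  case True
  have "(\<Sum>i<n. x i) + x n = 1" using x by (simp add: standard_simplex_def lessThan_Suc_atMost[symmetric])
  hence s: "(\<Sum>i<n. x i) = 1 - x n" by simp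
  have "(\<Sum>i<n. h x i) = (real n + 1) * (\<Sum>i<n. x i) - real n" by (simp add: h_def sum_subtractf sum_distrib_left)
  hence "(\<Sum>i<n. h x i) = (real n + 1) * (1 - x n) - real n" unfolding s .
  thus ?thesis using True by (simp add: spx_dual_def algebra_simps)
 qed
 have gauge_h: "spx_gg n (h x) <= 1" "spx_gg n (h x) = 1 <-> (EX i<=n. x i = 0)" if x: "x : std n" for x
 proof -
  have e: "spx_dual n (h x) ` {..n} = (%i. 1 - (real n + 1) * x i) ` {..n}" using dual_h[OF x] by simp
  have "1 - (real n + 1) * x i <= 1" for i using x by (simp add: standard_simplex_def)
  thus l: "spx_gg n (h x) <= 1" unfolding spx_gg_def e by simp
  show "spx_gg n (h x) = 1 <-> (EX i<=n. x i = 0)"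
  proof
  assume "spx_gg n (h x) = 1"
  hence "1 : (%i. 1 - (real n + 1) * x i) ` {..n}" using Max_in[of "(%i. 1 - (real n + 1) * x i) ` {..n}"] unfolding spx_gg_def e by force
  then obtain i where "i <= n" "(real n + 1) * x i = 0" by auto
  moreover have "real n + 1 ~= 0" by linarith
  ultimately show "EX i<=n. x i = 0" by auto
  next
  assume "EX i<=n. x i = 0"
  hence "1 <= spx_gg n (h x)" unfolding spx_gg_def e by auto
  thus "spx_gg n (h x) = 1" using l by simp
  qed
 qed
 have hin: "h x : G.body" if "x : std n" for x using gauge_h(1)[OF that] by (simp add: G.body_def co_sp_def h_def)
 have n1: "real n + 1 > 0" by linarith
 have kin: "k y : std n" if y: "y : G.body" for y
 proof -
  have d: "spx_dual n y i <= 1" if "i <= n" for i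
  proof -
  have "spx_dual n y i <= spx_gg n y" unfolding spx_gg_def using that by simp
  thus ?thesis using y by (simp add: G.body_def)
  qed
  have nn: "0 <= k y i" for i using d by (simp add: k_def)
  have "(\<Sum>i\<le>n. spx_dual n y i) = 0" by (simp add: spx_dual_def lessThan_Suc_atMost[symmetric] sum_negf)
  hence s: "(\<Sum>i\<le>n. k y i) = 1" by (simp add: k_def sum_divide_distrib[symmetric] sum_subtractf)
  have "k y i <= 1" for i
  proof (cases "i <= n")
  case True
  have "k y i <= (\<Sum>i\<le>n. k y i)" using True nn by (intro member_le_sum) auto
  thus ?thesis using s by simp
  qed (simp add: k_def)
  thus ?thesis using nn s by (simp add: standard_simplex_def k_def)
 qed
 show "homeomorphism (std n) G.body h k"
 proof (rule homeomorphismI)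
  show "con (std n) h"
  proof (rule con_coordwise)
  show "con (std n) (%x. h x i)" for i unfolding h_def by (cases "i < n") (auto intro!: continuous_on_diff continuous_on_mult cont_on_comp)
  qed
  show "con G.body k"
  proof (rule con_coordwise)
  show "con G.body (%y. k y i)" for i unfolding k_def spx_dual_def
   by (cases "i <= n"; cases "i = n") (auto intro!: continuous_on_divide continuous_on_diff continuous_on_sum continuous_on_add cont_on_comp)
  qed
  show "h ` std n <= G.body" "k ` G.body <= std n" using hin kin by blast+
  show "k (h x) = x" if "x : std n" for x
  proof
  show "k (h x) i = x i" for i using dual_h[OF that, of i] that by (cases "i <= n") (auto simp: k_def standard_simplex_def)
  qed
  show "h (k y) = y" if "y : G.body" for y using that by (cases "i < n") (auto simp: k_def h_def spx_dual_def G.body_def co_sp_def)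
 qed
 show "{x : std n. EX k<=n. x k = 0} = {x : std n. h x : G.bdry}" using gauge_h(2) hin by (auto simp: G.bdry_def G.body_def)
qed

section \<open>Gluing maps and filling boxes\<close>

lemma cmap_comp: "cmap (tp T) X f ==> con S g ==> g ` S <= T ==> cmap (tp S) X (%x. f (g x))" using cm_comp[of "tp S" "tp T" g X f]
 by (auto simp: o_def)

lemma cmap_after: "cmap (tp S) X g ==> cmap X Y f ==> cmap (tp S) Y (%x. f (g x))" using cm_comp[of "tp S" X g Y f] by (simp add: o_def)

text \<open>A continuous surjection from a compact onto a Hausdorff space is a quotient map.\<close>

lemma cpt_quot_lift:
 fixes q :: "'p::t2_space => 'q::metric_space"
 assumes "compact S" "con S q" "q ` S = T" "cmap (tp S) Z h" and "!!x y. x : S ==> y : S ==> q x = q y ==> h x = h y"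
 obtains g where "cmap (tp T) Z g" "!!x. x : S ==> g (q x) = h x"
proof -
 have "quotient_map (tp S) (tp T) q"
  by (rule T1_Spaces.continuous_imp_quotient_map) (use assms(1-3) in \<open>auto simp: compact_space_subtopology intro!: Hausdorff_space_subtopology \<close>)
 from quotient_map_lift_exists[OF this assms(4)] assms(5) that show thesis by (metis topspace_euclidean_subtopology)
qed

text \<open>Compactness is carried over from the standard simplex, which is homeomorphic to the
  disc.\<close>

lemma cpt_disc: "compact (disc n)" using disc_pair_spx[of n] compactin_standard_simplex[of n] compact_continuous_image
 by (fastforce simp: disc_pair_def euc_prod homeomorphism_def)

lemma sph_sub_disc: "sph n <= disc n" by (auto simp: nrm.body_def nrm.bdry_def)

lemma cpt_sph: "compact (sph n)" using nrm.body_hep[of n] cpt_disc closedin_compact_eq by (auto simp: hep_def)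

lemma glue_walls:
 fixes a b :: "'p::topological_space >< 's::topological_space => 'a"
 assumes AS: "A <= S" "closedin (tp S) A" and a: "cmap (tp (S >< R)) Y a" and b: "cmap (tp (S >< R)) Y b" and c: "cmap (tp ((A >< {0..1::real}) >< R)) Y c" and ca: "!!x s. x : A ==> s : R ==> c ((x, 0), s) = a (x, s)" and cb: "!!x s. x : A ==> s : R ==> c ((x, 1), s) = b (x, s)"
 obtains T where "cmap (tp ((A >< {0..1} Un S >< {0, 1}) >< R)) Y T" "!!x s. x : S ==> s : R ==> T ((x, 0), s) = a (x, s)" "!!x s. x : S ==> s : R ==> T ((x, 1), s) = b (x, s)" "!!x t s. x : A ==> t : {0..1} ==> s : R ==> T ((x, t), s) = c ((x, t), s)"
proof -
 let ?I = "{0..1::real}"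
 let ?L0 = "(S >< {0}) >< R" and ?L1 = "(S >< {1}) >< R" and ?C = "(A >< ?I) >< R" and ?B = "(S >< ?I) >< R"
 have cl0: "closedin (tp ?B) ?L0" and cl1: "closedin (tp ?B) ?L1" by (intro closedin_Times_l closedin_Times_r; auto)+
 have clC: "closedin (tp ?B) ?C" by (intro closedin_Times_l AS)
 have cl: "closedin (tp ?B) (?L1 Un ?C)" and sub: "?L0 <= ?B" "?L1 Un ?C <= ?B" "?L1 <= ?B" "?C <= ?B" using cl1 clC AS(1) by auto
 define b' where "b' = (%z. b (fst (fst z :: 'p >< real), snd z :: 's))"
 define a' where "a' = (%z. a (fst (fst z :: 'p >< real), snd z :: 's))"
 have proj: "con Q (%z. (fst (fst z :: 'p >< real), snd z :: 's))" for Q by (intro continuous_intros)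
 have cb': "cmap (tp ?L1) Y b'" unfolding b'_def by (rule cmap_comp[OF b proj]) auto
 have ca': "cmap (tp ?L0) Y a'" unfolding a'_def by (rule cmap_comp[OF a proj]) auto
 define T1 where "T1 z = (if z : ?L1 then b' z else c z)" for z
 have T1: "cmap (tp (?L1 Un ?C)) Y T1" unfolding T1_def
  by (rule cont_map_glue2[OF closedin_subset_trans[OF cl1] closedin_subset_trans[OF clC] cb' c]) (use sub cb in \<open>auto simp: b'_def\<close>)
 define T where "T z = (if z : ?L0 then a' z else T1 z)" for z
 have T: "cmap (tp (?L0 Un (?L1 Un ?C))) Y T" unfolding T_def
 proof (rule cont_map_glue2[OF closedin_subset_trans[OF cl0] closedin_subset_trans[OF cl] ca' T1])
  fix z
  assume z: "z : ?L0" "z : ?L1 Un ?C"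
  thus "a' z = T1 z" using ca by (auto simp: a'_def T1_def)
 qed (use sub in auto)
 have eq: "?L0 Un (?L1 Un ?C) = (A >< ?I Un S >< {0, 1}) >< R" by auto
 show thesis
 proof (rule that[OF T[unfolded eq]])
  show "T ((x, 0), s) = a (x, s)" "T ((x, 1), s) = b (x, s)" if "x : S" "s : R" for x s using that by (simp_all add: T_def T1_def a'_def b'_def)
  show "T ((x, t), s) = c ((x, t), s)" if "x : A" "t : ?I" "s : R" for x t s using that ca[of x s] cb[of x s] by (auto simp: T_def T1_def a'_def b'_def)
 qed
qed

text \<open>Filling a box over \<open>S\<close> whose bottom is \<open>F\<close> and whose walls over the two ends of the interval and
  over \<open>A\<close> are \<open>a\<close>, \<open>b\<close> and \<open>c\<close>; the top of the box is the result.\<close>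

lemma box_fill:
 assumes dp: "disc_pair n S A" and F: "cmap (tp (S >< {0..1::real})) Y F" and a: "cmap (tp (S >< {0..1::real})) Y a" and b: "cmap (tp (S >< {0..1::real})) Y b" and c: "cmap (tp ((A >< {0..1::real}) >< {0..1::real})) Y c" and Fa: "!!x. x : S ==> a (x, 0) = F (x, 0)" and Fb: "!!x. x : S ==> b (x, 0) = F (x, 1)" and Fc: "!!x t. x : A ==> t : {0..1} ==> c ((x, t), 0) = F (x, t)" and ca: "!!x s. x : A ==> s : {0..1} ==> c ((x, 0), s) = a (x, s)" and cb: "!!x s. x : A ==> s : {0..1} ==> c ((x, 1), s) = b (x, s)"
 obtains G where "cmap (tp (S >< {0..1::real})) Y G" "!!x. x : S ==> G (x, 0) = a (x, 1)" "!!x. x : S ==> G (x, 1) = b (x, 1)" "!!x t. x : A ==> t : {0..1} ==> G (x, t) = c ((x, t), 1)"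
proof -
 let ?I = "{0..1::real}"
 have AS: "A <= S" "closedin (tp S) A" using disc_pair_hep[OF dp] by (auto simp: hep_def)
 have hep2: "hep (S >< ?I) (A >< ?I Un S >< {0, 1})" by (rule disc_pair_hep[OF disc_pair_cyl[OF dp]])
 obtain T where T: "cmap (tp ((A >< ?I Un S >< {0, 1}) >< ?I)) Y T" "!!x s. x : S ==> s : ?I ==> T ((x, 0), s) = a (x, s)" "!!x s. x : S ==> s : ?I ==> T ((x, 1), s) = b (x, s)" "!!x t s. x : A ==> t : ?I ==> s : ?I ==> T ((x, t), s) = c ((x, t), s)"
  using glue_walls[OF AS a b c ca cb] by blast
 have "T (z, 0) = F z" if "z : A >< ?I Un S >< {0, 1}" for z using that Fa Fb Fc T(2-4) by auto
 from hep_ext[OF hep2 F T(1) this] obtain E where E: "cmap (tp ((S >< ?I) >< ?I)) Y E" "!!z t. z : A >< ?I Un S >< {0, 1} ==> t : ?I ==> E (z, t) = T (z, t)"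
  by blast
 show thesis
 proof
  show "cmap (tp (S >< ?I)) Y (%z. E (z, 1))" by (rule cmap_comp[OF E(1)]) (auto intro!: continuous_intros)
 qed (use E(2) T(2-4) in auto)
qed

subsection \<open>The sphere as a quotient of the disc\<close>

text \<open>Collapses the boundary of the disc to \<open>sphere_base\<close>, and sends the centre
  to the antipode. It identifies based maps on \<open>nsphere n\<close> with maps on
  \<open>disc n\<close> that are constant on \<open>sph n\<close>.\<close>

definition disc_to_sph :: "nat => ptx => nat => real" where "disc_to_sph n x = (%i. if i = 0 then 2 * (nrm n x)\<^sup>2 - 1 else 2 * sqrt (1 - (nrm n x)\<^sup>2) * x (i - 1))"

lemma nrm_Suc_square: "(nrm (Suc n) y)\<^sup>2 = (y 0)\<^sup>2 + (\<Sum>i<n. (y (Suc i))\<^sup>2)" by (simp only: nrm_square sum.lessThan_Suc_shift)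

lemma nrm_eq_1_iff: "nrm n x = 1 <-> (nrm n x)\<^sup>2 = 1" using nrm_nonneg[of n x] by (simp only: power2_eq_1_iff) linarith

lemma nrm_le_1_iff: "nrm n x <= 1 <-> (nrm n x)\<^sup>2 <= 1" using abs_square_le_1[of "nrm n x"] by simp

lemma cont_on_disc_to_sph: "con S (disc_to_sph n)"
proof (rule con_coordwise)
 show "con S (%x. disc_to_sph n x i)" for i unfolding disc_to_sph_def by (cases "i = 0") (auto intro!: continuous_intros cont_on_comp)
qed

lemma disc_to_sph_in: "x : disc n ==> disc_to_sph n x : sph (Suc n)"
proof -
 assume x: "x : disc n"
 hence r: "(nrm n x)\<^sup>2 <= 1" by (simp add: nrm.body_def nrm_le_1_iff[symmetric])
 have "(\<Sum>i<n. (2 * sqrt (1 - (nrm n x)\<^sup>2) * x i)\<^sup>2) = 4 * (1 - (nrm n x)\<^sup>2) * (\<Sum>i<n. (x i)\<^sup>2)" using r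
  by (simp add: power_mult_distrib sum_distrib_left)
 also have "... = 4 * (1 - (nrm n x)\<^sup>2) * (nrm n x)\<^sup>2" by (simp only: nrm_square)
 finally have "(nrm (Suc n) (disc_to_sph n x))\<^sup>2 = (2 * (nrm n x)\<^sup>2 - 1)\<^sup>2 + 4 * (1 - (nrm n x)\<^sup>2) * (nrm n x)\<^sup>2"
  unfolding nrm_Suc_square by (simp add: disc_to_sph_def)
 also have "... = 1" by (simp add: power2_eq_square algebra_simps)
 finally show ?thesis using x by (auto simp: nrm.bdry_def nrm.body_def co_sp_def nrm_eq_1_iff disc_to_sph_def)
qed

lemma disc_to_sph_bd: "x : disc n ==> disc_to_sph n x = sphere_base <-> x : sph n"
proof
 assume x: "x : disc n"
 show "x : sph n" if "disc_to_sph n x = sphere_base" using fun_cong[OF that, of 0] x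
  by (simp add: disc_to_sph_def sphere_base_def nrm.bdry_def nrm.body_def nrm_eq_1_iff)
 show "disc_to_sph n x = sphere_base" if "x : sph n" using that by (auto simp: disc_to_sph_def sphere_base_def nrm.bdry_def)
qed

lemma disc_to_sph_inj:
 assumes x: "x : disc n" and y: "y : disc n" and e: "disc_to_sph n x = disc_to_sph n y"
 shows "x = y | x : sph n & y : sph n"
proof (cases "x : sph n")
 case True
 thus ?thesis using disc_to_sph_bd[OF x] disc_to_sph_bd[OF y] e by simp
next
 case False
 have "(nrm n x)\<^sup>2 ~= 1" using False x by (auto simp: nrm.bdry_def nrm.body_def nrm_eq_1_iff)
 hence s: "sqrt (1 - (nrm n x)\<^sup>2) ~= 0" by simp
 have "x i = y i" for i using fun_cong[OF e, of "Suc i"] s fun_cong[OF e, of 0] by (simp add: disc_to_sph_def)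
 thus ?thesis by blast
qed

lemma disc_to_sph_onto: assumes n: "n >= 1" shows "disc_to_sph n ` disc n = sph (Suc n)"
proof
 show "disc_to_sph n ` disc n <= sph (Suc n)" using disc_to_sph_in by blast
 show "sph (Suc n) <= disc_to_sph n ` disc n"
 proof
  fix y
  assume y: "y : sph (Suc n)"
  hence s: "(y 0)\<^sup>2 + (\<Sum>i<n. (y (Suc i))\<^sup>2) = 1" using nrm_Suc_square[of n y] by (simp add: nrm.bdry_def)
  show "y : disc_to_sph n ` disc n"
  proof (cases "y 0 = 1")
  case True
  hence "y (Suc i) = 0" if "i < n" for i using s that by (simp add: sum_nonneg_eq_0_iff)
  hence "y = sphere_base"
  proof (intro ext)
  fix i
  show "y i = sphere_base i" using y True \<open>!!i. i < n ==> y (Suc i) = 0\<close>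
   by (cases i; cases "i <= n") (auto simp: sphere_base_def nrm.bdry_def co_sp_def)
  qed
  \<comment> \<open>Here \<open>n >= 1\<close> is essential: the base point is the image of the
    boundary, and \<open>sph 0\<close> is empty.\<close>
  moreover have "sphere_base : sph n" using n
   by (auto simp: nrm.bdry_def co_sp_def nrm_eq_1_iff nrm_square sphere_base_def if_distrib[of "%x. x ^ 2"] cong: if_cong)
  ultimately show ?thesis using disc_to_sph_bd sph_sub_disc[of n] by force
  next
  case False
  have "(y 0)\<^sup>2 <= 1" using s sum_nonneg[of "{..<n}" "%i. (y (Suc i))\<^sup>2"] by simp
  hence "\<bar>y 0\<bar> <= 1" by (simp only: abs_square_le_1)
  hence d: "(1 - y 0) / 2 > 0" using False by simp
  \<comment> \<open>Solving \<open>2 * r - 1 = y 0\<close> for the squared norm \<open>r\<close> of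
    the preimage gives \<open>1 - r = (1 - y 0) / 2\<close>, hence the denominator.\<close>
  define x where "x i = y (Suc i) / (2 * sqrt ((1 - y 0) / 2))" for i
  have "(nrm n x)\<^sup>2 = (\<Sum>i<n. (y (Suc i))\<^sup>2) / (2 * (1 - y 0))"
  proof -
  have "(2 * sqrt ((1 - y 0) / 2))\<^sup>2 = 2 * (1 - y 0)" using d by simp
  thus ?thesis by (simp only: nrm_square x_def power_divide sum_divide_distrib)
  qed
  also have "(\<Sum>i<n. (y (Suc i))\<^sup>2) = (1 + y 0) * (1 - y 0)" using s by (simp add: algebra_simps power2_eq_square)
  also have "... / (2 * (1 - y 0)) = (1 + y 0) / 2"
  proof -
  have "a * b / (2 * b) = a / 2" if "b ~= 0" for a b :: real using that by simp
  from this[of "1 - y 0" "1 + y 0"] show ?thesis using False by simp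
  qed
  finally have r: "(nrm n x)\<^sup>2 = (1 + y 0) / 2" .
  have "1 - (nrm n x)\<^sup>2 = (1 - y 0) / 2" unfolding r by (simp add: field_simps)
  hence sq: "sqrt (1 - (nrm n x)\<^sup>2) = sqrt ((1 - y 0) / 2)" by simp
  have "disc_to_sph n x = y"
  proof
  show "disc_to_sph n x i = y i" for i
  proof (cases i)
  case 0
  thus ?thesis unfolding disc_to_sph_def r by (simp add: add_divide_distrib)
  next
  case (Suc j)
  thus ?thesis using d unfolding disc_to_sph_def sq x_def by simp
  qed
  qed
  moreover have "x : disc n" using y r \<open>\<bar>y 0\<bar> <= 1\<close> by (auto simp: nrm.body_def co_sp_def nrm_le_1_iff nrm.bdry_def x_def)
  ultimately show ?thesis by auto
  qed
 qed
qed

lemma sph_base_in: "sphere_base : sph (Suc n)"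
 by (auto simp: nrm.bdry_def co_sp_def nrm_eq_1_iff nrm_square sphere_base_def if_distrib[of "%x. x ^ 2"] cong: if_cong)

section \<open>Relative lifting along weak homotopy equivalences\<close>

abbreviation bsd_htp :: "nat => 'a topology => 'a => (ptx => 'a) => (ptx => 'a) => bool" where "bsd_htp n X x \<equiv> homotopic_with (%h. h sphere_base = x) (nsphere n) X"
lemma htp_class_eq_iff:
 assumes "cmap (nsphere n) X g" "g sphere_base = x"
 shows "hcl n X x g = hcl n X x h <-> bsd_htp n X x g h"
proof
 assume "hcl n X x g = hcl n X x h"
 moreover have "g : hcl n X x g" using assms by (simp add: homotopy_class_def)
 ultimately show "bsd_htp n X x g h" by (simp add: homotopy_class_def homotopic_with_sym)
next
 assume gh: "bsd_htp n X x g h"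
 show "hcl n X x g = hcl n X x h" unfolding homotopy_class_def using homotopic_with_trans[OF gh] homotopic_with_trans[OF homotopic_with_symD[OF gh]]
  by auto
qed

lemma ind_htp_class:
 assumes f: "cmap X Y f" and g: "cmap (nsphere n) X g" "g sphere_base = x"
 shows "(\<Union>h\<in>hcl n X x g. hcl n Y (f x) (f o h)) = hcl n Y (f x) (f o g)"
proof -
 have "hcl n Y (f x) (f o h) = hcl n Y (f x) (f o g)" if "h : hcl n X x g" for h
 proof -
  have gh: "bsd_htp n X x g h" using that by (simp add: homotopy_class_def)
  have "bsd_htp n Y (f x) (f o g) (f o h)" by (rule hom_with_comp_l[OF gh f]) simp
  moreover have "cmap (nsphere n) Y (f o g)" "(f o g) sphere_base = f x" using cm_comp[OF g(1) f] g(2) by auto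
  ultimately show ?thesis using htp_class_eq_iff by metis
 qed
 moreover have "g : hcl n X x g" using g by (simp add: homotopy_class_def)
 ultimately show ?thesis by blast
qed

lemma path_comp_of_img: assumes f: "cmap X Y f" and ab: "pco X a b" shows "pco Y (f a) (f b)" using ab cm_comp[OF _ f]
 by (fastforce simp: path_component_of_def pathin_def)

lemma ind_comp:
 assumes f: "cmap X Y f" and a: "a : ts X"
 shows "(\<Union>x\<in>pcs X a. pcs Y (f x)) = pcs Y (f a)"
proof -
 have "pcs Y (f x) = pcs Y (f a)" if "pco X a x" for x using path_comp_of_img[OF f that] path_component_of_equiv by metis
 moreover have "pco X a a" using a by (simp add: path_component_of_refl)
 ultimately show ?thesis by blast
qed

section \<open>Lifting problems over a disc relative to its boundary sphere\<close>

definition fmix :: "real => ptx => ptx => nat => real" where "fmix s x y = (%i. (1 - s) * x i + s * y i)"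

lemma fmix_s [simp]: "fmix 0 x y = x" "fmix 1 x y = y" "fmix s x x = x" by (simp_all add: fmix_def algebra_simps)

lemma cont_on_fmix: "con S c ==> con S f ==> con S g ==> con S (%z. fmix (c z) (f z) (g z))" unfolding fmix_def
 by (rule con_coordwise) (intro continuous_on_add continuous_on_mult continuous_on_diff continuous_on_const; (assumption | erule cont_on_co))

lemma fmix_disc: assumes "x : disc n" "y : disc n" "s : {0..1}" shows "fmix s x y : disc n"
proof -
 have "nrm n (fmix s x y) <= nrm n (fscale (1 - s) x) + nrm n (fscale s y)" unfolding nrm_def fmix_def fscale_def by (rule L2_set_triangle_ineq)
 also have "... = (1 - s) * nrm n x + s * nrm n y" using assms(3) by (simp add: nrm_fscale)
 also have "... <= (1 - s) * 1 + s * 1" using assms by (intro add_mono mult_left_mono) (auto simp: nrm.body_def)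
 finally show ?thesis using assms by (simp add: nrm.body_def co_sp_def fmix_def)
qed

locale weak_eq =
 fixes X :: "'a topology" and Y :: "'b topology" and f :: "'a => 'b"
 assumes weq: "whe X Y f" begin

lemma cont: "cmap X Y f" using weq by (simp add: weak_homotopy_equivalence_def)

lemma pi0_inj: assumes "a : ts X" "b : ts X" "pco Y (f a) (f b)" shows "pco X a b"
proof -
 have "inj_on (%C. \<Union>x\<in>C. pcs Y (f x)) (pcso X)" using weq by (simp add: weak_homotopy_equivalence_def bij_betw_def)
 moreover have "(\<Union>x\<in>pcs X a. pcs Y (f x)) = (\<Union>x\<in>pcs X b. pcs Y (f x))"
  unfolding ind_comp[OF cont assms(1)] ind_comp[OF cont assms(2)] using assms(3) path_component_of_equiv by metis
 ultimately have "pcs X a = pcs X b" using assms(1,2) unfolding path_components_of_def by (auto dest: inj_onD)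
 thus ?thesis using assms(2) by (metis mem_Collect_eq path_component_of_refl)
qed

lemma pi0_surj: assumes "y : ts Y" obtains x where "x : ts X" "pco Y y (f x)"
proof -
 have "(%C. \<Union>x\<in>C. pcs Y (f x)) ` pcso X = pcso Y" using weq by (simp add: weak_homotopy_equivalence_def bij_betw_def)
 moreover have "pcs Y y : pcso Y" using assms by (simp add: path_components_of_def)
 ultimately obtain a where a: "a : ts X" "pcs Y y = (\<Union>x\<in>pcs X a. pcs Y (f x))" unfolding path_components_of_def by (smt (verit) imageE)
 moreover have "f a : ts Y" using a(1) cont by (auto simp: continuous_map_def)
 ultimately have "pco Y y (f a)" using ind_comp[OF cont a(1)] by (metis mem_Collect_eq path_component_of_refl)
 thus thesis using a(1) that by blast
qed

lemma pi_inj: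
 assumes n: "n >= 1" and g: "cmap (nsphere n) X g" "g sphere_base = x" and h: "cmap (nsphere n) X h" "h sphere_base = x" and gh: "bsd_htp n Y (f x) (f o g) (f o h)"
 shows "bsd_htp n X x g h"
proof -
 have "sphere_base : ts (nsphere n)" by (simp add: nsphere_eq sph_base_in)
 hence x: "x : ts X" using g by (auto simp: continuous_map_def)
 have "inj_on (%C. \<Union>f'\<in>C. hcl n Y (f x) (f o f')) (hgr n X x)" using weq n x by (simp add: weak_homotopy_equivalence_def bij_betw_def)
 moreover have "hcl n Y (f x) (f o g) = hcl n Y (f x) (f o h)" using gh htp_class_eq_iff[OF cm_comp[OF g(1) cont]] g(2) by simp
 hence "(\<Union>f'\<in>hcl n X x g. hcl n Y (f x) (f o f')) = (\<Union>f'\<in>hcl n X x h. hcl n Y (f x) (f o f'))"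
  unfolding ind_htp_class[OF cont g] ind_htp_class[OF cont h] .
 ultimately have "hcl n X x g = hcl n X x h" using g h unfolding homotopy_group_def by (auto dest: inj_onD)
 thus ?thesis using htp_class_eq_iff[OF g] by blast
qed

lemma pi_surj:
 assumes n: "n >= 1" and x: "x : ts X" and h: "cmap (nsphere n) Y h" "h sphere_base = f x"
 obtains g where "cmap (nsphere n) X g" "g sphere_base = x" "bsd_htp n Y (f x) h (f o g)"
proof -
 have "(%C. \<Union>f'\<in>C. hcl n Y (f x) (f o f')) ` hgr n X x = hgr n Y (f x)" using weq n x
  by (simp add: weak_homotopy_equivalence_def bij_betw_def)
 moreover have "hcl n Y (f x) h : hgr n Y (f x)" using h by (simp add: homotopy_group_def)
 ultimately obtain C where C: "C : hgr n X x" "hcl n Y (f x) h = (\<Union>f'\<in>C. hcl n Y (f x) (f o f'))" by blast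
 then obtain g where g: "cmap (nsphere n) X g" "g sphere_base = x" "C = hcl n X x g" unfolding homotopy_group_def by blast
 have "hcl n Y (f x) h = hcl n Y (f x) (f o g)" using C(2) ind_htp_class[OF cont g(1,2)] g(3) by simp
 thus thesis using that[OF g(1,2)] htp_class_eq_iff[OF h] by blast
qed

text \<open>The injectivity half of a weak equivalence. The extension \<open>g\<close> makes
  \<open>f o ta\<close> null-homotopic, hence \<open>ta\<close> is null-homotopic, and a
  null-homotopy is an extension over the disc. For \<open>n = 0\<close> the claim is that
  \<open>X\<close> is nonempty, and for \<open>n = 1\<close> that two points are joined by a
  path.\<close>

lemma ext_over_disc:
 assumes ta: "cmap (tp (sph n)) X ta" and g: "cmap (tp (disc n)) Y g" and gta: "!!x. x : sph n ==> g x = f (ta x)"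
 obtains ta' where "cmap (tp (disc n)) X ta'" "!!x. x : sph n ==> ta' x = ta x"
proof -
 consider "n = 0" | "n = 1" | m where "n = Suc (Suc m)" by (metis One_nat_def not0_implies_Suc)
 thus thesis
 proof cases
  case 1
  have "(%i. 0) : disc n" using nrm.zero by (simp add: nrm.body_def co_sp_def)
  hence "g (%i. 0) : ts Y" using g by (auto simp: continuous_map_def)
  then obtain x where "x : ts X" using pi0_surj by blast
  moreover have "sph n = {}" using 1 by (auto simp: nrm.bdry_def nrm_def)
  ultimately show thesis using that[of "%_. x"] by auto
 next
  case 2
  let ?e = sphere_base and ?e' = "fscale (-1) sphere_base"
  have e: "?e : sph n" "?e' : sph n" using sph_base_in[of 0] 2 by (auto simp: nrm.bdry_def co_sp_def nrm_def L2_set_def)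
  have tin: "ta z : ts X" if "z : sph n" for z using ta that by (auto simp: continuous_map_def)
  have ev: "x = ?e | x = ?e'" if "x : sph n" for x
  proof -
  have "\<bar>x 0\<bar> = 1" using that 2 by (simp add: nrm.bdry_def nrm_def L2_set_def)
  hence "x 0 = 1 | x 0 = -1" by linarith
  moreover have "x i = 0" if "i ~= 0" for i using that \<open>x : sph n\<close> 2 by (auto simp: nrm.bdry_def co_sp_def)
  ultimately show ?thesis by (auto simp: sphere_base_def)
  qed
  have "pathin Y (%s. g (fscale (2 * s - 1) ?e))" unfolding pathin_def
  proof (rule cmap_comp[OF g])
  show "con {0..1} (%s. fscale (2 * s - 1) sphere_base)" by (intro continuous_intros)
  show "(%s. fscale (2 * s - 1) sphere_base) ` {0..1} <= disc n" using 2 by (auto simp: nrm.body_def co_sp_def nrm_def L2_set_def sphere_base_def)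
  qed
  hence "pco Y (f (ta ?e')) (f (ta ?e))" unfolding path_component_of_def using gta[OF e(1)] gta[OF e(2)] by auto
  from pi0_inj[OF tin[OF e(2)] tin[OF e(1)] this] obtain ga :: "real => 'a" where ga: "cmap (tp {0..1}) X ga" "ga 0 = ta ?e'" "ga 1 = ta ?e"
   unfolding path_component_of_def pathin_def by blast
  show thesis
  proof (rule that)
  show "cmap (tp (disc n)) X (%x. ga ((x 0 + 1) / 2))"
  proof (rule cmap_comp[OF ga(1)])
  show "con (disc n) (%x. (x 0 + 1) / 2)" by (intro continuous_intros cont_on_comp) auto
  show "(%x. (x 0 + 1) / 2) ` disc n <= {0..1}" using 2 by (auto simp: nrm.body_def nrm_def L2_set_def)
  qed
  show "ga ((x 0 + 1) / 2) = ta x" if "x : sph n" for x using ev[OF that] ga(2,3) by (auto simp: sphere_base_def)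
  qed
 next
  case 3
  let ?p = "sphere_base" and ?m = "Suc m"
  have p: "?p : sph n" and ns: "nsphere ?m = tp (sph n)" using sph_base_in 3 nsphere_eq by auto
  \<comment> \<open>The straight-line contraction of the sphere to \<open>?p\<close> inside the disc
    keeps \<open>?p\<close> fixed, so the null-homotopy is pointed.\<close>
  have "cmap (tp ({0..1} >< sph n)) Y (%z. g (fmix (fst z) (snd z) ?p))"
  proof (rule cmap_comp[OF g])
  show "con ({0..1} >< sph n) (%z. fmix (fst z) (snd z) ?p)" by (intro cont_on_fmix continuous_intros)
  show "(%z. fmix (fst z) (snd z) ?p) ` ({0..1} >< sph n) <= disc n" using p sph_sub_disc[of n] by (auto intro!: fmix_disc)
  qed
  hence H: "cmap (ptop (tp {0..1}) (nsphere ?m)) Y (%z. g (fmix (fst z) (snd z) ?p))" by (simp only: ns prod_topology_subtopology_eu)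
  have tap: "ta ?p : ts X" using ta p by (auto simp: continuous_map_def)
  have "bsd_htp ?m Y (f (ta ?p)) (%x. g x) (%_. f (ta ?p))" unfolding homotopic_with_def
  proof (intro exI[of _ "%z. g (fmix (fst z) (snd z) ?p)"] conjI allI ballI H)
  qed (simp_all add: gta[OF p])
  moreover have "bsd_htp ?m Y (f (ta ?p)) (f o ta) (%x. g x)"
  proof (rule homotopic_with_equal)
  show "cmap (nsphere ?m) Y (f o ta)" unfolding ns by (rule cm_comp[OF ta cont])
  show "(f o ta) x = g x" if "x : ts (nsphere ?m)" for x using that gta[of x] by (simp add: ns)
  qed (simp_all add: gta[OF p])
  ultimately have "bsd_htp ?m Y (f (ta ?p)) (f o ta) (%_. f (ta ?p))" by (rule homotopic_with_trans[rotated])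
  hence "bsd_htp ?m X (ta ?p) ta (%_. ta ?p)" using ta tap by (intro pi_inj) (simp_all add: ns)
  then obtain h where h: "cmap (tp ({0..1} >< sph n)) X h" "!!x. h (0::real, x) = ta x" "!!x. h (1, x) = ta ?p"
   unfolding homotopic_with_def ns prod_topology_subtopology_eu by blast
  \<comment> \<open>The disc as a cone over its boundary: time 1 is the tip, where the null-homotopy
    is constant, so \<open>h\<close> descends to the disc.\<close>
  let ?q = "%z. fscale (1 - fst z) (snd z) :: nat => real"
  have qo: "?q ` ({0..1} >< sph n) = disc n"
  proof
  show "?q ` ({0..1} >< sph n) <= disc n" by (auto simp: nrm.body_def nrm.bdry_def fscale_co_sp nrm_fscale)
  show "disc n <= ?q ` ({0..1} >< sph n)"
  proof
  fix y
  assume y: "y : disc n"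
  hence yc: "y : co_sp n" "nrm n y <= 1" by (auto simp: nrm.body_def)
  show "y : ?q ` ({0..1} >< sph n)"
  proof (cases "nrm n y = 0")
  case True
  thus ?thesis using nrm.eq_0 yc using p by (intro image_eqI[of _ _ "(1, ?p)"]) auto
  next
  case False
  thus ?thesis using yc by (intro image_eqI[of _ _ "(1 - nrm n y, fscale (1 / nrm n y) y)"]) (auto simp: nrm.bdry_def fscale_co_sp nrm_fscale)
  qed
  qed
  qed
  have qf: "h z = h z'" if z: "z : {0..1} >< sph n" "z' : {0..1} >< sph n" "?q z = ?q z'" for z z'
  proof -
  have "nrm n (?q z) = nrm n (?q z')" using z(3) by simp
  hence s: "fst z = fst z'" using z(1,2) by (auto simp: nrm_fscale nrm.bdry_def)
  show ?thesis
  proof (cases "fst z = 1")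
  case True
  hence "z = (1, snd z)" "z' = (1, snd z')" using s by (auto simp: prod_eq_iff)
  thus ?thesis using h(3) by metis
  next
  case False
  have "snd z = snd z'"
  proof
  fix i
  show "snd z i = snd z' i" using fun_cong[OF z(3), of i] s False by simp
  qed
  hence "z = z'" using s by (simp add: prod_eq_iff)
  thus ?thesis by simp
  qed
  qed
  have qc: "con ({0..1} >< sph n) ?q" by (intro continuous_intros)
  have cp: "compact ({0..1::real} >< sph n)" by (intro compact_Times cpt_sph) simp
  obtain ta' where t: "cmap (tp (disc n)) X ta'" "!!z. z : {0..1} >< sph n ==> ta' (?q z) = h z" using cpt_quot_lift[OF cp qc qo h(1) qf] by blast
  have "ta' x = ta x" if "x : sph n" for x using t(2)[of "(0, x)"] h(2) that by simp
  thus thesis using that[OF t(1)] by blast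
 qed
qed

text \<open>The surjectivity half of a weak equivalence, translated from spheres to discs by
  \<open>disc_to_sph\<close>; the homotopy is constant on the boundary because it is
  pointed.\<close>

lemma lift_sph:
 assumes n: "n >= 1" and x0: "x0 : ts X" and g: "cmap (tp (disc n)) Y g" and gb: "!!x. x : sph n ==> g x = f x0"
 obtains al H where "cmap (tp (disc n)) X al" "!!x. x : sph n ==> al x = x0" "cmap (tp (disc n >< {0..1::real})) Y H" "!!x. x : disc n ==> H (x, 0) = g x" "!!x. x : disc n ==> H (x, 1) = f (al x)" "!!x t. x : sph n ==> t : {0..1} ==> H (x, t) = f x0"
proof -
 let ?q = "disc_to_sph n"
 have p: "sphere_base : sph n" using sph_base_in n by (cases n) auto
 have qb: "?q x = sphere_base" if "x : sph n" for x using that disc_to_sph_bd sph_sub_disc by blast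
 have "g x = g y" if xy: "x : disc n" "y : disc n" "?q x = ?q y" for x y using disc_to_sph_inj[OF xy] gb by auto
 then obtain k where k: "cmap (tp (sph (Suc n))) Y k" "!!x. x : disc n ==> k (?q x) = g x"
  using cpt_quot_lift[OF cpt_disc cont_on_disc_to_sph disc_to_sph_onto[OF n] g] by metis
 have ns: "nsphere n = tp (sph (Suc n))" by (rule nsphere_eq)
 have "k sphere_base = f x0" using k(2)[of sphere_base] p sph_sub_disc[of n] qb[OF p] gb[OF p] by auto
 then obtain a where a: "cmap (nsphere n) X a" "a sphere_base = x0" "bsd_htp n Y (f x0) k (f o a)" using pi_surj[OF n x0, of k] k(1) ns by metis
 obtain h where h: "cmap (tp ({0..1} >< sph (Suc n))) Y h" "!!x. h (0::real, x) = k x" "!!x. h (1, x) = f (a x)" "!!t. t : {0..1} ==> h (t, sphere_base) = f x0"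
  using a(3) unfolding homotopic_with_def ns by auto
 show thesis
 proof (rule that[of "%x. a (?q x)" "%z. h (snd z, ?q (fst z))"])
  show "cmap (tp (disc n)) X (%x. a (?q x))" using disc_to_sph_in by (intro cmap_comp[OF a(1)[unfolded ns]] cont_on_disc_to_sph) auto
  show "cmap (tp (disc n >< {0..1})) Y (%z. h (snd z, ?q (fst z)))"
  proof (rule cmap_comp[OF h(1)])
  show "con (disc n >< {0..1}) (%z. (snd z, ?q (fst z)))" by (intro con_Pair cont_on_o_fst[OF cont_on_disc_to_sph order_refl] con_snd con_id)
  qed (use disc_to_sph_in in auto)
 qed (use qb a(2) h(2-4) k(2) in auto)
qed

text \<open>The boundary values are first made liftable with \<open>C1\<close>, and then moved to a
  constant so that \<open>lift_sph\<close> applies; the resulting lift is dragged back to the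
  prescribed boundary values. Box filling combines these deformations into one homotopy with exactly
  the prescribed wall \<open>h\<close>.\<close>

lemma rel_lift_disc:
 assumes sg: "cmap (tp (disc n)) Y sg" and ta: "cmap (tp (sph n)) X ta" and h: "cmap (tp (sph n >< {0..1::real})) Y h" and h0: "!!x. x : sph n ==> h (x, 0) = sg x" and h1: "!!x. x : sph n ==> h (x, 1) = f (ta x)"
 obtains ta' H where "cmap (tp (disc n)) X ta'" "!!x. x : sph n ==> ta' x = ta x" "cmap (tp (disc n >< {0..1::real})) Y H" "!!x. x : disc n ==> H (x, 0) = sg x" "!!x. x : disc n ==> H (x, 1) = f (ta' x)" "!!x t. x : sph n ==> t : {0..1} ==> H (x, t) = h (x, t)"
proof (cases "n = 0")
 case True
 let ?z = "%i. 0 :: real"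
 have e: "sph n = {}" and d: "disc n = {?z}" using True by (auto simp: nrm.bdry_def nrm_def nrm.body_def co_sp_def)
 have "sg ?z : ts Y" using sg d by (auto simp: continuous_map_def)
 then obtain x where x: "x : ts X" "pco Y (sg ?z) (f x)" using pi0_surj by blast
 then obtain p :: "real => 'b" where p: "cmap (tp {0..1}) Y p" "p 0 = sg ?z" "p 1 = f x" unfolding path_component_of_def pathin_def by blast
 show thesis
 proof (rule that[of "%_. x" "%z. p (snd z)"])
  show "cmap (tp (disc n >< {0..1})) Y (%z. p (snd z))" by (rule cmap_comp[OF p(1)]) (auto intro!: continuous_intros)
 qed (use x p e d in auto)
next
 case False
 hence n: "n >= 1" by simp
 let ?I = "{0..1::real}" and ?p = sphere_base
 have dp: "disc_pair n (disc n) (sph n)" by (rule disc_pair_disc)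
 have hp: "hep (disc n) (sph n)" by (rule disc_pair_hep[OF dp])
 have p: "?p : sph n" using sph_base_in n by (cases n) auto
 have flip: "con Q (%z. (fst z, 1 - snd z))" for Q :: "(ptx >< real) set" by (intro continuous_intros)
 have bot: "con Q (%x. (x, c))" for Q :: "ptx set" and c :: real by (intro continuous_intros)
 obtain C1 where C1: "cmap (tp (disc n >< ?I)) Y C1" "!!x. x : disc n ==> C1 (x, 0) = sg x" "!!x t. x : sph n ==> t : ?I ==> C1 (x, t) = h (x, t)"
  using hep_ext[OF hp sg h h0] by blast
 have g1: "cmap (tp (disc n)) Y (%x. C1 (x, 1))" by (rule cmap_comp[OF C1(1) bot]) auto
 have g1b: "C1 (x, 1) = f (ta x)" if "x : sph n" for x using C1(3)[of x 1] h1 that by simp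
 \<comment> \<open>\<open>f o ta0\<close> may differ from the end of \<open>C1\<close> by an element
   of the n-th homotopy group of \<open>Y\<close>. So \<open>ta0\<close> is not yet the answer; it
   only serves to contract the boundary values in \<open>X\<close>.\<close>
 obtain ta0 where ta0: "cmap (tp (disc n)) X ta0" "!!x. x : sph n ==> ta0 x = ta x" using ext_over_disc[OF ta g1 g1b] by blast
 define x0 where "x0 = ta ?p"
 have x0: "x0 : ts X" using ta p by (auto simp: continuous_map_def x0_def)
 \<comment> \<open>A homotopy from \<open>ta\<close> to the constant \<open>x0\<close>, obtained by
   sliding the sphere through the disc to its base point.\<close>
 define ga where "ga = (%z. ta0 (fmix (snd z) (fst z) ?p))"
 have ga: "cmap (tp (sph n >< ?I)) X ga" unfolding ga_def
 proof (rule cmap_comp[OF ta0(1)])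
  show "con (sph n >< ?I) (%z. fmix (snd z) (fst z) ?p)" by (intro cont_on_fmix continuous_intros)
  show "(%z. fmix (snd z) (fst z) ?p) ` (sph n >< ?I) <= disc n" using p sph_sub_disc[of n] by (auto intro!: fmix_disc)
 qed
 have ga0: "ga (x, 0) = ta x" and ga1: "ga (x, 1) = x0" if "x : sph n" for x using ta0(2) that p by (simp_all add: ga_def x0_def)
 have fga: "cmap (tp (sph n >< ?I)) Y (%z. f (ga z))" by (rule cmap_after[OF ga cont])
 have "f (ga (x, 0)) = C1 (x, 1)" if "x : sph n" for x using ga0 g1b that by simp
 from hep_ext[OF hp g1 fga this] obtain C2 where C2: "cmap (tp (disc n >< ?I)) Y C2" "!!x. x : disc n ==> C2 (x, 0) = C1 (x, 1)" "!!x t. x : sph n ==> t : ?I ==> C2 (x, t) = f (ga (x, t))"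
  by blast
 have g2: "cmap (tp (disc n)) Y (%x. C2 (x, 1))" by (rule cmap_comp[OF C2(1) bot]) auto
 have "C2 (x, 1) = f x0" if "x : sph n" for x using C2(3)[of x 1] ga1 that by simp
 from lift_sph[OF n x0 g2 this] obtain al F where al: "cmap (tp (disc n)) X al" "!!x. x : sph n ==> al x = x0" and F: "cmap (tp (disc n >< ?I)) Y F" "!!x. x : disc n ==> F (x, 0) = C2 (x, 1)" "!!x. x : disc n ==> F (x, 1) = f (al x)" "!!x t. x : sph n ==> t : {0..1} ==> F (x, t) = f x0"
  by blast
 have gar: "cmap (tp (sph n >< ?I)) X (%z. ga (fst z, 1 - snd z))" by (rule cmap_comp[OF ga flip]) auto
 have "ga (fst (x, 0::real), 1 - snd (x, 0::real)) = al x" if "x : sph n" for x using ga1 al(2) that by simp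
 \<comment> \<open>Extending the reversed contraction from the boundary turns \<open>al\<close> into
   a map with boundary values \<open>ta\<close> again.\<close>
 from hep_ext[OF hp al(1) gar this] obtain E where E: "cmap (tp (disc n >< ?I)) X E" "!!x. x : disc n ==> E (x, 0) = al x" "!!x t. x : sph n ==> t : ?I ==> E (x, t) = ga (x, 1 - t)"
  by auto
 define ta' where "ta' x = E (x, 1)" for x
 have ta': "cmap (tp (disc n)) X ta'" unfolding ta'_def by (rule cmap_comp[OF E(1) bot]) auto
 have ta'b: "ta' x = ta x" if "x : sph n" for x using E(3)[of x 1] that ga0 by (simp add: ta'_def)
 have fta': "cmap (tp (disc n)) Y (%x. f (ta' x))" by (rule cmap_after[OF ta' cont])
 \<comment> \<open>Cancels the detour through \<open>x0\<close>. The box has bottom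
   \<open>F\<close>, end walls given by the reversed \<open>C2\<close> and by \<open>f o E\<close>,
   and the reversed contraction over the sphere; its top joins the end of \<open>C1\<close> to
   \<open>f o ta'\<close> and is constant in time on the sphere.\<close>
 obtain G1 where G1: "cmap (tp (disc n >< ?I)) Y G1" "!!x. x : disc n ==> G1 (x, 0) = C1 (x, 1)" "!!x. x : disc n ==> G1 (x, 1) = f (ta' x)" "!!x t. x : sph n ==> t : ?I ==> G1 (x, t) = f (ta x)"
 proof (rule box_fill[OF dp F(1), where a = "%z. C2 (fst z, 1 - snd z)" and b = "%z. f (E z)" and c = "%z. f (ga (fst (fst z), 1 - snd z))"])
  show "cmap (tp (disc n >< ?I)) Y (%z. C2 (fst z, 1 - snd z))" by (rule cmap_comp[OF C2(1) flip]) auto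
  show "cmap (tp (disc n >< ?I)) Y (%z. f (E z))" by (rule cmap_after[OF E(1) cont])
  show "cmap (tp ((sph n >< ?I) >< ?I)) Y (%z. f (ga (fst (fst z), 1 - snd z)))"
  proof (rule cmap_comp[OF fga])
  show "con ((sph n >< ?I) >< ?I) (%z. (fst (fst z), 1 - snd z))" by (intro continuous_intros)
  qed auto
 next
  fix G :: "ptx >< real => 'b"
  assume "cmap (tp (disc n >< ?I)) Y G" "!!x. x : disc n ==> G (x, 0) = C2 (fst (x, 1::real), 1 - snd (x, 1::real))" "!!x. x : disc n ==> G (x, 1) = f (E (x, 1))" "!!x t. x : sph n ==> t : ?I ==> G (x, t) = f (ga (fst (fst ((x, t), 1::real)), 1 - snd ((x, t), 1::real)))"
  thus thesis using that[of G] C2(2) ga0 by (simp add: ta'_def)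
 qed (use F C2 E ga1 sph_sub_disc[of n] in auto)
 show thesis
 \<comment> \<open>Undoes \<open>C1\<close> in the same manner. The wall
   \<open>h (x, 1 - s + s * t)\<close> is constant in \<open>t\<close> for \<open>s = 0\<close>,
   where it meets \<open>G1\<close>, and equals \<open>h\<close> for \<open>s = 1\<close>.\<close>
 proof (rule box_fill[OF dp G1(1), where a = "%z. C1 (fst z, 1 - snd z)" and b = "%z. f (ta' (fst z))" and c = "%z. h (fst (fst z), 1 - snd z + snd z * snd (fst z))"])
  show "cmap (tp (disc n >< ?I)) Y (%z. C1 (fst z, 1 - snd z))" by (rule cmap_comp[OF C1(1) flip]) auto
  show "cmap (tp (disc n >< ?I)) Y (%z. f (ta' (fst z)))"
  proof (rule cmap_comp[OF fta'])
  show "con (disc n >< ?I) fst" by (intro continuous_intros)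
  qed auto
  show "cmap (tp ((sph n >< ?I) >< ?I)) Y (%z. h (fst (fst z), 1 - snd z + snd z * snd (fst z)))"
  proof (rule cmap_comp[OF h])
  show "(%z. (fst (fst z), 1 - snd z + snd z * snd (fst z))) ` ((sph n >< ?I) >< ?I) <= sph n >< ?I" by (auto simp: mult_left_le)
  qed (intro continuous_intros)
 next
  fix G :: "ptx >< real => 'b"
  assume "cmap (tp (disc n >< ?I)) Y G" "!!x. x : disc n ==> G (x, 0) = C1 (fst (x, 1::real), 1 - snd (x, 1::real))" "!!x. x : disc n ==> G (x, 1) = f (ta' (fst (x, 1::real)))" "!!x t. x : sph n ==> t : ?I ==> G (x, t) = h (fst (fst ((x, t), 1::real)), 1 - snd ((x, t), 1::real) + snd ((x, t), 1::real) * snd (fst ((x, t), 1::real)))"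
  thus thesis using that[OF ta' ta'b, of G] C1(2) by simp
 qed (use G1 C1(3) h1 ta'b sph_sub_disc[of n] in auto)
qed

lemma rel_lift:
 fixes S :: "'p::topological_space set"
 assumes dp: "disc_pair n S A" and sg: "cmap (tp S) Y sg" and ta: "cmap (tp A) X ta" and h: "cmap (tp (A >< {0..1::real})) Y h" and h0: "!!x. x : A ==> h (x, 0) = sg x" and h1: "!!x. x : A ==> h (x, 1) = f (ta x)"
 obtains ta' H where "cmap (tp S) X ta'" "!!x. x : A ==> ta' x = ta x" "cmap (tp (S >< {0..1::real})) Y H" "!!x. x : S ==> H (x, 0) = sg x" "!!x. x : S ==> H (x, 1) = f (ta' x)" "!!x t. x : A ==> t : {0..1} ==> H (x, t) = h (x, t)"
proof -
 let ?I = "{0..1::real}"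
 obtain u v where uv: "homeomorphism S (disc n) u v" "A = {x : S. u x : sph n}" using dp unfolding disc_pair_def by blast
 have u: "con S u" "con (disc n) v" "!!x. x : S ==> v (u x) = x" "!!y. y : disc n ==> u (v y) = y" "u ` S = disc n" "v ` disc n = S"
  using uv(1) unfolding homeomorphism_def by auto
 have vs: "v ` sph n <= A" using sph_sub_disc u(4,6) uv(2) by force
 have cs: "con (sph n) v" by (rule con_sub[OF u(2) sph_sub_disc])
 have c1: "cmap (tp (disc n)) Y (%x. sg (v x))" by (rule cmap_comp[OF sg u(2)]) (use u(6) in auto)
 have c2: "cmap (tp (sph n)) X (%x. ta (v x))" by (rule cmap_comp[OF ta cs vs])
 have c3: "cmap (tp (sph n >< ?I)) Y (%z. h (v (fst z), snd z))"
 proof (rule cmap_comp[OF h])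
  show "con (sph n >< ?I) (%z. (v (fst z), snd z))" by (intro con_Pair cont_on_o_fst[OF cs order_refl] con_snd con_id)
 qed (use vs in auto)
 obtain ta' H where t: "cmap (tp (disc n)) X ta'" "!!x. x : sph n ==> ta' x = ta (v x)" and H: "cmap (tp (disc n >< ?I)) Y H" "!!x. x : disc n ==> H (x, 0) = sg (v x)" "!!x. x : disc n ==> H (x, 1) = f (ta' x)" "!!x t. x : sph n ==> t : ?I ==> H (x, t) = h (v x, t)"
  using rel_lift_disc[OF c1 c2 c3] h0 h1 vs by (smt (verit, best) fst_conv image_subset_iff snd_conv)
 show thesis
 proof (rule that[of "%x. ta' (u x)" "%z. H (u (fst z), snd z)"])
  show "cmap (tp S) X (%x. ta' (u x))" by (rule cmap_comp[OF t(1) u(1)]) (use u(5) in auto)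
  show "cmap (tp (S >< ?I)) Y (%z. H (u (fst z), snd z))"
  proof (rule cmap_comp[OF H(1)])
  show "con (S >< ?I) (%z. (u (fst z), snd z))" by (intro con_Pair cont_on_o_fst[OF u(1) order_refl] con_snd con_id)
  qed (use u(5) in auto)
  have iu: "u x : disc n" if "x : S" for x using u(5) that by blast
  show "ta' (u x) = ta x" if "x : A" for x using that uv(2) t(2) u(3) by auto
  show "H (u (fst (x, 0::real)), snd (x, 0::real)) = sg x" if "x : S" for x using iu[OF that] H(2) u(3)[OF that] by simp
  show "H (u (fst (x, 1::real)), snd (x, 1::real)) = f (ta' (u x))" if "x : S" for x using iu[OF that] H(3) by simp
  show "H (u (fst (x, t)), snd (x, t)) = h (x, t)" if "x : A" "t : ?I" for x t using that uv(2) H(4) u(3) by auto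
 qed
qed

end

section \<open>Families of maps compatible with faces\<close>

abbreviation spx_bd :: "nat => ptx set" where "spx_bd n \<equiv> {x : std n. EX k<=n. x k = 0}"
definition drop_co :: "nat => ptx => nat => real" where "drop_co k x = (%i. if i < k then x i else x (Suc i))"

lemma drop_co_face [simp]: "drop_co k (sface k y) = y" by (auto simp: drop_co_def simplical_face_def)

lemma face_drop_co: "x k = 0 ==> sface k (drop_co k x) = x" by (rule ext) (auto simp: drop_co_def simplical_face_def)

lemma spl_face_apply [simp]: "sface k y k = 0" by (simp add: simplical_face_def)

lemma sum_spl_face:
 fixes y :: "nat => real"
 shows "k <= Suc n ==> (\<Sum>i\<le>Suc n. sface k y i) = (\<Sum>i\<le>n. y i)"
proof (induction n)
 case 0
 thus ?case by (auto simp: simplical_face_def)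
next
 case (Suc n)
 show ?case
 proof (cases "k = Suc (Suc n)")
  case True
  hence "(\<Sum>i\<le>Suc n. sface k y i) = (\<Sum>i\<le>Suc n. y i)" by (intro sum.cong) (auto simp: simplical_face_def)
  thus ?thesis using True by simp
 next
  case False
  hence "(\<Sum>i\<le>Suc n. sface k y i) = (\<Sum>i\<le>n. y i)" using Suc by simp
  moreover have "sface k y (Suc (Suc n)) = y (Suc n)" using False Suc.prems by (simp add: simplical_face_def)
  ultimately show ?thesis by simp
 qed
qed

lemma face_in_spx: "k <= Suc n ==> y : std n ==> sface k y : std (Suc n)" using simplical_face_in_standard_simplex[of "Suc n" k y] by simp

lemma face_in_bd: "k <= Suc n ==> y : std n ==> sface k y : spx_bd (Suc n)" using face_in_spx spl_face_apply by blast

lemma drop_co_in_spx: assumes "x : std (Suc n)" "k <= Suc n" "x k = 0" shows "drop_co k x : std n"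
proof -
 have "(\<Sum>i\<le>n. drop_co k x i) = (\<Sum>i\<le>Suc n. sface k (drop_co k x) i)" using sum_spl_face[OF assms(2)] by metis
 also have "... = 1" using assms face_drop_co[of x k, OF assms(3)] by (simp add: standard_simplex_def)
 finally show ?thesis using assms by (auto simp: standard_simplex_def drop_co_def)
qed

lemma cont_on_spl_face: "con S f ==> con S (%z. sface k (f z :: nat => real))"
proof (rule con_coordwise)
 show "con S (%z. sface k (f z) i)" if "con S f" for i using cont_on_co[OF that] unfolding simplical_face_def by (cases "i < k"; cases "i = k") simp_all
qed

lemma cont_on_drop_co: "con S f ==> con S (%z. drop_co k (f z))"
proof (rule con_coordwise)
 show "con S (%z. drop_co k (f z) i)" if "con S f" for i using cont_on_co[OF that] unfolding drop_co_def by (cases "i < k") simp_all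
qed

text \<open>The boundary is a finite union of closed facets, on each of which
  \<open>drop_co k\<close> inverts the face map. The factor \<open>T\<close> carries the time
  parameters of homotopies.\<close>

lemma paste_spx_bd:
 fixes F :: "ptx >< 's::topological_space => 'a"
 assumes "!!k. k <= Suc n ==> cmap (tp (std n >< T)) X (%z. F (sface k (fst z), snd z))"
 shows "cmap (tp (spx_bd (Suc n) >< T)) X F"
proof (rule pasting_lemma_closed[where I = "{..Suc n}" and T = "%k. {x : std (Suc n). x k = 0} >< T" and f = "%_. F"])
 let ?D = "std (Suc n)"
 fix k
 assume "k : {..Suc n}"
 hence k: "k <= Suc n" by simp
 have "closedin (tp (spx_bd (Suc n))) {x : spx_bd (Suc n). x k = 0}"
  using continuous_closedin_preimage[OF cont_on_comp[where S = "spx_bd (Suc n)" and i = k], of "{0}"] by (simp add: Int_def)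
 also have "{x : spx_bd (Suc n). x k = 0} = {x : ?D. x k = 0}" using k by blast
 finally show "closedin (tp (spx_bd (Suc n) >< T)) ({x : ?D. x k = 0} >< T)" by (rule closedin_Times_l)
 have sub: "{x : ?D. x k = 0} >< T <= spx_bd (Suc n) >< T" using k by blast
 have "cmap (tp ({x : ?D. x k = 0} >< T)) X (%w. (%z. F (sface k (fst z), snd z)) (drop_co k (fst w), snd w))"
 proof (rule cmap_comp[OF assms[OF k]])
  show "con ({x : ?D. x k = 0} >< T) (%w. (drop_co k (fst w), snd w))" by (intro con_Pair cont_on_drop_co con_fst con_snd con_id)
  show "(%w. (drop_co k (fst w), snd w)) ` ({x : ?D. x k = 0} >< T) <= std n >< T" using drop_co_in_spx k by auto
 qed
 hence "cmap (tp ({x : ?D. x k = 0} >< T)) X F" by (rule cm_eq) (auto simp: face_drop_co)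
 thus "cmap (subtopology (tp (spx_bd (Suc n) >< T)) ({x : ?D. x k = 0} >< T)) X F" using sub by (simp add: subtopology_subtopology Int_absorb1)
next
 fix x
 assume "x : ts (tp (spx_bd (Suc n) >< T))"
 thus "EX j. j : {..Suc n} & x : {x : std (Suc n). x j = 0} >< T & F x = F x" by auto
qed auto

lemma paste_spx_bdry':
 assumes "!!k. k <= Suc n ==> cmap (tp (std n)) X (%z. F (sface k z))"
 shows "cmap (tp (spx_bd (Suc n))) X F"
proof -
 have "cmap (tp (spx_bd (Suc n) >< {0::real})) X (%z. F (fst z))"
 proof (rule paste_spx_bd)
  show "cmap (tp (std n >< {0::real})) X (%z. F (fst (sface k (fst z), snd z)))" if "k <= Suc n" for k unfolding fst_conv
   by (rule cmap_comp[OF assms[OF that]]) (auto intro: con_fst)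
 qed
 hence "cmap (tp (spx_bd (Suc n))) X (%x. F (fst (x, 0::real)))" by (rule cmap_comp) (auto intro!: con_Pair)
 thus ?thesis by simp
qed

lemma sing_face_face:
 assumes "i <= j" "j <= Suc n"
 shows "fce (Suc n) i (fce (Suc (Suc n)) (Suc j) s) = fce (Suc n) j (fce (Suc (Suc n)) i s)"
proof
 fix t
 show "fce (Suc n) i (fce (Suc (Suc n)) (Suc j) s) t = fce (Suc n) j (fce (Suc (Suc n)) i s) t"
 proof (cases "t : std n")
  case True
  have "sface (Suc j) (sface i t) = sface i (sface j t)" using assms(1) by (fastforce simp: simplical_face_def)
  thus ?thesis using face_in_spx[of i n t] face_in_spx[of j n t] assms by (simp add: singular_face_def)
 qed (simp add: singular_face_def)
qed

lemma sing_spx_face: "sing (Suc n) X s ==> k <= Suc n ==> sing n X (fce (Suc n) k s)" using singular_simplex_singular_face[of "Suc n" X s k] by simp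

lemma face_apply: "y : std n ==> fce (Suc n) k s y = s (sface k y)" by (simp add: singular_face_def)

text \<open>Data attached to the singular simplices of \<open>Z\<close>, with the values \<open>ev d x\<close> at the points \<open>x\<close> of
  the standard simplex, can be chosen compatibly with faces if data compatibly chosen on the boundary extend.\<close>

lemma semisimplicial_fam:
 fixes good :: "nat => (ptx => 's) => 'd => bool" and ev :: "'d => ptx => 'v"
 assumes zero: "!!s. sing 0 Z s ==> EX d. good 0 s d" and step: "!!n s e b. sing (Suc n) Z s ==> (!!k. k <= Suc n ==> good n (fce (Suc n) k s) (e k)) ==> (!!k y. k <= Suc n ==> y : std n ==> b (sface k y) = ev (e k) y) ==> EX d. good (Suc n) s d & (ALL x:spx_bd (Suc n). ev d x = b x)"
 obtains D where "!!n s. sing n Z s ==> good n s (D n s)" "!!n s k y. sing (Suc n) Z s ==> k <= Suc n ==> y : std n ==> ev (D (Suc n) s) (sface k y) = ev (D n (fce (Suc n) k s)) y"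
proof -
 let ?F = "%n. fce (Suc n)"
 define compat where "compat n s D' d <-> (ALL k<=Suc n. ALL y:std n. ev d (sface k y) = ev (D' (?F n k s)) y)" for n and s :: "ptx => 's" and D' d
 define D where "D = rec_nat (%s. SOME d. good 0 s d) (%n D' s. SOME d. good (Suc n) s d & compat n s D' d)"
 have D0: "D 0 s = (SOME d. good 0 s d)" and DS: "D (Suc n) s = (SOME d. good (Suc n) s d & compat n s (D n) d)" for n s by (simp_all add: D_def)
 have ext: "EX d. good (Suc n) s d & compat n s (D n) d" if s: "sing (Suc n) Z s" and g: "!!s. sing n Z s ==> good n s (D n s)" and c: "!!m s. n = Suc m ==> sing n Z s ==> compat m s (D m) (D n s)" for n s
 proof -
  \<comment> \<open>Two facets through \<open>x\<close> meet in a face of codimension two, where the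
    inductive compatibility and \<open>sing_face_face\<close> apply. For \<open>n = 0\<close> the
    facets are the two ends of an edge and do not meet.\<close>
  have agree: "ev (D n (?F n j s)) (drop_co j x) = ev (D n (?F n i s)) (drop_co i x)" if x: "x : std (Suc n)" "x i = 0" "x j = 0" "i < j" "j <= Suc n" for i j x
  proof (cases n)
  case 0
  hence ij: "i = 0" "j = 1" using x(4,5) by auto
  have "(\<Sum>i\<le>1. x i) = 1" using x(1) 0 by (simp add: standard_simplex_def)
  hence False using x(2,3) unfolding ij by simp
  thus ?thesis ..
  next
  case (Suc m)
  obtain j' where j': "j = Suc j'" using x(4) by (cases j) auto
  define w where "w = drop_co i (drop_co j x)"
  have xj: "drop_co j x : std n" "drop_co j x i = 0" using drop_co_in_spx[OF x(1,5,3)] x(2,4) by (auto simp: drop_co_def)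
  have w: "w : std m" using drop_co_in_spx[of _ m i] xj x Suc by (simp add: w_def)
  have "drop_co j x = sface i w" using face_drop_co[of "drop_co j x" i] xj(2) by (simp add: w_def)
  moreover have "drop_co i x = sface j' w" unfolding w_def drop_co_def simplical_face_def using x(2,3,4) j' by force
  moreover have "ev (D n (?F n j s)) (sface i w) = ev (D m (?F m i (?F n j s))) w" using c[OF Suc sing_spx_face[OF s x(5)]] w x Suc
   by (simp add: compat_def)
  moreover have "ev (D n (?F n i s)) (sface j' w) = ev (D m (?F m j' (?F n i s))) w" using c[OF Suc sing_spx_face[OF s, of i]] w x Suc j'
   by (simp add: compat_def)
  moreover have "?F m i (?F n j s) = ?F m j' (?F n i s)" using sing_face_face[of i j' m s] x j' Suc by simp
  ultimately show ?thesis by simp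
  qed
  \<comment> \<open>Some facet through \<open>x\<close> is picked to define the boundary value; by
    \<open>agree\<close> the pick has no influence.\<close>
  define ch where "ch x = (SOME k. k <= Suc n & x k = (0::real))" for x
  define b where "b x = ev (D n (?F n (ch x) s)) (drop_co (ch x) x)" for x
  have bk: "b (sface k y) = ev (D n (?F n k s)) y" if k: "k <= Suc n" and y: "y : std n" for k y
  proof -
  let ?x = "sface k y"
  have ch: "ch ?x <= Suc n & ?x (ch ?x) = 0" unfolding ch_def by (rule someI[of _ k]) (use k in simp)
  have x: "?x : std (Suc n)" by (rule face_in_spx[OF k y])
  have "b ?x = ev (D n (?F n k s)) (drop_co k ?x)"
  proof (cases "ch ?x" k rule: linorder_cases)
  case less
  thus ?thesis using agree[OF x _ _ less] ch k by (simp add: b_def)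
  next
  case equal
  thus ?thesis by (simp add: b_def)
  next
  case greater
  thus ?thesis using agree[OF x _ _ greater] ch by (simp add: b_def)
  qed
  thus ?thesis by simp
  qed
  have gk: "good n (?F n k s) (D n (?F n k s))" if "k <= Suc n" for k by (rule g[OF sing_spx_face[OF s that]])
  obtain d where d: "good (Suc n) s d" "ALL x:spx_bd (Suc n). ev d x = b x" using step[OF s gk bk] by blast
  have "compat n s (D n) d" unfolding compat_def
  proof (intro allI impI ballI)
  fix k y
  assume ky: "k <= Suc n" "y : std n"
  show "ev d (sface k y) = ev (D n (?F n k s)) y" unfolding bk[OF ky, symmetric] by (rule d(2)[rule_format, OF face_in_bd[OF ky]])
  qed
  thus ?thesis using d(1) by blast
 qed
 have P: "(ALL s. sing n Z s --> good n s (D n s)) & (ALL m s. n = Suc m --> sing n Z s --> compat m s (D m) (D n s))" for n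
 proof (induction n)
  case 0
  show ?case using someI_ex[OF zero] by (auto simp: D0)
 next
  case (Suc n)
  have "good (Suc n) s (D (Suc n) s) & compat n s (D n) (D (Suc n) s)" if "sing (Suc n) Z s" for s unfolding DS[of n s]
  proof (rule someI_ex)
  show "EX d. good (Suc n) s d & compat n s (D n) d" by (rule ext[OF that]) (use Suc in auto)
  qed
  thus ?case by auto
 qed
 show thesis by (rule that[of D]) (use P in \<open>auto simp: compat_def\<close>)
qed

lemma sing_spx_cmap: "sing n X s <-> cmap (tp (std n)) X s & s : extensional (std n)" by (simp add: singular_simplex_def euc_prod)

lemma res_eqD: "restrict f A = restrict g A ==> x : A ==> f x = g x" by (metis restrict_apply')

lemma face_spx_map: "k <= Suc n ==> fce (Suc n) k (simplex_map (Suc n) f s) = simplex_map n f (fce (Suc n) k s)"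
 by (rule ext) (auto simp: singular_face_def simplex_map_def face_in_spx)

lemma cmap_empty: "cmap (tp {}) X f" by simp

lemma spx_bd_0: "spx_bd 0 = {}" by (auto simp: standard_simplex_def)

lemma spx_bd_face:
 assumes "x : spx_bd (Suc n)"
 shows "EX k y. k <= Suc n & y : std n & x = sface k y"
proof -
 obtain k where k: "x : std (Suc n)" "k <= Suc n" "x k = 0" using assms by blast
 show ?thesis by (intro exI[of _ k] exI[of _ "drop_co k x"] conjI k(2) drop_co_in_spx[OF k] face_drop_co[of x k, OF k(3), symmetric])
qed

section \<open>A face-compatible homotopy inverse on singular simplices\<close>

context weak_eq begin

text \<open>\<open>rel_lift\<close> for the simplex and its boundary, made coherent by
  \<open>semisimplicial_fam\<close>. The outcome is a map \<open>r\<close> of singular simplices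
  from \<open>Y\<close> to \<open>X\<close>, with homotopies \<open>h\<close> from each simplex to
  its image under the composite of \<open>f\<close> and \<open>r\<close>.\<close>

lemma lift_simplices:
 obtains r h where "!!n sg. sing n Y sg ==> sing n X (r n sg)" "!!n sg k. sing (Suc n) Y sg ==> k <= Suc n ==> fce (Suc n) k (r (Suc n) sg) = r n (fce (Suc n) k sg)" "!!n sg. sing n Y sg ==> cmap (tp (std n >< {0..1::real})) Y (h n sg)" "!!n sg x. sing n Y sg ==> x : std n ==> h n sg (x, 0) = sg x" "!!n sg x. sing n Y sg ==> x : std n ==> h n sg (x, 1) = f (r n sg x)" "!!n sg k y t. sing (Suc n) Y sg ==> k <= Suc n ==> y : std n ==> t : {0..1} ==> h (Suc n) sg (sface k y, t) = h n (fce (Suc n) k sg) (y, t)"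
proof -
 let ?I = "{0..1::real}"
 define good where "good n sg d <-> sing n X (fst d) & cmap (tp (std n >< ?I)) Y (snd d) & (ALL x:std n. snd d (x, 0) = sg x & snd d (x, 1) = f (fst d x))" for n sg and d :: "(ptx => 'a) >< (ptx >< real => 'b)"
 \<comment> \<open>Restricting the time variable to the unit interval makes agreement of homotopies
   there an equality of functions.\<close>
 define ev where "ev d x = (fst d x, \<lambda>t\<in>?I. snd d (x, t))" for d :: "(ptx => 'a) >< (ptx >< real => 'b)" and x
 have make: "EX d. good n sg d & (ALL x:spx_bd n. fst d x = ta x & (ALL t:?I. snd d (x, t) = h (x, t)))" if sg: "sing n Y sg" and ta: "cmap (tp (spx_bd n)) X ta" and h: "cmap (tp (spx_bd n >< ?I)) Y h" and h0: "!!x. x : spx_bd n ==> h (x, 0) = sg x" and h1: "!!x. x : spx_bd n ==> h (x, 1) = f (ta x)" for n sg ta h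
 proof -
  have csg: "cmap (tp (std n)) Y sg" using sg by (simp add: sing_spx_cmap)
  obtain ta' H where tH: "cmap (tp (std n)) X ta'" "!!x. x : spx_bd n ==> ta' x = ta x" "cmap (tp (std n >< ?I)) Y H" "!!x. x : std n ==> H (x, 0) = sg x" "!!x. x : std n ==> H (x, 1) = f (ta' x)" "!!x t. x : spx_bd n ==> t : ?I ==> H (x, t) = h (x, t)"
   using rel_lift[OF disc_pair_spx csg ta h h0 h1] by blast
  show ?thesis using tH by (intro exI[of _ "(restrict ta' (std n), H)"]) (auto simp: good_def sing_spx_cmap)
 qed
 obtain D where D: "!!n s. sing n Y s ==> good n s (D n s)" "!!n s k y. sing (Suc n) Y s ==> k <= Suc n ==> y : std n ==> ev (D (Suc n) s) (sface k y) = ev (D n (fce (Suc n) k s)) y"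
 proof (rule semisimplicial_fam[where Z = Y and good = good and ev = ev])
  fix s
  assume s: "sing 0 Y s"
  have "EX d. good 0 s d & (ALL x:spx_bd 0. fst d x = undefined x & (ALL t:?I. snd d (x, t) = undefined (x, t)))"
   by (rule make[OF s]) (simp_all only: spx_bd_0 empty_iff Sigma_empty1 cmap_empty)
  thus "EX d. good 0 s d" by blast
 next
  fix n s e b
  assume s: "sing (Suc n) Y s" and e: "!!k. k <= Suc n ==> good n (fce (Suc n) k s) (e k)" and b: "!!k y. k <= Suc n ==> y : std n ==> b (sface k y) = ev (e k) y"
  let ?ta = "%x. fst (b x)" and ?h = "%z. snd (b (fst z)) (snd z)"
  have "EX d. good (Suc n) s d & (ALL x:spx_bd (Suc n). fst d x = ?ta x & (ALL t:?I. snd d (x, t) = ?h (x, t)))"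
  proof (rule make[OF s])
  show "cmap (tp (spx_bd (Suc n))) X ?ta"
  proof (rule paste_spx_bdry')
  fix k
  assume k: "k <= Suc n"
  have "cmap (tp (std n)) X (fst (e k))" using e[OF k] by (simp add: good_def sing_spx_cmap)
  thus "cmap (tp (std n)) X (%z. fst (b (sface k z)))" by (rule cm_eq) (simp add: b[OF k] ev_def)
  qed
  show "cmap (tp (spx_bd (Suc n) >< ?I)) Y ?h"
  proof (rule paste_spx_bd)
  fix k
  assume k: "k <= Suc n"
  have "cmap (tp (std n >< ?I)) Y (snd (e k))" using e[OF k] by (simp add: good_def)
  thus "cmap (tp (std n >< ?I)) Y (%z. snd (b (fst (sface k (fst z), snd z))) (snd (sface k (fst z), snd z)))"
   by (rule cm_eq) (auto simp: b[OF k] ev_def)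
  qed
  fix x
  assume "x : spx_bd (Suc n)"
  then obtain k y where ky: "k <= Suc n" "y : std n" "x = sface k y" using spx_bd_face by blast
  show "snd (b (fst (x, 0::real))) (snd (x, 0::real)) = s x" using e[OF ky(1)] ky by (simp add: b ev_def good_def face_apply)
  show "snd (b (fst (x, 1::real))) (snd (x, 1::real)) = f (fst (b x))" using e[OF ky(1)] ky by (simp add: b ev_def good_def)
  qed
  then obtain d where d: "good (Suc n) s d" "!!x t. x : spx_bd (Suc n) ==> fst d x = fst (b x)" "!!x t. x : spx_bd (Suc n) ==> t : ?I ==> snd d (x, t) = snd (b x) t"
   by auto
  have "ev d x = b x" if x: "x : spx_bd (Suc n)" for x using spx_bd_face[OF x] d(3)[OF x] d(2)[OF x] by (auto simp: b ev_def prod_eq_iff)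
  thus "EX d. good (Suc n) s d & (ALL x:spx_bd (Suc n). ev d x = b x)" using d(1) by blast
 qed (use that in blast)
 have g: "good n sg (D n sg)" if "sing n Y sg" for n sg using D(1)[OF that] .
 have ext: "fst (D (Suc n) sg) (sface k y) = fst (D n (fce (Suc n) k sg)) y" "t : ?I ==> snd (D (Suc n) sg) (sface k y, t) = snd (D n (fce (Suc n) k sg)) (y, t)" if "sing (Suc n) Y sg" "k <= Suc n" "y : std n" for n sg k y t
  using D(2)[OF that] by (auto simp: ev_def dest: res_eqD)
 show thesis
 proof (rule that[of "%n sg. fst (D n sg)" "%n sg. snd (D n sg)"])
  fix n sg k
  assume a: "sing (Suc n) Y sg" "k <= Suc n"
  have "fst (D n (fce (Suc n) k sg)) : extensional (std n)" using g[OF sing_spx_face[OF a]] by (simp add: good_def sing_spx_cmap)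
  thus "fce (Suc n) k (fst (D (Suc n) sg)) = fst (D n (fce (Suc n) k sg))"
   by (intro extensionalityI[of _ "std n"]) (auto simp: ext(1)[OF a] singular_face_def)
 qed (use g ext(2) in \<open>simp_all add: good_def\<close>)
qed

text \<open>The other composite. For a simplex \<open>ta\<close> of \<open>X\<close> the homotopy
  \<open>h\<close> of \<open>f o ta\<close> lies in \<open>Y\<close>, but both of its ends come from
  \<open>X\<close>; relative lifting over the cylinder on the simplex moves it into \<open>X\<close>
  with these ends fixed. The deformation between the two homotopies is part of the data, since it
  has to match on faces during the construction.\<close>

lemma lift_simplices_htp:
 assumes r: "!!n sg. sing n Y sg ==> sing n X (r n sg)" and rf: "!!n sg k. sing (Suc n) Y sg ==> k <= Suc n ==> fce (Suc n) k (r (Suc n) sg) = r n (fce (Suc n) k sg)" and h: "!!n sg. sing n Y sg ==> cmap (tp (std n >< {0..1::real})) Y (h n sg)" and h0: "!!n sg x. sing n Y sg ==> x : std n ==> h n sg (x, 0) = sg x" and h1: "!!n sg x. sing n Y sg ==> x : std n ==> h n sg (x, 1) = f (r n sg x)" and hf: "!!n sg k y t. sing (Suc n) Y sg ==> k <= Suc n ==> y : std n ==> t : {0..1} ==> h (Suc n) sg (sface k y, t) = h n (fce (Suc n) k sg) (y, t)"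
 obtains K where "!!n ta. sing n X ta ==> cmap (tp (std n >< {0..1::real})) X (K n ta)" "!!n ta x. sing n X ta ==> x : std n ==> K n ta (x, 0) = ta x" "!!n ta x. sing n X ta ==> x : std n ==> K n ta (x, 1) = r n (simplex_map n f ta) x" "!!n ta k y t. sing (Suc n) X ta ==> k <= Suc n ==> y : std n ==> t : {0..1} ==> K (Suc n) ta (sface k y, t) = K n (fce (Suc n) k ta) (y, t)"
proof -
 let ?I = "{0..1::real}" and ?Dl = standard_simplex and ?f = "%n. simplex_map n f"
 define good where "good n ta d <-> cmap (tp (?Dl n >< ?I)) X (fst d) & cmap (tp ((?Dl n >< ?I) >< ?I)) Y (snd d) & (ALL x:?Dl n. fst d (x, 0) = ta x & fst d (x, 1) = r n (?f n ta) x & (ALL t:?I. snd d ((x, t), 0) = h n (?f n ta) (x, t) & snd d ((x, t), 1) = f (fst d (x, t)) & snd d ((x, 0), t) = f (ta x) & snd d ((x, 1), t) = f (r n (?f n ta) x)))" for n ta and d :: "(ptx >< real => 'a) >< ((ptx >< real) >< real => 'b)"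
 define ev where "ev d x = (\<lambda>t\<in>?I. fst d (x, t), \<lambda>w\<in>?I >< ?I. snd d ((x, fst w), snd w))" for d :: "(ptx >< real => 'a) >< ((ptx >< real) >< real => 'b)" and x
 have fta: "sing n Y (?f n ta)" if "sing n X ta" for n ta using sing_map[OF that cont] .
 have make: "EX d. good n ta d & (ALL x:spx_bd n. ALL t:?I. fst d (x, t) = k (x, t) & (ALL s:?I. snd d ((x, t), s) = l ((x, t), s)))" if ta: "sing n X ta" and k: "cmap (tp (spx_bd n >< ?I)) X k" and l: "cmap (tp ((spx_bd n >< ?I) >< ?I)) Y l" and k01: "!!x. x : spx_bd n ==> k (x, 0) = ta x" "!!x. x : spx_bd n ==> k (x, 1) = r n (?f n ta) x" and l01: "!!x t. x : spx_bd n ==> t : ?I ==> l ((x, t), 0) = h n (?f n ta) (x, t)" "!!x t. x : spx_bd n ==> t : ?I ==> l ((x, t), 1) = f (k (x, t))" "!!x t. x : spx_bd n ==> t : ?I ==> l ((x, 0), t) = f (ta x)" "!!x t. x : spx_bd n ==> t : ?I ==> l ((x, 1), t) = f (r n (?f n ta) x)" for n ta k l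
 proof -
  let ?S = "?Dl n" and ?A = "spx_bd n"
  have dp: "disc_pair n ?S ?A" by (rule disc_pair_spx)
  have AS: "?A <= ?S" "closedin (tp ?S) ?A" using disc_pair_hep[OF dp] by (auto simp: hep_def)
  have cta: "cmap (tp ?S) X ta" and cr: "cmap (tp ?S) X (r n (?f n ta))" using ta r[OF fta[OF ta]] by (simp_all add: sing_spx_cmap)
  have cfst: "con Q fst" for Q :: "(ptx >< real) set" by (intro con_fst con_id)
  have cfst': "con Q fst" for Q :: "((ptx >< real) >< real) set" by (intro con_fst con_id)
  have fs: "fst ` (S >< T) <= S" for S :: "'p set" and T :: "'q set" by auto
  obtain T where T: "cmap (tp ((?A >< ?I Un ?S >< {0, 1}) >< ?I)) X T" "!!x s. x : ?S ==> s : ?I ==> T ((x, 0), s) = ta x" "!!x s. x : ?S ==> s : ?I ==> T ((x, 1), s) = r n (?f n ta) x" "!!x t s. x : ?A ==> t : ?I ==> s : ?I ==> T ((x, t), s) = k (x, t)"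
  proof (rule glue_walls[OF AS cmap_comp[OF cta cfst fs] cmap_comp[OF cr cfst fs] cmap_comp[OF k cfst' fs], of ?I])
  qed (use k01 that in auto)
  obtain L where L: "cmap (tp ((?A >< ?I Un ?S >< {0, 1}) >< ?I)) Y L" "!!x s. x : ?S ==> s : ?I ==> L ((x, 0), s) = f (ta x)" "!!x s. x : ?S ==> s : ?I ==> L ((x, 1), s) = f (r n (?f n ta) x)" "!!x t s. x : ?A ==> t : ?I ==> s : ?I ==> L ((x, t), s) = l ((x, t), s)"
  proof (rule glue_walls[OF AS cmap_after[OF cmap_comp[OF cta cfst fs] cont] cmap_after[OF cmap_comp[OF cr cfst fs] cont] l])
  qed (use l01 that in auto)
  have hn: "cmap (tp (?S >< ?I)) Y (h n (?f n ta))" by (rule h[OF fta[OF ta]])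
  have T0: "cmap (tp (?A >< ?I Un ?S >< {0, 1})) X (%z. T (z, 0))" by (rule cmap_comp[OF T(1)]) (auto intro!: con_Pair)
  have hb: "h n (?f n ta) (x, 0) = f (ta x)" "h n (?f n ta) (x, 1) = f (r n (?f n ta) x)" if "x : ?S" for x
   using h0[OF fta[OF ta] that] h1[OF fta[OF ta] that] that by (simp_all add: simplex_map_def)
  have L0: "L (z, 0) = h n (?f n ta) z" and L1: "L (z, 1) = f (T (z, 0))" if z: "z : ?A >< ?I Un ?S >< {0, 1}" for z
  proof -
  consider (A) x t where "z = (x, t)" "x : ?A" "t : ?I" | (B) x where "z = (x, 0)" "x : ?S" | (C) x where "z = (x, 1)" "x : ?S" using z by blast
  hence "L (z, 0) = h n (?f n ta) z & L (z, 1) = f (T (z, 0))"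
  proof cases
  case A
  thus ?thesis using L(4)[OF A(2,3)] l01(1,2)[OF A(2,3)] T(4)[OF A(2,3)] by simp
  next
  case B
  thus ?thesis using L(2)[OF B(2)] T(2)[OF B(2)] hb(1)[OF B(2)] by simp
  next
  case C
  thus ?thesis using L(3)[OF C(2)] T(3)[OF C(2)] hb(2)[OF C(2)] by simp
  qed
  thus "L (z, 0) = h n (?f n ta) z" "L (z, 1) = f (T (z, 0))" by simp_all
  qed
  obtain K H where K: "cmap (tp (?S >< ?I)) X K" "!!z. z : ?A >< ?I Un ?S >< {0, 1} ==> K z = T (z, 0)" and H: "cmap (tp ((?S >< ?I) >< ?I)) Y H" "!!z. z : ?S >< ?I ==> H (z, 0) = h n (?f n ta) z" "!!z. z : ?S >< ?I ==> H (z, 1) = f (K z)" "!!z t. z : ?A >< ?I Un ?S >< {0, 1} ==> t : ?I ==> H (z, t) = L (z, t)"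
   using rel_lift[OF disc_pair_cyl[OF dp] hn T0 L(1) L0 L1] by blast
  show ?thesis
  proof (intro exI[of _ "(K, H)"] conjI ballI)
  show "good n ta (K, H)" unfolding good_def fst_conv snd_conv
  proof (intro conjI ballI K(1) H(1))
  fix x
  assume x: "x : ?S"
  show "K (x, 0) = ta x" "K (x, 1) = r n (?f n ta) x" using K(2) T(2,3) x by auto
  fix t :: real
  assume t: "t : ?I"
  show "H ((x, t), 0) = h n (?f n ta) (x, t)" "H ((x, t), 1) = f (K (x, t))" using H(2,3) x t by auto
  show "H ((x, 0), t) = f (ta x)" "H ((x, 1), t) = f (r n (?f n ta) x)" using H(4) L(2,3) x t by auto
  qed
  next
  fix x t
  assume "x : ?A" "t : ?I"
  thus "fst (K, H) (x, t) = k (x, t)" using K(2) T(4) by simp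
  next
  fix x t s
  assume "x : ?A" "t : ?I" "s : ?I"
  thus "snd (K, H) ((x, t), s) = l ((x, t), s)" using H(4) L(4) by simp
  qed
 qed
 obtain D where D: "!!n s. sing n X s ==> good n s (D n s)" "!!n s k y. sing (Suc n) X s ==> k <= Suc n ==> y : ?Dl n ==> ev (D (Suc n) s) (sface k y) = ev (D n (fce (Suc n) k s)) y"
 proof (rule semisimplicial_fam[where Z = X and good = good and ev = ev])
  fix s
  assume s: "sing 0 X s"
  have "EX d. good 0 s d & (ALL x:spx_bd 0. ALL t:?I. fst d (x, t) = undefined (x, t) & (ALL s:?I. snd d ((x, t), s) = undefined ((x, t), s)))"
   by (rule make[OF s]) (simp_all only: spx_bd_0 empty_iff Sigma_empty1 cmap_empty)
  thus "EX d. good 0 s d" by blast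
 next
  fix n s e b
  assume s: "sing (Suc n) X s" and e: "!!k. k <= Suc n ==> good n (fce (Suc n) k s) (e k)" and b: "!!k y. k <= Suc n ==> y : ?Dl n ==> b (sface k y) = ev (e k) y"
  let ?k = "%z. fst (b (fst z)) (snd z)" and ?l = "%z. snd (b (fst (fst z))) (snd (fst z), snd z)"
  have s': "sing (Suc n) Y (?f (Suc n) s)" by (rule fta[OF s])
  have rk: "r n (?f n (fce (Suc n) k s)) y = r (Suc n) (?f (Suc n) s) (sface k y)" and hk: "t : ?I ==> h n (?f n (fce (Suc n) k s)) (y, t) = h (Suc n) (?f (Suc n) s) (sface k y, t)" if "k <= Suc n" "y : ?Dl n" for k y t
   using rf[OF s' that(1)] hf[OF s' that] face_spx_map[OF that(1)] face_apply[OF that(2)] by metis+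
  have "EX d. good (Suc n) s d & (ALL x:spx_bd (Suc n). ALL t:?I. fst d (x, t) = ?k (x, t) & (ALL s:?I. snd d ((x, t), s) = ?l ((x, t), s)))"
  proof (rule make[OF s])
  show "cmap (tp (spx_bd (Suc n) >< ?I)) X ?k"
  proof (rule paste_spx_bd)
  fix k
  assume k: "k <= Suc n"
  have "cmap (tp (?Dl n >< ?I)) X (fst (e k))" using e[OF k] by (simp add: good_def)
  thus "cmap (tp (?Dl n >< ?I)) X (%z. fst (b (fst (sface k (fst z), snd z))) (snd (sface k (fst z), snd z)))"
   by (rule cm_eq) (auto simp: b[OF k] ev_def)
  qed
  have "cmap (tp (spx_bd (Suc n) >< (?I >< ?I))) Y (%z. snd (b (fst z)) (snd z))"
  proof (rule paste_spx_bd)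
  fix k
  assume k: "k <= Suc n"
  have "cmap (tp ((?Dl n >< ?I) >< ?I)) Y (snd (e k))" using e[OF k] by (simp add: good_def)
  hence "cmap (tp (?Dl n >< (?I >< ?I))) Y (%z. snd (e k) ((fst z, fst (snd z)), snd (snd z)))"
   by (rule cmap_comp) (auto intro!: con_Pair con_fst con_snd con_id)
  thus "cmap (tp (?Dl n >< (?I >< ?I))) Y (%z. snd (b (fst (sface k (fst z), snd z))) (snd (sface k (fst z), snd z)))"
   by (rule cm_eq) (auto simp: b[OF k] ev_def)
  qed
  hence "cmap (tp ((spx_bd (Suc n) >< ?I) >< ?I)) Y (%w. (%z. snd (b (fst z)) (snd z)) (fst (fst w), snd (fst w), snd w))"
   by (rule cmap_comp) (auto intro!: con_Pair con_fst con_snd)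
  thus "cmap (tp ((spx_bd (Suc n) >< ?I) >< ?I)) Y ?l" by simp
  next
  fix x
  assume "x : spx_bd (Suc n)"
  then obtain k y where ky: "k <= Suc n" "y : ?Dl n" "x = sface k y" using spx_bd_face by blast
  note ek = e[OF ky(1), unfolded good_def]
  show "fst (b (fst (x, 0::real))) (snd (x, 0::real)) = s x" "fst (b (fst (x, 1::real))) (snd (x, 1::real)) = r (Suc n) (?f (Suc n) s) x" using ek ky
   by (simp_all add: b ev_def face_apply rk)
  fix t :: real
  assume t: "t : ?I"
  show "snd (b (fst (fst ((x, t), 0::real)))) (snd (fst ((x, t), 0::real)), snd ((x, t), 0::real)) = h (Suc n) (?f (Suc n) s) (x, t)" "snd (b (fst (fst ((x, t), 1::real)))) (snd (fst ((x, t), 1::real)), snd ((x, t), 1::real)) = f (fst (b (fst (x, t))) (snd (x, t)))" "snd (b (fst (fst ((x, 0::real), t)))) (snd (fst ((x, 0::real), t)), snd ((x, 0::real), t)) = f (s x)" "snd (b (fst (fst ((x, 1::real), t)))) (snd (fst ((x, 1::real), t)), snd ((x, 1::real), t)) = f (r (Suc n) (?f (Suc n) s) x)"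
   using ek ky t by (simp_all add: b ev_def face_apply rk hk)
  qed
  then obtain d where d: "good (Suc n) s d" "!!x t. x : spx_bd (Suc n) ==> t : ?I ==> fst d (x, t) = fst (b x) t" "!!x t s. x : spx_bd (Suc n) ==> t : ?I ==> s : ?I ==> snd d ((x, t), s) = snd (b x) (t, s)"
   by auto
  have "ev d x = b x" if x: "x : spx_bd (Suc n)" for x
  proof -
  obtain k y where ky: "k <= Suc n" "y : ?Dl n" "x = sface k y" using spx_bd_face[OF x] by blast
  have "fst (b x) : extensional ?I" "snd (b x) : extensional (?I >< ?I)" using ky by (simp_all add: b ev_def)
  moreover have "!!t. t : ?I ==> fst d (x, t) = fst (b x) t" using d(2)[OF x] by blast
  moreover have "!!w. w : ?I >< ?I ==> snd d ((x, fst w), snd w) = snd (b x) w" using d(3)[OF x] by auto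
  ultimately have "(\<lambda>t\<in>?I. fst d (x, t)) = fst (b x)" "(\<lambda>w\<in>?I >< ?I. snd d ((x, fst w), snd w)) = snd (b x)"
   by (intro extensionalityI[of _ ?I] extensionalityI[of _ "?I >< ?I"]; simp)+
  thus ?thesis by (simp add: ev_def)
  qed
  thus "EX d. good (Suc n) s d & (ALL x:spx_bd (Suc n). ev d x = b x)" using d(1) by blast
 qed (use that in blast)
 show thesis
 proof (rule that[of "%n ta. fst (D n ta)"])
  fix n ta k y t
  assume a: "sing (Suc n) X ta" "k <= Suc n" "y : ?Dl n" "t : ?I"
  show "fst (D (Suc n) ta) (sface k y, t) = fst (D n (fce (Suc n) k ta)) (y, t)" using D(2)[OF a(1-3)] a(4) by (auto simp: ev_def dest: res_eqD)
 qed (use D(1) in \<open>simp_all add: good_def\<close>)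
qed

end

section \<open>Quotient spaces and cochains\<close>

context vspace begin

lemma add_sg_sub: "submodule B K V ==> abelian_subgroup B V"
 by (rule abelian_subgroupI3[OF additive_subgroup.intro M.abelian_group_axioms]) (simp add: submodule_def)

lemma coset_eq_iff:
 assumes B: "submodule B K V" and x: "x : car V" and y: "y : car V"
 shows "B +>\<^sub>V x = B +>\<^sub>V y <-> x -[V] y : B"
proof -
 interpret B: abelian_subgroup B V by (rule add_sg_sub[OF B])
 have "x : B +>\<^sub>V y <-> x -[V] y : B" using B.a_rcos_module[OF y x] by (simp add: a_minus_def)
 thus ?thesis using B.a_rcos_self[OF x] M.a_repr_independence[OF _ y B.a_subgroup, of x] by blast
qed

lemma quot_car: "car (quot_space V B) = (%x. B +>\<^sub>V x) ` car V" by (auto simp: quot_space_def A_RCOSETS_def')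

lemma quot_zero: "(zero (quot_space V B)) = B" by (simp add: quot_space_def)

lemma quot_add:
 assumes "submodule B K V" "x : car V" "y : car V"
 shows "(B +>\<^sub>V x) +[quot_space V B] (B +>\<^sub>V y) = B +>\<^sub>V (x +[V] y)"
proof -
 interpret B: abelian_subgroup B V by (rule add_sg_sub[OF assms(1)])
 show ?thesis using B.a_rcos_sum[OF assms(2,3)] by (simp add: quot_space_def)
qed

lemma quot_zero_coset: "submodule B K V ==> B +>\<^sub>V (zero V) = B" using submoduleE(1)[of B] by simp

lemma quot_smult:
 assumes B: "submodule B K V" and a: "a : car K" and x: "x : car V"
 shows "a .[quot_space V B] (B +>\<^sub>V x) = B +>\<^sub>V (a .[V] x)"
proof -
 interpret B: abelian_subgroup B V by (rule add_sg_sub[OF B])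
 have e: "B +>\<^sub>V (a .[V] v) = B +>\<^sub>V (a .[V] x)" if "v : B +>\<^sub>V x" for v
 proof -
  have v: "v : car V" using that B.a_elemrcos_carrier[OF x] by blast
  have "v -[V] x : B" using that B.a_rcos_module[OF x v] by (simp add: a_minus_def)
  hence "a .[V] (v -[V] x) : B" using submoduleE(4)[OF B a] by blast
  thus ?thesis using a v x coset_eq_iff[OF B] by (simp add: a_minus_def smult_r_distr smult_r_minus)
 qed
 have "B +>\<^sub>V x ~= {}" using B.a_rcos_self[OF x] by blast
 hence "(\<Union>v\<in>B +>\<^sub>V x. B +>\<^sub>V (a .[V] v)) = B +>\<^sub>V (a .[V] x)" by (rule SUP_eq_const) (rule e)
 thus ?thesis by (simp add: quot_space_def)
qed

lemma quot_vs: assumes B: "submodule B K V" shows "vspace K (quot_space V B)"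
proof (rule vspaceI[OF K.field_axioms moduleI])
 let ?Q = "quot_space V B"
 note [simp] = quot_add[OF B] quot_smult[OF B] quot_zero
 have cl: "B +>\<^sub>V x : car ?Q" if "x : car V" for x using that quot_car by blast
 have ob: "EX v:car V. x = B +>\<^sub>V v" if "x : car ?Q" for x using that quot_car by blast
 show "cring K" by (rule K.is_cring)
 show "abelian_group ?Q"
 proof (rule abelian_groupI)
  show "(zero ?Q) : car ?Q" using cl[OF M.zero_closed] quot_zero_coset[OF B] by simp
  fix x y u
  assume "x : car ?Q" "y : car ?Q" "u : car ?Q"
  then obtain v w t where v: "v : car V" "w : car V" "t : car V" "x = B +>\<^sub>V v" "y = B +>\<^sub>V w" "u = B +>\<^sub>V t" using ob by metis
  show "x +[?Q] y : car ?Q" using v by (simp add: cl)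
  show "x +[?Q] y = y +[?Q] x" using v by (simp add: M.a_comm)
  show "x +[?Q] y +[?Q] u = x +[?Q] (y +[?Q] u)" using v by (simp add: M.a_assoc)
 next
  fix x
  assume "x : car ?Q"
  then obtain v where v: "v : car V" "x = B +>\<^sub>V v" using ob by metis
  show "(zero ?Q) +[?Q] x = x" using v quot_add[OF B M.zero_closed v(1)] quot_zero_coset[OF B] by simp
  have "(B +>\<^sub>V (\<ominus>\<^sub>V v)) +[?Q] x = zero ?Q" using v quot_zero_coset[OF B] by (simp add: M.l_neg)
  thus "EX y:car ?Q. y +[?Q] x = zero ?Q" using cl[of "\<ominus>\<^sub>V v"] v by blast
 qed
 fix a b x y
 assume "a : car K" "x : car ?Q"
 then obtain v where v: "a : car K" "v : car V" "x = B +>\<^sub>V v" using ob by metis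
 show "a .[?Q] x : car ?Q" using v by (simp add: cl)
 show "(a +[K] b) .[?Q] x = a .[?Q] x +[?Q] b .[?Q] x" if "b : car K" using v that by (simp add: smult_l_distr)
 show "a *[K] b .[?Q] x = a .[?Q] (b .[?Q] x)" if "b : car K" using v that by (simp add: smult_assoc1)
 show "a .[?Q] (x +[?Q] y) = a .[?Q] x +[?Q] a .[?Q] y" if y: "y : car ?Q" using ob[OF y] v by (auto simp: smult_r_distr)
next
 fix x
 assume "x : car (quot_space V B)"
 then obtain v where v: "v : car V" "x = B +>\<^sub>V v" using quot_car by blast
 thus "(one K) .[quot_space V B] x = x" using quot_smult[OF B K.one_closed v(1)] by simp
qed

end

section \<open>Cochains and their evaluation on integral chains\<close>

lemma cch_s [simp]: "(zero (cch K X p)) = (%sg. (zero K))" "c +[cch K X p] d = (%sg. c sg +[K] d sg)" "a .[cch K X p] c = (%sg. a *[K] c sg)"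
 by (simp_all add: cochains_def)

lemma cch_iff: "c : car (cch K X p) <-> (ALL sg. sing p X sg --> c sg : car K) & (ALL sg. ~ sing p X sg --> c sg = zero K)" by (simp add: cochains_def)

text \<open>The pairing of a cochain with integral chains, by the universal property of the free
  abelian group. It makes results on boundaries and chain maps available for cochains with values in
  \<open>K\<close>.\<close>

definition ceval :: "('k, 'r) ring_scheme => ('s => 'k) => ('s \<Rightarrow>\<^sub>0 int) => 'k" where "ceval K c = (SOME h. h : hom (free_Abelian_group UNIV) (add_monoid K) & (ALL x. h (frag_of x) = c x))"

text \<open>Pullback along a mere map of simplices, as needed for the inverse of a weak equivalence;
  \<open>cpb\<close> is the case of a continuous map.\<close>

definition pull :: "'k ring => 'a topology => nat => ((ptx => 'a) => (ptx => 'b)) => ('b, 'k) cochain => ('a, 'k) cochain" where "pull K X p A c = (%sg. if sing p X sg then c (A sg) else (zero K))"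

lemma cch_pb_eq: "cpb K X p f = pull K X p (simplex_map p f)" by (simp add: cochain_pullback_def pull_def fun_eq_iff)

text \<open>A morphism of semisimplicial sets between the singular sets; degeneracies are not
  involved.\<close>

definition ss_map :: "'a topology => 'b topology => (nat => (ptx => 'a) => (ptx => 'b)) => bool" where "ss_map X Y A <-> (ALL p sg. sing p X sg --> sing p Y (A p sg)) & (ALL p sg k. sing (Suc p) X sg --> k <= Suc p --> fce (Suc p) k (A (Suc p) sg) = A p (fce (Suc p) k sg))"

lemma ss_map_spx_map: "cmap X Y f ==> ss_map X Y (%p. simplex_map p f)" by (simp add: ss_map_def sing_map face_spx_map)

locale coeff = field K for K :: "'k ring" (structure) begin

lemma ceval_hom:
 assumes "c : UNIV -> car K"
 shows "ceval K c : hom (free_Abelian_group UNIV) (add_monoid K)" "ceval K c (frag_of x) = c x"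
proof -
 have "c ` UNIV <= car (add_monoid K)" using assms by auto
 then obtain h where "h : hom (free_Abelian_group UNIV) (add_monoid K)" "!!x. x : UNIV ==> h (frag_of x) = c x"
  using comm_group.free_Abelian_group_universal[OF a_comm_group] by blast
 hence "EX h. h : hom (free_Abelian_group UNIV) (add_monoid K) & (ALL x. h (frag_of x) = c x)" by blast
 from someI_ex[OF this] show "ceval K c : hom (free_Abelian_group UNIV) (add_monoid K)" "ceval K c (frag_of x) = c x" unfolding ceval_def by blast+
qed

context fixes c :: "'s => 'k" assumes c: "c : UNIV -> car K" begin

lemma ceval_cl [simp]: "ceval K c z : car K" using ceval_hom(1)[OF c] by (auto simp: hom_def)

lemma ceval_add: "ceval K c (a + b) = ceval K c a \<oplus> ceval K c b" using ceval_hom(1)[OF c] by (auto simp: hom_def)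

lemma ceval_0: "ceval K c 0 = \<zero>" using ceval_add[of 0 0] by simp

lemma ceval_minus: "ceval K c (- a) = \<ominus> ceval K c a" using ceval_add[of "- a" a] by (simp add: ceval_0 minus_equality)

lemma ceval_diff: "ceval K c (a - b) = ceval K c a \<ominus> ceval K c b" using ceval_add[of a "- b"] by (simp add: ceval_minus a_minus_def)

lemma ceval_sign: "ceval K c (frag_cmul ((-1) ^ k) z) = ((\<ominus> \<one>) [^] k) \<otimes> ceval K c z"
proof (induction k)
 case (Suc k)
 have "frag_cmul ((-1) ^ Suc k) z = - frag_cmul ((-1) ^ k) z" by simp
 hence "ceval K c (frag_cmul ((-1) ^ Suc k) z) = \<ominus> (((\<ominus> \<one>) [^] k) \<otimes> ceval K c z)" using Suc by (simp only: ceval_minus)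
 moreover have "(\<ominus> \<one>) [^] Suc k = \<ominus> ((\<ominus> \<one>) [^] k)" by (simp add: r_minus)
 ultimately show ?case by (simp add: l_minus)
qed simp

lemma ceval_sum: "finite I ==> ceval K c (sum g I) = (\<Oplus>i\<in>I. ceval K c (g i))"
 by (induction I rule: finite_induct) (simp_all add: ceval_0 ceval_add)

end

lemma ceval_eqI:
 assumes "c : UNIV -> car K" "d : UNIV -> car K" "Poly_Mapping.keys z <= S" "!!x. x : S ==> ceval K c (F (frag_of x)) = ceval K d (G (frag_of x))" "F 0 = 0" "G 0 = 0" "!!a b. F (a - b) = F a - F b" "!!a b. G (a - b) = G a - G b"
 shows "ceval K c (F z) = ceval K d (G z)"
using assms(3)
proof (induction z rule: frag_induction)
 case zero
 show ?case using assms by (simp add: ceval_0)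
next
 case (one x)
 thus ?case using assms by blast
next
 case (diff a b)
 thus ?case using assms by (simp add: ceval_diff)
qed

lemma cch_UNIV: "c : car (cch K X p) ==> c : UNIV -> car K" unfolding cch_iff by auto

lemma cch_cl [simp]: "c : car (cch K X p) ==> c sg : car K" using cch_UNIV by blast

lemma vs_cch: "vspace K (cch K X p)"
proof (rule vspaceI[OF field_axioms moduleI])
 let ?C = "cch K X p"
 show "cring K" by (rule is_cring)
 show "abelian_group ?C"
 proof (rule abelian_groupI)
  fix x
  assume x: "x : car ?C"
  have "(%sg. \<ominus> x sg) : car ?C" using x by (simp add: cch_iff)
  thus "EX y:car ?C. y +[?C] x = zero ?C" using x by (intro bexI[of _ "%sg. \<ominus> x sg"]) (simp_all add: l_neg)
  show "(zero ?C) +[?C] x = x" using x by simp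
  fix y z
  assume y: "y : car ?C" and z: "z : car ?C"
  show "x +[?C] y : car ?C" using x y by (simp add: cch_iff)
  show "x +[?C] y = y +[?C] x" using cch_cl[OF x] cch_cl[OF y] by (simp add: a_comm)
  show "x +[?C] y +[?C] z = x +[?C] (y +[?C] z)" using cch_cl[OF x] cch_cl[OF y] cch_cl[OF z] by (simp add: a_assoc)
 qed (simp add: cch_iff)
 fix a b x y
 assume a: "a : car K" and x: "x : car ?C"
 note xc = cch_cl[OF x]
 show "a .[?C] x : car ?C" using a x by (simp add: cch_iff)
 show "(a \<oplus> b) .[?C] x = a .[?C] x +[?C] b .[?C] x" "a \<otimes> b .[?C] x = a .[?C] (b .[?C] x)" if "b : car K" using a that xc
  by (simp_all add: l_distr m_assoc)
 show "a .[?C] (x +[?C] y) = a .[?C] x +[?C] a .[?C] y" if "y : car ?C" using a xc cch_cl[OF that] by (simp add: r_distr)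
next
 fix x
 assume x: "x : car (cch K X p)"
 show "\<one> \<odot>\<^sub>(cch K X p) x = x" using cch_cl[OF x] by simp
qed

end

section \<open>Singular cohomology\<close>

lemma (in vspace) sub_trivial: "submodule {(zero V)} K V" by (rule submoduleI) auto

context coeff begin

lemma sign_cl [simp]: "(\<ominus> \<one>) [^] (k::nat) : car K" by simp

text \<open>The coboundary is dual to the boundary of integral chains, with the same signs.\<close>

lemma cob_eval:
 assumes c: "c : car (cch K X p)" and sg: "sing (Suc p) X sg"
 shows "cob K X p c sg = ceval K c (bnd (Suc p) (frag_of sg))" using sg cch_UNIV[OF c]
 by (simp add: coboundary_map_def chain_boundary_of ceval_sum ceval_sign ceval_hom(2) del: sum.atMost_Suc)

lemma cob_lin_map: "lin_map K (cch K X p) (cch K X (Suc p)) (cob K X p)"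
proof -
 have cl: "c (fce (Suc p) k sg) : car K" if "c : car (cch K X p)" for c k sg using that by simp
 show ?thesis unfolding lin_map_def
 proof (intro conjI ballI funcsetI)
  fix c
  assume c: "c : car (cch K X p)"
  show "cob K X p c : car (cch K X (Suc p))" using cl[OF c] by (auto simp: cch_iff coboundary_map_def simp del: finsum_Suc)
  show "cob K X p (c +[cch K X p] d) = cob K X p c +[cch K X (Suc p)] cob K X p d" if d: "d : car (cch K X p)" for d using cl[OF c] cl[OF d]
   by (simp add: coboundary_map_def fun_eq_iff r_distr)
 next
  fix a c
  assume a: "a : car K" and c: "c : car (cch K X p)"
  have "(\<Oplus>k\<in>{..Suc p}. (\<ominus> \<one>) [^] k \<otimes> (a \<otimes> c (fce (Suc p) k sg))) = a \<otimes> (\<Oplus>k\<in>{..Suc p}. (\<ominus> \<one>) [^] k \<otimes> c (fce (Suc p) k sg))" for sg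
  proof -
  have "(\<Oplus>k\<in>{..Suc p}. (\<ominus> \<one>) [^] k \<otimes> (a \<otimes> c (fce (Suc p) k sg))) = (\<Oplus>k\<in>{..Suc p}. a \<otimes> ((\<ominus> \<one>) [^] k \<otimes> c (fce (Suc p) k sg)))"
   using a cl[OF c] by (intro finsum_cong') (auto simp: m_lcomm)
  also have "... = a \<otimes> (\<Oplus>k\<in>{..Suc p}. (\<ominus> \<one>) [^] k \<otimes> c (fce (Suc p) k sg))" using a cl[OF c]
   by (intro finsum_rdistr[symmetric]) auto
  finally show ?thesis .
  qed
  thus "cob K X p (a .[cch K X p] c) = a .[cch K X (Suc p)] cob K X p c" using a by (simp add: coboundary_map_def fun_eq_iff)
 qed
qed

lemmas cob_cl = lin_map_cl[OF vs_cch vs_cch cob_lin_map]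
lemma ceval_cob:
 assumes c: "c : car (cch K X p)" and z: "singular_chain (Suc p) X z"
 shows "ceval K (cob K X p c) z = ceval K c (bnd (Suc p) z)"
proof -
 note d = cch_UNIV[OF cob_cl[OF c]]
 show ?thesis
  by (rule ceval_eqI[OF d cch_UNIV[OF c] z[unfolded singular_chain_def], where F = "%z. z" and G = "bnd (Suc p)"]) (auto simp: ceval_hom(2)[OF d] cob_eval[OF c] chain_boundary_diff)
qed

lemma ccy_iff:
 fixes X :: "'b topology"
 shows "c : ccy K X p <-> c : car (cch K X p) & (ALL z. singular_chain (Suc p) X z --> ceval K c (bnd (Suc p) z) = \<zero>)"
proof -
 have "cob K X p c = (zero (cch K X (Suc p))) <-> (ALL z. singular_chain (Suc p) X z --> ceval K c (bnd (Suc p) z) = \<zero>)" if c: "c : car (cch K X p)"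
 proof
  assume e: "cob K X p c = zero (cch K X (Suc p))"
  have z0: "(%_. \<zero>) : (UNIV :: (ptx => 'b) set) -> car K" by simp
  have c0: "ceval K (%_. \<zero>) z = \<zero>" for z :: "(ptx => 'b) \<Rightarrow>\<^sub>0 int"
   using ceval_eqI[OF z0 z0 subset_UNIV, of "%z. z" "%_. 0" z] by (simp add: ceval_hom(2)[OF z0] ceval_0[OF z0])
  show "ALL z. singular_chain (Suc p) X z --> ceval K c (bnd (Suc p) z) = \<zero>"
  proof (intro allI impI)
  fix z
  assume "singular_chain (Suc p) X z"
  from ceval_cob[OF c this] show "ceval K c (bnd (Suc p) z) = \<zero>" unfolding e cch_s c0 by simp
  qed
 next
  assume e: "ALL z. singular_chain (Suc p) X z --> ceval K c (bnd (Suc p) z) = \<zero>"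
  have "cob K X p c sg = \<zero>" for sg using e cob_eval[OF c, of sg] by (cases "sing (Suc p) X sg") (auto simp: coboundary_map_def singular_chain_of)
  thus "cob K X p c = zero (cch K X (Suc p))" by auto
 qed
 thus ?thesis by (auto simp: cocycles_def)
qed

lemma ccy_sub: "submodule (ccy K X p) K (cch K X p)" using lin_map_vim_sub[OF vs_cch vs_cch cob_lin_map vspace.sub_trivial[OF vs_cch]]
 by (simp add: cocycles_def)

lemma ccy_cch: "c : ccy K X p ==> c : car (cch K X p)" by (simp add: ccy_iff)

lemma coboundaries_subset: "cbd K X p <= ccy K X p"
proof (cases p)
 case 0
 interpret C: vspace K "cch K X 0" by (rule vs_cch)
 show ?thesis using 0 C.sub_zero[OF ccy_sub] by simp
next
 case (Suc q)
 have "cob K X q c : ccy K X (Suc q)" if c: "c : car (cch K X q)" for c unfolding ccy_iff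
 proof (intro conjI allI impI cob_cl[OF c])
  fix z
  assume z: "singular_chain (Suc (Suc q)) X z"
  show "ceval K (cob K X q c) (bnd (Suc (Suc q)) z) = \<zero>"
   using ceval_cob[OF c singular_chain_boundary_alt[OF z]] chain_boundary_boundary_alt[OF z] using ceval_0[OF cch_UNIV[OF c]] by simp
 qed
 thus ?thesis using Suc by auto
qed

lemma cob_sub: "submodule (cbd K X p) K (cch K X p)"
proof (cases p)
 case 0
 show ?thesis using vspace.sub_trivial[OF vs_cch, of X 0] 0 by simp
next
 case (Suc q)
 interpret C: vspace K "cch K X q" by (rule vs_cch)
 show ?thesis using lin_map_img_sub[OF vs_cch vs_cch cob_lin_map C.carrier_is_submodule] Suc by simp
qed

definition zspace :: "'a topology => nat => ('k, ('a, 'k) cochain) module" where "zspace X p = (cch K X p)\<lparr>carrier := ccy K X p\<rparr>"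

lemma zspace_s [simp]: "car (zspace X p) = ccy K X p" "(zero (zspace X p)) = (%sg. \<zero>)" "c +[zspace X p] d = (%sg. c sg \<oplus> d sg)" "a .[zspace X p] c = (%sg. a \<otimes> c sg)"
 by (simp_all add: zspace_def)

lemma vs_zspace: "vspace K (zspace X p)"
proof -
 interpret C: vspace K "cch K X p" by (rule vs_cch)
 show ?thesis unfolding zspace_def using submodule.submodule_is_module[OF ccy_sub C.module_axioms] by (rule vspaceI[OF field_axioms])
qed

lemma cob_zspace: "submodule (cbd K X p) K (zspace X p)"
proof -
 interpret C: vspace K "cch K X p" by (rule vs_cch)
 show ?thesis unfolding zspace_def using C.sub_res[OF ccy_sub coboundaries_subset] cob_sub by blast
qed

lemma coh_eq: "coh K X p = quot_space (zspace X p) (cbd K X p)" by (simp add: cohomology_def zspace_def)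

lemma coh_class_eq: "cls K X p c = cbd K X p +>\<^sub>(zspace X p) c" by (simp add: coh_class_of_def a_r_coset_def r_coset_def)

lemma vs_coh: "vspace K (coh K X p)" unfolding coh_eq by (rule vspace.quot_vs[OF vs_zspace cob_zspace])

lemma car_coh: "car (coh K X p) = cls K X p ` ccy K X p" using vspace.quot_car[OF vs_zspace, of X p "cbd K X p"] by (simp add: coh_eq coh_class_eq)

lemma coh_class_cl [simp]: "c : ccy K X p ==> cls K X p c : car (coh K X p)" by (simp add: car_coh)

lemma zspace_minus:
 assumes "c : ccy K X p" "d : ccy K X p"
 shows "c -[zspace X p] d = (%sg. c sg \<ominus> d sg)"
proof -
 interpret Z: vspace K "zspace X p" by (rule vs_zspace)
 note cd = cch_cl[OF ccy_cch[OF assms(1)]] cch_cl[OF ccy_cch[OF assms(2)]]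
 have "\<ominus>\<^sub>(zspace X p) d = (\<ominus> \<one>) .[zspace X p] d" using assms Z.smult_l_minus[of \<one> d] Z.smult_one[of d] by simp
 thus ?thesis using cd by (simp add: a_minus_def l_minus)
qed

lemma coh_class_eq_iff:
 assumes "c : ccy K X p" "d : ccy K X p"
 shows "cls K X p c = cls K X p d <-> (%sg. c sg \<ominus> d sg) : cbd K X p"
 unfolding coh_class_eq using vspace.coset_eq_iff[OF vs_zspace cob_zspace, of c X p d] zspace_minus[OF assms] assms by simp

lemma coh_class_zero_iff:
 assumes "c : ccy K X p"
 shows "cls K X p c = (zero (coh K X p)) <-> c : cbd K X p"
proof -
 interpret Z: vspace K "zspace X p" by (rule vs_zspace)
 have "(zero (coh K X p)) = cls K X p (%sg. \<zero>)" using Z.quot_zero_coset[OF cob_zspace] by (simp add: coh_eq coh_class_eq Z.quot_zero)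
 moreover have "(%sg. \<zero>) : ccy K X p" using Z.M.zero_closed by simp
 ultimately show ?thesis using coh_class_eq_iff[OF assms] cch_cl[OF ccy_cch[OF assms]] by (simp add: a_minus_def)
qed

lemma coh_class_add:
 assumes "c : ccy K X p" "d : ccy K X p"
 shows "cls K X p c +[coh K X p] cls K X p d = cls K X p (%sg. c sg \<oplus> d sg)" using vspace.quot_add[OF vs_zspace cob_zspace] assms
 by (simp add: coh_eq coh_class_eq)

lemma coh_class_smult:
 assumes "a : car K" "c : ccy K X p"
 shows "a .[coh K X p] cls K X p c = cls K X p (%sg. a \<otimes> c sg)" using vspace.quot_smult[OF vs_zspace cob_zspace] assms
 by (simp add: coh_eq coh_class_eq)

lemma coh_class_mem: "c : ccy K X p ==> c : cls K X p c" and coh_class_memberD: "c : ccy K X p ==> d : cls K X p c ==> d : ccy K X p & cls K X p d = cls K X p c"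
proof -
 assume c: "c : ccy K X p"
 interpret Z: vspace K "zspace X p" by (rule vs_zspace)
 interpret B: abelian_subgroup "cbd K X p" "zspace X p" by (rule Z.add_sg_sub[OF cob_zspace])
 show "c : cls K X p c" using B.a_rcos_self[of c] c by (simp add: coh_class_eq)
 assume d: "d : cls K X p c"
 show "d : ccy K X p & cls K X p d = cls K X p c" using B.a_elemrcos_carrier[of c d] Z.M.a_repr_independence[OF _ _ B.a_subgroup, of d c] c d
  by (simp add: coh_class_eq)
qed

subsection \<open>Induced maps\<close>

lemma pull_cch: "ss_map X Y A ==> c : car (cch K Y p) ==> pull K X p (A p) c : car (cch K X p)" by (simp add: cch_iff pull_def ss_map_def)

lemma pull_coboundary:
 assumes A: "ss_map X Y A" and c: "c : car (cch K Y p)"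
 shows "cob K X p (pull K X p (A p) c) = pull K X (Suc p) (A (Suc p)) (cob K Y p c)"
proof
 fix sg
 show "cob K X p (pull K X p (A p) c) sg = pull K X (Suc p) (A (Suc p)) (cob K Y p c) sg"
 proof (cases "sing (Suc p) X sg")
  case True
  have A': "sing (Suc p) Y (A (Suc p) sg)" "!!k. k <= Suc p ==> fce (Suc p) k (A (Suc p) sg) = A p (fce (Suc p) k sg)" using A True
   by (auto simp: ss_map_def)
  have "(\<Oplus>k\<in>{..Suc p}. (\<ominus> \<one>) [^] k \<otimes> pull K X p (A p) c (fce (Suc p) k sg)) = (\<Oplus>k\<in>{..Suc p}. (\<ominus> \<one>) [^] k \<otimes> c (fce (Suc p) k (A (Suc p) sg)))"
   using sing_spx_face[OF True] A'(2) cch_cl[OF c] by (intro finsum_cong') (auto simp: pull_def)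
  thus ?thesis using A'(1) by (simp add: coboundary_map_def pull_def del: finsum_Suc)
 qed (simp add: coboundary_map_def pull_def)
qed

lemma pull_zero: "pull K X p A (%sg. \<zero>) = (%sg. \<zero>)" by (simp add: pull_def)

lemma pull_ccy: "ss_map X Y A ==> c : ccy K Y p ==> pull K X p (A p) c : ccy K X p" by (simp add: cocycles_def pull_cch pull_coboundary pull_zero)

lemma pull_cob: assumes "ss_map X Y A" "c : cbd K Y p" shows "pull K X p (A p) c : cbd K X p"
proof (cases p)
 case 0
 thus ?thesis using assms(2) by (simp add: pull_zero)
next
 case (Suc q)
 thus ?thesis using assms(2) using pull_coboundary[OF assms(1)] pull_cch[OF assms(1)] by force
qed

lemma pull_minus: "(%sg. pull K X p A c sg \<ominus> pull K X p A d sg) = pull K X p A (%sg. c sg \<ominus> d sg)" by (simp add: pull_def fun_eq_iff)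

lemma coh_map_class:
 assumes f: "cmap X Y f" and c: "c : ccy K Y p"
 shows "coh_map K X p f (cls K Y p c) = cls K X p (cpb K X p f c)"
proof -
 note A = ss_map_spx_map[OF f]
 have e: "cls K X p (cpb K X p f d) = cls K X p (cpb K X p f c)" if d: "d : cls K Y p c" for d
 proof -
  have d': "d : ccy K Y p" "(%sg. d sg \<ominus> c sg) : cbd K Y p" using coh_class_memberD[OF c d] coh_class_eq_iff[OF _ c] by auto
  show ?thesis using coh_class_eq_iff[OF pull_ccy[OF A d'(1)] pull_ccy[OF A c]] pull_cob[OF A d'(2)] by (simp add: cch_pb_eq pull_minus)
 qed
 have "cls K Y p c ~= {}" using coh_class_mem[OF c] by blast
 thus ?thesis unfolding coh_map_def by (rule SUP_eq_const) (rule e)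
qed

lemma pb_ccy: "cmap X Y f ==> c : ccy K Y p ==> cpb K X p f c : ccy K X p" unfolding cch_pb_eq by (rule pull_ccy[OF ss_map_spx_map])

lemma ccy_add: "c : ccy K X p ==> d : ccy K X p ==> (%sg. c sg \<oplus> d sg) : ccy K X p" and cocycles_smult: "a : car K ==> c : ccy K X p ==> (%sg. a \<otimes> c sg) : ccy K X p"
proof -
 interpret Z: vspace K "zspace X p" by (rule vs_zspace)
 show "c : ccy K X p ==> d : ccy K X p ==> (%sg. c sg \<oplus> d sg) : ccy K X p" using Z.M.a_closed[of c d] by simp
 show "a : car K ==> c : ccy K X p ==> (%sg. a \<otimes> c sg) : ccy K X p" using Z.smult_closed[of a c] by simp
qed

lemma coh_map_lin_map:
 assumes f: "cmap X Y f"
 shows "lin_map K (coh K Y p) (coh K X p) (coh_map K X p f)"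
unfolding lin_map_def car_coh
proof (intro conjI ballI funcsetI)
 fix a
 assume "a : cls K Y p ` ccy K Y p"
 then obtain c where c: "c : ccy K Y p" "a = cls K Y p c" by blast
 show "coh_map K X p f a : cls K X p ` ccy K X p" using c by (simp add: coh_map_class[OF f] pb_ccy[OF f])
 show "coh_map K X p f (a +[coh K Y p] b) = coh_map K X p f a +[coh K X p] coh_map K X p f b" if b: "b : cls K Y p ` ccy K Y p" for b
 proof -
  obtain d where d: "d : ccy K Y p" "b = cls K Y p d" using b by blast
  have "cpb K X p f (%sg. c sg \<oplus> d sg) = (%sg. cpb K X p f c sg \<oplus> cpb K X p f d sg)" by (simp add: cochain_pullback_def fun_eq_iff)
  thus ?thesis using c d by (simp add: coh_class_add coh_map_class[OF f] ccy_add pb_ccy[OF f])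
 qed
next
 fix k a
 assume k: "k : car K" and "a : cls K Y p ` ccy K Y p"
 then obtain c where c: "c : ccy K Y p" "a = cls K Y p c" by blast
 have "cpb K X p f (%sg. k \<otimes> c sg) = (%sg. k \<otimes> cpb K X p f c sg)" using k by (simp add: cochain_pullback_def fun_eq_iff)
 thus "coh_map K X p f (k .[coh K Y p] a) = k .[coh K X p] coh_map K X p f a" using c k
  by (simp add: coh_class_smult coh_map_class[OF f] cocycles_smult pb_ccy[OF f])
qed

lemma coh_map_cong:
 assumes "cmap X Y f" "!!x. x : ts X ==> f x = g x" "a : car (coh K Y p)"
 shows "coh_map K X p f a = coh_map K X p g a"
proof -
 have "cpb K X p f c = cpb K X p g c" for c
 proof
  fix sg
  show "cpb K X p f c sg = cpb K X p g c sg" using simplex_map_eq[of p X sg f g] assms(2) by (simp add: cochain_pullback_def)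
 qed
 thus ?thesis by (simp add: coh_map_def)
qed

lemma coh_map_id:
 assumes "!!x. x : ts X ==> f x = x" "a : car (coh K X p)"
 shows "coh_map K X p f a = a"
proof -
 obtain c where c: "c : ccy K X p" "a = cls K X p c" using assms(2) by (auto simp: car_coh)
 have f: "cmap X X f" using assms(1) cm_eq[OF continuous_map_id, of X f] by simp
 have "cpb K X p f c = c"
 proof
  fix sg
  show "cpb K X p f c sg = c sg" using ccy_cch[OF c(1)] simplex_map_id_gen[of p X sg f] assms(1) by (simp add: cochain_pullback_def cch_iff)
 qed
 thus ?thesis using coh_map_class[OF f c(1)] c(2) by simp
qed

lemma coh_map_comp:
 assumes f: "cmap X Y f" and g: "cmap Y Z g" and a: "a : car (coh K Z p)"
 shows "coh_map K X p f (coh_map K Y p g a) = coh_map K X p (g o f) a"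
proof -
 obtain c where c: "c : ccy K Z p" "a = cls K Z p c" using a by (auto simp: car_coh)
 have "cpb K X p f (cpb K Y p g c) = cpb K X p (g o f) c" using sing_map[OF _ f] by (auto simp: cochain_pullback_def simplex_map_compose)
 thus ?thesis using c by (simp add: coh_map_class[OF f] coh_map_class[OF g] coh_map_class[OF cm_comp[OF f g]] pb_ccy[OF g])
qed

end

section \<open>Weak equivalences induce isomorphisms in cohomology\<close>

abbreviation cyl :: "nat => (ptx >< real) topology" where "cyl n \<equiv> tp (std n >< {0..1::real})"
lemma fmix_spx: assumes "x : std n" "y : std n" "s : {0..1}" shows "fmix s x y : std n"
proof -
 have "(1 - s) * x i + s * y i <= (1 - s) * 1 + s * 1" for i using assms by (intro add_mono mult_left_mono) (auto simp: standard_simplex_def)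
 moreover have "(\<Sum>i\<le>n. (1 - s) * x i + s * y i) = (1 - s) * (\<Sum>i\<le>n. x i) + s * (\<Sum>i\<le>n. y i)"
  by (simp add: sum.distrib sum_distrib_left)
 ultimately show ?thesis using assms by (auto simp: standard_simplex_def fmix_def)
qed

text \<open>The cylinder is convex, so a straight-line contraction to \<open>a\<close> makes a cycle
  homologous to its image at a point, and cycles at a point bound in positive degree. In degree zero
  that image has to vanish by assumption.\<close>

lemma cyl_cycle_bd:
 fixes a :: "ptx >< real"
 assumes c: "singular_chain p (cyl n) c" "bnd p c = 0" and a: "a : std n >< {0..1}" and p: "1 <= p | chain_map p (%_. a) c = 0"
 shows "EX d. singular_chain (Suc p) (cyl n) d & bnd (Suc p) d = c"
proof -
 let ?Q = "cyl n" and ?k = "%_. a"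
 have "homotopic_with (%h. h : {} -> {}) ?Q ?Q id ?k" unfolding homotopic_with_def prod_topology_subtopology_eu
 proof (intro exI[of _ "%z. (fmix (fst z) (fst (snd z)) (fst a), (1 - fst z) * snd (snd z) + fst z * snd a)"] conjI allI ballI)
  have "(1 - s) * t + s * snd a : {0..1}" if "s : {0..1}" "t : {0..1}" for s t
  proof -
  have "(1 - s) * t + s * snd a <= (1 - s) * 1 + s * 1" using that a by (intro add_mono mult_left_mono) auto
  moreover have "0 <= (1 - s) * t + s * snd a" using that a by auto
  ultimately show ?thesis by simp
  qed
  moreover have "fmix s x (fst a) : std n" if "s : {0..1}" "x : std n" for s x using that a by (auto intro!: fmix_spx)
  ultimately show "cmap (tp ({0..1} >< std n >< {0..1})) ?Q (%z. (fmix (fst z) (fst (snd z)) (fst a), (1 - fst z) * snd (snd z) + fst z * snd a))"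
   by (auto intro!: con_Pair cont_on_fmix con_fst con_snd con_id continuous_on_const continuous_on_add continuous_on_mult continuous_on_diff)
 qed auto
 moreover have "singular_relcycle p ?Q {} c" using c by (simp add: singular_cycle)
 ultimately have "homologous_rel p ?Q {} (chain_map p id c) (chain_map p ?k c)" by (rule homotopic_imp_homologous_rel_chain_maps)
 hence b1: "singular_relboundary p ?Q {} (c - chain_map p ?k c)" by (simp add: homologous_rel_def chain_map_ident[OF c(1)])
 have b2: "singular_relboundary p ?Q {} (chain_map p ?k c)"
 proof (cases "1 <= p")
  case True
  have k: "cmap ?Q (subtopology ?Q {a}) ?k" using a by simp
  have "singular_relcycle p (subtopology ?Q {a}) {} (chain_map p ?k c)"
   using singular_chain_chain_map[OF c(1) k] chain_boundary_chain_map[OF c(1), of ?k] c(2) by (simp add: singular_cycle)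
  moreover have "ts (subtopology ?Q {a}) = {a}" using a by auto
  ultimately have "singular_relboundary p (subtopology ?Q {a}) {} (chain_map p ?k c)"
   using singular_boundary_eq_cycle_singleton[of "subtopology ?Q {a}" a p] True by auto
  thus ?thesis unfolding singular_boundary using singular_chain_subtopology by blast
 next
  case False
  thus ?thesis using p by simp
 qed
 show ?thesis using singular_relboundary_add[OF b1 b2] by (simp add: singular_boundary)
qed

lemma frag_cmul_minus_r: "frag_cmul c (a - b) = frag_cmul c a - frag_cmul c b" using frag_cmul_distrib2[of c "a - b" b] by simp

text \<open>The cancellation that makes the square of an alternating face sum vanish: the pairs
  \<open>(i, j)\<close> and \<open>(j + 1, i)\<close> carry opposite signs.\<close>

lemma alt_dbl_sum:
 fixes a :: "nat => nat => 's \<Rightarrow>\<^sub>0 int"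
 assumes a: "!!i j. i <= j ==> j <= n ==> a (Suc j) i = a i j"
 shows "(\<Sum>k\<le>Suc n. \<Sum>j\<le>n. frag_cmul ((-1) ^ (k + j)) (a k j)) = 0"
proof -
 let ?f = "%(k, j). frag_cmul ((-1) ^ (k + j)) (a k j)"
 let ?L = "{(i, j). i <= j & j <= n}"
 have L: "finite ?L" by (rule fin_sub[of _ "{..n} >< {..n}"]) auto
 have split: "{..Suc n} >< {..n} = ?L Un (%(i, j). (Suc j, i)) ` ?L"
 proof (intro Set.set_eqI iffI)
  fix z
  assume z: "z : {..Suc n} >< {..n}"
  show "z : ?L Un (%(i, j). (Suc j, i)) ` ?L"
  proof (cases "fst z <= snd z")
  case False
  hence "z = (%(i, j). (Suc j, i)) (snd z, fst z - 1)" "(snd z, fst z - 1) : ?L" using z by auto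
  thus ?thesis by blast
  qed (use z in auto)
 qed auto
 have "(\<Sum>k\<le>Suc n. \<Sum>j\<le>n. frag_cmul ((-1) ^ (k + j)) (a k j)) = sum ?f ({..Suc n} >< {..n})" by (rule sum.cartesian_product)
 also have "... = sum ?f ?L + sum ?f ((%(i, j). (Suc j, i)) ` ?L)" unfolding split
 proof (rule sum.union_disjoint[OF L finite_imageI[OF L]])
  have "snd z < fst z" if "z : (%(i, j). (Suc j, i)) ` ?L" for z using that by auto
  moreover have "fst z <= snd z" if "z : ?L" for z using that by auto
  ultimately show "?L Int (%(i, j). (Suc j, i)) ` ?L = {}" by auto
 qed
 also have "sum ?f ((%(i, j). (Suc j, i)) ` ?L) = (\<Sum>z\<in>?L. - ?f z)"
 proof (subst sum.reindex)
  show "inj_on (%(i, j). (Suc j, i)) ?L" by (auto simp: inj_on_def)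
  show "sum (?f o (%(i, j). (Suc j, i))) ?L = (\<Sum>z\<in>?L. - ?f z)"
  proof (rule sum.cong[OF refl])
  fix z
  assume "z : ?L"
  then obtain i j where z: "z = (i, j)" "i <= j" "j <= n" by blast
  have "(-1 :: int) ^ (Suc j + i) = - ((-1) ^ (i + j))" by (simp add: add.commute)
  thus "(?f o (%(i, j). (Suc j, i))) z = - ?f z" by (simp add: z a[OF z(2,3)])
  qed
 qed
 finally show ?thesis by (simp add: sum_negf)
qed

definition cyl_face :: "nat => ptx >< real => ptx >< real" where "cyl_face k z = (sface k (fst z), snd z)"

definition cyl_end :: "nat => real => ptx => ptx >< real" where "cyl_end n t = (\<lambda>x\<in>std n. (x, t))"

lemma cont_map_cyl_face: "k <= Suc n ==> cmap (cyl n) (cyl (Suc n)) (cyl_face k)" using face_in_spx[of k n]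
 by (auto simp: cyl_face_def intro!: con_Pair cont_on_spl_face con_fst con_snd)

lemma sing_spx_cyl_end: "t : {0..1} ==> sing n (cyl n) (cyl_end n t)"
proof -
 assume t: "t : {0..1}"
 have "cmap (tp (std n)) (cyl n) (%x. (x, t))" using t by (auto intro!: con_Pair)
 hence "cmap (tp (std n)) (cyl n) (cyl_end n t)" by (rule cm_eq) (simp add: cyl_end_def)
 thus ?thesis by (simp add: sing_spx_cmap cyl_end_def)
qed

lemma face_cyl_end: "k <= Suc n ==> fce (Suc n) k (cyl_end (Suc n) t) = simplex_map n (cyl_face k) (cyl_end n t)"
 by (rule ext) (auto simp: singular_face_def simplex_map_def cyl_end_def cyl_face_def face_in_spx)

lemma ch_map_ch_map: "chain_map p g (chain_map p f c) = chain_map p (g o f) c" by (simp add: chain_map_compose)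

text \<open>The method of acyclic models instead of an explicit triangulation: top minus bottom
  minus the sides is a cycle because the sides are prisms already constructed, and a cycle on the
  cylinder bounds.\<close>

lemma prism_chains:
 obtains P where "!!n. singular_chain (Suc n) (cyl n) (P n)" "bnd (Suc 0) (P 0) = frag_of (cyl_end 0 1) - frag_of (cyl_end 0 0)" "!!n. bnd (Suc (Suc n)) (P (Suc n)) = frag_of (cyl_end (Suc n) 1) - frag_of (cyl_end (Suc n) 0) - (\<Sum>k\<le>Suc n. frag_cmul ((-1) ^ k) (chain_map (Suc n) (cyl_face k) (P n)))"
proof -
 \<comment> \<open>The cylinder over a vertex has no side faces, hence the value 0 for
   \<open>n = 0\<close>.\<close>
 define side where "side Q n = (case n of 0 => 0 | Suc m => \<Sum>k\<le>Suc m. frag_cmul ((-1) ^ k) (chain_map (Suc m) (cyl_face k) Q))" for Q :: "(ptx => ptx >< real) \<Rightarrow>\<^sub>0 int" and n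
 have sideS: "side Q (Suc m) = (\<Sum>k\<le>Suc m. frag_cmul ((-1) ^ k) (chain_map (Suc m) (cyl_face k) Q))" for Q m by (simp add: side_def)
 define rhs where "rhs Q n = frag_of (cyl_end n 1) - frag_of (cyl_end n 0) - side Q n" for Q n
 define good where "good Q n R <-> singular_chain (Suc n) (cyl n) R & bnd (Suc n) R = rhs Q n" for Q n R
 define P where "P = rec_nat (SOME R. good 0 0 R) (%n Q. SOME R. good Q (Suc n) R)"
 have P0: "P 0 = (SOME R. good 0 0 R)" and PS: "P (Suc n) = (SOME R. good (P n) (Suc n) R)" for n by (simp_all add: P_def)
 define prev where "prev n = (case n of 0 => 0 | Suc m => P m)" for n
 have ends: "singular_chain n (cyl n) (frag_of (cyl_end n 1) - frag_of (cyl_end n 0))" for n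
  by (intro singular_chain_diff) (simp_all add: singular_chain_of sing_spx_cyl_end)
 have ex0: "EX R. good 0 0 R"
 proof -
  define a where "a = ((%j. if j = 0 then 1 else 0 :: real) :: nat => real, 0 :: real)"
  have a: "a : std 0 >< {0..1}" by (simp add: a_def)
  \<comment> \<open>In degree zero the difference of the two ends bounds because both collapse to
    the same point.\<close>
  have "simplex_map 0 (%_. a) (cyl_end 0 1) = simplex_map 0 (%_. a) (cyl_end 0 0)" by (auto simp: simplex_map_def)
  hence "chain_map 0 (%_. a) (frag_of (cyl_end 0 1) - frag_of (cyl_end 0 0)) = 0" by (simp add: chain_map_diff)
  with cyl_cycle_bd[OF ends[of 0] _ a] show ?thesis by (simp add: good_def rhs_def side_def chain_boundary_def)
 qed
 have exS: "EX R. good (P n) (Suc n) R" if g: "good (prev n) n (P n)" for n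
 proof -
  let ?F = "cyl_face" and ?E = "frag_of (cyl_end n 1) - frag_of (cyl_end n 0)"
  have Pn: "singular_chain (Suc n) (cyl n) (P n)" "bnd (Suc n) (P n) = ?E - side (prev n) n" using g by (auto simp: good_def rhs_def)
  have ch: "singular_chain (Suc n) (cyl (Suc n)) (rhs (P n) (Suc n))" unfolding rhs_def side_def
   by (auto intro!: singular_chain_diff[OF ends] singular_chain_sum singular_chain_cmul singular_chain_chain_map[OF Pn(1)] cont_map_cyl_face simp del: sum.atMost_Suc)
  have dE: "bnd (Suc n) (frag_of (cyl_end (Suc n) t)) = (\<Sum>k\<le>Suc n. frag_cmul ((-1) ^ k) (chain_map n (?F k) (frag_of (cyl_end n t))))" for t
   by (simp add: chain_boundary_of face_cyl_end)
  have "bnd (Suc n) (side (P n) (Suc n)) = (\<Sum>k\<le>Suc n. frag_cmul ((-1) ^ k) (chain_map n (?F k) (?E - side (prev n) n)))"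
   by (simp add: sideS chain_boundary_sum chain_boundary_cmul chain_boundary_chain_map[OF Pn(1)] Pn(2) del: sum.atMost_Suc)
  hence "bnd (Suc n) (rhs (P n) (Suc n)) = (\<Sum>k\<le>Suc n. frag_cmul ((-1) ^ k) (chain_map n (?F k) (side (prev n) n)))"
   unfolding rhs_def chain_boundary_diff dE by (simp add: chain_map_diff frag_cmul_minus_r sum_subtractf)
  also have "... = 0"
  proof (cases n)
  case 0
  thus ?thesis by (simp add: side_def)
  next
  case (Suc m)
  have "(\<Sum>k\<le>Suc n. frag_cmul ((-1) ^ k) (chain_map n (?F k) (side (prev n) n))) = (\<Sum>k\<le>Suc n. \<Sum>j\<le>n. frag_cmul ((-1) ^ (k + j)) (chain_map n (?F k o ?F j) (P m)))"
   using Suc by (simp add: side_def prev_def chain_map_sum ch_map_ch_map frag_cmul_sum power_add del: sum.atMost_Suc)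
  also have "... = 0"
  proof (rule alt_dbl_sum)
  fix i j :: nat
  assume "i <= j" "j <= n"
  hence "?F (Suc j) o ?F i = ?F i o ?F j" by (auto simp: cyl_face_def simplical_face_def fun_eq_iff)
  thus "chain_map n (?F (Suc j) o ?F i) (P m) = chain_map n (?F i o ?F j) (P m)" by simp
  qed
  finally show ?thesis .
  qed
  finally have "bnd (Suc n) (rhs (P n) (Suc n)) = 0" .
  moreover obtain a where "a : std (Suc n) >< {0..1::real}" using nonempty_standard_simplex[of "Suc n"] by force
  ultimately show ?thesis using cyl_cycle_bd[OF ch] by (simp add: good_def)
 qed
 have g: "good (prev n) n (P n)" for n
 proof (induction n)
  case 0
  thus ?case using someI_ex[OF ex0] by (simp add: P0 prev_def)
 next
  case (Suc n)
  thus ?case using someI_ex[OF exS[OF Suc]] by (simp add: PS prev_def)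
 qed
 show thesis
 proof (rule that[of P])
  show "singular_chain (Suc n) (cyl n) (P n)" for n using g[of n] by (simp add: good_def)
  show "bnd (Suc 0) (P 0) = frag_of (cyl_end 0 1) - frag_of (cyl_end 0 0)" using g[of 0] by (simp add: good_def rhs_def side_def)
  show "bnd (Suc (Suc n)) (P (Suc n)) = frag_of (cyl_end (Suc n) 1) - frag_of (cyl_end (Suc n) 0) - (\<Sum>k\<le>Suc n. frag_cmul ((-1) ^ k) (chain_map (Suc n) (cyl_face k) (P n)))" for n
   using g[of "Suc n"] by (simp add: good_def rhs_def side_def prev_def)
 qed
qed

context coeff begin

text \<open>Evaluating a cocycle on the images of the prisms gives a cochain whose coboundary is the
  difference of the two pullbacks. The boundary formula for the prism contributes the faces, and the
  cocycle vanishes on the boundary of the image.\<close>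

lemma cch_htp:
 fixes H :: "nat => (ptx => 'w) => ptx >< real => 'z"
 assumes H: "!!n sg. sing n W sg ==> cmap (cyl n) Z (H n sg)" and Hf: "!!n sg k y t. sing (Suc n) W sg ==> k <= Suc n ==> y : std n ==> t : {0..1} ==> H (Suc n) sg (sface k y, t) = H n (fce (Suc n) k sg) (y, t)" and A: "!!n sg. sing n W sg ==> A n sg = (\<lambda>x\<in>std n. H n sg (x, 0))" and B: "!!n sg. sing n W sg ==> B n sg = (\<lambda>x\<in>std n. H n sg (x, 1))" and c: "c : ccy K Z p"
 shows "(%sg. pull K W p (B p) c sg \<ominus> pull K W p (A p) c sg) : cbd K W p"
proof -
 obtain P where P: "!!n. singular_chain (Suc n) (cyl n) (P n)" "bnd (Suc 0) (P 0) = frag_of (cyl_end 0 1) - frag_of (cyl_end 0 0)" "!!n. bnd (Suc (Suc n)) (P (Suc n)) = frag_of (cyl_end (Suc n) 1) - frag_of (cyl_end (Suc n) 0) - (\<Sum>k\<le>Suc n. frag_cmul ((-1) ^ k) (chain_map (Suc n) (cyl_face k) (P n)))"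
  by (rule prism_chains) blast
 have cc: "c : car (cch K Z p)" and cz: "!!z. singular_chain (Suc p) Z z ==> ceval K c (bnd (Suc p) z) = \<zero>" using c by (simp_all add: ccy_iff)
 note cU = cch_UNIV[OF cc]
 have ends: "c (B p sg) \<ominus> c (A p sg) = ceval K c (chain_map p (H p sg) (frag_of (cyl_end p 1) - frag_of (cyl_end p 0)))" if sg: "sing p W sg" for sg
 proof -
  have "simplex_map p (H p sg) (cyl_end p 1) = B p sg" "simplex_map p (H p sg) (cyl_end p 0) = A p sg" unfolding A[OF sg] B[OF sg]
   by (auto simp: simplex_map_def cyl_end_def)
  thus ?thesis by (simp add: chain_map_diff ceval_diff[OF cU] ceval_hom(2)[OF cU])
 qed
 have bd: "ceval K c (chain_map p (H p sg) (bnd (Suc p) (P p))) = \<zero>" if sg: "sing p W sg" for sg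
  using cz[OF singular_chain_chain_map[OF P(1) H[OF sg]]] chain_boundary_chain_map[OF P(1), of p "H p sg"] by simp
 show ?thesis
 proof (cases p)
  case 0
  have "pull K W p (B p) c sg \<ominus> pull K W p (A p) c sg = \<zero>" for sg using ends[of sg] bd[of sg] P(2) 0 by (simp add: pull_def)
  thus ?thesis using 0 by simp
 next
  case (Suc m)
  \<comment> \<open>The prism over an \<open>m\<close>-simplex has dimension \<open>m + 1\<close>,
    so it can be paired with \<open>c\<close>; this lowers the degree by one.\<close>
  define D where "D sg = (if sing m W sg then ceval K c (chain_map (Suc m) (H m sg) (P m)) else \<zero>)" for sg
  have D: "D : car (cch K W m)" using ceval_cl[OF cU] by (simp add: cch_iff D_def)
  have "pull K W p (B p) c sg \<ominus> pull K W p (A p) c sg = cob K W m D sg" for sg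
  proof (cases "sing (Suc m) W sg")
  case True
  hence sg: "sing p W sg" using Suc by simp
  let ?S = "\<Sum>k\<le>Suc m. frag_cmul ((-1) ^ k) (chain_map (Suc m) (cyl_face k) (P m))"
  have e: "frag_of (cyl_end p 1) - frag_of (cyl_end p 0) = bnd (Suc p) (P p) + ?S" using P(3)[of m] Suc by simp
  have face: "chain_map p (H p sg) (chain_map (Suc m) (cyl_face k) (P m)) = chain_map (Suc m) (H m (fce (Suc m) k sg)) (P m)" if "k <= Suc m" for k
  proof -
  have "chain_map (Suc m) (H (Suc m) sg o cyl_face k) (P m) = chain_map (Suc m) (H m (fce (Suc m) k sg)) (P m)"
   by (rule chain_map_eq[OF P(1)]) (auto simp: cyl_face_def Hf[OF True that])
  thus ?thesis using Suc by (simp add: ch_map_ch_map)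
  qed
  have "c (B p sg) \<ominus> c (A p sg) = ceval K c (chain_map p (H p sg) ?S)"
   unfolding ends[OF sg] e chain_map_add ceval_add[OF cU] bd[OF sg] using ceval_cl[OF cU] by simp
  also have "chain_map p (H p sg) ?S = (\<Sum>k\<le>Suc m. frag_cmul ((-1) ^ k) (chain_map (Suc m) (H m (fce (Suc m) k sg)) (P m)))" using face
   by (simp add: chain_map_sum del: sum.atMost_Suc)
  also have "ceval K c ... = (\<Oplus>k\<in>{..Suc m}. (\<ominus> \<one>) [^] k \<otimes> ceval K c (chain_map (Suc m) (H m (fce (Suc m) k sg)) (P m)))"
   by (simp add: ceval_sum[OF cU] ceval_sign[OF cU] del: sum.atMost_Suc)
  also have "... = (\<Oplus>k\<in>{..Suc m}. (\<ominus> \<one>) [^] k \<otimes> D (fce (Suc m) k sg))" using sing_spx_face[OF True] ceval_cl[OF cU]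
   by (intro finsum_cong') (auto simp: D_def)
  finally show ?thesis using True sg by (simp add: coboundary_map_def pull_def)
  next
  case False
  thus ?thesis using Suc by (simp add: coboundary_map_def pull_def)
  qed
  thus ?thesis using D Suc by auto
 qed
qed

text \<open>The map \<open>r\<close> of \<open>lift_simplices\<close> induces the inverse; both
  composites are the identity up to coboundaries by \<open>cch_htp\<close>, with the homotopies
  \<open>h\<close> on \<open>Y\<close> and \<open>L\<close> on \<open>X\<close>.\<close>

lemma coh_map_bij:
 assumes "whe X Y f"
 shows "bij_betw (coh_map K X p f) (car (coh K Y p)) (car (coh K X p))"
proof -
 interpret weak_eq X Y f by (rule weak_eq.intro) fact
 let ?f = "%p. simplex_map p f"
 obtain r h where r: "!!n sg. sing n Y sg ==> sing n X (r n sg)" "!!n sg k. sing (Suc n) Y sg ==> k <= Suc n ==> fce (Suc n) k (r (Suc n) sg) = r n (fce (Suc n) k sg)" and h: "!!n sg. sing n Y sg ==> cmap (cyl n) Y (h n sg)" "!!n sg x. sing n Y sg ==> x : std n ==> h n sg (x, 0) = sg x" "!!n sg x. sing n Y sg ==> x : std n ==> h n sg (x, 1) = f (r n sg x)" "!!n sg k y t. sing (Suc n) Y sg ==> k <= Suc n ==> y : std n ==> t : {0..1} ==> h (Suc n) sg (sface k y, t) = h n (fce (Suc n) k sg) (y, t)"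
  by (rule lift_simplices) blast
 obtain L where L: "!!n ta. sing n X ta ==> cmap (cyl n) X (L n ta)" "!!n ta x. sing n X ta ==> x : std n ==> L n ta (x, 0) = ta x" "!!n ta x. sing n X ta ==> x : std n ==> L n ta (x, 1) = r n (simplex_map n f ta) x" "!!n ta k y t. sing (Suc n) X ta ==> k <= Suc n ==> y : std n ==> t : {0..1} ==> L (Suc n) ta (sface k y, t) = L n (fce (Suc n) k ta) (y, t)"
  using lift_simplices_htp[OF r h] by blast
 have rs: "ss_map Y X r" using r by (simp add: ss_map_def)
 have fs: "ss_map X Y ?f" by (rule ss_map_spx_map[OF cont])
 have rext: "r n sg : extensional (std n)" and sext: "sg : extensional (std n)" if "sing n Y sg" for n sg using that r(1)[OF that]
  by (simp_all add: sing_spx_cmap)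
 have Yh: "cls K Y p (pull K Y p (r p) (pull K X p (?f p) c)) = cls K Y p c" if c: "c : ccy K Y p" for c
 proof -
  have "(%sg. pull K Y p (%sg. ?f p (r p sg)) c sg \<ominus> pull K Y p (%sg. sg) c sg) : cbd K Y p"
  proof (rule cch_htp[OF h(1) h(4), where A = "%n sg. sg" and B = "%n sg. ?f n (r n sg)" and c = c])
  fix n sg
  assume sg: "sing n Y sg"
  show "sg = (\<lambda>x\<in>std n. h n sg (x, 0))" by (rule extensionalityI[OF sext[OF sg]]) (auto simp: h(2)[OF sg])
  show "?f n (r n sg) = (\<lambda>x\<in>std n. h n sg (x, 1))" by (auto simp: simplex_map_def h(3)[OF sg])
  qed (use c in auto)
  moreover have "pull K Y p (%sg. ?f p (r p sg)) c = pull K Y p (r p) (pull K X p (?f p) c)" using r(1) by (auto simp: pull_def)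
  moreover have "pull K Y p (%sg. sg) c = c" using ccy_cch[OF c] by (auto simp: pull_def fun_eq_iff cch_iff)
  ultimately show ?thesis using coh_class_eq_iff[OF pull_ccy[OF rs pull_ccy[OF fs c]] c] by simp
 qed
 have Xh: "cls K X p (pull K X p (?f p) (pull K Y p (r p) c)) = cls K X p c" if c: "c : ccy K X p" for c
 proof -
  have "(%sg. pull K X p (%sg. r p (?f p sg)) c sg \<ominus> pull K X p (%sg. sg) c sg) : cbd K X p"
  proof (rule cch_htp[OF L(1) L(4), where A = "%n sg. sg" and B = "%n sg. r n (?f n sg)" and c = c])
  fix n sg
  assume sg: "sing n X sg"
  have ext: "sg : extensional (std n)" using sg by (simp add: sing_spx_cmap)
  show "sg = (\<lambda>x\<in>std n. L n sg (x, 0))" by (rule extensionalityI[OF ext]) (auto simp: L(2)[OF sg])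
  show "r n (?f n sg) = (\<lambda>x\<in>std n. L n sg (x, 1))" by (rule extensionalityI[OF rext[OF sing_map[OF sg cont]]]) (auto simp: L(3)[OF sg])
  qed (use c in auto)
  moreover have "pull K X p (%sg. r p (?f p sg)) c = pull K X p (?f p) (pull K Y p (r p) c)" using sing_map[OF _ cont] by (auto simp: pull_def)
  moreover have "pull K X p (%sg. sg) c = c" using ccy_cch[OF c] by (auto simp: pull_def fun_eq_iff cch_iff)
  ultimately show ?thesis using coh_class_eq_iff[OF pull_ccy[OF fs pull_ccy[OF rs c]] c] by simp
 qed
 note cm = coh_map_class[OF cont, unfolded cch_pb_eq]
 show ?thesis unfolding bij_betw_def
 proof
  show "inj_on (coh_map K X p f) (car (coh K Y p))"
  proof (rule inj_onI)
  fix a b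
  assume "a : car (coh K Y p)" "b : car (coh K Y p)" and e: "coh_map K X p f a = coh_map K X p f b"
  then obtain c d where cd: "c : ccy K Y p" "a = cls K Y p c" "d : ccy K Y p" "b = cls K Y p d" by (auto simp: car_coh)
  have "(%sg. pull K X p (?f p) c sg \<ominus> pull K X p (?f p) d sg) : cbd K X p"
   using e cd coh_class_eq_iff[OF pull_ccy[OF fs cd(1)] pull_ccy[OF fs cd(3)]] by (simp add: cm)
  from pull_cob[OF rs this] have "cls K Y p (pull K Y p (r p) (pull K X p (?f p) c)) = cls K Y p (pull K Y p (r p) (pull K X p (?f p) d))"
   using coh_class_eq_iff[OF pull_ccy[OF rs pull_ccy[OF fs cd(1)]] pull_ccy[OF rs pull_ccy[OF fs cd(3)]]] by (simp add: pull_minus)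
  thus "a = b" using Yh cd by simp
  qed
  show "coh_map K X p f ` car (coh K Y p) = car (coh K X p)"
  proof
  show "coh_map K X p f ` car (coh K Y p) <= car (coh K X p)" using lin_map_cl[OF vs_coh vs_coh coh_map_lin_map[OF cont]] by blast
  show "car (coh K X p) <= coh_map K X p f ` car (coh K Y p)"
  proof
  fix a
  assume "a : car (coh K X p)"
  then obtain c where c: "c : ccy K X p" "a = cls K X p c" by (auto simp: car_coh)
  have "a = coh_map K X p f (cls K Y p (pull K Y p (r p) c))" using c Xh[OF c(1)] cm[OF pull_ccy[OF rs c(1)]] by simp
  thus "a : coh_map K X p f ` car (coh K Y p)" using pull_ccy[OF rs c(1)] by simp
  qed
  qed
 qed
qed

end

section \<open>The cup product\<close>

definition spx_shift :: "nat => ptx => nat => real" where "spx_shift p x = (%i. if i < p then 0 else x (i - p))"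

lemma back_face_eq: "back_face p q sg = restrict (sg o spx_shift p) (std q)" by (simp add: back_face_def spx_shift_def[abs_def])

lemma spx_shift_in: "x : std q ==> spx_shift p x : std (p + q)"
proof -
 assume x: "x : std q"
 have "(\<Sum>i\<le>p + q. spx_shift p x i) = (\<Sum>i\<in>{p..p + q}. spx_shift p x i)" by (rule sum.mono_neutral_right) (auto simp: spx_shift_def)
 also have "... = (\<Sum>i\<le>q. spx_shift p x (i + p))" using sum.shift_bounds_cl_nat_ivl[of "spx_shift p x" 0 p q]
  by (simp add: atLeast0AtMost add.commute)
 finally show ?thesis using x by (auto simp: standard_simplex_def spx_shift_def)
qed

lemma front_in: "x : std p ==> x : std (p + q)" using standard_simplex_mono[of p "p + q"] by auto

lemma sing_spx_front: "sing (p + q) X sg ==> sing p X (front_face p sg)"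
proof -
 assume "sing (p + q) X sg"
 hence "cmap (tp (std (p + q))) X sg" by (simp add: sing_spx_cmap)
 hence "cmap (tp (std p)) X (%x. sg x)" by (rule cmap_comp[of _ _ _ _ "%x. x"]) (use front_in in \<open>auto \<close>)
 thus ?thesis by (simp add: sing_spx_cmap front_face_def)
qed

lemma cont_on_spx_shift: "con S (spx_shift p)"
proof (rule con_coordwise)
 show "con S (%x. spx_shift p x i)" for i by (cases "i < p") (simp_all add: spx_shift_def cont_on_comp)
qed

lemma sing_spx_back: "sing (p + q) X sg ==> sing q X (back_face p q sg)"
proof -
 assume "sing (p + q) X sg"
 hence "cmap (tp (std (p + q))) X sg" by (simp add: sing_spx_cmap)
 hence "cmap (tp (std q)) X (%x. sg (spx_shift p x))" by (rule cmap_comp[OF _ cont_on_spx_shift]) (use spx_shift_in in auto)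
 hence "cmap (tp (std q)) X (back_face p q sg)" by (rule cm_eq) (simp add: back_face_eq)
 thus ?thesis by (simp add: sing_spx_cmap back_face_eq)
qed

lemma front_face_face:
 assumes "k <= p"
 shows "front_face p (fce (Suc (p + q)) k sg) = fce (Suc p) k (front_face (Suc p) sg)" using assms face_in_spx[of k p] front_in[of _ p q]
 by (intro ext) (auto simp: front_face_def singular_face_def)

lemma back_face_face:
 assumes "k <= p"
 shows "back_face p q (fce (Suc (p + q)) k sg) = back_face (Suc p) q sg"
proof -
 have "sface k (spx_shift p x) = spx_shift (Suc p) x" for x using assms by (auto simp: simplical_face_def spx_shift_def fun_eq_iff)
 thus ?thesis using spx_shift_in[of _ q p] by (intro ext) (auto simp: back_face_eq singular_face_def)
qed

lemma front_face_face':
 assumes "p < k"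
 shows "front_face p (fce (Suc (p + q)) k sg) = front_face p sg"
proof -
 have "sface k x = x" if "x : std p" for x :: "nat => real" using assms that by (auto simp: simplical_face_def standard_simplex_def)
 thus ?thesis using front_in[of _ p q] by (intro ext) (auto simp: front_face_def singular_face_def)
qed

lemma back_face_face': "k <= Suc q ==> back_face p q (fce (Suc (p + q)) (p + k) sg) = fce (Suc q) k (back_face p (Suc q) sg)"
proof -
 assume k: "k <= Suc q"
 have "sface (p + k) (spx_shift p x) = spx_shift p (sface k x)" for x by (auto simp: simplical_face_def spx_shift_def fun_eq_iff)
 thus ?thesis using spx_shift_in[of _ q p] face_in_spx[OF k] by (intro ext) (auto simp: back_face_eq singular_face_def)
qed

lemma face_front_last: "fce (Suc p) (Suc p) (front_face (Suc p) sg) = front_face p sg"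
proof -
 have "sface (Suc p) x = x" if "x : std p" for x :: "nat => real" using that by (auto simp: simplical_face_def standard_simplex_def)
 thus ?thesis using front_in[of _ p 1] by (intro ext) (auto simp: front_face_def singular_face_def)
qed

lemma face_back_first: "fce (Suc q) 0 (back_face p (Suc q) sg) = back_face (Suc p) q sg"
proof -
 have "spx_shift p (sface 0 x) = spx_shift (Suc p) x" for x by (auto simp: simplical_face_def spx_shift_def)
 thus ?thesis using face_in_spx[of 0 q] by (intro ext) (auto simp: back_face_eq singular_face_def)
qed

context coeff begin

lemma finsum_split_Suc:
 fixes t :: "nat => 'k"
 assumes t: "!!k. t k : car K"
 shows "(\<Oplus>k\<in>{..Suc (p + q)}. t k) = (\<Oplus>k\<in>{..p}. t k) \<oplus> (\<Oplus>j\<in>{..q}. t (Suc (p + j)))"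
proof (induction q)
 case 0
 thus ?case using t by (simp add: a_comm)
next
 case (Suc q)
 have "(\<Oplus>k\<in>{..Suc (p + Suc q)}. t k) = t (Suc (p + Suc q)) \<oplus> ((\<Oplus>k\<in>{..p}. t k) \<oplus> (\<Oplus>j\<in>{..q}. t (Suc (p + j))))"
  using t Suc by simp
 also have "... = (\<Oplus>k\<in>{..p}. t k) \<oplus> (t (Suc (p + Suc q)) \<oplus> (\<Oplus>j\<in>{..q}. t (Suc (p + j))))" using t
  by (intro a_lcomm) auto
 also have "t (Suc (p + Suc q)) \<oplus> (\<Oplus>j\<in>{..q}. t (Suc (p + j))) = (\<Oplus>j\<in>{..Suc q}. t (Suc (p + j)))" using t by simp
 finally show ?case .
qed

lemma sign_square: "(\<ominus> \<one>) [^] (p::nat) \<otimes> (\<ominus> \<one>) [^] p = \<one>"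
proof (induction p)
 case (Suc p)
 show ?case using Suc by (simp add: l_minus r_minus)
qed simp

text \<open>The faces of a simplex of dimension \<open>p + q + 1\<close> split into those that omit
  one of the vertices 0 to \<open>p\<close>, which change the front, and the others, which change
  the back. Completing both sums adds two terms that cancel.\<close>

lemma leibniz:
 assumes c: "c : car (cch K X p)" and d: "d : car (cch K X q)"
 shows "cob K X (p + q) (ccup K X p q c d) = (%sg. ccup K X (Suc p) q (cob K X p c) d sg \<oplus> (\<ominus> \<one>) [^] p \<otimes> ccup K X p (Suc q) c (cob K X q d) sg)"
proof
 fix sg
 let ?s = "%k::nat. (\<ominus> \<one>) [^] k"
 show "cob K X (p + q) (ccup K X p q c d) sg = ccup K X (Suc p) q (cob K X p c) d sg \<oplus> ?s p \<otimes> ccup K X p (Suc q) c (cob K X q d) sg"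
 proof (cases "sing (Suc (p + q)) X sg")
  case False
  thus ?thesis by (simp add: coboundary_map_def cochain_cup_def)
 next
  case True
  note cc = cch_cl[OF c] and dc = cch_cl[OF d]
  let ?d0 = "d (back_face (Suc p) q sg)" and ?c0 = "c (front_face p sg)"
  define u where "u k = ?s k \<otimes> (c (fce (Suc p) k (front_face (Suc p) sg)) \<otimes> ?d0)" for k
  define v where "v j = ?s p \<otimes> (?s j \<otimes> (?c0 \<otimes> d (fce (Suc q) j (back_face p (Suc q) sg))))" for j
  define t where "t k = ?s k \<otimes> (c (front_face p (fce (Suc (p + q)) k sg)) \<otimes> d (back_face p q (fce (Suc (p + q)) k sg)))" for k
  have cl [simp]: "u k : car K" "v k : car K" "t k : car K" for k using cc dc by (simp_all add: u_def v_def t_def)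
  have "cob K X (p + q) (ccup K X p q c d) sg = (\<Oplus>k\<in>{..Suc (p + q)}. t k)"
   using True sing_spx_face[OF True] cc dc unfolding coboundary_map_def t_def by (simp only: if_True) (intro finsum_cong', auto simp: cochain_cup_def)
  also have "... = (\<Oplus>k\<in>{..p}. t k) \<oplus> (\<Oplus>j\<in>{..q}. t (Suc (p + j)))" by (rule finsum_split_Suc) simp
  also have "(\<Oplus>k\<in>{..p}. t k) = (\<Oplus>k\<in>{..p}. u k)" using cc dc
   by (intro finsum_cong') (auto simp: t_def u_def front_face_face back_face_face)
  also have "(\<Oplus>j\<in>{..q}. t (Suc (p + j))) = (\<Oplus>j\<in>{..q}. v (Suc j))"
  proof (intro finsum_cong')
  fix j
  assume "j : {..q}"
  hence "back_face p q (fce (Suc (p + q)) (Suc (p + j)) sg) = fce (Suc q) (Suc j) (back_face p (Suc q) sg)" using back_face_face'[of "Suc j" q p sg]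
   by simp
  moreover have "?s (Suc (p + j)) = ?s p \<otimes> ?s (Suc j)" using nat_pow_mult[of "\<ominus> \<one>" p "Suc j"] by simp
  ultimately show "t (Suc (p + j)) = v (Suc j)" using cc dc by (simp add: t_def v_def front_face_face' m_assoc)
  qed auto
  also have "(\<Oplus>k\<in>{..p}. u k) \<oplus> (\<Oplus>j\<in>{..q}. v (Suc j)) = (\<Oplus>k\<in>{..Suc p}. u k) \<oplus> (\<Oplus>j\<in>{..Suc q}. v j)"
  proof -
  \<comment> \<open>The added terms: omitting the last vertex of the front and omitting the first
    vertex of the back give the same two faces, with opposite signs.\<close>
  have uv: "u (Suc p) = \<ominus> v 0" and u: "(\<Oplus>k\<in>{..Suc p}. u k) = u (Suc p) \<oplus> (\<Oplus>k\<in>{..p}. u k)" using cc dc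
   by (simp_all add: u_def v_def face_front_last face_back_first l_minus r_minus)
  have v: "(\<Oplus>j\<in>{..Suc q}. v j) = (\<Oplus>j\<in>{..q}. v (Suc j)) \<oplus> v 0" by (rule finsum_Suc2) simp
  have alg: "a \<oplus> b = (\<ominus> x \<oplus> a) \<oplus> (b \<oplus> x)" if "a : car K" "b : car K" "x : car K" for a b x using that
   by (simp add: a_ac r_neg)
  show ?thesis unfolding u v uv by (rule alg) auto
  qed
  also have "(\<Oplus>k\<in>{..Suc p}. u k) = cob K X p c (front_face (Suc p) sg) \<otimes> ?d0"
  proof -
  have "(\<Oplus>k\<in>{..Suc p}. u k) = (\<Oplus>k\<in>{..Suc p}. ?s k \<otimes> c (fce (Suc p) k (front_face (Suc p) sg)) \<otimes> ?d0)" using cc dc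
   by (intro finsum_cong') (auto simp: u_def m_assoc)
  also have "... = (\<Oplus>k\<in>{..Suc p}. ?s k \<otimes> c (fce (Suc p) k (front_face (Suc p) sg))) \<otimes> ?d0" using cc dc
   by (intro finsum_ldistr[symmetric]) auto
  finally show ?thesis using sing_spx_front[of "Suc p" q X sg] True by (simp add: coboundary_map_def)
  qed
  also have "(\<Oplus>j\<in>{..Suc q}. v j) = ?s p \<otimes> (?c0 \<otimes> cob K X q d (back_face p (Suc q) sg))"
  proof -
  have "(\<Oplus>j\<in>{..Suc q}. v j) = (\<Oplus>j\<in>{..Suc q}. (?s p \<otimes> ?c0) \<otimes> (?s j \<otimes> d (fce (Suc q) j (back_face p (Suc q) sg))))"
   using cc dc by (intro finsum_cong') (auto simp: v_def m_ac)
  also have "... = (?s p \<otimes> ?c0) \<otimes> (\<Oplus>j\<in>{..Suc q}. ?s j \<otimes> d (fce (Suc q) j (back_face p (Suc q) sg)))" using cc dc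
   by (intro finsum_rdistr[symmetric]) auto
  finally show ?thesis using sing_spx_back[of p "Suc q" X sg] True cc dc by (simp add: coboundary_map_def m_assoc)
  qed
  finally show ?thesis using True by (simp add: cochain_cup_def)
 qed
qed

lemma cup_cch: "c : car (cch K X p) ==> d : car (cch K X q) ==> ccup K X p q c d : car (cch K X (p + q))" by (auto simp: cch_iff cochain_cup_def)

lemma cup_zero: "d : car (cch K X q) ==> ccup K X p q (%sg. \<zero>) d = (%sg. \<zero>)" "c : car (cch K X p) ==> ccup K X p q c (%sg. \<zero>) = (%sg. \<zero>)"
 by (simp_all add: cochain_cup_def fun_eq_iff)

lemma cup_ccy:
 assumes c: "c : ccy K X p" and d: "d : ccy K X q"
 shows "ccup K X p q c d : ccy K X (p + q)"
proof -
 note cd = ccy_cch[OF c] ccy_cch[OF d]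
 have z: "cob K X p c = (%sg. \<zero>)" "cob K X q d = (%sg. \<zero>)" using c d by (simp_all add: cocycles_def)
 have "cob K X (p + q) (ccup K X p q c d) = (%sg. \<zero>)" unfolding leibniz[OF cd] z cup_zero(1)[OF cd(2)] cup_zero(2)[OF cd(1)] by simp
 thus ?thesis using cup_cch[OF cd] by (simp add: cocycles_def)
qed

lemma cup_cob_l:
 assumes c: "c : cbd K X p" and d: "d : ccy K X q"
 shows "ccup K X p q c d : cbd K X (p + q)"
proof (cases p)
 case 0
 have "submodule (cbd K X q) K (cch K X q)" by (rule cob_sub)
 thus ?thesis using 0 c cup_zero(1)[OF ccy_cch[OF d]] vspace.sub_zero[OF vs_cch] by simp
next
 case (Suc r)
 then obtain e where e: "e : car (cch K X r)" "c = cob K X r e" using c by auto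
 have d0: "cob K X q d = (%sg. \<zero>)" using d by (simp add: cocycles_def)
 have "ccup K X (Suc r) q c d = cob K X (r + q) (ccup K X r q e d)"
  unfolding leibniz[OF e(1) ccy_cch[OF d]] d0 e(2) cup_zero(2)[OF e(1)] using cup_cch[OF cob_cl[OF e(1)] ccy_cch[OF d]] by simp
 thus ?thesis using Suc cup_cch[OF e(1) ccy_cch[OF d]] by auto
qed

lemma cup_cob_r:
 assumes c: "c : ccy K X p" and d: "d : cbd K X q"
 shows "ccup K X p q c d : cbd K X (p + q)"
proof (cases q)
 case 0
 have "submodule (cbd K X p) K (cch K X p)" by (rule cob_sub)
 thus ?thesis using 0 d cup_zero(2)[OF ccy_cch[OF c]] vspace.sub_zero[OF vs_cch] by simp
next
 case (Suc r)
 then obtain e where e: "e : car (cch K X r)" "d = cob K X r e" using d by auto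
 have c0: "cob K X p c = (%sg. \<zero>)" using c by (simp add: cocycles_def)
 let ?cup = "ccup K X p (Suc r) c d"
 have cl: "?cup sg : car K" for sg using cup_cch[OF ccy_cch[OF c] cob_cl[OF e(1)]] e(2) by simp
 have "cob K X (p + r) (ccup K X p r c e) = (%sg. (\<ominus> \<one>) [^] p \<otimes> ?cup sg)"
  unfolding leibniz[OF ccy_cch[OF c] e(1)] c0 e(2)[symmetric] cup_zero(1)[OF e(1)] using cl by simp
 \<comment> \<open>The sign in \<open>leibniz\<close> is moved to the other side by multiplying with
   it once more.\<close>
 hence "?cup = (\<ominus> \<one>) [^] p .[cch K X (Suc (p + r))] cob K X (p + r) (ccup K X p r c e)" using cl
  by (simp add: m_assoc[symmetric] sign_square)
 also have "... : cbd K X (Suc (p + r))"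
  using module.submoduleE(4)[OF _ cob_sub[of X "Suc (p + r)"], of "(\<ominus> \<one>) [^] p"] vs_cch cup_cch[OF ccy_cch[OF c] e(1)]
  by (auto simp: vspace_def)
 finally show ?thesis using Suc by simp
qed

lemma cup_minus_l: "d : car (cch K X q) ==> c : car (cch K X p) ==> c' : car (cch K X p) ==> (%sg. ccup K X p q c d sg \<ominus> ccup K X p q c' d sg) = ccup K X p q (%sg. c sg \<ominus> c' sg) d"
 by (simp add: cochain_cup_def fun_eq_iff a_minus_def l_distr l_minus)

lemma cup_minus_r: "c : car (cch K X p) ==> d : car (cch K X q) ==> d' : car (cch K X q) ==> (%sg. ccup K X p q c d sg \<ominus> ccup K X p q c d' sg) = ccup K X p q c (%sg. d sg \<ominus> d' sg)"
 by (simp add: cochain_cup_def fun_eq_iff a_minus_def r_distr r_minus)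

lemma coh_cup_class:
 assumes c: "c : ccy K X p" and d: "d : ccy K X q"
 shows "coh_cup K X p q (cls K X p c) (cls K X q d) = cls K X (p + q) (ccup K X p q c d)"
proof -
 let ?r = "cls K X (p + q) (ccup K X p q c d)"
 have e: "cls K X (p + q) (ccup K X p q c' d') = ?r" if c'0: "c' : cls K X p c" and d'0: "d' : cls K X q d" for c' d'
 proof -
  have c': "c' : ccy K X p" "(%sg. c' sg \<ominus> c sg) : cbd K X p" and d': "d' : ccy K X q" "(%sg. d' sg \<ominus> d sg) : cbd K X q"
   using coh_class_memberD[OF c c'0] coh_class_eq_iff[OF _ c] coh_class_memberD[OF d d'0] coh_class_eq_iff[OF _ d] by auto
  have "cls K X (p + q) (ccup K X p q c' d') = cls K X (p + q) (ccup K X p q c d')"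
   using coh_class_eq_iff[OF cup_ccy[OF c'(1) d'(1)] cup_ccy[OF c d'(1)]] cup_cob_l[OF c'(2) d'(1)] cup_minus_l[OF ccy_cch[OF d'(1)] ccy_cch[OF c'(1)] ccy_cch[OF c]]
   by simp
  also have "... = ?r"
   using coh_class_eq_iff[OF cup_ccy[OF c d'(1)] cup_ccy[OF c d]] cup_cob_r[OF c d'(2)] cup_minus_r[OF ccy_cch[OF c] ccy_cch[OF d'(1)] ccy_cch[OF d]]
   by simp
  finally show ?thesis .
 qed
 have ne: "cls K X p c ~= {}" "cls K X q d ~= {}" using coh_class_mem c d by blast+
 show ?thesis unfolding coh_cup_def by (rule SUP_eq_const[OF ne(1)], rule SUP_eq_const[OF ne(2)], rule e)
qed

lemma coh_cup_cl: "a : car (coh K X p) ==> b : car (coh K X q) ==> coh_cup K X p q a b : car (coh K X (p + q))"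
 by (auto simp: car_coh coh_cup_class cup_ccy)

lemma coh_zero: "(zero (coh K X p)) = cls K X p (%sg. \<zero>)" and zero_cocycle: "(%sg. \<zero>) : ccy K X p"
proof -
 interpret Z: vspace K "zspace X p" by (rule vs_zspace)
 show "(%sg. \<zero>) : ccy K X p" using Z.M.zero_closed by simp
 thus "(zero (coh K X p)) = cls K X p (%sg. \<zero>)" using coh_class_zero_iff[of "%sg. \<zero>"] vspace.sub_zero[OF vs_cch cob_sub] by auto
qed

lemma coh_cup_zero: "b : car (coh K X q) ==> coh_cup K X p q (zero (coh K X p)) b = zero (coh K X (p + q))" "a : car (coh K X p) ==> coh_cup K X p q a (zero (coh K X q)) = zero (coh K X (p + q))"
 by (auto simp: car_coh coh_zero coh_cup_class zero_cocycle cup_zero ccy_cch)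

lemma coh_map_cup:
 assumes f: "cmap X Y f" and a: "a : car (coh K Y p)" and b: "b : car (coh K Y q)"
 shows "coh_map K X (p + q) f (coh_cup K Y p q a b) = coh_cup K X p q (coh_map K X p f a) (coh_map K X q f b)"
proof -
 obtain c d where c: "c : ccy K Y p" "a = cls K Y p c" and d: "d : ccy K Y q" "b = cls K Y q d" using a b by (auto simp: car_coh)
 have "cpb K X (p + q) f (ccup K Y p q c d) = ccup K X p q (cpb K X p f c) (cpb K X q f d)"
 proof
  fix sg
  have "front_face p (simplex_map (p + q) f sg) = simplex_map p f (front_face p sg)" using front_in[of _ p q]
   by (intro ext) (auto simp: front_face_def simplex_map_def)
  moreover have "back_face p q (simplex_map (p + q) f sg) = simplex_map q f (back_face p q sg)" using spx_shift_in[of _ q p]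
   by (intro ext) (auto simp: back_face_eq simplex_map_def)
  ultimately show "cpb K X (p + q) f (ccup K Y p q c d) sg = ccup K X p q (cpb K X p f c) (cpb K X q f d) sg"
   using sing_spx_front[of p q X sg] sing_spx_back[of p q X sg] sing_map[OF _ f] by (auto simp: cochain_pullback_def cochain_cup_def)
 qed
 thus ?thesis using c d by (simp add: coh_cup_class coh_map_class[OF f] cup_ccy pb_ccy[OF f])
qed

end

section \<open>The cohomology algebra and its functoriality\<close>

definition alg_map :: "'k ring => 'a topology => ('a => 'b) => (nat => ('b, 'k) coh_class) => nat => ('a, 'k) coh_class" where "alg_map K X f a = (%p. coh_map K X p f (a p))"

lemma alg_s [simp]: "(zero (calg K X)) = (%p. (zero (coh K X p)))" "a +[calg K X] b = (%p. a p +[coh K X p] b p)" "r .[calg K X] a = (%p. r .[coh K X p] a p)"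
 by (simp_all add: cohomology_algebra_def)

lemma alg_mult: "a *[calg K X] b = (%n. \<Oplus>\<^sub>(coh K X n) p\<in>{..n}. coh_cup K X p (n - p) (a p) (b (n - p)))"
 by (simp add: cohomology_algebra_def)

lemma alg_car: "a : car (calg K X) <-> (ALL p. a p : car (coh K X p)) & finite {p. a p ~= zero (coh K X p)}" by (simp add: cohomology_algebra_def)

context coeff begin

lemma coh_mod: "module K (coh K X p)" by (rule vspace.axioms(2)[OF vs_coh])

lemma coh_group: "abelian_group (coh K X p)" using coh_mod by (rule module.axioms(2))

lemma vs_alg: "vspace K (calg K X)"
proof (rule vspaceI[OF field_axioms moduleI])
 let ?A = "calg K X"
 show "cring K" by (rule is_cring)
 show "abelian_group ?A"
 proof (rule abelian_groupI)
  fix x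
  assume x: "x : car ?A"
  hence xc: "x p : car (coh K X p)" for p by (simp add: alg_car)
  interpret H: abelian_group "coh K X p" for p by (rule coh_group)
  have "(%p. \<ominus>\<^sub>(coh K X p) x p) : car ?A" using x by (simp add: alg_car)
  thus "EX y:car ?A. y +[?A] x = zero ?A" by (rule bexI[rotated]) (simp add: xc H.l_neg)
  show "(zero ?A) +[?A] x = x" by (simp add: xc)
  fix y z
  assume y: "y : car ?A" and z: "z : car ?A"
  hence yz: "y p : car (coh K X p)" "z p : car (coh K X p)" for p by (simp_all add: alg_car)
  have "{p. x p +[coh K X p] y p ~= zero (coh K X p)} <= {p. x p ~= zero (coh K X p)} Un {p. y p ~= zero (coh K X p)}" by auto
  hence "finite {p. x p +[coh K X p] y p ~= zero (coh K X p)}" by (rule fin_sub) (use x y in \<open>simp add: alg_car\<close>)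
  thus "x +[?A] y : car ?A" using xc yz by (simp add: alg_car)
  show "x +[?A] y = y +[?A] x" using xc yz by (simp add: H.a_comm)
  show "x +[?A] y +[?A] z = x +[?A] (y +[?A] z)" using xc yz by (simp add: H.a_assoc)
 next
  interpret H: abelian_group "coh K X p" for p by (rule coh_group)
  show "(zero ?A) : car ?A" by (simp add: alg_car)
 qed
 interpret H: module K "coh K X p" for p by (rule coh_mod)
 fix x
 assume x: "x : car ?A"
 hence xc: "x p : car (coh K X p)" for p by (simp add: alg_car)
 show "\<one> \<odot>\<^sub>?A x = x" by (simp add: xc)
 fix a
 assume a: "a : car K"
 have z: "a .[coh K X p] x p = zero (coh K X p)" if "x p = zero (coh K X p)" for p unfolding that using a by simp
 have "finite {p. a .[coh K X p] x p ~= zero (coh K X p)}"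
  by (rule fin_sub[of _ "{p. x p ~= zero (coh K X p)}"]) (use x z in \<open>auto simp: alg_car\<close>)
 thus "a .[?A] x : car ?A" using a xc by (simp add: alg_car)
 show "(a \<oplus> b) .[?A] x = a .[?A] x +[?A] b .[?A] x" "a \<otimes> b .[?A] x = a .[?A] (b .[?A] x)" if "b : car K" for b using a that xc
  by (simp_all add: H.smult_l_distr H.smult_assoc1)
 show "a .[?A] (x +[?A] y) = a .[?A] x +[?A] a .[?A] y" if "y : car ?A" for y using a xc that by (simp add: alg_car H.smult_r_distr)
qed

lemma alg_mult_cl:
 assumes a: "a : car (calg K X)" and b: "b : car (calg K X)"
 shows "a *[calg K X] b : car (calg K X)"
proof -
 interpret H: abelian_group "coh K X p" for p by (rule coh_group)
 let ?z = "%p. (zero (coh K X p))"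
 have ac: "a p : car (coh K X p)" "b p : car (coh K X p)" for p using a b by (simp_all add: alg_car)
 have cup: "coh_cup K X p (n - p) (a p) (b (n - p)) : car (coh K X n)" if "p <= n" for p n using coh_cup_cl[OF ac(1)[of p] ac(2)[of "n - p"]] that
  by simp
 have "{n. (a *[calg K X] b) n ~= ?z n} <= (%(p, q). p + q) ` ({p. a p ~= ?z p} >< {q. b q ~= ?z q})"
 proof
  fix n
  assume n: "n : {n. (a *[calg K X] b) n ~= ?z n}"
  show "n : (%(p, q). p + q) ` ({p. a p ~= ?z p} >< {q. b q ~= ?z q})"
  proof (rule ccontr)
  assume no: "n ~: (%(p, q). p + q) ` ({p. a p ~= ?z p} >< {q. b q ~= ?z q})"
  have "coh_cup K X p (n - p) (a p) (b (n - p)) = ?z n" if p: "p : {..n}" for p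
  proof -
  have "a p = ?z p | b (n - p) = ?z (n - p)"
  proof (rule ccontr)
  assume "~ (a p = ?z p | b (n - p) = ?z (n - p))"
  hence "n : (%(p, q). p + q) ` ({p. a p ~= ?z p} >< {q. b q ~= ?z q})" using p by (intro image_eqI[of _ _ "(p, n - p)"]) auto
  thus False using no by simp
  qed
  thus ?thesis using coh_cup_zero(1)[OF ac(2)[of "n - p"], of p] coh_cup_zero(2)[OF ac(1)[of p], of "n - p"] p by auto
  qed
  hence "(a *[calg K X] b) n = (\<Oplus>\<^sub>(coh K X n) p\<in>{..n}. ?z n)" unfolding alg_mult by (intro H.finsum_cong') auto
  thus False using n by simp
  qed
 qed
 moreover have "finite ((%(p, q). p + q) ` ({p. a p ~= ?z p} >< {q. b q ~= ?z q}))" using a b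
  by (intro finite_imageI finite_cartesian_product) (simp_all add: alg_car)
 ultimately have "finite {n. (a *[calg K X] b) n ~= ?z n}" by (rule fin_sub)
 moreover have "(a *[calg K X] b) n : car (coh K X n)" for n unfolding alg_mult by (intro H.finsum_closed) (use cup in auto)
 ultimately show ?thesis by (simp add: alg_car)
qed

lemma one_ccy: "(%sg. if sing 0 X sg then \<one> else \<zero>) : ccy K X 0"
proof -
 let ?u = "%sg. if sing 0 X sg then \<one> else \<zero>"
 have "cob K X 0 ?u sg = \<zero>" for sg
 proof (cases "sing (Suc 0) X sg")
  case True
  have "(\<Oplus>k\<in>{..Suc 0}. (\<ominus> \<one>) [^] k \<otimes> ?u (fce (Suc 0) k sg)) = (\<Oplus>k\<in>{..Suc 0}. (\<ominus> \<one>) [^] (k::nat))"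
   using sing_spx_face[OF True] by simp
  also have "... = \<zero>" by (simp add: l_neg)
  finally show ?thesis using True by (simp only: coboundary_map_def if_True)
 qed (simp add: coboundary_map_def)
 thus ?thesis by (simp add: cocycles_def cch_iff fun_eq_iff)
qed

lemma alg_one_cl: "(one (calg K X)) : car (calg K X)"
proof -
 interpret H: abelian_group "coh K X p" for p by (rule coh_group)
 let ?o = "one (calg K X)"
 have "{p. ?o p ~= zero (coh K X p)} <= {0}" by (auto simp: cohomology_algebra_def)
 hence "finite {p. ?o p ~= zero (coh K X p)}" by (rule fin_sub) simp
 moreover have "?o p : car (coh K X p)" for p by (simp add: cohomology_algebra_def one_ccy)
 ultimately show ?thesis by (simp add: alg_car)
qed

definition cup_prods :: "'a topology => nat => (nat => ('a, 'k) coh_class) set" where "cup_prods X l = {foldr (monoid.mult (calg K X)) as (one (calg K X)) | as. length as = l & set as <= posc K X}"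

lemma cup_pow_eq: "cup_power K X l = lsp K (calg K X) (cup_prods X l)" by (simp add: cup_power_def cup_prods_def)

lemma cup_foldr_cl: "set as <= car (calg K X) ==> foldr (monoid.mult (calg K X)) as (one (calg K X)) : car (calg K X)"
 by (induction as) (simp_all add: alg_one_cl alg_mult_cl)

lemma pos_sub: "posc K X <= car (calg K X)" by (auto simp: positive_cohomology_def)

lemma cup_prods_sub: "cup_prods X l <= car (calg K X)" using pos_sub cup_foldr_cl unfolding cup_prods_def by blast

lemma cup_pow_sub: "submodule (cup_power K X l) K (calg K X)" unfolding cup_pow_eq by (rule vspace.span_sub[OF vs_alg cup_prods_sub])

lemma alg_map_lin_map:
 assumes f: "cmap X Y f"
 shows "lin_map K (calg K Y) (calg K X) (alg_map K X f)"
proof -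
 note l = coh_map_lin_map[OF f]
 note m = lin_map_cl[OF vs_coh vs_coh l] lin_map_zero[OF vs_coh vs_coh l] lin_map_add[OF vs_coh vs_coh l] lin_map_smult[OF vs_coh vs_coh l]
 have fin: "finite {p. alg_map K X f a p ~= zero (coh K X p)}" if "a : car (calg K Y)" for a
  by (rule fin_sub[of _ "{p. a p ~= zero (coh K Y p)}"]) (use that m(2) in \<open>auto simp: alg_map_def alg_car\<close>)
 show ?thesis unfolding lin_map_def
 proof (intro conjI ballI funcsetI)
  fix a
  assume a: "a : car (calg K Y)"
  show "alg_map K X f a : car (calg K X)" using fin[OF a] a m(1) by (simp add: alg_car) (simp add: alg_map_def)
  show "alg_map K X f (a +[calg K Y] b) = alg_map K X f a +[calg K X] alg_map K X f b" if "b : car (calg K Y)" for b using a that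
   by (simp add: alg_map_def m(3) alg_car)
 next
  fix r a
  assume "r : car K" "a : car (calg K Y)"
  thus "alg_map K X f (r .[calg K Y] a) = r .[calg K X] alg_map K X f a" by (simp add: alg_map_def m(4) alg_car)
 qed
qed

lemma alg_map_mult:
 assumes f: "cmap X Y f" and a: "a : car (calg K Y)" and b: "b : car (calg K Y)"
 shows "alg_map K X f (a *[calg K Y] b) = alg_map K X f a *[calg K X] alg_map K X f b"
proof
 fix n
 interpret H: abelian_group "coh K X p" for p by (rule coh_group)
 have ac: "a p : car (coh K Y p)" "b p : car (coh K Y p)" for p using a b by (simp_all add: alg_car)
 have cup: "coh_cup K Y p (n - p) (a p) (b (n - p)) : car (coh K Y n)" if "p <= n" for p using coh_cup_cl[OF ac(1)[of p] ac(2)[of "n - p"]] that by simp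
 note l = lin_map_cl[OF vs_coh vs_coh coh_map_lin_map[OF f]]
 have "alg_map K X f (a *[calg K Y] b) n = (\<Oplus>\<^sub>(coh K X n) p\<in>{..n}. coh_map K X n f (coh_cup K Y p (n - p) (a p) (b (n - p))))"
  unfolding alg_map_def alg_mult by (rule lin_map_finsum[OF vs_coh vs_coh coh_map_lin_map[OF f]]) (use cup in auto)
 also have "... = (alg_map K X f a *[calg K X] alg_map K X f b) n" unfolding alg_mult alg_map_def
 proof (rule H.finsum_cong'[OF refl])
  have "coh_cup K X p (n - p) (coh_map K X p f (a p)) (coh_map K X (n - p) f (b (n - p))) : car (coh K X n)" if "p <= n" for p
   using coh_cup_cl[OF l[OF ac(1)[of p]] l[OF ac(2)[of "n - p"]]] that by simp
  thus "(%p. coh_cup K X p (n - p) (coh_map K X p f (a p)) (coh_map K X (n - p) f (b (n - p)))) : {..n} -> car (coh K X n)" by auto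
  show "coh_map K X n f (coh_cup K Y p (n - p) (a p) (b (n - p))) = coh_cup K X p (n - p) (coh_map K X p f (a p)) (coh_map K X (n - p) f (b (n - p)))" if "p : {..n}" for p
   using coh_map_cup[OF f ac(1)[of p] ac(2)[of "n - p"]] that by simp
 qed
 finally show "alg_map K X f (a *[calg K Y] b) n = (alg_map K X f a *[calg K X] alg_map K X f b) n" .
qed

lemma alg_map_one: assumes f: "cmap X Y f" shows "alg_map K X f (one (calg K Y)) = one (calg K X)"
proof
 fix p
 show "alg_map K X f (one (calg K Y)) p = (one (calg K X)) p"
 proof (cases "p = 0")
  case True
  have "cpb K X 0 f (%sg. if sing 0 Y sg then \<one> else \<zero>) = (%sg. if sing 0 X sg then \<one> else \<zero>)" using sing_map[OF _ f]
   by (auto simp: cochain_pullback_def)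
  thus ?thesis using True coh_map_class[OF f one_ccy] by (simp add: alg_map_def cohomology_algebra_def)
 next
  case False
  thus ?thesis using lin_map_zero[OF vs_coh vs_coh coh_map_lin_map[OF f]] by (simp add: alg_map_def cohomology_algebra_def)
 qed
qed

lemma alg_map_foldr:
 assumes f: "cmap X Y f"
 shows "set as <= car (calg K Y) ==> alg_map K X f (foldr (monoid.mult (calg K Y)) as (one (calg K Y))) = foldr (monoid.mult (calg K X)) (map (alg_map K X f) as) (one (calg K X))"
 by (induction as) (simp_all add: alg_map_one[OF f] alg_map_mult[OF f] cup_foldr_cl)

lemma alg_map_pos: "cmap X Y f ==> alg_map K X f ` posc K Y <= posc K X"
proof -
 assume f: "cmap X Y f"
 have "alg_map K X f a : posc K X" if "a : posc K Y" for a
  using lin_map_cl[OF vs_alg vs_alg alg_map_lin_map[OF f], of a] that lin_map_zero[OF vs_coh vs_coh coh_map_lin_map[OF f, of 0]]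
  by (simp add: positive_cohomology_def alg_map_def)
 thus ?thesis by blast
qed

lemma alg_map_cup_pow:
 assumes f: "cmap X Y f"
 shows "alg_map K X f ` cup_power K Y l <= cup_power K X l"
proof -
 have "alg_map K X f ` cup_prods Y l <= cup_prods X l"
 proof
  fix z
  assume "z : alg_map K X f ` cup_prods Y l"
  then obtain as where as: "length as = l" "set as <= posc K Y" "z = alg_map K X f (foldr (monoid.mult (calg K Y)) as (one (calg K Y)))"
   unfolding cup_prods_def by blast
  show "z : cup_prods X l" using alg_map_pos[OF f] unfolding cup_prods_def using as alg_map_foldr[OF f, of as] pos_sub
   by (intro CollectI exI[of _ "map (alg_map K X f) as"]) auto
 qed
 hence "lsp K (calg K X) (alg_map K X f ` cup_prods Y l) <= cup_power K X l" unfolding cup_pow_eq by (rule vspace.span_mono[OF vs_alg])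
 thus ?thesis unfolding cup_pow_eq[of Y l] using lin_map_span[OF vs_alg vs_alg alg_map_lin_map[OF f] cup_prods_sub] by blast
qed

lemma alg_map_bij:
 assumes w: "whe X Y f"
 shows "bij_betw (alg_map K X f) (car (calg K Y)) (car (calg K X))" and "alg_map K X f ` posc K Y = posc K X"
proof -
 have f: "cmap X Y f" using w by (simp add: weak_homotopy_equivalence_def)
 note b = coh_map_bij[OF w]
 note z = lin_map_zero[OF vs_coh vs_coh coh_map_lin_map[OF f]]
 have inj: "inj_on (alg_map K X f) (car (calg K Y))"
 proof (rule inj_onI)
  fix a a'
  assume a: "a : car (calg K Y)" "a' : car (calg K Y)" "alg_map K X f a = alg_map K X f a'"
  show "a = a'"
  proof
  fix p
  have "coh_map K X p f (a p) = coh_map K X p f (a' p)" using fun_cong[OF a(3), of p] by (simp add: alg_map_def)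
  thus "a p = a' p" using inj_onD[OF bij_betw_imp_inj_on[OF b[of p]], of "a p" "a' p"] a(1,2) by (simp add: alg_car)
  qed
 qed
 have surj: "EX c:car (calg K Y). alg_map K X f c = a & (a 0 = zero (coh K X 0) --> c 0 = zero (coh K Y 0))" if a: "a : car (calg K X)" for a
 proof -
  define c where "c p = inv_into (car (coh K Y p)) (coh_map K X p f) (a p)" for p
  have c: "c p : car (coh K Y p)" "coh_map K X p f (c p) = a p" for p using a b[of p] unfolding c_def
   by (auto simp: alg_car bij_betw_def inv_into_into f_inv_into_f)
  \<comment> \<open>Injectivity sends zero components back to zero components. So the preimage has
    finite support, and it has positive degree if \<open>a\<close> has.\<close>
  have cz: "c p = zero (coh K Y p)" if "a p = zero (coh K X p)" for p
  proof -
  have "coh_map K X p f (c p) = coh_map K X p f (zero (coh K Y p))" using c(2) that z by simp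
  moreover have "(zero (coh K Y p)) : car (coh K Y p)" using coh_group by (rule abelian_groupE(2))
  ultimately show ?thesis using b[of p] c(1) unfolding bij_betw_def by (blast dest: inj_onD)
  qed
  have "finite {p. c p ~= zero (coh K Y p)}" by (rule fin_sub[of _ "{p. a p ~= zero (coh K X p)}"]) (use a cz in \<open>auto simp: alg_car\<close>)
  thus ?thesis using c cz by (intro bexI[of _ c]) (auto simp: alg_car alg_map_def)
 qed
 show "bij_betw (alg_map K X f) (car (calg K Y)) (car (calg K X))"
  unfolding bij_betw_def using inj surj lin_map_cl[OF vs_alg vs_alg alg_map_lin_map[OF f]] by blast
 show "alg_map K X f ` posc K Y = posc K X"
 proof
  show "alg_map K X f ` posc K Y <= posc K X" by (rule alg_map_pos[OF f])
  show "posc K X <= alg_map K X f ` posc K Y"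
  proof
  fix a
  assume a: "a : posc K X"
  thus "a : alg_map K X f ` posc K Y" using surj[of a] by (auto simp: positive_cohomology_def)
  qed
 qed
qed

text \<open>Factors of positive degree lift to factors of positive degree, so every product is the
  image of a product; the image of a span is a subspace and therefore contains the span of the
  products.\<close>

lemma alg_map_cup_pow_eq:
 assumes w: "whe X Y f"
 shows "alg_map K X f ` cup_power K Y l = cup_power K X l"
proof
 have f: "cmap X Y f" using w by (simp add: weak_homotopy_equivalence_def)
 show "alg_map K X f ` cup_power K Y l <= cup_power K X l" by (rule alg_map_cup_pow[OF f])
 have "cup_prods X l <= alg_map K X f ` cup_power K Y l"
 proof
  fix z
  assume "z : cup_prods X l"
  then obtain as where as: "length as = l" "set as <= posc K X" "z = foldr (monoid.mult (calg K X)) as (one (calg K X))" unfolding cup_prods_def by blast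
  define bs where "bs = map (inv_into (posc K Y) (alg_map K X f)) as"
  have bs: "map (alg_map K X f) bs = as" "set bs <= posc K Y" using as(2) alg_map_bij(2)[OF w]
   by (auto simp: bs_def f_inv_into_f inv_into_into intro!: map_idI)
  have "z = alg_map K X f (foldr (monoid.mult (calg K Y)) bs (one (calg K Y)))"
   using alg_map_foldr[OF f, of bs] subset_trans[OF bs(2) pos_sub] bs(1) as(3) by simp
  moreover have "foldr (monoid.mult (calg K Y)) bs (one (calg K Y)) : cup_prods Y l" unfolding cup_prods_def using bs as(1) by auto
  ultimately show "z : alg_map K X f ` cup_power K Y l" unfolding cup_pow_eq using vspace.span_sup[OF vs_alg] by blast
 qed
 thus "cup_power K X l <= alg_map K X f ` cup_power K Y l" unfolding cup_pow_eq[of X l]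
  by (intro vspace.span_min[OF vs_alg] lin_map_img_sub[OF vs_alg vs_alg alg_map_lin_map[OF f]] cup_pow_sub)
qed

lemma alg_map_id: "(!!x. x : ts X ==> f x = x) ==> a : car (calg K X) ==> alg_map K X f a = a" by (simp add: alg_map_def alg_car coh_map_id)

lemma alg_map_comp: "cmap X Y f ==> cmap Y Z g ==> a : car (calg K Z) ==> alg_map K X f (alg_map K Y g a) = alg_map K X (g o f) a"
 by (simp add: alg_map_def alg_car coh_map_comp)

lemma alg_map_cong: "cmap X Y f ==> (!!x. x : ts X ==> f x = g x) ==> a : car (calg K Y) ==> alg_map K X f a = alg_map K X g a"
 by (simp add: alg_map_def alg_car coh_map_cong[of X Y f g])

end

section \<open>Persistent cup modules\<close>

text \<open>An ambient module for the cup modules: the degree \<open>p\<close> part of it is a copy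
  of cohomology in degree \<open>p\<close>, and it contains the degree \<open>p\<close> part of each
  cup module as a submodule.\<close>

definition alg_mod :: "'k ring => 'a pers_space => ('k, nat => ('a, 'k) coh_class) pers_module" where "alg_mod K X = \<lparr>vec_at = (%t. calg K (sp X t)), res = (%s t. alg_map K (sp X s) (tr X s t))\<rparr>"

definition conc :: "'k ring => 'a topology => nat => (nat => ('a, 'k) coh_class) set => (nat => ('a, 'k) coh_class) set" where "conc K X p W = {a : W. ALL q. q ~= p --> a q = zero (coh K X q)}"

lemma lin_map_res: "lin_map K V W f ==> A <= car V ==> f ` A <= B ==> lin_map K (V\<lparr>carrier := A\<rparr>) (W\<lparr>carrier := B\<rparr>) f"
 unfolding lin_map_def by (auto simp: subset_iff)

lemma alg_mod_s: "vt (alg_mod K X) t = calg K (sp X t)" "res (alg_mod K X) = (%s t. alg_map K (sp X s) (tr X s t))" by (simp_all add: alg_mod_def)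

lemma deg_alg_mod: "vt (degp p (alg_mod K X)) t = (calg K (sp X t))\<lparr>carrier := conc K (sp X t) p (car (calg K (sp X t)))\<rparr>" "res (degp p (alg_mod K X)) = (%s t. alg_map K (sp X s) (tr X s t))"
 by (simp_all add: degree_part_def alg_mod_def conc_def)

lemma deg_cup_mod: "vt (dcup p K l X) t = (calg K (sp X t))\<lparr>carrier := conc K (sp X t) p (cup_power K (sp X t) l)\<rparr>" "res (dcup p K l X) = (%s t. alg_map K (sp X s) (tr X s t))"
 by (simp_all add: degree_part_def cup_module_def conc_def alg_map_def fun_eq_iff)

lemma per_sp_s:
 assumes "psp X"
 shows "s <= t ==> cmap (sp X s) (sp X t) (tr X s t)" and "x : ts (sp X t) ==> tr X t t x = x" and "r <= s ==> s <= t ==> x : ts (sp X r) ==> tr X s t (tr X r s x) = tr X r t x"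
 using assms unfolding persistent_space_def by blast+

context coeff begin

lemma alg_map_tr:
 assumes f: "cmap X Y f" and g: "cmap Y Z g" and h: "cmap X Z h" and e: "!!x. x : ts X ==> g (f x) = h x" and a: "a : car (calg K Z)"
 shows "alg_map K X f (alg_map K Y g a) = alg_map K X h a" using alg_map_comp[OF f g a] alg_map_cong[OF cm_comp[OF f g] _ a, of h] e by simp

lemma conc_sub: assumes W: "submodule W K (calg K X)" shows "submodule (conc K X p W) K (calg K X)"
proof -
 interpret A: vspace K "calg K X" by (rule vs_alg)
 interpret H: module K "coh K X q" for q by (rule coh_mod)
 have sub: "W <= car (calg K X)" by (rule A.submoduleE(1)[OF W])
 show ?thesis
 proof (rule A.submoduleI)
  show "conc K X p W <= car (calg K X)" using sub by (auto simp: conc_def)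
  show "(zero (calg K X)) : conc K X p W" using A.sub_zero[OF W] by (simp add: conc_def)
  show "r .[calg K X] a : conc K X p W" if "r : car K" "a : conc K X p W" for r a using that A.submoduleE(4)[OF W, of r a] by (auto simp: conc_def)
  show "a +[calg K X] b : conc K X p W" if "a : conc K X p W" "b : conc K X p W" for a b using that A.submoduleE(5)[OF W, of a b]
   by (auto simp: conc_def)
  show "\<ominus>\<^sub>(calg K X) a : conc K X p W" if a: "a : conc K X p W" for a
  proof -
  have ac: "a : car (calg K X)" using a sub by (auto simp: conc_def)
  have "\<ominus>\<^sub>(calg K X) a = (\<ominus> \<one>) .[calg K X] a" using A.smult_l_minus[OF one_closed ac] A.smult_one[OF ac] by simp
  moreover have "(\<ominus> \<one>) .[calg K X] a : W" using A.submoduleE(4)[OF W] a by (simp add: conc_def)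
  ultimately show ?thesis using a by (simp add: conc_def)
  qed
 qed
qed

lemma alg_map_conc:
 assumes f: "cmap X Y f" and "alg_map K X f ` W <= W'"
 shows "alg_map K X f ` conc K Y p W <= conc K X p W'" using assms(2) lin_map_zero[OF vs_coh vs_coh coh_map_lin_map[OF f]]
 by (auto simp: conc_def alg_map_def)

lemma alg_car_sub: "submodule (car (calg K X)) K (calg K X)" using vs_alg by (rule module.carrier_is_submodule[OF vspace.axioms(2)])

lemma per_mod_alg: assumes X: "psp X" shows "per_mod K (alg_mod K X)"
proof (rule per_mod.intro)
 note P = per_sp_s[OF X]
 show "vspace K (vt (alg_mod K X) t)" for t by (simp add: alg_mod_def vs_alg)
 show "lin_map K (vt (alg_mod K X) t) (vt (alg_mod K X) s) (res (alg_mod K X) s t)" if "s <= t" for s t using alg_map_lin_map[OF P(1)[OF that]]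
  by (simp add: alg_mod_def)
 show "res (alg_mod K X) t t v = v" if "v : vc (alg_mod K X) t" for t v using alg_map_id[of "sp X t" "tr X t t" v] P(2) that by (simp add: alg_mod_def)
 show "res (alg_mod K X) r s (res (alg_mod K X) s t v) = res (alg_mod K X) r t v" if "r <= s" "s <= t" "v : vc (alg_mod K X) t" for r s t v
  using alg_map_tr[OF P(1)[OF that(1)] P(1)[OF that(2)] P(1)[OF order_trans[OF that(1,2)]] P(3)[OF that(1,2)], of v] that(3) by (simp add: alg_mod_def)
qed

lemma per_mod_deg_alg: assumes X: "psp X" shows "per_mod K (degp p (alg_mod K X))"
proof (rule per_mod_sub[OF per_mod_alg[OF X]])
 let ?U = "%t. conc K (sp X t) p (car (calg K (sp X t)))"
 show "submodule (?U t) K (vt (alg_mod K X) t)" for t using conc_sub[OF alg_car_sub] by (simp add: alg_mod_def)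
 show "res (alg_mod K X) s t ` ?U t <= ?U s" if "s <= t" for s t
 proof -
  have f: "cmap (sp X s) (sp X t) (tr X s t)" by (rule per_sp_s(1)[OF X that])
  show ?thesis unfolding alg_mod_def pers_module.simps by (rule alg_map_conc[OF f]) (use lin_map_cl[OF vs_alg vs_alg alg_map_lin_map[OF f]] in blast)
 qed
qed (simp_all only: deg_alg_mod alg_mod_s)

lemma deg_cup_sub:
 assumes X: "psp X"
 shows "submodule (conc K (sp X t) p (cup_power K (sp X t) l)) K (vt (degp p (alg_mod K X)) t)" and "s <= t ==> res (degp p (alg_mod K X)) s t ` conc K (sp X t) p (cup_power K (sp X t) l) <= conc K (sp X s) p (cup_power K (sp X s) l)"
proof -
 have "conc K (sp X t) p (cup_power K (sp X t) l) <= conc K (sp X t) p (car (calg K (sp X t)))"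
  using module.submoduleE(1)[OF vspace.axioms(2)[OF vs_alg] cup_pow_sub] by (auto simp: conc_def)
 from vspace.sub_res[OF vs_alg conc_sub[OF alg_car_sub] this] show "submodule (conc K (sp X t) p (cup_power K (sp X t) l)) K (vt (degp p (alg_mod K X)) t)"
  unfolding deg_alg_mod using conc_sub[OF cup_pow_sub] by blast
 show "res (degp p (alg_mod K X)) s t ` conc K (sp X t) p (cup_power K (sp X t) l) <= conc K (sp X s) p (cup_power K (sp X s) l)" if "s <= t"
  unfolding deg_alg_mod by (intro alg_map_conc alg_map_cup_pow per_sp_s(1)[OF X that])
qed

lemma deg_cup_res: "vt (dcup p K l X) t = (vt (degp p (alg_mod K X)) t)\<lparr>carrier := conc K (sp X t) p (cup_power K (sp X t) l)\<rparr>" "res (dcup p K l X) = res (degp p (alg_mod K X))"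
 by (simp_all add: deg_cup_mod deg_alg_mod)

lemma per_mod_cup: assumes X: "psp X" shows "per_mod K (dcup p K l X)" by (rule per_mod_sub[OF per_mod_deg_alg[OF X] deg_cup_sub[OF X] deg_cup_res])

lemma per_mod_coh: assumes X: "psp X" shows "per_mod K (pcoh K X p)"
proof (rule per_mod.intro)
 note P = per_sp_s[OF X]
 show "vspace K (vt (pcoh K X p) t)" for t by (simp add: pers_cohomology_def vs_coh)
 show "lin_map K (vt (pcoh K X p) t) (vt (pcoh K X p) s) (res (pcoh K X p) s t)" if "s <= t" for s t using coh_map_lin_map[OF P(1)[OF that]]
  by (simp add: pers_cohomology_def)
 show "res (pcoh K X p) t t v = v" if "v : vc (pcoh K X p) t" for t v using coh_map_id[of "sp X t" "tr X t t" v] P(2) that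
  by (simp add: pers_cohomology_def)
 show "res (pcoh K X p) r s (res (pcoh K X p) s t v) = res (pcoh K X p) r t v" if "r <= s" "s <= t" "v : vc (pcoh K X p) t" for r s t v
  using coh_map_comp[OF P(1)[OF that(1)] P(1)[OF that(2)], of v p] P(3)[OF that(1,2)] that(3) coh_map_cong[OF cm_comp[OF P(1)[OF that(1)] P(1)[OF that(2)]], of "tr X r t" v p]
  by (simp add: pers_cohomology_def)
qed

text \<open>Extending a class by zero in the other degrees is an isomorphism from cohomology in
  degree \<open>p\<close> onto the degree \<open>p\<close> part of the algebra.\<close>

lemma q_tame_deg_alg:
 assumes X: "psp X" and q: "q_tame K (pcoh K X p)"
 shows "q_tame K (degp p (alg_mod K X))"
proof (rule q_tame_iso[OF per_mod_coh[OF X] per_mod_deg_alg[OF X] _ q])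
 interpret H: module K "coh K Y r" for Y :: "'b topology" and r by (rule coh_mod)
 define h where "h t c = (%r. if r = p then c else (zero (coh K (sp X t) r)))" for t c
 have hin: "h t c : conc K (sp X t) p (car (calg K (sp X t)))" if "c : car (coh K (sp X t) p)" for t c using that
  by (simp add: conc_def alg_car) (simp add: h_def)
 show "pers_iso K (pcoh K X p) (degp p (alg_mod K X))" unfolding pers_iso_def
 proof (intro exI[of _ h] conjI allI impI ballI)
  fix t
  show "lin_map K (vt (pcoh K X p) t) (vt (degp p (alg_mod K X)) t) (h t)" unfolding lin_map_def deg_alg_mod pers_cohomology_def using hin
   by (auto simp: h_def fun_eq_iff)
  show "bij_betw (h t) (vc (pcoh K X p) t) (car (vt (degp p (alg_mod K X)) t))" unfolding deg_alg_mod pers_cohomology_def pers_module.simps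
  proof (rule bij_betw_byWitness[where f' = "%a. a p"])
  show "h t ` car (coh K (sp X t) p) <= car (calg K (sp X t) \<lparr>carrier := conc K (sp X t) p (car (calg K (sp X t)))\<rparr>)" using hin by auto
  qed (auto simp: h_def conc_def alg_car fun_eq_iff)
 next
  fix s t :: real and v
  assume st: "s <= t" and v: "v : vc (pcoh K X p) t"
  show "h s (res (pcoh K X p) s t v) = res (degp p (alg_mod K X)) s t (h t v)"
   using lin_map_zero[OF vs_coh vs_coh coh_map_lin_map[OF per_sp_s(1)[OF X st]]]
   by (auto simp: deg_alg_mod pers_cohomology_def alg_map_def h_def fun_eq_iff)
 qed
qed

lemma q_tame_cup: assumes X: "psp X" and q: "q_tame_cohomology K X" shows "q_tame K (dcup p K l X)"
proof -
 have "q_tame K (pcoh K X p)" using q by (simp add: q_tame_cohomology_def)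
 from per_mod.q_tame_sub[OF per_mod_deg_alg[OF X] q_tame_deg_alg[OF X this] deg_cup_sub[OF X] deg_cup_res] show ?thesis .
qed

section \<open>Interleavings and weak equivalences on cup modules\<close>

lemma lin_map_deg_cup:
 assumes f: "cmap (sp X s) (sp Y t) f"
 shows "lin_map K (vt (dcup p K l Y) t) (vt (dcup p K l X) s) (alg_map K (sp X s) f)"
unfolding deg_cup_mod
proof (rule lin_map_res[OF alg_map_lin_map[OF f]])
 show "conc K (sp Y t) p (cup_power K (sp Y t) l) <= car (calg K (sp Y t))" using module.submoduleE(1)[OF vspace.axioms(2)[OF vs_alg] cup_pow_sub]
  by (auto simp: conc_def)
 show "alg_map K (sp X s) f ` conc K (sp Y t) p (cup_power K (sp Y t) l) <= conc K (sp X s) p (cup_power K (sp X s) l)"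
  by (intro alg_map_conc alg_map_cup_pow f)
qed

lemma deg_cup_alg: "a : vc (dcup p K l X) t ==> a : car (calg K (sp X t))" using module.submoduleE(1)[OF vspace.axioms(2)[OF vs_alg] cup_pow_sub]
 by (auto simp: deg_cup_mod conc_def)

lemma deg_cup_nat:
 assumes A: "psp A" and B: "psp B" and c: "!!t. cmap (sp A (t - ep)) (sp B t) (et (t - ep))" and n: "!!s t x. s <= t ==> x : ts (sp A s) ==> et t (tr A s t x) = tr B (s + ep) (t + ep) (et s x)" and st: "s <= t" and v: "v : vc (dcup p K l B) t"
 shows "alg_map K (sp A (s - ep)) (et (s - ep)) (res (dcup p K l B) s t v) = res (dcup p K l A) (s - ep) (t - ep) (alg_map K (sp A (t - ep)) (et (t - ep)) v)"
proof -
 note va = deg_cup_alg[OF v] and tA = per_sp_s(1)[OF A] and tB = per_sp_s(1)[OF B]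
 have st': "s - ep <= t - ep" using st by simp
 let ?h = "tr B s t o et (s - ep)"
 have h: "cmap (sp A (s - ep)) (sp B t) ?h" by (rule cm_comp[OF c tB[OF st]])
 have "et (t - ep) (tr A (s - ep) (t - ep) x) = ?h x" if "x : ts (sp A (s - ep))" for x using n[OF st' that] by simp
 from alg_map_tr[OF tA[OF st'] c h this va] alg_map_tr[OF c tB[OF st] h _ va] show ?thesis unfolding deg_cup_mod by (simp add: o_def)
qed

lemma intl_cup:
 assumes X: "psp X" and Y: "psp Y" and ep: "0 <= ep" and int: "interleaved ep X Y"
 shows "per_intl K ep (dcup p K l X) (dcup p K l Y)"
proof -
 let ?V = "dcup p K l X" and ?W = "dcup p K l Y"
 obtain ph ps where I: "ALL t. cmap (sp X t) (sp Y (t + ep)) (ph t)" "ALL t. cmap (sp Y t) (sp X (t + ep)) (ps t)" "ALL s t. s <= t --> (ALL x:ts (sp X s). ph t (tr X s t x) = tr Y (s + ep) (t + ep) (ph s x))" "ALL s t. s <= t --> (ALL y:ts (sp Y s). ps t (tr Y s t y) = tr X (s + ep) (t + ep) (ps s y))" "ALL t. ALL x:ts (sp X t). ps (t + ep) (ph t x) = tr X t (t + 2 * ep) x" "ALL t. ALL y:ts (sp Y t). ph (t + ep) (ps t y) = tr Y t (t + 2 * ep) y"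
  using int unfolding interleaved_def by blast
 note i0 = I[rule_format]
 have e: "t - ep + ep = t" "t - ep - ep = t - 2 * ep" "t - 2 * ep + ep = t - ep" "t - 2 * ep + 2 * ep = t" for t :: real by simp_all
 have i: "cmap (sp X (t - ep)) (sp Y t) (ph (t - ep))" "cmap (sp Y (t - ep)) (sp X t) (ps (t - ep))" for t using i0(1)[of "t - ep"] i0(2)[of "t - ep"]
  by auto
 have j: "cmap (sp X (t - 2 * ep)) (sp Y (t - ep)) (ph (t - 2 * ep))" "cmap (sp Y (t - 2 * ep)) (sp X (t - ep)) (ps (t - 2 * ep))" for t
  using i0(1)[of "t - 2 * ep"] i0(2)[of "t - 2 * ep"] by auto
 note PX = per_sp_s[OF X] and PY = per_sp_s[OF Y]
 define f where "f t = alg_map K (sp Y (t - ep)) (ps (t - ep))" for t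
 define g where "g t = alg_map K (sp X (t - ep)) (ph (t - ep))" for t
 have "shift_map K ep ?V ?W f" unfolding shift_map_def f_def using lin_map_deg_cup[OF i(2)] deg_cup_nat[where et = ps, OF Y X i(2) i0(4)] by blast
 moreover have "shift_map K ep ?W ?V g" unfolding shift_map_def g_def using lin_map_deg_cup[OF i(1)] deg_cup_nat[where et = ph, OF X Y i(1) i0(3)]
  by blast
 moreover have "g (t - ep) (f t v) = res ?V (t - 2 * ep) t v" if v: "v : vc ?V t" for t v
 proof -
  have le: "t - 2 * ep <= t" using ep by simp
  have "ps (t - ep) (ph (t - 2 * ep) x) = tr X (t - 2 * ep) t x" if "x : ts (sp X (t - 2 * ep))" for x using i0(5)[OF that] by simp
  from alg_map_tr[OF j(1) i(2) PX(1)[OF le] this deg_cup_alg[OF v]] show ?thesis unfolding deg_cup_mod f_def g_def e .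
 qed
 moreover have "f (t - ep) (g t v) = res ?W (t - 2 * ep) t v" if v: "v : vc ?W t" for t v
 proof -
  have le: "t - 2 * ep <= t" using ep by simp
  have "ph (t - ep) (ps (t - 2 * ep) x) = tr Y (t - 2 * ep) t x" if "x : ts (sp Y (t - 2 * ep))" for x using i0(6)[OF that] by simp
  from alg_map_tr[OF j(2) i(1) PY(1)[OF le] this deg_cup_alg[OF v]] show ?thesis unfolding deg_cup_mod f_def g_def e .
 qed
 ultimately show ?thesis unfolding per_intl_def by blast
qed

text \<open>An isomorphism of modules, recorded as an interleaving with shift 0 so that it can be
  composed with proper interleavings.\<close>

lemma wk_eqv_cup:
 assumes Z: "psp Z" and X: "psp X" and nt: "nat_trans Z X ph" and w: "!!t. whe (sp Z t) (sp X t) (ph t)"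
 shows "per_intl K 0 (dcup p K l X) (dcup p K l Z)"
proof (rule per_intl_iso[OF per_mod_cup[OF X] per_mod_cup[OF Z]])
 let ?h = "%t. alg_map K (sp Z t) (ph t)"
 have c: "cmap (sp Z t) (sp X t) (ph t)" for t using nt by (simp add: nat_trans_def)
 have n: "ph t (tr Z s t x) = tr X s t (ph s x)" if "s <= t" "x : ts (sp Z s)" for s t x using nt that by (simp add: nat_trans_def)
 show "pers_iso K (dcup p K l X) (dcup p K l Z)" unfolding pers_iso_def
 proof (intro exI[of _ ?h] conjI allI impI ballI)
  fix t
  show "lin_map K (vt (dcup p K l X) t) (vt (dcup p K l Z) t) (?h t)" by (rule lin_map_deg_cup[OF c])
  note z = lin_map_zero[OF vs_coh vs_coh coh_map_lin_map[OF c[of t]]]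
  have CX: "a : car (calg K (sp X t))" if "a : cup_power K (sp X t) l" for a using module.submoduleE(1)[OF vspace.axioms(2)[OF vs_alg] cup_pow_sub] that
   by blast
  have "?h t ` conc K (sp X t) p (cup_power K (sp X t) l) = conc K (sp Z t) p (cup_power K (sp Z t) l)"
  proof
  show "?h t ` conc K (sp X t) p (cup_power K (sp X t) l) <= conc K (sp Z t) p (cup_power K (sp Z t) l)" by (intro alg_map_conc alg_map_cup_pow c)
  show "conc K (sp Z t) p (cup_power K (sp Z t) l) <= ?h t ` conc K (sp X t) p (cup_power K (sp X t) l)"
  proof
  fix b
  assume b: "b : conc K (sp Z t) p (cup_power K (sp Z t) l)"
  hence "b : ?h t ` cup_power K (sp X t) l" using alg_map_cup_pow_eq[OF w[of t], of l] by (simp add: conc_def)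
  then obtain a where a: "a : cup_power K (sp X t) l" "b = ?h t a" by blast
  have "a q = zero (coh K (sp X t) q)" if "q ~= p" for q
  proof -
  have "coh_map K (sp Z t) q (ph t) (a q) = coh_map K (sp Z t) q (ph t) (zero (coh K (sp X t) q))" using b a(2) that z[of q]
   by (simp add: conc_def alg_map_def)
  moreover have "(zero (coh K (sp X t) q)) : car (coh K (sp X t) q)" using coh_group by (rule abelian_groupE(2))
  ultimately show ?thesis using inj_onD[OF bij_betw_imp_inj_on[OF coh_map_bij[OF w[of t], of q]]] CX[OF a(1)] by (simp add: alg_car)
  qed
  thus "b : ?h t ` conc K (sp X t) p (cup_power K (sp X t) l)" using a by (auto simp: conc_def)
  qed
  qed
  moreover have "inj_on (?h t) (conc K (sp X t) p (cup_power K (sp X t) l))"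
   by (rule inj_on_subset[OF bij_betw_imp_inj_on[OF alg_map_bij(1)[OF w]]]) (use CX in \<open>auto simp: conc_def\<close>)
  ultimately show "bij_betw (?h t) (vc (dcup p K l X) t) (vc (dcup p K l Z) t)" by (simp add: deg_cup_mod bij_betw_def)
 next
  fix s t :: real and v
  assume st: "s <= t" and v: "v : vc (dcup p K l X) t"
  let ?k = "tr X s t o ph s"
  note tX = per_sp_s(1)[OF X st] and tZ = per_sp_s(1)[OF Z st]
  have k: "cmap (sp Z s) (sp X t) ?k" by (rule cm_comp[OF c tX])
  from alg_map_tr[OF c tX k _ deg_cup_alg[OF v]] alg_map_tr[OF tZ c k _ deg_cup_alg[OF v]] n[OF st] show "?h s (res (dcup p K l X) s t v) = res (dcup p K l Z) s t (?h t v)"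
   unfolding deg_cup_mod by simp
 qed
qed

text \<open>For any replacements and any interleaving of them, the modules of \<open>X\<close> and
  \<open>Y\<close> are interleaved with the same shift, because weak equivalences contribute shift
  0. The bound thus holds before either infimum is taken, for every universe type.\<close>

theorem cup_barcodes_le_d_HI:
 fixes X :: "'a pers_space" and Y :: "'b pers_space"
 assumes X: "psp X" "q_tame_cohomology K X" and Y: "psp Y" "q_tame_cohomology K Y"
 shows "d_B (barc K (dcup p K l X)) (barc K (dcup p K l Y)) <= d_HI TYPE('u) X Y"
unfolding d_HI_def
proof (rule Inf_greatest)
 fix e
 assume "e : {d_I_Top X' Y' | (X' :: 'u pers_space) (Y' :: 'u pers_space). psp X' & psp Y' & weakly_equivalent TYPE('u) X' X & weakly_equivalent TYPE('u) Y' Y}"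
 then obtain X' Y' :: "'u pers_space" where e: "e = d_I_Top X' Y'" and P: "psp X'" "psp Y'" and wX: "weakly_equivalent TYPE('u) X' X" and wY: "weakly_equivalent TYPE('u) Y' Y"
  by blast
 have weq: "per_intl K 0 (dcup p K l A) (dcup p K l B)" if A: "psp A" and B: "psp B" and w: "weakly_equivalent TYPE('u) A B" for A :: "'u pers_space" and B :: "'c pers_space"
 proof -
  obtain Z :: "'u pers_space" and ph ps where Z: "psp Z" "nat_trans Z A ph" "nat_trans Z B ps" "!!t. whe (sp Z t) (sp A t) (ph t)" "!!t. whe (sp Z t) (sp B t) (ps t)"
   using w unfolding weakly_equivalent_def by blast
  from per_intl_trans[OF per_mod_cup[OF A] per_mod_cup[OF Z(1)] per_mod_cup[OF B] order_refl order_refl wk_eqv_cup[OF Z(1) A Z(2,4)] per_intl_sym[OF wk_eqv_cup[OF Z(1) B Z(3,5)]]] show ?thesis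
   by simp
 qed
 show "d_B (barc K (dcup p K l X)) (barc K (dcup p K l Y)) <= e" unfolding e d_I_Top_def
 proof (rule Inf_greatest)
  fix r
  assume "r : {ereal ep |ep. 0 <= ep & interleaved ep X' Y'}"
  then obtain ep where ep: "r = ereal ep" "0 <= ep" "interleaved ep X' Y'" by blast
  note mod = per_mod_cup[OF X(1)] per_mod_cup[OF P(1)] per_mod_cup[OF P(2)] per_mod_cup[OF Y(1)]
  have 1: "per_intl K (0 + ep) (dcup p K l X) (dcup p K l Y')"
   by (rule per_intl_trans[OF mod(1) mod(2) mod(3) order_refl ep(2) per_intl_sym[OF weq[OF P(1) X(1) wX]] intl_cup[OF P ep(2,3)]])
  have "0 <= 0 + ep" using ep(2) by simp
  from per_intl_trans[OF mod(1) mod(3) mod(4) this order_refl 1 weq[OF P(2) Y(1) wY]] have "per_intl K ep (dcup p K l X) (dcup p K l Y)" by simp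
  from algebraic_stab[OF mod(1) q_tame_cup[OF X] mod(4) q_tame_cup[OF Y] ep(2) this] show "d_B (barc K (dcup p K l X)) (barc K (dcup p K l Y)) <= r"
   unfolding ep(1) .
 qed
qed

end

section \<open>Geometric realizations\<close>

text \<open>The section \<open>s\<close> may depend on the base point \<open>a\<close>; it is only
  required to return to \<open>a\<close>, with a homotopy fixing \<open>a\<close>. The separate
  condition on empty spaces is needed for surjectivity on path components, as without a point there
  is no section.\<close>

lemma wk_htp_equivalenceI:
 assumes f: "cmap A B f" and ne: "ts A = {} ==> ts B = {}" and s: "!!a. a : ts A ==> EX s. cmap B A s & (ALL y:ts B. f (s y) = y) & s (f a) = a & homotopic_with (%h. h a = a) A A (%x. x) (%x. s (f x))"
 shows "whe A B f"
proof -
 have fB: "f a : ts B" if "a : ts A" for a using f that by (auto simp: continuous_map_def)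
 have "bij_betw (%C. \<Union>x\<in>C. pcs B (f x)) (pcso A) (pcso B)" unfolding bij_betw_def
 proof
  show "inj_on (%C. \<Union>x\<in>C. pcs B (f x)) (pcso A)"
  proof (rule inj_onI)
  fix C D
  assume "C : pcso A" "D : pcso A" and e: "(\<Union>x\<in>C. pcs B (f x)) = (\<Union>x\<in>D. pcs B (f x))"
  then obtain a b where ab: "a : ts A" "C = pcs A a" "b : ts A" "D = pcs A b" unfolding path_components_of_def by blast
  have "pcs B (f a) = pcs B (f b)" using e unfolding ab(2,4) ind_comp[OF f ab(1)] ind_comp[OF f ab(3)] .
  hence pB: "pco B (f a) (f b)" using fB[OF ab(3)] by (metis mem_Collect_eq path_component_of_refl)
  obtain s where s: "cmap B A s" "s (f a) = a" "homotopic_with (%h. h a = a) A A (%x. x) (%x. s (f x))" using s[OF ab(1)] by blast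
  obtain h where h: "cmap (ptop (tp {0..1::real}) A) A h" "!!x. h (0, x) = x" "!!x. h (1, x) = s (f x)" using s(3) unfolding homotopic_with_def by blast
  have "cmap (tp {0..1}) A (h o (%t. (t, b)))" using ab(3) by (intro cm_comp[OF _ h(1)]) (simp add: continuous_map_pairwise o_def)
  hence "pco A b (s (f b))" unfolding path_component_of_def pathin_def using h(2,3) by auto
  moreover have "pco A a (s (f b))" using path_comp_of_img[OF s(1) pB] s(2) by simp
  ultimately show "C = D" using path_component_of_equiv ab(2,4) by metis
  qed
  show "(%C. \<Union>x\<in>C. pcs B (f x)) ` pcso A = pcso B"
  proof
  show "(%C. \<Union>x\<in>C. pcs B (f x)) ` pcso A <= pcso B" using ind_comp[OF f] fB by (auto simp: path_components_of_def)
  show "pcso B <= (%C. \<Union>x\<in>C. pcs B (f x)) ` pcso A"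
  proof
  fix D
  assume "D : pcso B"
  then obtain y where y: "y : ts B" "D = pcs B y" unfolding path_components_of_def by blast
  then obtain a where "a : ts A" using ne by blast
  from s[OF this] obtain s where s: "cmap B A s" "ALL y:ts B. f (s y) = y" by blast
  have sy: "s y : ts A" using s(1) y(1) by (auto simp: continuous_map_def)
  have "D = (\<Union>x\<in>pcs A (s y). pcs B (f x))" unfolding ind_comp[OF f sy] y(2) using s(2) y(1) by simp
  thus "D : (%C. \<Union>x\<in>C. pcs B (f x)) ` pcso A" using sy unfolding path_components_of_def by blast
  qed
  qed
 qed
 moreover have "bij_betw (%C. \<Union>g\<in>C. hcl n B (f a) (f o g)) (hgr n A a) (hgr n B (f a))" if a: "a : ts A" for n a unfolding bij_betw_def
 proof
  obtain s where s: "cmap B A s" "ALL y:ts B. f (s y) = y" "s (f a) = a" "homotopic_with (%h. h a = a) A A (%x. x) (%x. s (f x))" using s[OF a] by blast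
  show "inj_on (%C. \<Union>g\<in>C. hcl n B (f a) (f o g)) (hgr n A a)"
  proof (rule inj_onI)
  fix C D
  assume "C : hgr n A a" "D : hgr n A a" and e: "(\<Union>g\<in>C. hcl n B (f a) (f o g)) = (\<Union>g\<in>D. hcl n B (f a) (f o g))"
  then obtain g g' where g: "cmap (nsphere n) A g" "g sphere_base = a" "C = hcl n A a g" and g': "cmap (nsphere n) A g'" "g' sphere_base = a" "D = hcl n A a g'"
   unfolding homotopy_group_def by blast
  have "hcl n B (f a) (f o g) = hcl n B (f a) (f o g')" using e unfolding g(3) g'(3) ind_htp_class[OF f g(1,2)] ind_htp_class[OF f g'(1,2)] .
  hence "bsd_htp n B (f a) (f o g) (f o g')" using htp_class_eq_iff[OF cm_comp[OF g(1) f]] g(2) by simp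
  from hom_with_comp_l[OF this s(1), where q = "%h. h sphere_base = a"] have sfg: "bsd_htp n A a (s o (f o g)) (s o (f o g'))" using s(3) by simp
  have ret: "bsd_htp n A a k (s o (f o k))" if k: "cmap (nsphere n) A k" "k sphere_base = a" for k
   using homotopic_with_compose_continuous_map_right[OF s(4) k(1), where q = "%h. h sphere_base = a"] k(2) by (simp add: o_def)
  have "bsd_htp n A a g g'" using homotopic_with_trans[OF homotopic_with_trans[OF ret[OF g(1,2)] sfg] homotopic_with_symD[OF ret[OF g'(1,2)]]] .
  thus "C = D" using htp_class_eq_iff[OF g(1,2)] g(3) g'(3) by simp
  qed
  show "(%C. \<Union>g\<in>C. hcl n B (f a) (f o g)) ` hgr n A a = hgr n B (f a)"
  proof
  show "(%C. \<Union>g\<in>C. hcl n B (f a) (f o g)) ` hgr n A a <= hgr n B (f a)"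
  proof
  fix D
  assume "D : (%C. \<Union>g\<in>C. hcl n B (f a) (f o g)) ` hgr n A a"
  then obtain g where g: "cmap (nsphere n) A g" "g sphere_base = a" "D = (\<Union>h\<in>hcl n A a g. hcl n B (f a) (f o h))" unfolding homotopy_group_def
   by blast
  have "D = hcl n B (f a) (f o g)" unfolding g(3) by (rule ind_htp_class[OF f g(1,2)])
  thus "D : hgr n B (f a)" unfolding homotopy_group_def using cm_comp[OF g(1) f] g(2) by simp
  qed
  show "hgr n B (f a) <= (%C. \<Union>g\<in>C. hcl n B (f a) (f o g)) ` hgr n A a"
  proof
  fix D
  assume "D : hgr n B (f a)"
  then obtain h where h: "cmap (nsphere n) B h" "h sphere_base = f a" "D = hcl n B (f a) h" unfolding homotopy_group_def by blast
  have sh: "cmap (nsphere n) A (s o h)" "(s o h) sphere_base = a" using cm_comp[OF h(1) s(1)] h(2) s(3) by auto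
  have "bsd_htp n B (f a) h (f o (s o h))"
  proof (rule homotopic_with_equal)
  show "cmap (nsphere n) B h" by (rule h(1))
  show "h x = (f o (s o h)) x" if "x : ts (nsphere n)" for x
  proof -
  have "h x : ts B" using h(1) that by (auto simp: continuous_map_def)
  thus ?thesis using s(2) by simp
  qed
  qed (simp_all add: h(2) s(3))
  hence "D = (\<Union>g\<in>hcl n A a (s o h). hcl n B (f a) (f o g))" unfolding ind_htp_class[OF f sh] h(3) using htp_class_eq_iff[OF h(1,2)] by simp
  moreover have "hcl n A a (s o h) : hgr n A a" unfolding homotopy_group_def using sh by blast
  ultimately show "D : (%C. \<Union>g\<in>C. hcl n B (f a) (f o g)) ` hgr n A a" by blast
  qed
  qed
 qed
 ultimately show ?thesis using f by (simp add: weak_homotopy_equivalence_def)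
qed

text \<open>Compact subspaces of \<open>X\<close> suffice as test spaces. They are copied into the
  type of the test spaces by sending \<open>x\<close> to the singleton of its singleton.\<close>

lemma cgwh_sp_if_k_Hd:
 fixes X :: "'a topology"
 assumes k: "k_space X" and H: "Hausdorff_space X"
 shows "cgwh_space X"
proof -
 have "weak_Hausdorff_space X" unfolding weak_Hausdorff_space_def by (metis compact_space_def image_compactin compactin_imp_closedin[OF H])
 moreover have "compactly_generated_space X" unfolding compactly_generated_space_def
 proof (intro allI impI)
  fix A
  assume A: "A <= ts X" and test: "ALL (T :: 'a set set topology) u. compact_space T & Hausdorff_space T & cmap T X u --> closedin T {x : ts T. u x : A}"
  have "closedin (subtopology X C) (C Int A)" if C: "compactin X C" for C
  proof -
  let ?i = "%x. {{x}}" and ?j = "%S. the_elem (the_elem S)"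
  define T where "T = pullback_topology (?i ` C) ?j (subtopology X C)"
  have CX: "C <= ts X" by (rule compactin_subset_topspace[OF C])
  have tT: "ts T = ?i ` C" and j: "cmap T (subtopology X C) ?j" using CX continuous_map_pullback[OF continuous_map_id, of "?i ` C" ?j "subtopology X C"]
   by (auto simp: T_def topspace_pullback_topology)
  have i: "cmap (subtopology X C) T ?i" unfolding T_def by (rule continuous_map_pullback') (use CX in \<open>auto simp: o_def\<close>)
  have "homeomorphic_maps T (subtopology X C) ?j ?i" unfolding homeomorphic_maps_def using i j tT by auto
  hence hom: "T homeomorphic_space subtopology X C" by (auto simp: homeomorphic_space_def)
  have "compact_space T" using homeomorphic_compact_space[OF hom] C by (simp add: compact_space_subtopology)
  moreover have "Hausdorff_space T" using homeomorphic_Hausdorff_space[OF hom] H by (simp add: Hausdorff_space_subtopology)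
  moreover have "cmap T X ?j" using j by (rule continuous_map_into_fulltopology)
  ultimately have "closedin T {x : ts T. ?j x : A}" using test by blast
  hence "closedin (subtopology X C) {x : ts (subtopology X C). ?i x : {x : ts T. ?j x : A}}" by (rule closedin_continuous_map_preimage[OF i])
  moreover have "{x : ts (subtopology X C). ?i x : {x : ts T. ?j x : A}} = C Int A" using tT CX by auto
  ultimately show ?thesis by simp
  qed
  thus "closedin X A" using k A unfolding k_space by blast
 qed
 ultimately show ?thesis by (simp add: cgwh_space_def)
qed

section \<open>Geometric realizations of simplicial complexes\<close>

definition spl_cx :: "'v set set => bool" where "spl_cx P <-> (ALL sg:P. finite sg & sg ~= {}) & (ALL sg:P. ALL ta. ta <= sg --> ta ~= {} --> ta : P)"

lemma real_pts_eq: assumes P: "spl_cx P" shows "rpts P = (\<Union>sg\<in>P. csx sg)"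
proof (intro Set.set_eqI iffI)
 fix x
 assume x: "x : rpts P"
 hence "x : csx {v. x v ~= 0}" by (auto simp: realization_points_def closed_simplex_def)
 thus "x : (\<Union>sg\<in>P. csx sg)" using x by (auto simp: realization_points_def)
next
 fix x
 assume "x : (\<Union>sg\<in>P. csx sg)"
 then obtain sg where sg: "sg : P" "ALL v. 0 <= x v" "ALL v. v ~: sg --> x v = 0" "(\<Sum>v\<in>sg. x v) = 1" by (auto simp: closed_simplex_def)
 have fin: "finite sg" using P sg(1) by (simp add: spl_cx_def)
 have sub: "{v. x v ~= 0} <= sg" using sg(3) by blast
 have "(\<Sum>v | x v ~= 0. x v) = (\<Sum>v\<in>sg. x v)" by (rule sum.mono_neutral_left[OF fin sub]) auto
 moreover have "{v. x v ~= 0} ~= {}"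
 proof
  assume e: "{v. x v ~= 0} = {}"
  show False using calculation sg(4) unfolding e by simp
 qed
 ultimately show "x : rpts P" using P sg sub by (auto simp: realization_points_def spl_cx_def)
qed

lemma ts_real [simp]: "ts (geo P) = rpts P" if "spl_cx P"
proof -
 have "openin (geo P) (rpts P)" unfolding open_geo
 proof (intro conjI ballI order_refl)
  fix sg
  assume "sg : P"
  hence "rpts P Int csx sg = csx sg" using real_pts_eq[OF that] by auto
  thus "openin (subtopology (powertop_real UNIV) (csx sg)) (rpts P Int csx sg)" by (simp add: openin_subtopology_refl)
 qed
 moreover have "U <= rpts P" if "openin (geo P) U" for U using that by (simp add: open_geo)
 ultimately show ?thesis by (metis openin_subset openin_topspace subset_antisym)
qed

lemma cont_map_from_real:
 assumes P: "spl_cx P" and f: "!!sg. sg : P ==> cmap (tp (csx sg)) T f"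
 shows "cmap (geo P) T f"
unfolding continuous_map_def ts_real[OF P]
proof (intro conjI allI impI funcsetI)
 show "f x : ts T" if "x : rpts P" for x using that f by (auto simp: real_pts_eq[OF P] continuous_map_def)
 fix U
 assume U: "openin T U"
 show "openin (geo P) {x : rpts P. f x : U}" unfolding open_geo
 proof (intro conjI ballI)
  fix sg
  assume sg: "sg : P"
  have "{x : rpts P. f x : U} Int csx sg = {x : ts (tp (csx sg)). f x : U}" using sg real_pts_eq[OF P] by auto
  thus "openin (subtopology (powertop_real UNIV) (csx sg)) ({x : rpts P. f x : U} Int csx sg)" using open_pre[OF f[OF sg] U] by (simp add: euc_prod)
 qed blast
qed

lemma cl_spx_inc: assumes P: "spl_cx P" and sg: "sg : P" shows "cmap (tp (csx sg)) (geo P) (%x. x)"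
unfolding continuous_map_def ts_real[OF P]
proof (intro conjI allI impI)
 show "(%x. x) : ts (tp (csx sg)) -> rpts P" using sg real_pts_eq[OF P] by auto
 fix U
 assume "openin (geo P) U"
 hence "openin (tp (csx sg)) (U Int csx sg)" using sg by (simp add: open_geo euc_prod)
 thus "openin (tp (csx sg)) {x : ts (tp (csx sg)). x : U}" by (simp add: Int_def conj_commute)
qed

lemma real_to_prod: "spl_cx P ==> cmap (geo P) euclidean (%x. x)" by (rule cont_map_from_real) auto

text \<open>The weak topology is finer than the product topology, which is Hausdorff.\<close>

lemma Hd_real: "spl_cx P ==> Hausdorff_space (geo P)"
proof (rule Hausdorff_space_injective_preimage)
 have "Hausdorff_space (powertop_real (UNIV :: 'a set))" by (simp add: Hausdorff_space_product_topology)
 thus "Hausdorff_space (euclidean :: ('a => real) topology)" by (simp add: euc_prod)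
qed (auto intro: real_to_prod)

lemma cpt_cl_spx: "finite sg ==> compact (csx sg)"
proof -
 assume sg: "finite sg"
 let ?B = "PiE UNIV (%v. if v : sg then {0..1} else {0 :: real})"
 have "compactin (powertop_real UNIV) ?B" by (simp add: compactin_PiE)
 hence B: "compact ?B" by (simp add: euc_prod)
 have comp: "con UNIV (%x :: 'a => real. x v)" for v by simp
 have "closed {x :: 'a => real. (\<Sum>v\<in>sg. x v) = 1}" by (intro closed_Collect_eq continuous_on_sum comp continuous_on_const)
 from compact_Int_closed[OF B this] have "compact (?B Int {x. (\<Sum>v\<in>sg. x v) = 1})" .
 also have "?B Int {x. (\<Sum>v\<in>sg. x v) = 1} = csx sg"
 proof (intro Set.set_eqI iffI)
  fix x
  assume x: "x : csx sg"
  hence "x v <= 1" if "v : sg" for v using member_le_sum[OF that _ sg, of x] by (simp add: closed_simplex_def)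
  thus "x : ?B Int {x. (\<Sum>v\<in>sg. x v) = 1}" using x by (auto simp: closed_simplex_def)
 next
  fix x
  assume "x : ?B Int {x. (\<Sum>v\<in>sg. x v) = 1}"
  hence x: "x : ?B" "(\<Sum>v\<in>sg. x v) = 1" by auto
  have "x v : (if v : sg then {0..1} else {0})" for v using PiE_mem[OF x(1), of v] by simp
  hence "0 <= x v & (v ~: sg --> x v = 0)" for v by (metis atLeastAtMost_iff order_refl singletonD)
  thus "x : csx sg" using x(2) by (simp add: closed_simplex_def)
 qed
 finally show ?thesis .
qed

text \<open>Closed simplices are compact and detect the open sets of the weak topology.\<close>

lemma k_sp_real: assumes P: "spl_cx P" shows "k_space (geo P)"
unfolding k_space_open
proof (intro allI impI)
 fix S
 assume S: "S <= ts (geo P) & (ALL C. compactin (geo P) C --> openin (subtopology (geo P) C) (C Int S))"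
 show "openin (geo P) S" unfolding open_geo
 proof (intro conjI ballI)
  show "S <= rpts P" using S P by simp
  fix sg
  assume sg: "sg : P"
  let ?c = "tp (csx sg)"
  have i: "cmap ?c (geo P) (%x. x)" by (rule cl_spx_inc[OF P sg])
  have "compactin ?c (csx sg)" using cpt_cl_spx[of sg] P sg by (simp add: spl_cx_def)
  hence "compactin (geo P) (csx sg)" using image_compactin[OF _ i] by simp
  hence "openin (subtopology (geo P) (csx sg)) (csx sg Int S)" using S by blast
  moreover have "cmap ?c (subtopology (geo P) (csx sg)) (%x. x)" using i by (auto simp: cm_in_sub)
  ultimately have "openin ?c {x : ts ?c. x : csx sg Int S}" by (rule open_pre[rotated])
  moreover have "{x : ts ?c. x : csx sg Int S} = S Int csx sg" by auto
  ultimately show "openin (subtopology (powertop_real UNIV) (csx sg)) (S Int csx sg)" by (simp add: euc_prod)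
 qed
qed

text \<open>The realization is a quotient of the disjoint union of its closed simplices, and products with
  the interval preserve quotient maps.\<close>

lemma cont_map_from_real_cyl:
 assumes P: "spl_cx P" and f: "!!sg. sg : P ==> cmap (tp ({0..1::real} >< csx sg)) T f"
 shows "cmap (ptop (tp {0..1}) (geo P)) T f"
proof -
 let ?I = "tp {0..1::real}" and ?E = "euclidean :: ('a => real) topology"
 \<comment> \<open>The disjoint union of the closed simplices, modelled as a subspace of the product
   of the discrete space \<open>P\<close> with the space of all coordinate functions.\<close>
 define D where "D = Sigma P csx"
 define W where "W = subtopology (ptop (discrete_topology P) ?E) D"
 have tW: "ts W = D" by (auto simp: W_def D_def)
 have sndW: "cmap W ?E snd" and fstW: "cmap W (discrete_topology P) fst" unfolding W_def
  by (auto intro: continuous_map_from_subtopology continuous_map_fst continuous_map_snd)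
 have piece: "openin W {z : D. fst z = sg}" if "sg : P" for sg using open_pre[OF fstW, of "{sg}"] that by (simp add: tW)
 have q: "quotient_map W (geo P) snd" unfolding quotient_map_def ts_real[OF P] tW
 proof (intro conjI allI impI)
  show "snd ` D = rpts P" using real_pts_eq[OF P] by (force simp: D_def)
  fix U
  assume U: "U <= rpts P"
  show "openin W {z : D. snd z : U} = openin (geo P) U"
  proof
  assume o: "openin W {z : D. snd z : U}"
  show "openin (geo P) U" unfolding open_geo
  proof (intro conjI ballI U)
  fix sg
  assume sg: "sg : P"
  have "cmap (tp (csx sg)) W (%x. (sg, x))" unfolding W_def cm_in_sub using sg by (auto simp: continuous_map_pairwise o_def D_def)
  from open_pre[OF this o] have "openin (tp (csx sg)) {x : csx sg. (sg, x) : {z : D. snd z : U}}" by simp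
  moreover have "{x : csx sg. (sg, x) : {z : D. snd z : U}} = U Int csx sg" using sg by (auto simp: D_def)
  ultimately show "openin (subtopology (powertop_real UNIV) (csx sg)) (U Int csx sg)" by (simp add: euc_prod)
  qed
  next
  assume "openin (geo P) U"
  moreover have "cmap W (geo P) snd"
  proof (rule pasting_lemma[where I = P and T = "%sg. {z : D. fst z = sg}" and f = "%_. snd"])
  fix sg
  assume sg: "sg : P"
  have "cmap (subtopology W {z : D. fst z = sg}) (tp (csx sg)) snd" using sndW by (auto simp: cm_in_sub D_def intro: continuous_map_from_subtopology)
  from cm_comp[OF this cl_spx_inc[OF P sg]] show "cmap (subtopology W {z : D. fst z = sg}) (geo P) snd" by (simp add: o_def)
  qed (use piece tW in \<open>auto simp: D_def\<close>)
  ultimately have "openin W {z : ts W. snd z : U}" by (rule open_pre[rotated])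
  thus "openin W {z : D. snd z : U}" by (simp add: tW)
  qed
 qed
 have q': "quotient_map (ptop ?I W) (ptop ?I (geo P)) (%(t, z). (t, snd z))"
 proof (rule quotient_map_prod_right[OF _ _ q])
  have "compact_space ?I" by (simp add: compact_space_subtopology)
  thus "locally_compact_space ?I" by (rule compact_imp_locally_compact_space)
  show "Hausdorff_space ?I | regular_space ?I" by (simp add: Hausdorff_space_subtopology)
 qed
 have "cmap (ptop ?I W) T (f o (%(t, z). (t, snd z)))"
 proof (rule pasting_lemma[where I = P and T = "%sg. {0..1} >< {z : D. fst z = sg}" and f = "%_. f o (%(t, z). (t, snd z))"])
  fix sg
  assume sg: "sg : P"
  show "openin (ptop ?I W) ({0..1} >< {z : D. fst z = sg})" using piece[OF sg] by (simp add: openin_prod_Times_iff)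
  let ?S = "subtopology (ptop ?I W) ({0..1} >< {z : D. fst z = sg})"
  have a: "cmap ?S ?I (%w. fst w)" by (intro continuous_map_from_subtopology continuous_map_fst)
  have "cmap ?S W (%w. snd w)" by (intro continuous_map_from_subtopology continuous_map_snd)
  from cm_comp[OF this sndW] have "cmap ?S ?E (%w. snd (snd w))" by (simp add: o_def)
  hence b: "cmap ?S (tp (csx sg)) (%w. snd (snd w))" by (auto simp: cm_in_sub D_def)
  have "cmap ?S (ptop ?I (tp (csx sg))) (%w. (fst w, snd (snd w)))" unfolding continuous_map_pairwise using a b by (simp add: o_def)
  hence "cmap ?S (tp ({0..1} >< csx sg)) (%w. (fst w, snd (snd w)))" by simp
  from cm_comp[OF this f[OF sg]] show "cmap ?S T (f o (%(t, z). (t, snd z)))" by (simp add: o_def case_prod_beta)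
 next
  fix x
  assume "x : ts (ptop ?I W)"
  thus "EX sg. sg : P & x : {0..1} >< {z : D. fst z = sg} & (f o (%(t, z). (t, snd z))) x = (f o (%(t, z). (t, snd z))) x" by (auto simp: tW D_def)
 qed auto
 thus ?thesis using continuous_compose_quotient_map[OF q'] by blast
qed

section \<open>Projections of vertices and the induced maps of realizations\<close>

lemma cont_map_into_real:
 assumes S: "spl_cx S" "ta : S" and f: "!!v. con Z (%z. f z v)" "f ` Z <= csx ta"
 shows "cmap (tp Z) (geo S) f"
proof -
 have "con Z f" by (rule con_coordwise) (rule f(1))
 hence "cts Z (csx ta) f" using f(2) by auto
 from cm_comp[OF this cl_spx_inc[OF S]] show ?thesis by (simp add: o_def)
qed

text \<open>The map of realizations induced by the vertex map \<open>pj\<close>: barycentric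
  coordinates are added up along fibres. Summing over the support of \<open>x\<close> makes it
  independent of a simplex containing \<open>x\<close>.\<close>

definition push :: "('r => 'v) => ('r => real) => 'v => real" where "push pj x = (%m. \<Sum>r | x r ~= 0 & pj r = m. x r)"

lemma push_eq:
 assumes "finite sg" "x : csx sg"
 shows "push pj x m = (\<Sum>r\<in>{r : sg. pj r = m}. x r)" unfolding push_def using assms
 by (intro sum.mono_neutral_left) (auto simp: closed_simplex_def)

lemma push_in: assumes "finite sg" "x : csx sg" shows "push pj x : csx (pj ` sg)"
proof -
 have "(\<Sum>m\<in>pj ` sg. push pj x m) = (\<Sum>r\<in>sg. x r)" unfolding push_eq[OF assms] by (rule sum.image_gen[symmetric]) (rule assms(1))
 moreover have "push pj x m = 0" if "m ~: pj ` sg" for m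
 proof -
  have "{r : sg. pj r = m} = {}" using that by blast
  thus ?thesis unfolding push_eq[OF assms] by (simp only: sum.empty)
 qed
 moreover have "0 <= push pj x m" for m unfolding push_eq[OF assms] using assms(2) by (intro sum_nonneg) (auto simp: closed_simplex_def)
 ultimately show ?thesis using assms(2) by (simp add: closed_simplex_def)
qed

lemma cont_on_push: assumes "finite sg" shows "con (csx sg) (%x. push pj x m)"
proof -
 have "con (csx sg) (%x. \<Sum>r\<in>{r : sg. pj r = m}. x r)" by (intro continuous_on_sum con_sub[OF con_coords]) simp
 thus ?thesis by (rule continuous_on_eq) (simp add: push_eq[OF assms])
qed

text \<open>A family of probability weights on the fibres of \<open>pj\<close> is a section of \<open>push pj\<close> up to homotopy.\<close>

definition spread :: "('r => 'v) => ('r => real) => ('v => real) => 'r => real" where "spread pj w y = (%r. y (pj r) * w r)"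

text \<open>The full preimage of the complex: finite sets of points in one fibre are simplices as
  well, which is what makes the fibres contractible.\<close>

definition pl_cx :: "('r => 'v) => 'r set => 'v set set => 'r set set" where "pl_cx pj R S = {sg. sg <= R & finite sg & sg ~= {} & pj ` sg : S}"

lemma spl_pl_cx: "spl_cx S ==> spl_cx (pl_cx pj R S)"
unfolding spl_cx_def pl_cx_def
proof (intro conjI ballI allI impI)
 fix sg ta
 assume S: "(ALL sg:S. finite sg & sg ~= {}) & (ALL sg:S. ALL ta. ta <= sg --> ta ~= {} --> ta : S)" and sg: "sg : {sg. sg <= R & finite sg & sg ~= {} & pj ` sg : S}" and ta: "ta <= sg" "ta ~= {}"
 have s: "sg <= R" "finite sg" "pj ` sg : S" using sg by auto
 have i: "pj ` ta <= pj ` sg" "pj ` ta ~= {}" using ta by auto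
 have "pj ` ta : S" by (rule mp[OF mp[OF spec[OF bspec[OF conjunct2[OF S] s(3)]] i(1)] i(2)])
 thus "ta : {sg. sg <= R & finite sg & sg ~= {} & pj ` sg : S}" using order_trans[OF ta(1) s(1)] fin_sub[OF ta(1) s(2)] ta(2) by simp
qed simp_all

lemma cont_push: assumes S: "spl_cx S" shows "cmap (geo (pl_cx pj R S)) (geo S) (push pj)"
proof (rule cont_map_from_real[OF spl_pl_cx[OF S]])
 fix sg
 assume "sg : pl_cx pj R S"
 hence f: "finite sg" "pj ` sg : S" by (auto simp: pl_cx_def)
 show "cmap (tp (csx sg)) (geo S) (push pj)" by (rule cont_map_into_real[OF S f(2) cont_on_push[OF f(1)]]) (use push_in[OF f(1)] in blast)
qed

locale fuzzy_section =
 fixes pj :: "'r => 'v" and R :: "'r set" and S :: "'v set set" and w :: "'r => real"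
 assumes S: "spl_cx S" and w_nonneg: "0 <= w r" and w_R: "w r ~= 0 ==> r : R" and w_fin: "m : \<Union>S ==> finite {r. pj r = m & w r ~= 0}" and w_sum: "m : \<Union>S ==> (\<Sum>r | pj r = m & w r ~= 0. w r) = 1" begin

abbreviation "P \<equiv> pl_cx pj R S"
definition lift :: "'v set => 'r set" where "lift sg = {r. pj r : sg & w r ~= 0}"

lemma P: "spl_cx P" by (rule spl_pl_cx[OF S])

lemma lift_in: assumes sg: "sg : S" shows "lift sg : P" "pj ` lift sg = sg" "finite (lift sg)"
proof -
 have "lift sg = (\<Union>m\<in>sg. {r. pj r = m & w r ~= 0})" by (auto simp: lift_def)
 moreover have "finite sg" "sg ~= {}" using S sg by (auto simp: spl_cx_def)
 ultimately show f: "finite (lift sg)" using w_fin sg by auto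
 show e: "pj ` lift sg = sg"
 proof
  show "sg <= pj ` lift sg"
  proof
  fix m
  assume m: "m : sg"
  hence "(\<Sum>r | pj r = m & w r ~= 0. w r) ~= 0" using w_sum[OF UnionI[OF sg]] by simp
  hence "{r. pj r = m & w r ~= 0} ~= {}" by force
  thus "m : pj ` lift sg" using m by (auto simp: lift_def)
  qed
 qed (auto simp: lift_def)
 show "lift sg : P" using f e sg \<open>sg ~= {}\<close> w_R by (auto simp: pl_cx_def lift_def)
qed

lemma spr_in:
 assumes sg: "sg : S" and y: "y : csx sg"
 shows "spread pj w y : csx (lift sg)" "push pj (spread pj w y) = y"
proof -
 have fib: "(\<Sum>r\<in>{r : lift sg. pj r = m}. spread pj w y r) = y m" if "m : sg" for m
 proof -
  have "{r : lift sg. pj r = m} = {r. pj r = m & w r ~= 0}" using that by (auto simp: lift_def)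
  hence "(\<Sum>r\<in>{r : lift sg. pj r = m}. spread pj w y r) = (\<Sum>r | pj r = m & w r ~= 0. y m * w r)" by (intro sum.cong) (auto simp: spread_def)
  also have "... = y m" using w_sum[OF UnionI[OF sg that]] by (simp add: sum_distrib_left[symmetric])
  finally show ?thesis .
 qed
 have "(\<Sum>r\<in>lift sg. spread pj w y r) = (\<Sum>m\<in>pj ` lift sg. \<Sum>r\<in>{r : lift sg. pj r = m}. spread pj w y r)"
  by (rule sum.image_gen[OF lift_in(3)[OF sg]])
 also have "... = (\<Sum>m\<in>sg. y m)" unfolding lift_in(2)[OF sg] by (intro sum.cong fib) auto
 finally have s: "(\<Sum>r\<in>lift sg. spread pj w y r) = 1" using y by (simp add: closed_simplex_def)
 show c: "spread pj w y : csx (lift sg)" using y w_nonneg s by (auto simp: closed_simplex_def spread_def lift_def)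
 show "push pj (spread pj w y) = y"
 proof
  fix m
  show "push pj (spread pj w y) m = y m"
  proof (cases "m : sg")
  case True
  thus ?thesis using fib push_eq[OF lift_in(3)[OF sg] c, of pj m] by simp
  next
  case False
  thus ?thesis using lift_in(2)[OF sg] using push_in[OF lift_in(3)[OF sg] c, of pj] y by (simp add: closed_simplex_def)
  qed
 qed
qed

lemma cont_spr: "cmap (geo S) (geo P) (spread pj w)"
proof (rule cont_map_from_real[OF S])
 fix sg
 assume sg: "sg : S"
 show "cmap (tp (csx sg)) (geo P) (spread pj w)"
 proof (rule cont_map_into_real[OF P lift_in(1)[OF sg]])
  show "con (csx sg) (%z. spread pj w z v)" for v unfolding spread_def by (intro continuous_on_mult continuous_on_const con_sub[OF con_coords]) simp
 qed (use spr_in(1)[OF sg] in blast)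
qed

lemma push_spr: "y : ts (geo S) ==> push pj (spread pj w y) = y" using spr_in(2) S by (auto simp: real_pts_eq)

lemma spr_htp:
 assumes a: "spread pj w (push pj a) = a"
 shows "homotopic_with (%h. h a = a) (geo P) (geo P) (%x. x) (%x. spread pj w (push pj x))"
unfolding homotopic_with_def
proof (intro exI conjI allI ballI)
 let ?H = "%z r. (1 - fst z) * snd z r + fst z * spread pj w (push pj (snd z)) r"
 show "cmap (ptop (tp {0..1}) (geo P)) (geo P) ?H"
 proof (rule cont_map_from_real_cyl[OF P])
  fix sg
  assume sg: "sg : P"
  hence f: "finite sg" "pj ` sg : S" by (auto simp: pl_cx_def)
  let ?ta = "sg Un lift (pj ` sg)"
  note L = lift_in[OF f(2)]
  have ta: "?ta : P" using sg L by (auto simp: pl_cx_def image_Un)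
  have fin: "finite ?ta" using f(1) L(3) by simp
  show "cmap (tp ({0..1} >< csx sg)) (geo P) ?H"
  proof (rule cont_map_into_real[OF P ta])
  fix v
  have p: "con ({0..1::real} >< csx sg) (%z. push pj (snd z) (pj v))" by (rule con_comp2[OF cont_on_push[OF f(1)] con_snd[OF con_id]]) auto
  have c: "con ({0..1::real} >< csx sg) (%z. snd z v)" by (rule con_comp2[OF con_coords con_snd[OF con_id]]) auto
  show "con ({0..1} >< csx sg) (%z. ?H z v)" unfolding spread_def
   by (intro continuous_on_add continuous_on_mult continuous_on_diff continuous_on_const p c con_fst con_id)
  next
  show "?H ` ({0..1} >< csx sg) <= csx ?ta"
  proof
  fix y
  assume "y : ?H ` ({0..1} >< csx sg)"
  then obtain t x where t: "t : {0..1}" and x: "x : csx sg" and y: "y = (%r. (1 - t) * x r + t * spread pj w (push pj x) r)" by auto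
  define z where "z = spread pj w (push pj x)"
  have z: "z : csx (lift (pj ` sg))" unfolding z_def by (rule spr_in(1)[OF f(2) push_in[OF f(1) x]])
  have "(\<Sum>r\<in>?ta. y r) = (1 - t) * (\<Sum>r\<in>?ta. x r) + t * (\<Sum>r\<in>?ta. z r)" unfolding y z_def[symmetric]
   by (simp add: sum.distrib sum_distrib_left)
  thus "y : csx ?ta"
   using sum.mono_neutral_left[OF fin, of sg x] sum.mono_neutral_left[OF fin, of "lift (pj ` sg)" z] using x z t unfolding y z_def[symmetric]
   by (simp add: closed_simplex_def)
  qed
  qed
 qed
 show "?H (0, x) = x" "?H (1, x) = spread pj w (push pj x)" for x by auto
 show "?H (t, a) = a" for t by (simp add: a algebra_simps)
qed

end

text \<open>\<open>A\<close> stands for a copy of the realization with points in another type. For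
  each point a section through it is produced by suitable weights, as
  \<open>wk_htp_equivalenceI\<close> requires.\<close>

theorem push_wk_eqv:
 fixes pj :: "'r => 'v"
 assumes S: "spl_cx S" and R: "\<Union>S <= pj ` R" and e: "homeomorphic_maps A (geo (pl_cx pj R S)) i e"
 shows "whe A (geo S) (push pj o i)"
proof (rule wk_htp_equivalenceI)
 let ?P = "pl_cx pj R S"
 note P = spl_pl_cx[OF S, of pj R]
 define rh where "rh m = (SOME r. r : R & pj r = m)" for m
 have rh: "rh m : R" "pj (rh m) = m" if "m : \<Union>S" for m using someI_ex[of "%r. r : R & pj r = m"] R that unfolding rh_def by blast+
 \<comment> \<open>On a fibre where \<open>a\<close> has mass, the weights are the conditional
   distribution of \<open>a\<close>, so that spreading the push forward restores \<open>a\<close>.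
   On the remaining fibres over vertices all weight sits at one chosen point.\<close>
 define w where "w a r = (if push pj a (pj r) ~= 0 then a r / push pj a (pj r) else if pj r : \<Union>S & r = rh (pj r) then 1 else 0)" for a r
 have fz: "fuzzy_section pj R S (w a)" and fix_pt: "spread pj (w a) (push pj a) = a" if a: "a : ts (geo ?P)" for a
 proof -
  obtain sg where sg: "sg : ?P" "a : csx sg" using a P by (auto simp: real_pts_eq)
  hence f: "finite sg" "sg <= R" "pj ` sg : S" by (auto simp: pl_cx_def)
  have a0: "0 <= a r" "r ~: sg ==> a r = 0" for r using sg(2) by (auto simp: closed_simplex_def)
  have p0: "0 <= push pj a m" for m using push_in[OF f(1) sg(2), of pj] by (simp add: closed_simplex_def)
  have pz: "a r = 0" if "push pj a (pj r) = 0" for r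
  proof (cases "r : sg")
  case True
  hence "a r <= (\<Sum>r'\<in>{r' : sg. pj r' = pj r}. a r')" using f(1) a0 by (intro member_le_sum) auto
  thus ?thesis using that a0(1)[of r] unfolding push_eq[OF f(1) sg(2)] by simp
  qed (rule a0)
  have fib: "finite {r. pj r = m & w a r ~= 0} & (\<Sum>r | pj r = m & w a r ~= 0. w a r) = 1" if m: "m : \<Union>S" for m
  proof (cases "push pj a m = 0")
  case True
  have "{r. pj r = m & w a r ~= 0} = {rh m}" using True m rh[OF m] by (auto simp: w_def)
  thus ?thesis using True m rh[OF m] by (simp add: w_def)
  next
  case False
  have e: "{r. pj r = m & w a r ~= 0} = {r. a r ~= 0 & pj r = m}" using False by (auto simp: w_def)
  have "finite {r. a r ~= 0 & pj r = m}" by (rule fin_sub[OF _ f(1)]) (use a0(2) in blast)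
  moreover have "(\<Sum>r | a r ~= 0 & pj r = m. w a r) = (\<Sum>r | a r ~= 0 & pj r = m. a r / push pj a m)" using False
   by (intro sum.cong) (auto simp: w_def)
  moreover have "... = push pj a m / push pj a m" by (simp add: push_def sum_divide_distrib[symmetric])
  ultimately show ?thesis unfolding e using False by simp
  qed
  show "fuzzy_section pj R S (w a)"
  proof
  show "spl_cx S" by (rule S)
  show "0 <= w a r" for r using a0 p0 by (simp add: w_def)
  show "r : R" if r: "w a r ~= 0" for r
  proof (cases "push pj a (pj r) = 0")
  case True
  hence "pj r : \<Union>S" "r = rh (pj r)" using r by (auto simp: w_def split: if_splits)
  thus ?thesis using rh(1) by metis
  next
  case False
  hence "a r ~= 0" using r by (simp add: w_def)
  thus ?thesis using a0(2) f(2) by blast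
  qed
  qed (use fib in auto)
  show "spread pj (w a) (push pj a) = a"
  proof
  fix r
  show "spread pj (w a) (push pj a) r = a r" using pz[of r] by (simp add: spread_def w_def)
  qed
 qed
 have ci: "cmap A (geo ?P) i" and ce: "cmap (geo ?P) A e" and ie: "!!x. x : ts A ==> e (i x) = x" "!!y. y : ts (geo ?P) ==> i (e y) = y" using e
  by (simp_all add: homeomorphic_maps_def)
 have it: "i x : ts (geo ?P)" if "x : ts A" for x using ci that by (auto simp: continuous_map_def)
 show "cmap A (geo S) (push pj o i)" by (rule cm_comp[OF ci cont_push[OF S]])
 show "ts (geo S) = {}" if A: "ts A = {}"
 proof (rule ccontr)
  have e: "ts (geo ?P) = {}" using continuous_map_image_subset_topspace[OF ce] unfolding A by blast
  assume "ts (geo S) ~= {}"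
  then obtain sg where sg: "sg : S" using S by (auto simp: real_pts_eq)
  have "sg ~= {}" using S sg by (simp add: spl_cx_def)
  then obtain m where m: "m : sg" by blast
  hence mS: "m : \<Union>S" "{m} : S" using sg S by (auto simp: spl_cx_def)
  have "{rh m} : ?P" using rh[OF mS(1)] mS(2) by (auto simp: pl_cx_def)
  moreover have "(%r. if r = rh m then 1 else 0) : csx {rh m}" by (simp add: closed_simplex_def)
  ultimately show False using e P by (auto simp: real_pts_eq)
 qed
 fix x
 assume x: "x : ts A"
 define a where "a = i x"
 have a: "a : ts (geo ?P)" unfolding a_def by (rule it[OF x])
 interpret fuzzy_section pj R S "w a" by (rule fz[OF a])
 have st: "spread pj (w a) y : ts (geo ?P)" if "y : ts (geo S)" for y using cont_spr that by (auto simp: continuous_map_def)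
 show "EX s. cmap (geo S) A s & (ALL y:ts (geo S). (push pj o i) (s y) = y) & s ((push pj o i) x) = x & homotopic_with (%h. h x = x) A A (%x. x) (%x. s ((push pj o i) x))"
 proof (intro exI[of _ "e o spread pj (w a)"] conjI ballI)
  show "cmap (geo S) A (e o spread pj (w a))" by (rule cm_comp[OF cont_spr ce])
  show "(push pj o i) ((e o spread pj (w a)) y) = y" if "y : ts (geo S)" for y using ie(2)[OF st[OF that]] push_spr[OF that] by simp
  show "(e o spread pj (w a)) ((push pj o i) x) = x" using fix_pt[OF a] ie(1)[OF x] by (simp add: a_def)
  have 1: "homotopic_with (%h. h x = a) A (geo ?P) ((%y. y) o i) ((%y. spread pj (w a) (push pj y)) o i)"
   by (rule homotopic_with_compose_continuous_map_right[OF spr_htp[OF fix_pt[OF a]] ci]) (simp add: a_def)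
  have "homotopic_with (%h. h x = x) A A (e o ((%y. y) o i)) (e o ((%y. spread pj (w a) (push pj y)) o i))"
   by (rule hom_with_comp_l[OF 1 ce]) (simp add: a_def ie(1)[OF x])
  thus "homotopic_with (%h. h x = x) A A (%x. x) (%x. (e o spread pj (w a)) ((push pj o i) x))" by (rule homotopic_with_eq) (use ie x in auto)
 qed
qed

text \<open>Moves a topology along an injection into another type. It is used to place the mediating
  spaces into the universe type of \<open>d_HI\<close>.\<close>

definition copy :: "('a => 'u) => 'a topology => 'u topology" where "copy e T = pullback_topology (e ` ts T) (inv_into UNIV e) T"

lemma copy_homeo: assumes "inj e" shows "homeomorphic_maps (copy e T) T (inv_into UNIV e) e"
 using continuous_map_pullback[OF continuous_map_id, of "e ` ts T" "inv_into UNIV e" T] assms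
 by (auto simp: copy_def homeomorphic_maps_def topspace_pullback_topology)

lemma cont_copy:
 assumes e: "inj e" and c: "cmap T T' (%x. x)"
 shows "cmap (copy e T) (copy e T') (%x. x)"
proof -
 have h: "cmap (copy e T) T (inv_into UNIV e)" "cmap T' (copy e T') e" using copy_homeo[OF e] by (simp_all add: homeomorphic_maps_def)
 have "cmap (copy e T) (copy e T') (e o ((%x. x) o inv_into UNIV e))" by (rule cm_comp[OF cm_comp[OF h(1) c] h(2)])
 thus ?thesis by (rule cm_eq) (auto simp: copy_def topspace_pullback_topology e)
qed

lemma cont_real_mono: assumes "spl_cx S" "spl_cx T" "S <= T" shows "cmap (geo S) (geo T) (%x. x)"
 by (rule cont_map_from_real[OF assms(1)]) (rule cl_spx_inc[OF assms(2)], use assms(3) in blast)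

lemma per_real:
 assumes e: "inj e" and S: "!!t. spl_cx (S t)" and mono: "!!s t. s <= t ==> S s <= S t"
 shows "psp \<lparr>space_at = (%t. copy e (geo (S t))), transition = (%s t x. x)\<rparr>"
proof -
 have "cgwh_space (copy e (geo (S t)))" for t
 proof (rule cgwh_sp_if_k_Hd)
  have h: "copy e (geo (S t)) homeomorphic_space geo (S t)" using copy_homeo[OF e] by (auto simp: homeomorphic_space_def)
  show "k_space (copy e (geo (S t)))" using homeomorphic_k_space[OF h] k_sp_real[OF S] by simp
  show "Hausdorff_space (copy e (geo (S t)))" using homeomorphic_Hausdorff_space[OF h] Hd_real[OF S] by simp
 qed
 thus ?thesis unfolding persistent_space_def using cont_copy[OF e cont_real_mono[OF S S mono]] by simp
qed

section \<open>Vietoris-Rips filtrations and correspondences\<close>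

lemma spl_vr_cx: "spl_cx (vr_complex M t)" unfolding spl_cx_def vr_complex_def by (auto intro: fin_sub)

lemma vr_cx_mono: "s <= t ==> vr_complex M s <= vr_complex M t" unfolding vr_complex_def by force

lemma copy_id [simp]: "copy (%x. x) T = T"
proof -
 have "openin (copy (%x. x) T) U = openin T U" for U by (auto simp: copy_def openin_pullback_topology dest: openin_subset)
 thus ?thesis by (simp add: topology_eq)
qed

lemma per_VR: "psp (VR M)" using per_real[of "%x. x" "vr_complex M", OF _ spl_vr_cx vr_cx_mono] by (simp add: VR_def)

text \<open>The points of the mediating spaces are the pairs in a correspondence.\<close>

definition pl_VR :: "(('r => real) => 'u) => ('r => 'a) => 'r set => 'a metric => 'u pers_space" where "pl_VR e pj R M = \<lparr>space_at = (%t. copy e (geo (pl_cx pj R (vr_complex M t)))), transition = (%s t x. x)\<rparr>"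

lemma per_pl_VR: "inj e ==> psp (pl_VR e pj R M)"
unfolding pl_VR_def
proof (rule per_real)
 show "pl_cx pj R (vr_complex M s) <= pl_cx pj R (vr_complex M t)" if "s <= t" for s t using vr_cx_mono[OF that, of M] by (auto simp: pl_cx_def)
qed (auto intro: spl_pl_cx spl_vr_cx)

text \<open>The pulled back filtration is itself the mediating space: one leg is the identity, the
  other the push forward along \<open>pj\<close>.\<close>

lemma wk_eqv_pl_VR:
 assumes e: "inj e" and R: "pj ` R = mspace M"
 shows "weakly_equivalent TYPE('u) (pl_VR e pj R M :: 'u pers_space) (VR M)"
unfolding weakly_equivalent_def
proof (intro exI conjI allI)
 show "psp (pl_VR e pj R M)" by (rule per_pl_VR[OF e])
 show "nat_trans (pl_VR e pj R M) (pl_VR e pj R M) (%t x. x)" by (simp add: nat_trans_def)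
 have id: "whe T T (%x. x)" for T :: "'u topology" by (rule wk_htp_equivalenceI) (auto intro!: exI[of _ "%x. x"])
 show "whe (sp (pl_VR e pj R M) t) (sp (pl_VR e pj R M) t) (%x. x)" for t by (rule id)
 have "\<Union>(vr_complex M t) <= pj ` R" for t unfolding R by (auto simp: vr_complex_def)
 note w = push_wk_eqv[OF spl_vr_cx this copy_homeo[OF e]]
 thus "whe (sp (pl_VR e pj R M) t) (sp (VR M) t) (push pj o inv_into UNIV e)" for t by (simp add: pl_VR_def VR_def)
 thus "nat_trans (pl_VR e pj R M) (VR M) (%t. push pj o inv_into UNIV e)" unfolding nat_trans_def
  by (simp add: weak_homotopy_equivalence_def pl_VR_def VR_def)
qed

text \<open>Both pulled back filtrations have their vertices in the same set \<open>R\<close> and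
  the same transition maps, so the inclusions of complexes after shifting by \<open>2 * ep\<close>
  already form an interleaving.\<close>

lemma d_HI_VR_le:
 fixes e :: "('a >< 'b => real) => 'u" and M :: "'a metric" and N :: "'b metric"
 assumes e: "inj e" and f: "isometric_embedding M Z f" and g: "isometric_embedding N Z g" and ep: "0 <= ep" and M: "!!m. m : mspace M ==> EX n:mspace N. mdist Z (f m) (g n) <= ep" and N: "!!n. n : mspace N ==> EX m:mspace M. mdist Z (f m) (g n) <= ep"
 shows "d_HI TYPE('u) (VR M) (VR N) <= ereal (2 * ep)"
proof -
 \<comment> \<open>The correspondence of points that are \<open>ep\<close>-close in
   \<open>Z\<close>. Two applications of the triangle inequality bound its distortion by
   \<open>2 * ep\<close>, and \<open>M\<close> and \<open>N\<close> say that it projects onto both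
   metric spaces.\<close>
 define R where "R = {(m, n). m : mspace M & n : mspace N & mdist Z (f m) (g n) <= ep}"
 have RM: "fst ` R = mspace M" and RN: "snd ` R = mspace N" using M N by (force simp: R_def)+
 have close: "\<bar>mdist M (fst r) (fst r') - mdist N (snd r) (snd r')\<bar> <= 2 * ep" if r: "r : R" "r' : R" for r r'
 proof -
  let ?d = "mdist Z"
  have "fst r : mspace M" "fst r' : mspace M" "snd r : mspace N" "snd r' : mspace N" and d: "?d (f (fst r)) (g (snd r)) <= ep" "?d (f (fst r')) (g (snd r')) <= ep"
   using r by (auto simp: R_def)
  hence z: "f (fst r) : mspace Z" "f (fst r') : mspace Z" "g (snd r) : mspace Z" "g (snd r') : mspace Z" and i: "mdist M (fst r) (fst r') = ?d (f (fst r)) (f (fst r'))" "mdist N (snd r) (snd r') = ?d (g (snd r)) (g (snd r'))"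
   using f g by (auto simp: isometric_embedding_def)
  have "?d (f (fst r)) (f (fst r')) <= ?d (f (fst r)) (g (snd r)) + (?d (g (snd r)) (g (snd r')) + ?d (g (snd r')) (f (fst r')))"
   using mdist_triangle[OF z(1,3,2)] mdist_triangle[OF z(3,4,2)] by simp
  moreover have "?d (g (snd r)) (g (snd r')) <= ?d (g (snd r)) (f (fst r)) + (?d (f (fst r)) (f (fst r')) + ?d (f (fst r')) (g (snd r')))"
   using mdist_triangle[OF z(3,1,4)] mdist_triangle[OF z(1,2,4)] by simp
  ultimately show ?thesis unfolding i using d by (simp add: mdist_commute)
 qed
 let ?P = "%t. pl_cx fst R (vr_complex M t)" and ?Q = "%t. pl_cx snd R (vr_complex N t)"
 have eqP: "?P t = {sg. sg <= R & finite sg & sg ~= {} & (ALL r:sg. ALL r':sg. mdist M (fst r) (fst r') <= t)}" for t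
  unfolding pl_cx_def vr_complex_def RM[symmetric] by auto
 have eqQ: "?Q t = {sg. sg <= R & finite sg & sg ~= {} & (ALL r:sg. ALL r':sg. mdist N (snd r) (snd r') <= t)}" for t
  unfolding pl_cx_def vr_complex_def RN[symmetric] by auto
 have "?P t <= ?Q (t + 2 * ep)" for t
 proof
  fix sg
  assume sg: "sg : ?P t"
  have "mdist N (snd r) (snd r') <= t + 2 * ep" if "r : sg" "r' : sg" for r r'
  proof -
  have "r : R" "r' : R" "mdist M (fst r) (fst r') <= t" using sg that unfolding eqP by auto
  thus ?thesis using close[of r r'] by simp
  qed
  thus "sg : ?Q (t + 2 * ep)" using sg unfolding eqP eqQ by simp
 qed
 note PQ = cont_copy[OF e cont_real_mono[OF spl_pl_cx[OF spl_vr_cx] spl_pl_cx[OF spl_vr_cx] this]]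
 have "?Q t <= ?P (t + 2 * ep)" for t
 proof
  fix sg
  assume sg: "sg : ?Q t"
  have "mdist M (fst r) (fst r') <= t + 2 * ep" if "r : sg" "r' : sg" for r r'
  proof -
  have "r : R" "r' : R" "mdist N (snd r) (snd r') <= t" using sg that unfolding eqQ by auto
  thus ?thesis using close[of r r'] by simp
  qed
  thus "sg : ?P (t + 2 * ep)" using sg unfolding eqP eqQ by simp
 qed
 note QP = cont_copy[OF e cont_real_mono[OF spl_pl_cx[OF spl_vr_cx] spl_pl_cx[OF spl_vr_cx] this]]
 have "interleaved (2 * ep) (pl_VR e fst R M) (pl_VR e snd R N)" unfolding interleaved_def
  by (rule exI[of _ "%t x. x"], rule exI[of _ "%t x. x"]) (simp add: pl_VR_def PQ QP)
 hence "d_I_Top (pl_VR e fst R M) (pl_VR e snd R N) <= ereal (2 * ep)" unfolding d_I_Top_def using ep by (intro Inf_lower) auto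
 moreover have "d_HI TYPE('u) (VR M) (VR N) <= d_I_Top (pl_VR e fst R M) (pl_VR e snd R N)" unfolding d_HI_def
  by (rule Inf_lower, rule CollectI, rule exI[of _ "pl_VR e fst R M"], rule exI[of _ "pl_VR e snd R N"], intro conjI refl per_pl_VR e wk_eqv_pl_VR RM RN)
 ultimately show ?thesis by simp
qed

theorem d_HI_VR_le_d_GH:
 fixes e :: "('a >< 'b => real) => 'u" and M :: "'a metric" and N :: "'b metric"
 assumes e: "inj e"
 shows "d_HI TYPE('u) (VR M) (VR N) <= 2 * d_GH M N"
proof -
 let ?h = "d_HI TYPE('u) (VR M) (VR N)"
 \<comment> \<open>The factor 2 is moved to the left so that the bound can be checked on the members
   of the two nested infima.\<close>
 have "?h / 2 <= d_GH M N" unfolding d_GH_def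
 proof (rule Inf_greatest)
  fix d
  assume "d : {d_H Z (f ` mspace M) (g ` mspace N) | (Z :: ('a + 'b) metric) f g. isometric_embedding M Z f & isometric_embedding N Z g}"
  then obtain Z :: "('a + 'b) metric" and f g where d: "d = d_H Z (f ` mspace M) (g ` mspace N)" and fg: "isometric_embedding M Z f" "isometric_embedding N Z g"
   by blast
  show "?h / 2 <= d" unfolding d d_H_def
  proof (rule Inf_greatest)
  fix r
  assume "r : {ereal ep | ep. 0 <= ep & (ALL a:f ` mspace M. EX b:g ` mspace N. mdist Z a b <= ep) & (ALL b:g ` mspace N. EX a:f ` mspace M. mdist Z a b <= ep)}"
  then obtain ep where ep: "r = ereal ep" "0 <= ep" "ALL m:mspace M. EX n:mspace N. mdist Z (f m) (g n) <= ep" "ALL n:mspace N. EX m:mspace M. mdist Z (f m) (g n) <= ep"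
   by auto
  have "?h <= ereal (2 * ep)" by (rule d_HI_VR_le[OF e fg ep(2)]) (use ep(3,4) in auto)
  thus "?h / 2 <= r" unfolding ep(1) by (cases ?h) auto
  qed
 qed
 thus ?thesis by (cases ?h; cases "d_GH M N") auto
qed

theorem proposition1p3:
  fixes K :: "'k ring"
    and X :: "'a pers_space" and Y :: "'b pers_space"
    and M :: "'c metric" and N :: "'d metric"
  assumes "field K"
  shows
    "(persistent_space X \<and> persistent_space Y \<and> q_tame_cohomology K X \<and> q_tame_cohomology K Y \<longrightarrow>
        (SUP l\<in>{1..}. SUP p\<in>{1..}.
           d_B (barc K (degree_part p (cup_module K l X)))
               (barc K (degree_part p (cup_module K l Y))))
        \<le> d_HI TYPE('u) X Y)
     \<and>
     (q_tame_cohomology K (VR M) \<and> q_tame_cohomology K (VR N) \<longrightarrow>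
        (SUP l\<in>{1..}. SUP p\<in>{1..}.
           d_B (barc K (degree_part p (cup_module K l (VR M))))
               (barc K (degree_part p (cup_module K l (VR N)))))
        \<le> 2 * d_GH M N
        \<and>
        ((\<exists>e :: ('c \<times> 'd \<Rightarrow> real) \<Rightarrow> 'u. inj e) \<longrightarrow>
           d_HI TYPE('u) (VR M) (VR N) \<le> 2 * d_GH M N))"
proof -
 interpret coeff K by (rule coeff.intro[OF assms])
 \<comment> \<open>The type \<open>'u\<close> does not occur in this bound, so the universe may be
   chosen: it is the type of the points of the mediating realizations, with the identity as
   injection.\<close>
 have "d_B (barc K (degp p (cup_module K l (VR M)))) (barc K (degp p (cup_module K l (VR N)))) <= 2 * d_GH M N" if "q_tame_cohomology K (VR M)" "q_tame_cohomology K (VR N)" for l p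
  by (rule order_trans[OF cup_barcodes_le_d_HI[OF per_VR that(1) per_VR that(2)] d_HI_VR_le_d_GH[OF inj_on_id2]])
 thus ?thesis using cup_barcodes_le_d_HI[of X Y] d_HI_VR_le_d_GH by (intro conjI impI SUP_least) auto
qed

end
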